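(* Let $0<p<1$ and $\theta\ge 0$, and let $\mathcal{M}=\{M_n\}_{n\ge 0}$ be a $p$-regular sequence with infinite $p$-characteristic $\kappa(p,\mathcal{M})=+\infty$. Let $\mathcal{M}_1=\{M_{n+1}\}_{n\ge 0}$ denote the shifted sequence and let $\theta_1=\theta/(1-p)$. Then $\boldsymbol{\pi}_0: W^{p,\theta}_{\mathcal{M}}\to L^p(\mathbb{R})$ is surjective, and $\boldsymbol{\pi}$ supplies an isomorphism \[ W^{p,\theta}_{\mathcal{M}}\cong L^p(\mathbb{R})\oplus W^{p,\theta_1}_{\mathcal{M}_1}, \] that is, the map $f\mapsto(\boldsymbol{\alpha}f,\boldsymbol{\delta}f)$ is an isomorphism (a linear homeomorphism) of $W^{p,\theta}_{\mathcal{M}}$ onto $L^p(\mathbb{R})\oplus W^{p,\theta_1}_{\mathcal{M}_1}$. Moreover, $\mathcal{M}_1$ inherits the assumed properties of $\mathcal{M}$: it is $p$-regular with $\kappa(p,\mathcal{M}_1)=+\infty$.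
   Context: $\|f\|_p=(\int_{\mathbb{R}}|f|^p\,dx)^{1/p}$ is the quasinorm of $L^p=L^p(\mathbb{R})$. A weight sequence $\mathcal{M}=\{M_n\}_{n\ge 0}$ is a sequence of positive real numbers; it is logarithmically convex if $n\mapsto\log M_n$ is convex. The $p$-characteristic is $\kappa(p,\mathcal{M})=\limsup_{n\to+\infty}\sum_{j=1}^{n}(1-p)^j\log M_j$. A logarithmically convex sequence $\mathcal{M}$ with $\kappa(p,\mathcal{M})=+\infty$ is called $p$-regular if one of the following holds: (i) $\liminf_{n\to+\infty}(1-p)^n\log M_n>0$; or (ii) $\log M_n=\mathrm{o}((1-p)^{-n})$ and $n\log n\le(\delta+\mathrm{o}(1))\log M_n$ as $n\to+\infty$, for some $\delta<1$. For $f\in C^\infty(\mathbb{R})$ put $\|f\|_{p,\mathcal{M}}=\sup_{n\ge 0}\|f^{(n)}\|_p/M_n$. The test class is \[ \mathscr{S}_{p,\theta,\mathcal{M}}^\circledast=\Big\{f\in C^\infty(\mathbb{R}):\ \|f\|_{p,\mathcal{M}}<+\infty\ \text{ and }\ \limsup_{n\to+\infty}(1-p)^n\log\|f^{(n)}\|_\infty\le\theta\Big\} \] (with $\log 0=-\infty$). The $L^p$-Carleman space $W^{p,\theta}_{\mathcal{M}}$ is the abstract completion of $\mathscr{S}_{p,\theta,\mathcal{M}}^\circledast$ with respect to $\|\cdot\|_{p,\mathcal{M}}$. Let $\ell^\infty(L^p,\mathcal{M})$ be the space of sequences $(f_0,f_1,f_2,\ldots)$ in $L^p$ with finite quasinorm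 $\sup_{n\ge 0}\|f_n\|_p/M_n$. The map $\boldsymbol{\pi}f=(f,f',f'',\ldots)$ on test functions extends to an isometry $\boldsymbol{\pi}:W^{p,\theta}_{\mathcal{M}}\to\ell^\infty(L^p,\mathcal{M})$, and $\boldsymbol{\pi}_n f$ is the $n$-th component of $\boldsymbol{\pi}f$. The map $\boldsymbol{\alpha}=\boldsymbol{\pi}_0:W^{p,\theta}_{\mathcal{M}}\to L^p$ is the continuous extension of $f\mapsto f$, and $\boldsymbol{\delta}:W^{p,\theta}_{\mathcal{M}}\to W^{p,\theta_1}_{\mathcal{M}_1}$ is the continuous extension of $f\mapsto f'$, both initially defined on $\mathscr{S}_{p,\theta,\mathcal{M}}^\circledast$. *)

theory Defs
  imports "HOL-Analysis.Analysis" "HOL-Library.Landau_Symbols"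
begin

section \<open>Complex quasinormed spaces on explicit carriers\<close>

record 'a qspace =
  car :: "'a set"
  add :: "'a \<Rightarrow> 'a \<Rightarrow> 'a"
  smul :: "complex \<Rightarrow> 'a \<Rightarrow> 'a"
  qnorm :: "'a \<Rightarrow> real"

definition qdiff :: "'a qspace \<Rightarrow> 'a \<Rightarrow> 'a \<Rightarrow> 'a" where
  "qdiff V x y = add V x (smul V (- 1) y)"

definition qtop :: "'a qspace \<Rightarrow> 'a topology" where
  "qtop V = topology (\<lambda>U. U \<subseteq> car V \<and>
     (\<forall>x\<in>U. \<exists>r>0. {y \<in> car V. qnorm V (qdiff V y x) < r} \<subseteq> U))"

lemma openin_qtop:
  "openin (qtop V) U \<longleftrightarrow> U \<subseteq> car V \<and>
     (\<forall>x\<in>U. \<exists>r>0. {y \<in> car V. qnorm V (qdiff V y x) < r} \<subseteq> U)"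
proof -
  let ?O = "\<lambda>U. U \<subseteq> car V \<and> (\<forall>x\<in>U. \<exists>r>0. {y \<in> car V. qnorm V (qdiff V y x) < r} \<subseteq> U)"
  have "?O (S \<inter> T)" if S: "?O S" and T: "?O T" for S T
  proof (intro conjI ballI)
    show "S \<inter> T \<subseteq> car V" using S by blast
  next
    fix x assume x: "x \<in> S \<inter> T"
    obtain r where r: "r > 0" "{y \<in> car V. qnorm V (qdiff V y x) < r} \<subseteq> S" using S x by blast
    obtain s where s: "s > 0" "{y \<in> car V. qnorm V (qdiff V y x) < s} \<subseteq> T" using T x by blast
    show "\<exists>r>0. {y \<in> car V. qnorm V (qdiff V y x) < r} \<subseteq> S \<inter> T"
      using r s by (intro exI[of _ "min r s"]) auto
  qed
  moreover have "?O (\<Union>K)" if "\<forall>S\<in>K. ?O S" for K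
    using that by (meson Sup_least Union_iff Union_upper subset_trans)
  ultimately have "istopology ?O"
    unfolding istopology_def by blast
  then show ?thesis
    by (simp add: qtop_def topology_inverse')
qed

lemma topspace_qtop [simp]: "topspace (qtop V) = car V"
proof -
  have "openin (qtop V) (car V)"
    by (auto simp: openin_qtop intro: exI[of _ 1])
  then show ?thesis
    by (metis openin_qtop openin_subset openin_topspace subset_antisym)
qed

definition linear_between :: "'a qspace \<Rightarrow> 'b qspace \<Rightarrow> ('a \<Rightarrow> 'b) \<Rightarrow> bool" where
  "linear_between V U T \<longleftrightarrow>
     (\<forall>x\<in>car V. T x \<in> car U) \<and>
     (\<forall>x\<in>car V. \<forall>y\<in>car V. T (add V x y) = add U (T x) (T y)) \<and>
     (\<forall>c. \<forall>x\<in>car V. T (smul V c x) = smul U c (T x))"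

definition linear_homeomorphism :: "'a qspace \<Rightarrow> 'b qspace \<Rightarrow> ('a \<Rightarrow> 'b) \<Rightarrow> bool" where
  "linear_homeomorphism V U T \<longleftrightarrow>
     linear_between V U T \<and> homeomorphic_map (qtop V) (qtop U) T"

text \<open>With the maximum as quasinorm, balls are products of balls, so the topology of the direct
  sum is the product topology.\<close>

definition direct_sum :: "'a qspace \<Rightarrow> 'b qspace \<Rightarrow> ('a \<times> 'b) qspace" where
  "direct_sum V U = \<lparr>
     car = car V \<times> car U,
     add = (\<lambda>x y. (add V (fst x) (fst y), add U (snd x) (snd y))),
     smul = (\<lambda>c x. (smul V c (fst x), smul U c (snd x))),
     qnorm = (\<lambda>x. max (qnorm V (fst x)) (qnorm U (snd x)))\<rparr>"

section \<open>Abstract completion\<close>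

definition cauchy_seqs :: "'a qspace \<Rightarrow> (nat \<Rightarrow> 'a) set" where
  "cauchy_seqs V = {s. (\<forall>k. s k \<in> car V) \<and>
     (\<forall>\<epsilon>>0. \<exists>N. \<forall>j\<ge>N. \<forall>k\<ge>N. qnorm V (qdiff V (s j) (s k)) < \<epsilon>)}"

definition null_rel :: "'a qspace \<Rightarrow> ((nat \<Rightarrow> 'a) \<times> (nat \<Rightarrow> 'a)) set" where
  "null_rel V = {(s, t). s \<in> cauchy_seqs V \<and> t \<in> cauchy_seqs V \<and>
     (\<lambda>k. qnorm V (qdiff V (s k) (t k))) \<longlonglongrightarrow> 0}"

definition rep :: "'a set \<Rightarrow> 'a" where
  "rep A = (SOME a. a \<in> A)"

text \<open>The quasinorm of a class is the limit of the quasinorms along any representative. The limit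
  exists whenever some power of the quasinorm is subadditive, as is the case for the
  \<open>p\<close>-th power of the quasinorms below.\<close>

definition qcompletion :: "'a qspace \<Rightarrow> (nat \<Rightarrow> 'a) set qspace" where
  "qcompletion V = \<lparr>
     car = cauchy_seqs V // null_rel V,
     add = (\<lambda>A B. null_rel V `` {\<lambda>k. add V (rep A k) (rep B k)}),
     smul = (\<lambda>c A. null_rel V `` {\<lambda>k. smul V c (rep A k)}),
     qnorm = (\<lambda>A. lim (\<lambda>k. qnorm V (rep A k)))\<rparr>"

definition qembed :: "'a qspace \<Rightarrow> 'a \<Rightarrow> (nat \<Rightarrow> 'a) set" where
  "qembed V x = null_rel V `` {\<lambda>_. x}"

text \<open>The continuous map \<open>qcompletion V \<rightarrow> U\<close> extending \<open>T\<close>; it is made unique as a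
  HOL function by fixing its values outside the carrier.\<close>

definition cont_extension :: "'a qspace \<Rightarrow> 'b qspace \<Rightarrow> ('a \<Rightarrow> 'b) \<Rightarrow> (nat \<Rightarrow> 'a) set \<Rightarrow> 'b" where
  "cont_extension V U T = (THE F. F \<in> extensional (car (qcompletion V)) \<and>
     continuous_map (qtop (qcompletion V)) (qtop U) F \<and>
     (\<forall>x\<in>car V. F (qembed V x) = T x))"

section \<open>The space \<open>L\<^sup>p(\<real>)\<close> and sequences in it\<close>

definition Lp_fun :: "real \<Rightarrow> (real \<Rightarrow> complex) set" where
  "Lp_fun p = {f \<in> borel_measurable lebesgue. integrable lebesgue (\<lambda>x. norm (f x) powr p)}"

definition Lp_norm :: "real \<Rightarrow> (real \<Rightarrow> complex) \<Rightarrow> real" where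
  "Lp_norm p f = (\<integral>x. norm (f x) powr p \<partial>lebesgue) powr (1 / p)"

definition ae_rel :: "real \<Rightarrow> ((real \<Rightarrow> complex) \<times> (real \<Rightarrow> complex)) set" where
  "ae_rel p = {(f, g). f \<in> Lp_fun p \<and> g \<in> Lp_fun p \<and> (AE x in lebesgue. f x = g x)}"

definition Lp_class :: "real \<Rightarrow> (real \<Rightarrow> complex) \<Rightarrow> (real \<Rightarrow> complex) set" where
  "Lp_class p f = ae_rel p `` {f}"

definition Lp :: "real \<Rightarrow> (real \<Rightarrow> complex) set qspace" where
  "Lp p = \<lparr>
     car = Lp_fun p // ae_rel p,
     add = (\<lambda>A B. Lp_class p (\<lambda>x. rep A x + rep B x)),
     smul = (\<lambda>c A. Lp_class p (\<lambda>x. c * rep A x)),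
     qnorm = (\<lambda>A. Lp_norm p (rep A))\<rparr>"

definition linf_Lp :: "real \<Rightarrow> (nat \<Rightarrow> real) \<Rightarrow> (nat \<Rightarrow> (real \<Rightarrow> complex) set) qspace" where
  "linf_Lp p M = \<lparr>
     car = {F. (\<forall>n. F n \<in> car (Lp p)) \<and> bdd_above (range (\<lambda>n. qnorm (Lp p) (F n) / M n))},
     add = (\<lambda>F G n. add (Lp p) (F n) (G n)),
     smul = (\<lambda>c F n. smul (Lp p) c (F n)),
     qnorm = (\<lambda>F. SUP n. qnorm (Lp p) (F n) / M n)\<rparr>"

section \<open>Weight sequences\<close>

definition weight_sequence :: "(nat \<Rightarrow> real) \<Rightarrow> bool" where
  "weight_sequence M \<longleftrightarrow> (\<forall>n. M n > 0)"

definition log_convex :: "(nat \<Rightarrow> real) \<Rightarrow> bool" where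
  "log_convex M \<longleftrightarrow> (\<forall>n. 2 * ln (M (n + 1)) \<le> ln (M n) + ln (M (n + 2)))"

definition p_characteristic :: "real \<Rightarrow> (nat \<Rightarrow> real) \<Rightarrow> ereal" where
  "p_characteristic p M = limsup (\<lambda>n. ereal (\<Sum>j = 1..n. (1 - p) ^ j * ln (M j)))"

definition p_regular :: "real \<Rightarrow> (nat \<Rightarrow> real) \<Rightarrow> bool" where
  "p_regular p M \<longleftrightarrow>
     weight_sequence M \<and> log_convex M \<and> p_characteristic p M = \<infinity> \<and>
     (liminf (\<lambda>n. ereal ((1 - p) ^ n * ln (M n))) > 0 \<or>
      (\<lambda>n. ln (M n)) \<in> o(\<lambda>n. 1 / (1 - p) ^ n) \<and>
      (\<exists>\<delta><1. \<exists>e. e \<longlonglongrightarrow> 0 \<and>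
         (\<forall>\<^sub>F n in sequentially. real n * ln (real n) \<le> (\<delta> + e n) * ln (M n))))"

section \<open>Test functions and \<open>L\<^sup>p\<close>-Carleman spaces\<close>

definition nderiv :: "nat \<Rightarrow> (real \<Rightarrow> complex) \<Rightarrow> real \<Rightarrow> complex" where
  "nderiv n = (\<lambda>f x. vector_derivative f (at x)) ^^ n"

definition smooth :: "(real \<Rightarrow> complex) \<Rightarrow> bool" where
  "smooth f \<longleftrightarrow> (\<forall>n x. nderiv n f differentiable at x)"

definition sup_norm :: "(real \<Rightarrow> complex) \<Rightarrow> ereal" where
  "sup_norm f = (SUP x. ereal (norm (f x)))"

text \<open>The logarithm of an element of \<open>[0, \<infinity>]\<close>.\<close>

definition eln :: "ereal \<Rightarrow> ereal" where
  "eln x = (if x = 0 then - \<infinity> else if x = \<infinity> then \<infinity> else ereal (ln (real_of_ereal x)))"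

definition carleman_test :: "real \<Rightarrow> real \<Rightarrow> (nat \<Rightarrow> real) \<Rightarrow> (real \<Rightarrow> complex) qspace" where
  "carleman_test p \<theta> M = \<lparr>
     car = {f. smooth f \<and>
       (\<forall>n. nderiv n f \<in> Lp_fun p) \<and> bdd_above (range (\<lambda>n. Lp_norm p (nderiv n f) / M n)) \<and>
       limsup (\<lambda>n. ereal ((1 - p) ^ n) * eln (sup_norm (nderiv n f))) \<le> ereal \<theta>},
     add = (\<lambda>f g x. f x + g x),
     smul = (\<lambda>c f x. c * f x),
     qnorm = (\<lambda>f. SUP n. Lp_norm p (nderiv n f) / M n)\<rparr>"

definition carleman_space ::
    "real \<Rightarrow> real \<Rightarrow> (nat \<Rightarrow> real) \<Rightarrow> (nat \<Rightarrow> real \<Rightarrow> complex) set qspace" where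
  "carleman_space p \<theta> M = qcompletion (carleman_test p \<theta> M)"

definition shift_seq :: "(nat \<Rightarrow> real) \<Rightarrow> nat \<Rightarrow> real" where
  "shift_seq M = (\<lambda>n. M (n + 1))"

definition pi_map ::
    "real \<Rightarrow> real \<Rightarrow> (nat \<Rightarrow> real) \<Rightarrow> (nat \<Rightarrow> real \<Rightarrow> complex) set \<Rightarrow> nat \<Rightarrow> (real \<Rightarrow> complex) set" where
  "pi_map p \<theta> M =
     cont_extension (carleman_test p \<theta> M) (linf_Lp p M) (\<lambda>f n. Lp_class p (nderiv n f))"

definition alpha_map ::
    "real \<Rightarrow> real \<Rightarrow> (nat \<Rightarrow> real) \<Rightarrow> (nat \<Rightarrow> real \<Rightarrow> complex) set \<Rightarrow> (real \<Rightarrow> complex) set" where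
  "alpha_map p \<theta> M =
     cont_extension (carleman_test p \<theta> M) (Lp p) (\<lambda>f. Lp_class p f)"

definition delta_map ::
    "real \<Rightarrow> real \<Rightarrow> (nat \<Rightarrow> real) \<Rightarrow>
     (nat \<Rightarrow> real \<Rightarrow> complex) set \<Rightarrow> (nat \<Rightarrow> real \<Rightarrow> complex) set" where
  "delta_map p \<theta> M =
     cont_extension (carleman_test p \<theta> M) (carleman_space p (\<theta> / (1 - p)) (shift_seq M))
       (\<lambda>f. qembed (carleman_test p (\<theta> / (1 - p)) (shift_seq M)) (nderiv 1 f))"

end

(*
  For u in the test class, the quasinorm of u is the maximum of |u|_p / M_0 and the shifted
  quasinorm of u', so f |-> (alpha f, delta f) is bilipschitz, and it is onto as soon as for every f in
  L^p and every test function g of the shifted class there are test functions u with u close to f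
  and u' close to g. Since p < 1, a jump can be smoothed at arbitrarily small cost: averaging it
  over widths a_0 > a_1 > ... gives an n-th derivative of size 1 / (a_0 ... a_(n-1)), but it lives on a
  set of measure a_n. The condition kappa = infinity says that the widths for which all
  derivatives cost little, relative to M, satisfy (1 - p)^n log(1 / a_n) -> 0, so that the smoothed
  jump does not affect the growth condition on the sup-norms.

  Smoothed jumps approximate every f in L^p by functions with almost vanishing derivatives. To
  obtain u' close to g, subtract from the primitive of g a staircase of smoothed jumps that keeps
  it small. The jumps are placed by a stopping time: dyadic intervals are halved until |I| C^p is at
  most A(I), where C is the integral of |g| over I and A is a finite measure dominating all
  |g^(k)|^p / M_(k+1)^p up to factors 2^-k. On an interval that is halved, this inequality fails, which forces
  the derivatives of g themselves to grow at least as fast as those of the smoothed jump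
  with the same budget; hence the staircase is not rougher than g.
*)

theory Submission
  imports Defs
begin

section \<open>Mollification widths\<close>

text \<open>On a bad interval I let S_0 be the integral of |g| and S_(n+1) the maximum of |g^(n)|.
  Since |f| = |f|^q |f|^p with q = 1 - p, badness gives, up to powers of 2 and unless g^(n-1) hardly
  oscillates, S_n <= |I| M_(n+1)^p S_0^p S_(n+1)^q. In logarithms this is the inequality version of
  the recursion that defines the cheapest widths, so log (S_n / S_0) can be compared step by step
  with B_n, the logarithm of the n-th derivative of the smoothed jump. The obstacle: the recursion
  divides by q at each step, which amplifies an early error to const / q^n, the very scale on which
  the sup-norms are restricted; even a lost constant factor is fatal. The budget is therefore
  relaxed by a factor exp X, which yields a surplus that is quadratic in n and outweighs all powers
  of 2. Moreover the widths must shrink geometrically to fit into I, which breaks the recursion at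
  some steps; there Landau's inequality takes its place. All this is uniform for intervals of length
  exp (- D) with D large. Only finitely many dyadic scales remain, and for each of them q^n B_n -> 0
  suffices.\<close>

locale width_selection =
  fixes p :: real and L :: "nat \<Rightarrow> real"
  assumes p_pos: "0 < p" and p_less_1: "p < 1"
    and convex: "L (Suc n) - L n \<le> L (Suc (Suc n)) - L (Suc n)"
    and divergent: "\<exists>n. C < (\<Sum>i<n. (1 - p) ^ i * (L (Suc i) - L i))"
begin

definition q :: real where "q = 1 - p"
definition m :: "nat \<Rightarrow> real" where "m n = L (Suc n) - L n"
text \<open>Two losses per derivative: \<open>ln 2 / p\<close> from taking the \<open>p\<close>-th
  root of a factor 2 (\<open>bad_min\<close>), and \<open>ln 2\<close> from comparing a maximum with
  twice the minimum (\<open>bad_profile\<close>).\<close>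

definition chain_const :: real where "chain_const = (1 + 1 / p) * ln 2"
text \<open>The first summand makes each width at most half of the preceding one. The second makes
  half of \<open>q * p * b D n\<close> exceed \<open>(ln 2 + p * chain_const) * (n + 1)\<close>,
  which excludes the first alternative of \<open>sup_profile\<close> on greedy steps.\<close>

definition K :: real where "K = ln 2 + 2 * (ln 2 + p * chain_const) / (q * p)"
text \<open>The maximum over real \<open>n\<close> of
  \<open>3 * ln 2 * (n + 1) + q * n - p * n * (n - 1) / 2\<close>, found by completing the square;
  see \<open>X_absorbs\<close>.\<close>

definition X :: real where "X = 3 * ln 2 + (p / 2 + 3 * ln 2 + q)\<^sup>2 / (2 * p)"

text \<open>A jump mollified with the widths \<open>exp (- b D i)\<close> has an \<open>n\<close>-th derivative of size
  \<open>exp (B D n)\<close> and of \<open>L\<^sup>p\<close>-cost about \<open>exp (p * B D n - q * b D n)\<close>, up to powers of 2. The greedy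
  choice \<open>b D n = eq_width D n (B D n)\<close> makes this cost \<open>exp (p * L n - D + X)\<close>; the increment \<open>K\<close>
  keeps the widths decreasing at least geometrically.\<close>

definition eq_width :: "real \<Rightarrow> nat \<Rightarrow> real \<Rightarrow> real" where
  "eq_width D n B = (p * (B - L n) + D - X + ln 2 * (real n + 1)) / q"

fun state :: "real \<Rightarrow> nat \<Rightarrow> real \<times> real" where
  "state D 0 = (0, max (D + K) (eq_width D 0 0))"
| "state D (Suc n) = (fst (state D n) + snd (state D n),
     max (snd (state D n) + K) (eq_width D (Suc n) (fst (state D n) + snd (state D n))))"

definition B :: "real \<Rightarrow> nat \<Rightarrow> real" where "B D n = fst (state D n)"
definition b :: "real \<Rightarrow> nat \<Rightarrow> real" where "b D n = snd (state D n)"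

section \<open>Basic estimates for the greedy widths\<close>

lemma q_pos: "0 < q" and q_less_1: "q < 1" and one_minus_q: "1 - q = p"
  using p_pos p_less_1 by (auto simp: q_def)

lemma B_0 [simp]: "B D 0 = 0" and B_Suc: "B D (Suc n) = B D n + b D n"
  and b_0: "b D 0 = max (D + K) (eq_width D 0 0)"
  and b_Suc: "b D (Suc n) = max (b D n + K) (eq_width D (Suc n) (B D (Suc n)))"
  by (simp_all add: B_def b_def)

lemma B_sum: "B D n = (\<Sum>i<n. b D i)"
  by (induction n) (simp_all add: B_Suc)

lemma chain_const_pos: "chain_const > 0"
  using p_pos by (simp add: chain_const_def add_pos_pos)

lemma K_ge: "K \<ge> ln 2" and K_pos: "K > 0"
proof -
  have "2 * (ln 2 + p * chain_const) / (q * p) > 0"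
    using p_pos q_pos chain_const_pos by (intro divide_pos_pos mult_pos_pos add_pos_pos) auto
  then show "K \<ge> ln 2" "K > 0" unfolding K_def by (auto simp: add_pos_pos less_imp_le)
qed

lemma eq_width_le_b: "eq_width D n (B D n) \<le> b D n"
  by (cases n) (auto simp: b_0 b_Suc)

lemma b_ge_cost: "p * (B D n - L n) + D - X + ln 2 * (real n + 1) \<le> q * b D n"
  using eq_width_le_b[of D n] q_pos by (simp add: eq_width_def field_simps)

lemma b_Suc_ge: "b D n + K \<le> b D (Suc n)" by (simp add: b_Suc)

lemma b_mono: "i \<le> j \<Longrightarrow> b D i \<le> b D j"
  by (rule lift_Suc_mono_le[of "b D"]) (use b_Suc_ge K_pos in \<open>smt (verit)\<close>)

lemma b_ge: "D + K * (real n + 1) \<le> b D n"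
proof (induction n)
  case (Suc n)
  then show ?case using b_Suc_ge[of D n] by (simp add: algebra_simps)
qed (simp add: b_0)

text \<open>Inserting \<open>B D (Suc n) = B D n + b D n\<close> and bounding
  \<open>p * (B D n - L n)\<close> by the cost inequality at \<open>n\<close> eliminates
  \<open>B\<close>: the coefficients \<open>q\<close> and \<open>p\<close> of \<open>b D n\<close>
  add up to 1, and a recursion in \<open>b\<close> alone remains.\<close>

lemma eq_width_Suc_le: "eq_width D (Suc n) (B D (Suc n)) \<le> (b D n - p * m n + ln 2) / q"
proof -
  have "p * (B D n + b D n - L (Suc n)) + D - X + ln 2 * (real (Suc n) + 1) \<le> b D n - p * m n + ln 2"
    using b_ge_cost[of D n] unfolding m_def q_def by (simp add: algebra_simps)
  then show ?thesis unfolding eq_width_def B_Suc using q_pos by (simp add: divide_right_mono)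
qed

lemma m_mono: "i \<le> j \<Longrightarrow> m i \<le> m j"
  by (rule lift_Suc_mono_le[of m]) (use convex in \<open>auto simp: m_def\<close>)

lemma geometric_sum: "(\<Sum>i<n. q ^ i) \<le> 1 / p"
proof -
  have "(\<Sum>i<n. q ^ i) * p = 1 - q ^ n"
    using one_diff_power_eq[of q n] one_minus_q by (simp add: mult.commute)
  then have "(\<Sum>i<n. q ^ i) * p \<le> 1" using q_pos by (smt (verit) zero_le_power)
  then show ?thesis using p_pos by (simp add: field_simps)
qed

lemma inverse_geometric_sum: "(\<Sum>i<n. 1 / q ^ i) \<le> q / (p * q ^ n)"
proof (induction n)
  case (Suc n)
  have "q / (p * q ^ n) + 1 / q ^ n = q / (p * q ^ Suc n)"
    using p_pos q_pos one_minus_q by (simp add: field_simps)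
  then show ?case using Suc by simp
qed (use p_pos q_pos in auto)

section \<open>Decay of the scaled widths\<close>

lemma m_unbounded: "\<exists>n. \<forall>k\<ge>n. C \<le> m k"
proof (rule ccontr)
  assume "\<not> ?thesis"
  then have le: "m k \<le> \<bar>C\<bar>" for k using m_mono by (smt (verit))
  obtain n where n: "\<bar>C\<bar> * (1 / p) < (\<Sum>i<n. q ^ i * m i)" using divergent by (auto simp: q_def m_def)
  have "(\<Sum>i<n. q ^ i * m i) \<le> (\<Sum>i<n. q ^ i * \<bar>C\<bar>)"
    by (intro sum_mono mult_left_mono le) (use q_pos in auto)
  also have "\<dots> = \<bar>C\<bar> * (\<Sum>i<n. q ^ i)" by (simp add: sum_distrib_left mult.commute)
  also have "\<dots> \<le> \<bar>C\<bar> * (1 / p)" by (intro mult_left_mono geometric_sum) auto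
  finally show False using n by simp
qed

abbreviation r :: real where "r \<equiv> (1 + q) / 2"

text \<open>After finitely many steps, independently of \<open>D\<close>, the scaled widths either contract by a fixed
  factor or lose the amount that \<open>M\<close> pays for.\<close>

lemma scaled_step:
  "\<exists>n0. \<forall>n\<ge>n0. p * m n \<ge> ln 2 \<and> (\<forall>D\<ge>0. q ^ Suc n * b D (Suc n) \<le> r * (q ^ n * b D n) \<or>
      q ^ Suc n * b D (Suc n) \<le> q ^ n * b D n - q ^ n * (p * m n - ln 2))"
proof -
  obtain n1 where n1: "\<And>k. k \<ge> n1 \<Longrightarrow> ln 2 / p \<le> m k" using m_unbounded by meson
  obtain n2 :: nat where n2: "2 * q / p < real n2" using reals_Archimedean2 by blast
  show ?thesis
  proof (intro exI[of _ "max n1 n2"] allI impI conjI)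
    fix n assume n: "max n1 n2 \<le> n"
    show pm: "ln 2 \<le> p * m n" using n1[of n] n p_pos by (simp add: field_simps)
    fix D :: real assume D: "0 \<le> D"
    show "q ^ Suc n * b D (Suc n) \<le> r * (q ^ n * b D n) \<or>
      q ^ Suc n * b D (Suc n) \<le> q ^ n * b D n - q ^ n * (p * m n - ln 2)"
    proof (cases "b D (Suc n) = b D n + K")
      case True
      have bn: "K * (real n + 1) \<le> b D n" using b_ge[of D n] D by simp
      have "2 * q / p \<le> real n" using n2 n by linarith
      then have "2 * q \<le> p * real n" using p_pos by (simp add: field_simps)
      then have "2 * q * K \<le> p * (K * real n)" using K_pos mult_right_mono[of "2 * q" "p * real n" K] by (simp add: ac_simps)
      also have "\<dots> \<le> p * b D n" using bn p_pos K_pos by (intro mult_left_mono) (auto simp: algebra_simps)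
      finally have "q * (b D n + K) \<le> r * b D n" unfolding q_def by (simp add: field_simps)
      then have "q ^ n * (q * (b D n + K)) \<le> q ^ n * (r * b D n)" using q_pos by (intro mult_left_mono) auto
      then show ?thesis using True by (simp add: ac_simps)
    next
      case False
      then have "b D (Suc n) \<le> (b D n - p * m n + ln 2) / q"
        using eq_width_Suc_le[of D n] by (auto simp: b_Suc max_def split: if_splits)
      then have "q * b D (Suc n) \<le> b D n - p * m n + ln 2" using q_pos by (simp add: field_simps)
      then have "q ^ n * (q * b D (Suc n)) \<le> q ^ n * (b D n - p * m n + ln 2)"
        using q_pos by (intro mult_left_mono) auto
      then show ?thesis by (simp add: algebra_simps)
    qed
  qed
qed

text \<open>From an index independent of \<open>D\<close> on, \<open>p * m n - ln 2\<close> is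
  nonnegative, so both alternatives of \<open>scaled_step\<close> are decreases. The uniformity in
  \<open>D\<close> is what \<open>growth_uniform\<close> needs, where intervals of all small lengths
  occur.\<close>

lemma scaled_antimono:
  "\<exists>n0. \<forall>D\<ge>0. \<forall>i\<ge>n0. \<forall>j\<ge>i. q ^ j * b D j \<le> q ^ i * b D i"
proof -
  obtain n0 where n0: "\<And>n D. n \<ge> n0 \<Longrightarrow> D \<ge> 0 \<Longrightarrow> p * m n \<ge> ln 2 \<and>
     (q ^ Suc n * b D (Suc n) \<le> r * (q ^ n * b D n) \<or>
      q ^ Suc n * b D (Suc n) \<le> q ^ n * b D n - q ^ n * (p * m n - ln 2))"
    using scaled_step by metis
  have step_le: "q ^ Suc n * b D (Suc n) \<le> q ^ n * b D n" if "n \<ge> n0" "D \<ge> 0" for n D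
  proof -
    have "0 \<le> D + K * (real n + 1)" using that K_pos by simp
    then have "0 \<le> b D n" using b_ge[of D n] by linarith
    then have nn: "0 \<le> q ^ n * b D n" using q_pos by simp
    have "r * (q ^ n * b D n) \<le> 1 * (q ^ n * b D n)"
      by (rule mult_right_mono[OF _ nn]) (use q_less_1 in simp)
    moreover have "0 \<le> q ^ n * (p * m n - ln 2)" using n0[OF that] q_pos by simp
    ultimately show ?thesis using n0[OF that] by linarith
  qed
  show ?thesis
  proof (intro exI[of _ n0] allI impI)
    fix D :: real and i j :: nat assume D: "0 \<le> D" and i: "n0 \<le> i" and ij: "i \<le> j"
    show "q ^ j * b D j \<le> q ^ i * b D i"
      using ij
    proof (induction rule: dec_induct)
      case (step k)
      then show ?case using step_le[of k D] D i by simp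
    qed simp
  qed
qed

lemma b_nonneg: "D \<ge> 0 \<Longrightarrow> 0 \<le> b D n"
proof -
  assume "D \<ge> 0"
  then have "0 \<le> D + K * (real n + 1)" using K_pos by simp
  then show ?thesis using b_ge[of D n] by linarith
qed

text \<open>The scaled widths eventually decrease to a limit \<open>T\<close>. If
  \<open>T > 0\<close>, a contraction by the factor \<open>r\<close> is impossible near
  \<open>T\<close>, so every late step loses \<open>q ^ n * (p * m n - ln 2)\<close>. These losses
  have bounded sum, against the divergence of the sums of \<open>q ^ i * m i\<close>. This is where
  the infinite characteristic enters.\<close>

lemma scaled_width_tendsto_0:
  assumes D: "D \<ge> 0"
  shows "(\<lambda>n. q ^ n * b D n) \<longlonglongrightarrow> 0"
proof -
  define t where "t n = q ^ n * b D n" for n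
  obtain n0 where n0: "\<And>n. n \<ge> n0 \<Longrightarrow> p * m n \<ge> ln 2 \<and> (t (Suc n) \<le> r * t n \<or>
      t (Suc n) \<le> t n - q ^ n * (p * m n - ln 2))"
    using scaled_step D unfolding t_def by metis
  obtain n1 where n1: "\<And>i j. n1 \<le> i \<Longrightarrow> i \<le> j \<Longrightarrow> t j \<le> t i"
    using scaled_antimono D unfolding t_def by metis
  have t_nonneg: "0 \<le> t n" for n using b_nonneg[OF D] q_pos by (simp add: t_def)
  have "decseq (\<lambda>n. t (n + n1))" using n1 by (auto simp: decseq_def)
  moreover have "\<And>n. 0 \<le> t (n + n1)" using t_nonneg by simp
  ultimately obtain T where T: "(\<lambda>n. t (n + n1)) \<longlonglongrightarrow> T" "\<And>i. T \<le> t (i + n1)"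
    using decseq_convergent[of "\<lambda>n. t (n + n1)" 0] by blast
  then have T0: "0 \<le> T" using LIMSEQ_le_const[OF T(1), of 0] t_nonneg by auto
  have tT: "t \<longlonglongrightarrow> T" using T(1) LIMSEQ_offset by blast
  have "T = 0"
  proof (rule ccontr)
    assume "T \<noteq> 0"
    then have Tpos: "T > 0" using T0 by simp
    have r: "0 < r" "r < 1" using q_pos q_less_1 by auto
    then have "T < T / r" using Tpos by (simp add: field_simps)
    then have "\<forall>\<^sub>F n in sequentially. t n < T / r" using tT order_tendstoD(2) by blast
    then obtain n2 where n2: "\<And>n. n \<ge> n2 \<Longrightarrow> t n < T / r" by (auto simp: eventually_sequentially)
    define N where "N = max (max n0 n1) n2"
    have step: "t (Suc n) \<le> t n - q ^ n * (p * m n - ln 2)" if "n \<ge> N" for n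
    proof -
      have "r * t n < T" using n2[of n] that r by (simp add: N_def field_simps)
      moreover have "T \<le> t (Suc n)" using T(2)[of "Suc n - n1"] that by (simp add: N_def)
      ultimately show ?thesis using n0[of n] that by (auto simp: N_def)
    qed
    have sum: "t (N + k) + (\<Sum>i = N..<N + k. q ^ i * (p * m i - ln 2)) \<le> t N" for k
    proof (induction k)
      case (Suc k)
      then show ?case using step[of "N + k"] by simp
    qed simp
    \<comment> \<open>Only the losses from \<open>N\<close> on telescope; \<open>C\<close> covers
      the terms before, since \<open>divergent\<close> speaks of sums from 0.\<close>
    define C where "C = (\<Sum>i<N. \<bar>q ^ i * (p * m i - ln 2)\<bar>)"
    have bound: "(\<Sum>i<n. q ^ i * (p * m i - ln 2)) \<le> C + t N" for n
    proof (cases "n \<le> N")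
      case True
      have "(\<Sum>i<n. q ^ i * (p * m i - ln 2)) \<le> (\<Sum>i<n. \<bar>q ^ i * (p * m i - ln 2)\<bar>)"
        by (rule sum_mono) auto
      also have "\<dots> \<le> C" unfolding C_def by (rule sum_mono2) (use True in auto)
      finally show ?thesis using t_nonneg[of N] by simp
    next
      case False
      then obtain k where k: "n = N + k" using le_Suc_ex[of N n] by auto
      have "(\<Sum>i<n. q ^ i * (p * m i - ln 2)) = (\<Sum>i<N. q ^ i * (p * m i - ln 2)) + (\<Sum>i = N..<N + k. q ^ i * (p * m i - ln 2))"
        unfolding k using sum.atLeastLessThan_concat[of 0 N "N + k" "\<lambda>i. q ^ i * (p * m i - ln 2)"]
        by (simp add: lessThan_atLeast0)
      moreover have "(\<Sum>i<N. q ^ i * (p * m i - ln 2)) \<le> C" unfolding C_def by (rule sum_mono) auto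
      ultimately show ?thesis using sum[of k] t_nonneg[of "N + k"] by simp
    qed
    obtain n where "(C + t N + ln 2 / p) / p < (\<Sum>i<n. q ^ i * m i)"
      using divergent by (auto simp: q_def m_def)
    then have "C + t N + ln 2 / p < p * (\<Sum>i<n. q ^ i * m i)" using p_pos by (simp add: field_simps)
    also have "\<dots> = (\<Sum>i<n. q ^ i * (p * m i - ln 2)) + ln 2 * (\<Sum>i<n. q ^ i)"
      by (simp add: sum_distrib_left sum_subtractf algebra_simps)
    also have "\<dots> \<le> C + t N + ln 2 * (1 / p)"
      by (intro add_mono bound mult_left_mono geometric_sum) auto
    finally show False by simp
  qed
  then show ?thesis using tT unfolding t_def by simp
qed

text \<open>The bounds \<open>e / q ^ i\<close> grow geometrically, so their sum is comparable with
  the last of them and stays on the scale \<open>1 / q ^ n\<close>.\<close>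

lemma B_tail_le:
  assumes "\<And>i. N \<le> i \<Longrightarrow> q ^ i * b D i \<le> e" "0 \<le> e" "N \<le> n"
  shows "B D n \<le> B D N + e * (q / (p * q ^ n))"
proof -
  have "B D n = B D N + (\<Sum>i=N..<n. b D i)"
    unfolding B_sum using assms(3) sum.atLeastLessThan_concat[of 0 N n "b D"]
    by (simp add: lessThan_atLeast0)
  also have "(\<Sum>i=N..<n. b D i) \<le> (\<Sum>i=N..<n. e * (1 / q ^ i))"
    by (rule sum_mono) (use assms q_pos in \<open>auto simp: field_simps\<close>)
  also have "\<dots> \<le> (\<Sum>i<n. e * (1 / q ^ i))"
    by (rule sum_mono2) (use assms q_pos in auto)
  also have "\<dots> = e * (\<Sum>i<n. 1 / q ^ i)" by (simp add: sum_distrib_left)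
  also have "\<dots> \<le> e * (q / (p * q ^ n))" by (intro mult_left_mono inverse_geometric_sum assms)
  finally show ?thesis by simp
qed

lemma B_nonneg: "D \<ge> 0 \<Longrightarrow> 0 \<le> B D n"
  unfolding B_sum by (intro sum_nonneg) (use b_nonneg in auto)

lemma scaled_B_tendsto_0:
  assumes D: "D \<ge> 0"
  shows "(\<lambda>n. q ^ n * B D n) \<longlonglongrightarrow> 0"
proof (rule LIMSEQ_I)
  fix e :: real assume e: "e > 0"
  define e' where "e' = e * p / (2 * q)"
  have e': "e' > 0" using e p_pos q_pos by (simp add: e'_def)
  have "\<forall>\<^sub>F n in sequentially. q ^ n * b D n < e'"
    using scaled_width_tendsto_0[OF D] e' order_tendstoD(2) by blast
  then obtain N where N: "\<And>n. n \<ge> N \<Longrightarrow> q ^ n * b D n < e'" by (auto simp: eventually_sequentially)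
  have "(\<lambda>n. q ^ n * B D N) \<longlonglongrightarrow> 0 * B D N"
    by (intro tendsto_mult LIMSEQ_power_zero tendsto_const) (use q_pos q_less_1 in auto)
  then have "\<forall>\<^sub>F n in sequentially. q ^ n * B D N < e / 2"
    using e order_tendstoD(2)[of _ "0 * B D N" _ "e / 2"] by simp
  then obtain N' where N': "\<And>n. n \<ge> N' \<Longrightarrow> q ^ n * B D N < e / 2" by (auto simp: eventually_sequentially)
  show "\<exists>no. \<forall>n\<ge>no. norm (q ^ n * B D n - 0) < e"
  proof (intro exI[of _ "max N N'"] allI impI)
    fix n assume n: "max N N' \<le> n"
    have "B D n \<le> B D N + e' * (q / (p * q ^ n))"
      by (rule B_tail_le) (use N e' n in \<open>auto intro: less_imp_le\<close>)
    then have "q ^ n * B D n \<le> q ^ n * (B D N + e' * (q / (p * q ^ n)))" using q_pos by (intro mult_left_mono) auto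
    also have "\<dots> = q ^ n * B D N + e / 2" using q_pos p_pos by (simp add: e'_def field_simps)
    also have "\<dots> < e" using N'[of n] n by simp
    finally show "norm (q ^ n * B D n - 0) < e" using B_nonneg[OF D, of n] q_pos by simp
  qed
qed

text \<open>What is known of \<open>S 0 = \<integral>\<bar>g\<bar>\<close> and \<open>S (n + 1) = sup \<bar>g\<^sup>(\<^sup>n\<^sup>)\<bar>\<close> on a bad interval of length
  \<open>exp (- D)\<close>: either \<open>g\<^sup>(\<^sup>n\<^sup>)\<close> oscillates little, or it is controlled by the integral of the next
  derivative, which badness and \<open>L\<^sup>p\<close>-size bound from above; the last clause is Landau's inequality.\<close>

definition sup_profile :: "real \<Rightarrow> (nat \<Rightarrow> real) \<Rightarrow> bool" where
  "sup_profile D S \<longleftrightarrow> 0 < S 0 \<and> (\<forall>n. 0 \<le> S n) \<and>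
     S 0 \<le> exp (2 * ln 2 + p * L 0 - D) * S 0 powr p * S (Suc 0) powr q \<and>
     (\<forall>n. S (Suc n) \<le> exp (L n + chain_const * (real n + 1)) * S 0 \<or>
        S (Suc n) \<le> exp (2 * ln 2 * (real n + 2) + p * L (Suc n) - D) * S 0 powr p * S (Suc (Suc n)) powr q) \<and>
     (\<forall>n. 8 * exp D * S n \<le> S (Suc n) \<longrightarrow> (S (Suc n))\<^sup>2 \<le> 8 * S n * S (Suc (Suc n)))"

text \<open>After a greedy step the next greedy width exceeds the present one by
  \<open>(p * b D n - p * m n + ln 2) / q\<close>. As \<open>b D n \<ge> D\<close>, this is at least
  \<open>K\<close> for the finitely many steps in question once \<open>D\<close> is large.\<close>

lemma no_plateau:
  "\<exists>D0. \<forall>D\<ge>D0. \<forall>n\<le>n0. b D n = eq_width D n (B D n)"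
proof (intro exI allI impI)
  fix D and n
  assume D: "max (max 0 ((X + p * L 0 + q * K) / p)) ((p * \<bar>m n0\<bar> + q * K) / p) \<le> D" and n: "n \<le> n0"
  have D1: "0 \<le> D" using D by simp
  have D2: "X + p * L 0 + q * K \<le> p * D" using D p_pos by (simp add: field_simps)
  have D3: "p * \<bar>m n0\<bar> + q * K \<le> p * D" using D p_pos by (simp add: field_simps)
  show "b D n = eq_width D n (B D n)"
    using n
  proof (induction n)
    case 0
    have "q * (D + K) \<le> p * (0 - L 0) + D - X + ln 2 * (real 0 + 1)"
      using D2 by (simp add: q_def algebra_simps add_nonneg_nonneg) (use ln_gt_zero[of 2] in linarith)
    then have "D + K \<le> eq_width D 0 0" unfolding eq_width_def using q_pos by (simp add: field_simps)
    then show ?case by (simp add: b_0)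
  next
    case (Suc n)
    then have IH: "b D n = eq_width D n (B D n)" by simp
    have cost: "q * b D n = p * (B D n - L n) + D - X + ln 2 * (real n + 1)"
      unfolding IH eq_width_def using q_pos by simp
    have "D + K * (real n + 1) \<le> b D n" by (rule b_ge)
    moreover have "0 \<le> K * (real n + 1)" using K_pos by simp
    ultimately have "D \<le> b D n" by linarith
    then have "p * D \<le> p * b D n" using p_pos by (simp add: mult_left_mono)
    moreover have "p * m n \<le> p * \<bar>m n0\<bar>" using m_mono[of n n0] Suc.prems p_pos by (intro mult_left_mono) auto
    ultimately have "q * K + p * m n \<le> p * b D n" using D3 by linarith
    then have "q * (b D n + K) \<le> q * b D n + p * b D n - p * m n + ln 2"
      by (simp add: algebra_simps) (use ln_gt_zero[of 2] in linarith)
    also have "\<dots> = p * (B D (Suc n) - L (Suc n)) + D - X + ln 2 * (real (Suc n) + 1)"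
      unfolding cost B_Suc m_def by (simp add: algebra_simps)
    finally have "b D n + K \<le> eq_width D (Suc n) (B D (Suc n))" unfolding eq_width_def
      using q_pos by (simp add: field_simps)
    then show ?case by (simp add: b_Suc)
  qed
qed

lemma X_absorbs: "3 * ln 2 * (real n + 1) + q * real n \<le> p * (real n * (real n - 1) / 2) + X"
proof -
  define c where "c = p / 2 + 3 * ln 2 + q"
  have "0 \<le> (p * real n - c)\<^sup>2 / (2 * p)" using p_pos by simp
  also have "\<dots> = p * (real n)\<^sup>2 / 2 - c * real n + c\<^sup>2 / (2 * p)"
    using p_pos by (simp add: power2_eq_square field_simps)
  finally have "c * real n \<le> p * (real n)\<^sup>2 / 2 + c\<^sup>2 / (2 * p)" by simp
  moreover have "c * real n = p / 2 * real n + 3 * ln 2 * real n + q * real n"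
    unfolding c_def by (simp add: algebra_simps)
  moreover have "p * (real n * (real n - 1) / 2) = p * (real n)\<^sup>2 / 2 - p / 2 * real n"
    by (simp add: algebra_simps power2_eq_square diff_divide_distrib)
  moreover have "X = 3 * ln 2 + c\<^sup>2 / (2 * p)" by (simp add: X_def c_def)
  moreover have "3 * ln 2 * (real n + 1) = 3 * ln 2 * real n + 3 * (ln 2 :: real)" by (simp add: algebra_simps)
  ultimately show ?thesis by linarith
qed

text \<open>The exponents \<open>p\<close> and \<open>q\<close> add up to 1, so the inequality is
  homogeneous in \<open>S\<close> and only the ratios to \<open>S 0\<close> remain.\<close>

lemma chain_ln:
  assumes "0 < S 0" "0 < S n" "0 \<le> S (Suc n)" "S n \<le> exp c * S 0 powr p * S (Suc n) powr q"
  shows "0 < S (Suc n) \<and> ln (S n / S 0) \<le> c + q * ln (S (Suc n) / S 0)"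
proof -
  have pos: "0 < S (Suc n)"
  proof (rule ccontr)
    assume "\<not> ?thesis"
    then have "S (Suc n) = 0" using assms by simp
    then show False using assms by simp
  qed
  have "ln (S n) \<le> ln (exp c * S 0 powr p * S (Suc n) powr q)"
    using assms pos by (subst ln_le_cancel_iff) auto
  also have "\<dots> = c + p * ln (S 0) + q * ln (S (Suc n))"
    using assms pos by (simp add: ln_mult ln_powr)
  finally have "ln (S n) - ln (S 0) \<le> c + q * (ln (S (Suc n)) - ln (S 0))"
    by (simp add: q_def algebra_simps)
  then show ?thesis using pos assms by (simp add: ln_div)
qed

text \<open>The heart of the matter. Up to an error that is negligible for large \<open>D\<close>, the greedy widths
  produce the smallest growth compatible with the profile of any function: each step
  of the recursion is either the equality case of the chain inequality or dominated by
  the logarithmic convexity of the sup-norms. The constant \<open>X\<close> pays for the loss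
  in all but finitely many of the former steps.\<close>

lemma growth_comparison:
  assumes e: "e > 0"
  shows "\<exists>D0\<ge>0. \<forall>D\<ge>D0. \<forall>S n. sup_profile D S \<longrightarrow> (\<forall>i<n. e \<le> q ^ i * b D i) \<longrightarrow>
    0 < S n \<and> q ^ n * (B D n - ln (S n / S 0)) \<le> e"
proof -
  \<comment> \<open>The loss at a step that is not greedy: \<open>K\<close> from raising the width,
    \<open>ln 8\<close> from Landau's inequality.\<close>
  define c where "c = K + ln 8"
  have c: "c > 0" using K_pos by (simp add: c_def add_pos_pos)
  have "(\<lambda>n. (c + 1) / p * q ^ n) \<longlonglongrightarrow> (c + 1) / p * 0"
    by (intro tendsto_mult LIMSEQ_power_zero tendsto_const) (use q_pos q_less_1 in auto)
  moreover have "0 < e * q * p / 4" using e q_pos p_pos by simp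
  ultimately have "\<forall>\<^sub>F n in sequentially. (c + 1) / p * q ^ n < e * q * p / 4"
    by (intro order_tendstoD(2)) auto
  then obtain n0 where n0: "(c + 1) / p * q ^ n0 < e * q * p / 4"
    by (auto simp: eventually_sequentially)
  \<comment> \<open>\<open>y / q ^ i\<close> is the tolerated error. From \<open>i - 1\<close> to
    \<open>i\<close> it increases by \<open>p * y / q ^ i\<close>, which is at least
    \<open>c + 1\<close> for \<open>i \<ge> n0\<close>, although \<open>y\<close> itself is below a
    small fraction of \<open>e\<close>.\<close>
  define y where "y = (c + 1) / p * q ^ n0"
  have y: "0 < y" "y \<le> e * q * p / 4" using n0 c p_pos q_pos by (auto simp: y_def)
  obtain D1 where D1: "\<And>D n. D1 \<le> D \<Longrightarrow> n \<le> n0 \<Longrightarrow> b D n = eq_width D n (B D n)"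
    using no_plateau[of n0] by blast
  define C2 where "C2 = X + p\<^sup>2 * \<bar>L 0\<bar> + q * p * \<bar>L 1\<bar>"
  define C3 where "C3 = C2 - X + p * \<bar>m 0\<bar>"
  define C4 where "C4 = X + p * \<bar>L 0\<bar> + q * ln 8"
  define D0 where "D0 = max (max 0 D1) (max (2 * C3 / (q * p) + 1) (2 * C4 / (p * p)))"
  \<comment> \<open>The slope of \<open>ln (S i)\<close> beats the width \<open>b D i\<close> by
    \<open>i\<close>, up to the error. Summing the surplus \<open>i\<close> gives the quadratic gain
    that absorbs the powers of 2 in later steps.\<close>
  have main: "0 < S n \<and> (\<forall>i<n. real i - y / q ^ i \<le> ln (S (Suc i) / S 0) - ln (S i / S 0) - b D i)"
    if D: "D0 \<le> D" and S: "sup_profile D S" and t: "\<forall>i<n. e \<le> q ^ i * b D i" for D S n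
    using t
  proof (induction n)
    case 0
    then show ?case using S by (simp add: sup_profile_def)
  next
    case (Suc n)
    define \<beta> where "\<beta> i = ln (S i / S 0)" for i
    have \<beta>0: "\<beta> 0 = 0" using S by (simp add: \<beta>_def sup_profile_def)
    have Spos: "0 < S n" and f: "\<And>i. i < n \<Longrightarrow> real i - y / q ^ i \<le> \<beta> (Suc i) - \<beta> i - b D i"
      using Suc by (auto simp: \<beta>_def)
    have S0: "0 < S 0" and Sn: "\<And>n. 0 \<le> S n" using S by (auto simp: sup_profile_def)
    have Dnn: "0 \<le> D" and DD1: "D1 \<le> D" using D by (auto simp: D0_def)
    have F: "real n * (real n - 1) / 2 - y * (q / (p * q ^ n)) \<le> \<beta> n - B D n"
    proof -
      have "(\<Sum>i<n. real i - y / q ^ i) \<le> (\<Sum>i<n. \<beta> (Suc i) - \<beta> i - b D i)"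
        by (rule sum_mono) (use f in auto)
      also have "\<dots> = \<beta> n - B D n"
        using sum_lessThan_telescope[of \<beta> n] by (simp add: sum_subtractf B_sum \<beta>0)
      finally have "(\<Sum>i<n. real i) - y * (\<Sum>i<n. 1 / q ^ i) \<le> \<beta> n - B D n"
        by (simp add: sum_subtractf sum_distrib_left)
      moreover have "(\<Sum>i<n. real i) = real n * (real n - 1) / 2"
        by (induction n) (simp_all add: field_simps)
      moreover have "y * (\<Sum>i<n. 1 / q ^ i) \<le> y * (q / (p * q ^ n))"
        by (intro mult_left_mono inverse_geometric_sum) (use y in auto)
      ultimately show ?thesis by linarith
    qed
    \<comment> \<open>As long as the scaled widths are at least \<open>e\<close>, the error is a
      small fraction of the width itself.\<close>
    have y_small: "y / q ^ i \<le> q * p / 4 * b D i" if "i \<le> n" for i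
    proof -
      have "e \<le> q ^ i * b D i" using Suc.prems that by simp
      then have "e * (q * p / 4) \<le> (q ^ i * b D i) * (q * p / 4)"
        by (rule mult_right_mono) (use q_pos p_pos in simp)
      then have "y \<le> (q ^ i * b D i) * (q * p / 4)" using y by simp
      then show ?thesis using q_pos by (simp add: field_simps)
    qed
    have goal: "0 < S (Suc n) \<and> real n - y / q ^ n \<le> \<beta> (Suc n) - \<beta> n - b D n"
    proof (cases "b D n = eq_width D n (B D n)")
      case True
      then have cost: "q * b D n = p * (B D n - L n) + D - X + ln 2 * (real n + 1)"
        unfolding eq_width_def using q_pos by simp
      \<comment> \<open>For \<open>n > 0\<close> the first alternative of the profile has to be
        excluded. It would bound \<open>\<beta> n\<close> by about \<open>L k\<close>, whereas the
        greedy equality makes \<open>B D n\<close>, and with it \<open>\<beta> n\<close>, exceed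
        \<open>L k\<close> by a multiple of \<open>b D n\<close>.\<close>
      have "S n \<le> exp (2 * ln 2 * (real n + 1) + p * L n - D) * S 0 powr p * S (Suc n) powr q"
      proof (cases n)
        case 0
        then show ?thesis using S by (simp add: sup_profile_def)
      next
        case (Suc k)
        \<comment> \<open>Two rounds of the cost inequality bound \<open>D\<close> by
          \<open>q * q * b D n\<close> up to a constant. So the fraction
          \<open>q - q * q = q * p\<close> of \<open>b D n\<close> survives in
          \<open>p * (B D n - L k)\<close>: half of it pays for constants and terms linear in
          \<open>n\<close>, a quarter for the error \<open>y\<close>, and a quarter is left
          over.\<close>
        have b1: "q * b D 1 \<ge> p * (b D 0 - L 1) + D - X + ln 2 * 2"
          using b_ge_cost[of D 1] B_Suc[of D 0] by simp
        have b0: "q * b D 0 \<ge> p * (0 - L 0) + D - X + ln 2"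
          using b_ge_cost[of D 0] by simp
        have "q * (q * b D 1) \<ge> q * (p * (b D 0 - L 1) + D - X + ln 2 * 2)"
          using b1 q_pos by (intro mult_left_mono) auto
        moreover have "p * (q * b D 0) \<ge> p * (p * (0 - L 0) + D - X + ln 2)"
          using b0 p_pos by (intro mult_left_mono) auto
        ultimately have "q * q * b D 1 \<ge> (p + q) * (D - X) - p * p * L 0 - q * p * L 1 + p * ln 2 + q * ln 2 * 2"
          by (simp add: algebra_simps)
        moreover have "p * p * L 0 \<le> p\<^sup>2 * \<bar>L 0\<bar>" "q * p * L 1 \<le> q * p * \<bar>L 1\<bar>"
          using p_pos q_pos by (auto simp: power2_eq_square intro!: mult_left_mono)
        moreover have "p + q = 1" by (simp add: q_def)
        moreover have "0 \<le> p * ln 2 + q * ln 2 * 2" using p_pos q_pos by simp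
        ultimately have "D \<le> q * q * b D 1 + C2" unfolding C2_def by simp
        also have "\<dots> \<le> q * q * b D n + C2"
          using b_mono[of 1 n D] Suc q_pos by (simp add: mult_left_mono)
        finally have Dle: "D \<le> q * q * b D n + C2" .
        have "m 0 \<le> m k" by (rule m_mono) simp
        then have "p * (- \<bar>m 0\<bar>) \<le> p * m k" using p_pos by (intro mult_left_mono) auto
        then have "p * (B D n - L k) \<ge> q * b D n - D + X - ln 2 * (real n + 1) - p * \<bar>m 0\<bar>"
          using cost unfolding Suc m_def by (simp add: algebra_simps)
        then have "p * (B D n - L k) \<ge> q * b D n - q * q * b D n - C3 - ln 2 * (real n + 1)"
          using Dle unfolding C3_def by linarith
        moreover have "q * b D n - q * q * b D n = q * p * b D n" by (simp add: q_def algebra_simps)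
        ultimately have 1: "p * (B D n - L k) \<ge> q * p * b D n - C3 - ln 2 * (real n + 1)" by simp
        have "2 * C3 / (q * p) < D" using D by (simp add: D0_def)
        then have 2: "C3 < q * p / 2 * D" using p_pos q_pos by (simp add: field_simps)
        have "2 * (ln 2 + p * chain_const) / (q * p) \<le> K" by (simp add: K_def)
        then have 3: "ln 2 + p * chain_const \<le> q * p / 2 * K" using p_pos q_pos by (simp add: field_simps)
        then have "(ln 2 + p * chain_const) * (real n + 1) \<le> q * p / 2 * K * (real n + 1)"
          by (intro mult_right_mono) auto
        moreover have "q * p / 2 * (D + K * (real n + 1)) \<le> q * p / 2 * b D n"
          using b_ge p_pos q_pos by (intro mult_left_mono) auto
        moreover have "q * p / 2 * (D + K * (real n + 1)) = q * p / 2 * D + q * p / 2 * K * (real n + 1)"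
          by (simp only: distrib_left mult.assoc)
        ultimately have 4: "q * p / 2 * D + (ln 2 + p * chain_const) * (real n + 1) \<le> q * p / 2 * b D n"
          by linarith
        have yk: "p * (y * (q / (p * q ^ n))) \<le> q * p / 4 * b D n"
        proof -
          have "p * (y * (q / (p * q ^ n))) = y / q ^ n * q" using p_pos q_pos by (simp add: field_simps)
          also have "\<dots> \<le> y / q ^ n * 1" by (rule mult_left_mono) (use y q_pos q_less_1 in auto)
          finally have "p * (y * (q / (p * q ^ n))) \<le> y / q ^ n" by simp
          then show ?thesis using y_small[of n] by linarith
        qed
        have "p * (real n * (real n - 1) / 2) \<ge> 0" using p_pos Suc by simp
        moreover have "p * (real n * (real n - 1) / 2 - y * (q / (p * q ^ n))) \<le> p * (\<beta> n - B D n)"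
          using F p_pos by (intro mult_left_mono) auto
        moreover have "p * (real n * (real n - 1) / 2 - y * (q / (p * q ^ n))) =
            p * (real n * (real n - 1) / 2) - p * (y * (q / (p * q ^ n)))" by (rule right_diff_distrib)
        ultimately have "p * (\<beta> n - B D n) \<ge> - (q * p / 4 * b D n)"
          using yk by linarith
        moreover have "p * (\<beta> n - L k) = p * (\<beta> n - B D n) + p * (B D n - L k)"
          by (simp add: algebra_simps)
        moreover have "(ln 2 + p * chain_const) * (real n + 1) =
            ln 2 * (real n + 1) + p * chain_const * (real n + 1)" by (rule distrib_right)
        ultimately have "p * (\<beta> n - L k) > p * chain_const * (real n + 1) + q * p / 4 * b D n"
          using 1 2 4
        proof -
          assume as: "- (q * p / 4 * b D n) \<le> p * (\<beta> n - B D n)"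
            "p * (\<beta> n - L k) = p * (\<beta> n - B D n) + p * (B D n - L k)"
            "(ln 2 + p * chain_const) * (real n + 1) = ln 2 * (real n + 1) + p * chain_const * (real n + 1)"
            "p * (B D n - L k) \<ge> q * p * b D n - C3 - ln 2 * (real n + 1)"
            "C3 < q * p / 2 * D"
            "q * p / 2 * D + (ln 2 + p * chain_const) * (real n + 1) \<le> q * p / 2 * b D n"
          \<comment> \<open>With all products replaced by variables the claim is purely
            linear.\<close>
          have gen: "w < z" if "- (v / 4) \<le> f" "z = f + g" "u = l + t" "v - C - l \<le> g" "C < d"
              "d + u \<le> v / 2" "w = t + v / 4" for v f z g u l t C d w :: real
            using that by linarith
          show ?thesis
            by (rule gen[of "q * p * b D n" "p * (\<beta> n - B D n)" _ "p * (B D n - L k)"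
                  "(ln 2 + p * chain_const) * (real n + 1)" "ln 2 * (real n + 1)"
                  "p * chain_const * (real n + 1)" C3 "q * p / 2 * D"])
              (use as in \<open>simp_all only: times_divide_eq_left minus_divide_left\<close>)
        qed
        moreover have "0 \<le> q * p / 4 * b D n" using b_nonneg[OF Dnn] p_pos q_pos by simp
        ultimately have "p * (chain_const * (real n + 1)) < p * (\<beta> n - L k)" by (simp add: ac_simps)
        then have "chain_const * (real n + 1) < \<beta> n - L k" using p_pos by simp
        moreover have "chain_const * (real k + 1) \<le> chain_const * (real n + 1)"
          using chain_const_pos Suc by (intro mult_left_mono) auto
        ultimately have lt: "L k + chain_const * (real k + 1) < \<beta> n" by linarith
        have "\<not> S n \<le> exp (L k + chain_const * (real k + 1)) * S 0"
        proof
          assume "S n \<le> exp (L k + chain_const * (real k + 1)) * S 0"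
          then have "S n / S 0 \<le> exp (L k + chain_const * (real k + 1))" using S0 by (simp add: field_simps)
          then have "\<beta> n \<le> L k + chain_const * (real k + 1)"
            unfolding \<beta>_def using S0 Spos by (metis divide_pos_pos ln_exp ln_mono)
          then show False using lt by simp
        qed
        then show ?thesis using S unfolding sup_profile_def Suc by (auto simp: algebra_simps)
      qed
      from chain_ln[OF S0 Spos Sn this]
      have pos: "0 < S (Suc n)" and ch: "\<beta> n \<le> 2 * ln 2 * (real n + 1) + p * L n - D + q * \<beta> (Suc n)"
        by (auto simp: \<beta>_def)
      have "p * (real n * (real n - 1) / 2 - y * (q / (p * q ^ n))) \<le> p * (\<beta> n - B D n)"
        using F p_pos by (intro mult_left_mono) auto
      \<comment> \<open>The propagated error is exactly the one allowed at \<open>n\<close>: greedy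
        steps reproduce the form \<open>y / q ^ n\<close> without loss.\<close>
      moreover have "p * (y * (q / (p * q ^ n))) = q * (y / q ^ n)" using p_pos by simp
      ultimately have "p * (real n * (real n - 1) / 2) - q * (y / q ^ n) \<le> p * (\<beta> n - B D n)"
        by (simp add: right_diff_distrib)
      moreover have "q * (\<beta> (Suc n) - \<beta> n - b D n) \<ge> p * (\<beta> n - B D n) + X - 3 * ln 2 * (real n + 1)"
        using ch cost unfolding q_def by (simp add: algebra_simps)
      ultimately have "q * (\<beta> (Suc n) - \<beta> n - b D n) \<ge> q * real n - q * (y / q ^ n)"
        using X_absorbs[of n] by linarith
      then have "q * (real n - y / q ^ n) \<le> q * (\<beta> (Suc n) - \<beta> n - b D n)" by (simp add: right_diff_distrib)
      then show ?thesis using pos q_pos by simp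
    next
      case False
      \<comment> \<open>The width was obtained by adding \<open>K\<close>, which \<open>D1\<close>
        excludes for the first steps. So \<open>n\<close> is late enough for the increase of the
        error to pay for the loss \<open>c\<close>.\<close>
      then have nn: "n0 < n" using D1[OF DD1, of n] by force
      then obtain k where k: "n = Suc k" by (cases n) auto
      have bn: "b D n = b D k + K" using False unfolding k by (auto simp: b_Suc max_def)
      have kn: "k < n" "k \<le> n" using k by auto
      have "q * b D 0 \<ge> p * (0 - L 0) + D - X + ln 2" using b_ge_cost[of D 0] by simp
      moreover have "q * b D 0 \<le> q * b D k" by (rule mult_left_mono[OF b_mono]) (use q_pos in auto)
      ultimately have b0: "q * b D k \<ge> p * (0 - L 0) + D - X + ln 2" by linarith
      \<comment> \<open>Together with the induction hypothesis this gives the growth that the Landau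
        clause of the profile presupposes. It holds for large \<open>D\<close> because
        \<open>q * b D k\<close> is at least about \<open>D\<close> and
        \<open>1 - p / 2 > q\<close>; the part \<open>p / 2 * b D k\<close> set aside covers the
        error at \<open>k\<close>.\<close>
      have "D + ln 8 \<le> b D k - p / 2 * b D k"
      proof -
        have eq: "(1 - p / 2) * (p * (0 - L 0) + D - X) \<le> (1 - p / 2) * (q * b D k)"
        proof (rule mult_left_mono)
          have "(0::real) < ln 2" by simp
          then show "p * (0 - L 0) + D - X \<le> q * b D k" using b0 by linarith
        qed (use p_less_1 in simp)
        have "p * L 0 + X \<le> X + p * \<bar>L 0\<bar>" using p_pos by simp
        moreover have "0 \<le> X" using p_pos by (simp add: X_def add_nonneg_nonneg)
        ultimately have "(1 - p / 2) * (p * L 0 + X) \<le> X + p * \<bar>L 0\<bar>"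
        proof -
          assume a: "p * L 0 + X \<le> X + p * \<bar>L 0\<bar>" and X: "0 \<le> X"
          have "(1 - p / 2) * (p * L 0 + X) \<le> (1 - p / 2) * (X + p * \<bar>L 0\<bar>)"
            by (rule mult_left_mono[OF a]) (use p_less_1 in simp)
          also have "\<dots> \<le> 1 * (X + p * \<bar>L 0\<bar>)"
            by (rule mult_right_mono) (use p_pos X in auto)
          finally show ?thesis by simp
        qed
        then have "(1 - p / 2) * (p * (0 - L 0) + D - X) \<ge> D - p / 2 * D - (X + p * \<bar>L 0\<bar>)"
          by (simp add: algebra_simps)
        moreover have "X + p * \<bar>L 0\<bar> + q * ln 8 \<le> p / 2 * D"
        proof -
          have "2 * C4 / (p * p) \<le> D" using D by (simp add: D0_def)
          then have "2 * C4 \<le> p * p * D" using p_pos by (simp add: field_simps)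
          also have "\<dots> \<le> p * 1 * D" using p_pos p_less_1 Dnn by (intro mult_right_mono mult_left_mono) auto
          finally show ?thesis by (simp add: C4_def)
        qed
        moreover have "q * (D + ln 8) = D - p * D + q * ln 8" by (simp add: q_def algebra_simps)
        ultimately have "q * (D + ln 8) \<le> (1 - p / 2) * (q * b D k)"
          using eq by linarith
        then have "q * (D + ln 8) \<le> q * (b D k - p / 2 * b D k)" by (simp add: algebra_simps)
        then show ?thesis using q_pos by simp
      qed
      moreover have "y / q ^ k \<le> p / 2 * b D k"
      proof -
        have "q * p / 4 * b D k \<le> p / 2 * b D k"
          using b_nonneg[OF Dnn, of k] p_pos q_pos q_less_1 by (intro mult_right_mono) auto
        then show ?thesis using y_small[OF kn(2)] by linarith
      qed
      ultimately have slope: "D + ln 8 \<le> \<beta> n - \<beta> k" using f[OF kn(1)] unfolding k by simp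
      \<comment> \<open>If \<open>S k\<close> vanished, the premise of the Landau clause would hold
        trivially and force \<open>S n = 0\<close>.\<close>
      have Sk: "0 < S k" using Suc.IH Suc.prems S kn(1)
      proof (cases "k = 0")
        case False
        then show ?thesis
        proof -
          have "S k \<noteq> 0"
          proof
            assume "S k = 0"
            then have "8 * exp D * S k \<le> S (Suc k)" using Sn by simp
            then have "(S (Suc k))\<^sup>2 \<le> 8 * S k * S (Suc (Suc k))" using S by (auto simp: sup_profile_def)
            then show False using \<open>S k = 0\<close> Spos k by simp
          qed
          then show ?thesis using Sn[of k] by simp
        qed
      qed (use S0 in simp)
      have "ln (S n) - ln (S k) \<ge> D + ln 8" using slope S0 Spos Sk by (simp add: \<beta>_def ln_div)
      then have "exp (D + ln 8 + ln (S k)) \<le> exp (ln (S n))" by simp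
      then have "8 * exp D * S k \<le> S (Suc k)" using Spos Sk k by (simp add: exp_add)
      then have lan: "(S n)\<^sup>2 \<le> 8 * S k * S (Suc n)" using S k by (auto simp: sup_profile_def)
      have pos: "0 < S (Suc n)"
      proof (rule ccontr)
        assume "\<not> 0 < S (Suc n)"
        then have "S (Suc n) = 0" using Sn[of "Suc n"] by simp
        then show False using lan Spos by simp
      qed
      have "ln ((S n)\<^sup>2) \<le> ln (8 * S k * S (Suc n))"
        using lan pos Sk Spos by (subst ln_le_cancel_iff) auto
      then have "2 * ln (S n) \<le> ln 8 + ln (S k) + ln (S (Suc n))"
        using pos Sk Spos by (simp add: ln_mult ln_realpow)
      then have "\<beta> n - \<beta> k - ln 8 \<le> \<beta> (Suc n) - \<beta> n"
        using pos Sk Spos S0 by (simp add: \<beta>_def ln_div)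
      then have "\<beta> (Suc n) - \<beta> n - b D n \<ge> real k - y / q ^ k - c"
        using f[OF kn(1)] bn unfolding c_def k by linarith
      \<comment> \<open>The error grows by enough to pay for \<open>c\<close> and for raising the
        surplus from \<open>k\<close> to \<open>n = k + 1\<close>.\<close>
      moreover have "y / q ^ n - y / q ^ k \<ge> c + 1"
      proof -
        have "q ^ n \<le> q ^ n0" by (rule power_decreasing) (use nn q_pos q_less_1 in auto)
        then have "1 \<le> q ^ n0 / q ^ n" using q_pos by simp
        then have "(c + 1) * 1 \<le> (c + 1) * (q ^ n0 / q ^ n)" by (rule mult_left_mono) (use c in simp)
        also have "\<dots> = p * (y / q ^ n)" using p_pos by (simp add: y_def)
        also have "\<dots> = y / q ^ n - y / q ^ k" using q_pos k by (simp add: q_def field_simps)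
        finally show ?thesis by simp
      qed
      ultimately show ?thesis using pos k by simp
    qed
    then show ?case using f unfolding \<beta>_def by (auto simp: less_Suc_eq)
  qed
  show ?thesis
  proof (intro exI[of _ D0] conjI allI impI)
    show "0 \<le> D0" by (simp add: D0_def)
    fix D S n assume D: "D0 \<le> D" and S: "sup_profile D S" and t: "\<forall>i<n. e \<le> q ^ i * b D i"
    from main[OF this] show "0 < S n" by blast
    have f: "\<And>i. i < n \<Longrightarrow> real i - y / q ^ i \<le> ln (S (Suc i) / S 0) - ln (S i / S 0) - b D i"
      using main[OF D S t] by blast
    have S0: "ln (S 0 / S 0) = 0" using S by (simp add: sup_profile_def)
    have "(\<Sum>i<n. - (y * (1 / q ^ i))) \<le> (\<Sum>i<n. ln (S (Suc i) / S 0) - ln (S i / S 0) - b D i)"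
      by (rule sum_mono) (use f in \<open>fastforce simp: algebra_simps\<close>)
    also have "\<dots> = ln (S n / S 0) - B D n"
      using sum_lessThan_telescope[of "\<lambda>i. ln (S i / S 0)" n] by (simp add: sum_subtractf B_sum S0)
    finally have "B D n - ln (S n / S 0) \<le> y * (\<Sum>i<n. 1 / q ^ i)"
      by (simp add: sum_negf sum_distrib_left)
    also have "\<dots> \<le> y * (q / (p * q ^ n))"
      by (intro mult_left_mono inverse_geometric_sum) (use y in auto)
    finally have "q ^ n * (B D n - ln (S n / S 0)) \<le> q ^ n * (y * (q / (p * q ^ n)))"
      using q_pos by (intro mult_left_mono) auto
    also have "\<dots> = y * q / p" using q_pos by (simp add: field_simps)
    also have "\<dots> \<le> e * q * p / 4 * q / p" using y p_pos q_pos by (intro divide_right_mono mult_right_mono) auto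
    also have "\<dots> = e * (q * q / 4)" using p_pos by simp
    also have "\<dots> \<le> e * 1" using e q_pos q_less_1 mult_mono[of q 1 q 1] by (intro mult_left_mono) auto
    finally show "q ^ n * (B D n - ln (S n / S 0)) \<le> e" by simp
  qed
qed

text \<open>Up to the first \<open>k\<close> where the scaled width falls below \<open>e'\<close>,
  \<open>growth_comparison\<close> transfers the bounds on \<open>S\<close> to the ramp. From then
  on the scaled widths stay small by monotonicity, and \<open>B_tail_le\<close> controls the rest. A
  large \<open>D\<close> pushes \<open>k\<close> beyond \<open>n1\<close> and beyond the start of
  monotonicity, because \<open>b D i \<ge> D\<close>.\<close>

lemma growth_uniform:
  assumes e: "e > 0"
  shows "\<exists>D0\<ge>0. \<forall>D\<ge>D0. \<forall>S \<Theta>. sup_profile D S \<longrightarrow> 0 \<le> \<Theta> \<longrightarrow>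
    (\<forall>n\<ge>n1. S (Suc n) \<le> exp (\<Theta> / q ^ n)) \<longrightarrow> (\<forall>n\<ge>n1. S 0 * exp (B D (Suc n)) \<le> exp ((\<Theta> + e) / q ^ n))"
proof -
  \<comment> \<open>Calibrated so that the two errors \<open>e' / q ^ Suc n\<close> and
    \<open>e' / (p * q ^ n)\<close> add up to \<open>e / q ^ n\<close>.\<close>
  define e' where "e' = e / (1 / q + 1 / p)"
  have s: "1 / q + 1 / p > 0" using p_pos q_pos by (simp add: add_pos_pos)
  then have e': "e' > 0" using e by (simp add: e'_def)
  obtain D1 where D1: "D1 \<ge> 0" "\<And>D S n. D1 \<le> D \<Longrightarrow> sup_profile D S \<Longrightarrow> (\<forall>i<n. e' \<le> q ^ i * b D i) \<Longrightarrow>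
    0 < S n \<and> q ^ n * (B D n - ln (S n / S 0)) \<le> e'"
    using growth_comparison[OF e'] by blast
  obtain N1 where N1: "\<And>D i j. 0 \<le> D \<Longrightarrow> N1 \<le> i \<Longrightarrow> i \<le> j \<Longrightarrow> q ^ j * b D j \<le> q ^ i * b D i"
    using scaled_antimono by meson
  define D0 where "D0 = max D1 (e' / q ^ (max N1 n1 + 1))"
  show ?thesis
  proof (intro exI[of _ D0] conjI allI impI)
    show "0 \<le> D0" using D1 by (simp add: D0_def)
    fix D S \<Theta> n
    assume D: "D0 \<le> D" and S: "sup_profile D S" and \<Theta>: "0 \<le> \<Theta>"
      and SS: "\<forall>n\<ge>n1. S (Suc n) \<le> exp (\<Theta> / q ^ n)" and n: "n1 \<le> n"
    have Dnn: "0 \<le> D" and DD1: "D1 \<le> D" using D D1 by (auto simp: D0_def)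
    have S0: "0 < S 0" using S by (simp add: sup_profile_def)
    have "\<forall>\<^sub>F i in sequentially. q ^ i * b D i < e'"
      using scaled_width_tendsto_0[OF Dnn] e' order_tendstoD(2) by blast
    then have ex: "\<exists>i. q ^ i * b D i < e'" by (auto simp: eventually_sequentially)
    define k where "k = (LEAST i. q ^ i * b D i < e')"
    have k: "q ^ k * b D k < e'" unfolding k_def using ex by (rule LeastI_ex)
    have before: "e' \<le> q ^ i * b D i" if "i < k" for i
      using not_less_Least[of i "\<lambda>i. q ^ i * b D i < e'"] that by (simp add: k_def)
    have kgt: "max N1 n1 + 1 < k"
    proof (rule ccontr)
      assume "\<not> ?thesis"
      then have "q ^ (max N1 n1 + 1) \<le> q ^ k" by (intro power_decreasing) (use q_pos q_less_1 in auto)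
      moreover have "D \<le> b D k" using b_ge[of D k] K_pos by (smt (verit) mult_nonneg_nonneg of_nat_0_le_iff)
      ultimately have "q ^ (max N1 n1 + 1) * D \<le> q ^ k * b D k" by (intro mult_mono) (use Dnn q_pos in auto)
      moreover have "e' / q ^ (max N1 n1 + 1) \<le> D" using D by (simp add: D0_def)
      then have "e' \<le> q ^ (max N1 n1 + 1) * D" using q_pos by (simp add: field_simps)
      ultimately show False using k by simp
    qed
    have comp: "S 0 * exp (B D (Suc i)) \<le> exp (\<Theta> / q ^ i + e' / q ^ Suc i)" if "Suc i \<le> k" "n1 \<le> i" for i
    proof -
      have "\<forall>j<Suc i. e' \<le> q ^ j * b D j" using before that by auto
      from D1(2)[OF DD1 S this]
      have pos: "0 < S (Suc i)" and "q ^ Suc i * (B D (Suc i) - ln (S (Suc i) / S 0)) \<le> e'" by auto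
      then have "B D (Suc i) - ln (S (Suc i) / S 0) \<le> e' / q ^ Suc i" using q_pos by (simp add: field_simps)
      then have "ln (S 0) + B D (Suc i) \<le> ln (S (Suc i)) + e' / q ^ Suc i" using pos S0 by (simp add: ln_div)
      then have "exp (ln (S 0) + B D (Suc i)) \<le> exp (ln (S (Suc i)) + e' / q ^ Suc i)" by simp
      then have "S 0 * exp (B D (Suc i)) \<le> S (Suc i) * exp (e' / q ^ Suc i)"
        using pos S0 by (simp add: exp_add)
      also have "\<dots> \<le> exp (\<Theta> / q ^ i) * exp (e' / q ^ Suc i)"
        using SS that by (intro mult_right_mono) auto
      finally show ?thesis by (simp add: exp_add)
    qed
    have e_eq: "e' / q ^ Suc n + e' * (1 / (p * q ^ n)) = e / q ^ n"
    proof -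
      have "e' / q ^ Suc n + e' * (1 / (p * q ^ n)) = e' * (1 / q + 1 / p) / q ^ n"
        using q_pos p_pos by (simp add: field_simps)
      then show ?thesis using s by (simp add: e'_def)
    qed
    show "S 0 * exp (B D (Suc n)) \<le> exp ((\<Theta> + e) / q ^ n)"
    proof (cases "Suc n \<le> k")
      case True
      have "0 \<le> e' * (1 / (p * q ^ n))" using e' p_pos q_pos by simp
      then have "exp (\<Theta> / q ^ n + e' / q ^ Suc n) \<le> exp ((\<Theta> + e) / q ^ n)"
        using e_eq by (simp add: add_divide_distrib)
      then show ?thesis using comp[OF True n] by linarith
    next
      case False
      obtain j where j: "k = Suc j" using kgt by (cases k) auto
      have tail: "q ^ i * b D i \<le> e'" if "k \<le> i" for i
        using N1[OF Dnn, of k i] that kgt k by linarith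
      have "B D (Suc n) \<le> B D k + e' * (q / (p * q ^ Suc n))"
        by (rule B_tail_le) (use tail e' False in auto)
      then have "S 0 * exp (B D (Suc n)) \<le> S 0 * exp (B D k + e' * (q / (p * q ^ Suc n)))" using S0 by simp
      also have "\<dots> = (S 0 * exp (B D (Suc j))) * exp (e' * (1 / (p * q ^ n)))"
        using q_pos by (simp add: exp_add j)
      also have "\<dots> \<le> exp (\<Theta> / q ^ j + e' / q ^ Suc j) * exp (e' * (1 / (p * q ^ n)))"
        by (intro mult_right_mono comp) (use j kgt in auto)
      also have "\<dots> \<le> exp (\<Theta> / q ^ n + e' / q ^ Suc n) * exp (e' * (1 / (p * q ^ n)))"
      proof -
        have jn: "j \<le> n" using False j by simp
        then have "q ^ n \<le> q ^ j" "q ^ Suc n \<le> q ^ Suc j"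
          using q_pos q_less_1 by (auto intro!: power_decreasing simp del: power_Suc)
        then have "\<Theta> / q ^ j \<le> \<Theta> / q ^ n" "e' / q ^ Suc j \<le> e' / q ^ Suc n"
          using \<Theta> e' q_pos by (auto intro!: divide_left_mono simp del: power_Suc)
        then show ?thesis by (intro mult_right_mono) (simp_all add: add_mono del: power_Suc)
      qed
      also have "\<dots> = exp ((\<Theta> + e) / q ^ n)"
        using e_eq by (simp add: exp_add[symmetric] add_divide_distrib add.assoc)
      finally show ?thesis .
    qed
  qed
qed

end

section \<open>Smooth steps with prescribed widths\<close>

definition moving_average :: "real \<Rightarrow> (real \<Rightarrow> real) \<Rightarrow> real \<Rightarrow> real" where
  "moving_average a f x = integral {x - a..x} f / a"

text \<open>With the window moved to the fixed interval \<open>{0..a}\<close>, monotonicity in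
  \<open>x\<close> becomes monotonicity of the integrand.\<close>

lemma moving_average_shift:
  assumes "a > 0" "f integrable_on {x - a..x}"
  shows "moving_average a f x = integral {0..a} (\<lambda>t. f (x - a + t)) / a"
proof -
  have "((\<lambda>t. f (t + (x - a))) has_integral integral {x - a..x} f) {x - a - (x - a)..x - (x - a)}"
    using has_integral_shift_real_ivl[of f "integral {x - a..x} f" "x - a" x "x - a"] assms(2)
    by (simp add: has_integral_integral)
  then have "integral {0..a} (\<lambda>t. f (x - a + t)) = integral {x - a..x} f"
    by (simp add: integral_unique add.commute)
  then show ?thesis by (simp add: moving_average_def)
qed

lemma mono_integrable_on:
  fixes f :: "real \<Rightarrow> real"
  assumes "mono f"
  shows "f integrable_on {u..v}"
  by (rule integrable_on_mono_on) (use assms in \<open>auto simp: mono_on_def mono_def\<close>)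

lemma moving_average_le:
  assumes "a > 0" "f integrable_on {x - a..x}" "\<And>t. x - a \<le> t \<Longrightarrow> t \<le> x \<Longrightarrow> f t \<le> c"
  shows "moving_average a f x \<le> c"
proof -
  have "integral {x - a..x} f \<le> integral {x - a..x} (\<lambda>_. c)"
    by (rule integral_le) (use assms in auto)
  also have "\<dots> = c * a" using assms by simp
  finally show ?thesis using assms by (simp add: moving_average_def field_simps)
qed

lemma moving_average_ge:
  assumes "a > 0" "f integrable_on {x - a..x}" "\<And>t. x - a \<le> t \<Longrightarrow> t \<le> x \<Longrightarrow> c \<le> f t"
  shows "c \<le> moving_average a f x"
proof -
  have "integral {x - a..x} (\<lambda>_. c) \<le> integral {x - a..x} f"
    by (rule integral_le) (use assms in auto)
  moreover have "integral {x - a..x} (\<lambda>_. c) = c * a" using assms by simp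
  ultimately show ?thesis using assms by (simp add: moving_average_def field_simps)
qed

lemma moving_average_mono:
  assumes "a > 0" "f integrable_on {x - a..x}" "g integrable_on {x - a..x}"
    "\<And>t. x - a \<le> t \<Longrightarrow> t \<le> x \<Longrightarrow> f t \<le> g t"
  shows "moving_average a f x \<le> moving_average a g x"
  unfolding moving_average_def
  by (intro divide_right_mono integral_le) (use assms in auto)

lemma mono_moving_average:
  assumes "a > 0" "mono f"
  shows "mono (moving_average a f)"
proof (rule monoI)
  fix x y :: real assume xy: "x \<le> y"
  have i: "(\<lambda>t. f (z - a + t)) integrable_on {0..a}" for z
    by (rule mono_integrable_on) (use assms in \<open>auto simp: mono_def\<close>)
  have "integral {0..a} (\<lambda>t. f (x - a + t)) \<le> integral {0..a} (\<lambda>t. f (y - a + t))"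
    by (rule integral_le) (use assms i xy in \<open>auto simp: mono_def\<close>)
  then show "moving_average a f x \<le> moving_average a f y"
    using assms by (simp add: moving_average_shift mono_integrable_on divide_right_mono)
qed

locale halving_widths =
  fixes a :: "nat \<Rightarrow> real"
  assumes a_pos: "a n > 0" and a_half: "a (Suc n) \<le> a n / 2"
begin

text \<open>The Heaviside function averaged over windows of lengths \<open>a (n + k - 1)\<close>,
  ..., \<open>a n\<close>, the narrowest first. The windows look backwards, so nothing spills over
  to negative \<open>x\<close>. The starting index is kept variable because differentiation raises
  it.\<close>

fun box_step :: "nat \<Rightarrow> nat \<Rightarrow> real \<Rightarrow> real" where
  "box_step 0 n = indicator {0..}"
| "box_step (Suc k) n = moving_average (a n) (box_step k (Suc n))"

definition smooth_step :: "nat \<Rightarrow> real \<Rightarrow> real" where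
  "smooth_step n x = lim (\<lambda>k. box_step k n x)"

text \<open>The derivative of a moving average is a difference quotient of the averaged function;
  hence the \<open>k\<close>-th derivative of step \<open>n\<close> is an iterated difference
  quotient of step \<open>n + k\<close>.\<close>

fun step_deriv :: "nat \<Rightarrow> nat \<Rightarrow> real \<Rightarrow> real" where
  "step_deriv 0 n = smooth_step n"
| "step_deriv (Suc k) n = (\<lambda>x. (step_deriv k (Suc n) x - step_deriv k (Suc n) (x - a n)) / a n)"

lemma mono_box_step: "mono (box_step k n)"
proof (induction k arbitrary: n)
  case 0
  then show ?case by (auto simp: mono_def indicator_def)
next
  case (Suc k)
  then show ?case using mono_moving_average[OF a_pos] by simp
qed

lemma box_step_integrable: "box_step k n integrable_on {u..v}"
  by (rule mono_integrable_on[OF mono_box_step])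

lemma box_step_bounds: "0 \<le> box_step k n x \<and> box_step k n x \<le> 1"
proof (induction k arbitrary: n x)
  case (Suc k)
  then show ?case
    using moving_average_ge[where c = 0 and x = x, OF a_pos[of n] box_step_integrable[of k "Suc n"]]
      moving_average_le[where c = 1 and x = x, OF a_pos[of n] box_step_integrable[of k "Suc n"]] by auto
qed auto

lemma box_step_neg: "x < 0 \<Longrightarrow> box_step k n x = 0"
proof (induction k arbitrary: n x)
  case (Suc k)
  have "moving_average (a n) (box_step k (Suc n)) x \<le> 0"
    by (rule moving_average_le[OF a_pos box_step_integrable]) (use Suc in auto)
  then show ?case using box_step_bounds[of "Suc k" n x] by simp
qed auto

text \<open>By halving, the windows from \<open>a n\<close> on have total length at most
  \<open>2 * a n\<close>.\<close>

lemma box_step_one: "2 * a n \<le> x \<Longrightarrow> box_step k n x = 1"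
proof (induction k arbitrary: n x)
  case 0
  then show ?case using a_pos[of n] by (simp add: indicator_def)
next
  case (Suc k)
  have "1 \<le> moving_average (a n) (box_step k (Suc n)) x"
  proof (rule moving_average_ge[OF a_pos box_step_integrable])
    fix t assume "x - a n \<le> t" "t \<le> x"
    then have "2 * a (Suc n) \<le> t" using Suc.prems a_half[of n] by linarith
    then show "1 \<le> box_step k (Suc n) t" using Suc.IH by simp
  qed
  then show ?case using box_step_bounds[of "Suc k" n x] by simp
qed

lemma box_step_Suc_le: "box_step (Suc k) n x \<le> box_step k n x"
proof (induction k arbitrary: n x)
  case 0
  show ?case
  proof (cases "x < 0")
    case True then show ?thesis using box_step_neg[of x "Suc 0" n] by (simp add: indicator_def)
  next
    case False then show ?thesis using box_step_bounds[of "Suc 0" n x] by (simp add: indicator_def)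
  qed
next
  case (Suc k)
  have "moving_average (a n) (box_step (Suc k) (Suc n)) x \<le> moving_average (a n) (box_step k (Suc n)) x"
    by (rule moving_average_mono[OF a_pos box_step_integrable box_step_integrable]) (rule Suc.IH)
  then show ?case by simp
qed

lemma box_step_tendsto: "(\<lambda>k. box_step k n x) \<longlonglongrightarrow> smooth_step n x"
proof -
  have "decseq (\<lambda>k. box_step k n x)" by (rule decseq_SucI) (rule box_step_Suc_le)
  then have "convergent (\<lambda>k. box_step k n x)"
    using box_step_bounds by (metis decseq_convergent convergentI)
  then show ?thesis unfolding smooth_step_def by (simp add: convergent_LIMSEQ_iff)
qed

lemma smooth_step_bounds: "0 \<le> smooth_step n x" "smooth_step n x \<le> 1"
  using box_step_bounds by (auto intro: LIMSEQ_le_const[OF box_step_tendsto] LIMSEQ_le_const2[OF box_step_tendsto])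

lemma smooth_step_one: "2 * a n \<le> x \<Longrightarrow> smooth_step n x = 1"
  by (simp add: smooth_step_def box_step_one)

lemma mono_smooth_step: "mono (smooth_step n)"
proof (rule monoI)
  fix x y :: real assume "x \<le> y"
  then show "smooth_step n x \<le> smooth_step n y"
    by (intro LIMSEQ_le[OF box_step_tendsto box_step_tendsto]) (use mono_box_step in \<open>auto simp: mono_def\<close>)
qed

text \<open>The limit inherits the recursion. Continuity and differentiability are read off from
  this self-similarity, as the approximations themselves are not smooth.\<close>

lemma smooth_step_avg: "smooth_step n x = moving_average (a n) (smooth_step (Suc n)) x"
proof -
  have "(\<lambda>k. integral {x - a n..x} (box_step k (Suc n))) \<longlonglongrightarrow> integral {x - a n..x} (smooth_step (Suc n))"
    by (rule dominated_convergence(2)[where h = "\<lambda>_. 1"])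
      (use box_step_integrable box_step_bounds box_step_tendsto in auto)
  then have "(\<lambda>k. box_step (Suc k) n x) \<longlonglongrightarrow> moving_average (a n) (smooth_step (Suc n)) x"
    using a_pos[of n] by (auto simp: moving_average_def intro!: tendsto_intros)
  moreover have "(\<lambda>k. box_step (Suc k) n x) \<longlonglongrightarrow> smooth_step n x"
    using box_step_tendsto LIMSEQ_Suc by blast
  ultimately show ?thesis using LIMSEQ_unique by blast
qed

lemma continuous_smooth_step: "isCont (smooth_step n) x"
proof -
  define F where "F = (\<lambda>y. integral {x - a n - 1..y} (smooth_step (Suc n)))"
  have int: "smooth_step (Suc n) integrable_on {u..v}" for u v
    by (rule mono_integrable_on[OF mono_smooth_step])
  have cF: "continuous_on {x - a n - 1..x + 1} F"
    unfolding F_def by (rule indefinite_integral_continuous_1[OF int])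
  have eq: "smooth_step n y = (F y - F (y - a n)) / a n" if "y \<in> {x - 1<..<x + 1}" for y
  proof -
    have "F (y - a n) + integral {y - a n..y} (smooth_step (Suc n)) = F y"
      unfolding F_def by (rule Henstock_Kurzweil_Integration.integral_combine[OF _ _ int])
        (use that a_pos[of n] in auto)
    then show ?thesis by (simp add: smooth_step_avg moving_average_def)
  qed
  have "continuous_on {x - 1<..<x + 1} (\<lambda>y. (F y - F (y - a n)) / a n)"
  proof (intro continuous_intros)
    show "continuous_on {x - 1<..<x + 1} F"
      by (rule continuous_on_subset[OF cF]) (use a_pos[of n] in auto)
    show "continuous_on {x - 1<..<x + 1} (\<lambda>y. F (y - a n))"
      by (rule continuous_on_compose2[OF cF]) (use a_pos[of n] in \<open>auto intro!: continuous_intros\<close>)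
  qed (use a_pos[of n] in auto)
  then have "continuous_on {x - 1<..<x + 1} (smooth_step n)"
    by (rule continuous_on_eq) (simp add: eq)
  then show ?thesis by (simp add: continuous_on_eq_continuous_at)
qed

lemma smooth_step_zero: "x \<le> 0 \<Longrightarrow> smooth_step n x = 0"
proof -
  assume x: "x \<le> 0"
  have neg: "smooth_step n y = 0" if "y < 0" for y using that by (simp add: smooth_step_def box_step_neg)
  \<comment> \<open>The approximations are known to vanish only for negative arguments; the value at
    0 comes from continuity.\<close>
  have "smooth_step n 0 \<le> 0"
  proof (rule LIMSEQ_le_const2)
    show "(\<lambda>k. smooth_step n (- inverse (real (Suc k)))) \<longlonglongrightarrow> smooth_step n 0"
      by (rule isCont_tendsto_compose[OF continuous_smooth_step])
        (use tendsto_minus[OF LIMSEQ_inverse_real_of_nat] in simp)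
  qed (auto intro!: exI[of _ 0] simp: neg)
  then show ?thesis using neg x smooth_step_bounds[of n 0] by (cases "x = 0") auto
qed

lemma smooth_step_deriv:
  "(smooth_step n has_real_derivative (smooth_step (Suc n) x - smooth_step (Suc n) (x - a n)) / a n) (at x)"
proof -
  define F where "F = (\<lambda>y. integral {x - a n - 1..y} (smooth_step (Suc n)))"
  have cont: "continuous_on S (smooth_step (Suc n))" for S
    by (simp add: continuous_at_imp_continuous_on continuous_smooth_step)
  have int: "smooth_step (Suc n) integrable_on {u..v}" for u v
    by (rule mono_integrable_on[OF mono_smooth_step])
  have dF: "(F has_real_derivative smooth_step (Suc n) y) (at y)" if "y \<in> {x - a n - 1<..<x + 1}" for y
  proof -
    have "(F has_real_derivative smooth_step (Suc n) y) (at y within {x - a n - 1..x + 1})"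
      unfolding F_def by (rule integral_has_real_derivative[OF cont]) (use that in auto)
    then have "(F has_real_derivative smooth_step (Suc n) y) (at y within {x - a n - 1<..<x + 1})"
      by (rule has_field_derivative_subset) auto
    then show ?thesis using that at_within_open[of y "{x - a n - 1<..<x + 1}"] by simp
  qed
  have eq: "smooth_step n y = (F y - F (y - a n)) / a n" if "y \<in> {x - 1<..<x + 1}" for y
  proof -
    have "F (y - a n) + integral {y - a n..y} (smooth_step (Suc n)) = F y"
      unfolding F_def by (rule Henstock_Kurzweil_Integration.integral_combine[OF _ _ int])
        (use that a_pos[of n] in auto)
    then show ?thesis by (simp add: smooth_step_avg moving_average_def)
  qed
  have "((\<lambda>y. (F y - F (y - a n)) / a n) has_real_derivative
      (smooth_step (Suc n) x - smooth_step (Suc n) (x - a n) * 1) / a n) (at x)"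
  proof (intro DERIV_cdivide DERIV_diff)
    show "(F has_real_derivative smooth_step (Suc n) x) (at x)" by (rule dF) (use a_pos[of n] in auto)
    show "((\<lambda>y. F (y - a n)) has_real_derivative smooth_step (Suc n) (x - a n) * 1) (at x)"
      by (rule DERIV_chain2[where g = "\<lambda>y. y - a n"])
        (use a_pos[of n] in \<open>auto intro!: dF derivative_eq_intros\<close>)
  qed
  then have "((\<lambda>y. (F y - F (y - a n)) / a n) has_real_derivative
      (smooth_step (Suc n) x - smooth_step (Suc n) (x - a n)) / a n) (at x)" by simp
  then show ?thesis
    by (rule has_field_derivative_transform_within_open[where S = "{x - 1<..<x + 1}"])
      (auto simp: eq)
qed

lemma step_deriv_DERIV: "(step_deriv k n has_real_derivative step_deriv (Suc k) n x) (at x)"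
proof (induction k arbitrary: n x)
  case 0
  show ?case using smooth_step_deriv by simp
next
  case (Suc k)
  have "((\<lambda>x. (step_deriv k (Suc n) x - step_deriv k (Suc n) (x - a n)) / a n) has_real_derivative
      (step_deriv (Suc k) (Suc n) x - step_deriv (Suc k) (Suc n) (x - a n) * 1) / a n) (at x)"
    by (intro DERIV_cdivide DERIV_diff Suc.IH DERIV_chain2[where g = "\<lambda>y. y - a n"])
      (auto intro!: derivative_eq_intros)
  then show ?case by simp
qed

lemma step_deriv_zero: "x \<le> 0 \<Longrightarrow> step_deriv k n x = 0"
proof (induction k arbitrary: n x)
  case (Suc k)
  then show ?case using a_pos[of n] by (simp add: Suc.IH)
qed (simp add: smooth_step_zero)

lemma step_deriv_right: "2 * a n \<le> x \<Longrightarrow> step_deriv (Suc k) n x = 0"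
proof (induction k arbitrary: n x)
  case 0
  then show ?case using a_half[of n] a_pos[of n] by (simp add: smooth_step_one)
next
  case (Suc k)
  have "step_deriv (Suc k) (Suc n) x = 0" "step_deriv (Suc k) (Suc n) (x - a n) = 0"
    by (rule Suc.IH, use Suc.prems a_half[of n] a_pos[of n] in linarith)+
  then show ?case by (subst step_deriv.simps(2)) (simp only: diff_self div_0)
qed

lemma step_deriv_bound: "\<bar>step_deriv k n x\<bar> \<le> 2 ^ k / (\<Prod>i<k. a (n + i))"
proof (induction k arbitrary: n x)
  case 0
  then show ?case using smooth_step_bounds[of n x] by simp
next
  case (Suc k)
  let ?P = "2 ^ k / (\<Prod>i<k. a (Suc n + i))"
  have "\<bar>step_deriv k (Suc n) x - step_deriv k (Suc n) (x - a n)\<bar> \<le> ?P + ?P"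
    using Suc[of "Suc n" x] Suc[of "Suc n" "x - a n"] by linarith
  then have "\<bar>step_deriv (Suc k) n x\<bar> \<le> (?P + ?P) / a n"
    using a_pos[of n] by (simp only: step_deriv.simps abs_divide abs_of_pos divide_right_mono)
  also have "\<dots> = 2 ^ Suc k / (\<Prod>i<Suc k. a (n + i))"
    by (subst prod.lessThan_Suc_shift) simp
  finally show ?case .
qed

end

section \<open>Quasinorms and towers of derivatives\<close>

text \<open>The \<open>p\<close>-th power of the quasinorm in [0, infinity]. It is subadditive, and
  unlike \<open>Lp_norm\<close>, whose integral defaults to 0, it detects functions outside
  \<open>L^p\<close>.\<close>

definition ecost :: "real \<Rightarrow> (real \<Rightarrow> complex) \<Rightarrow> ennreal" where
  "ecost p f = (\<integral>\<^sup>+x. ennreal (norm (f x) powr p) \<partial>lebesgue)"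

text \<open>Division by \<open>a + c\<close> reduces the claim to \<open>t \<le> t powr p\<close>
  for \<open>t\<close> in [0, 1].\<close>

lemma powr_add_le:
  fixes a c p :: real
  assumes "0 \<le> a" "0 \<le> c" "0 < p" "p \<le> 1"
  shows "(a + c) powr p \<le> a powr p + c powr p"
proof (cases "a + c = 0")
  case False
  then have s: "a + c > 0" using assms by simp
  have le: "x / (a + c) \<le> x powr p / (a + c) powr p" if "0 \<le> x" "x \<le> a + c" for x
  proof -
    have "(x / (a + c)) powr 1 \<le> (x / (a + c)) powr p"
      by (rule powr_mono') (use that s assms in auto)
    then show ?thesis using that s by (simp add: powr_divide split: if_splits)
  qed
  have "1 = a / (a + c) + c / (a + c)" using s by (simp add: add_divide_distrib[symmetric])
  also have "\<dots> \<le> a powr p / (a + c) powr p + c powr p / (a + c) powr p"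
    by (intro add_mono le) (use assms in auto)
  finally have "1 \<le> (a powr p + c powr p) / (a + c) powr p" by (simp add: add_divide_distrib)
  then show ?thesis using s by simp
qed (use assms in simp)

lemma ecost_add:
  assumes "0 < p" "p \<le> 1" "f \<in> borel_measurable lebesgue" "g \<in> borel_measurable lebesgue"
  shows "ecost p (\<lambda>x. f x + g x) \<le> ecost p f + ecost p g"
proof -
  have "ennreal (norm (f x + g x) powr p) \<le> ennreal (norm (f x) powr p) + ennreal (norm (g x) powr p)" for x
  proof -
    have "norm (f x + g x) powr p \<le> (norm (f x) + norm (g x)) powr p"
      by (rule powr_mono2) (use assms norm_triangle_ineq in auto)
    also have "\<dots> \<le> norm (f x) powr p + norm (g x) powr p" by (rule powr_add_le) (use assms in auto)
    finally show ?thesis by (simp add: ennreal_plus[symmetric] ennreal_leI del: ennreal_plus)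
  qed
  then have "ecost p (\<lambda>x. f x + g x) \<le> (\<integral>\<^sup>+x. ennreal (norm (f x) powr p) + ennreal (norm (g x) powr p) \<partial>lebesgue)"
    unfolding ecost_def by (intro nn_integral_mono) auto
  also have "\<dots> = ecost p f + ecost p g"
    unfolding ecost_def by (rule nn_integral_add) (use assms in measurable)
  finally show ?thesis .
qed

lemma ecost_cmult:
  assumes [measurable]: "f \<in> borel_measurable lebesgue"
  shows "ecost p (\<lambda>x. c * f x) = ennreal (norm c powr p) * ecost p f"
proof -
  have "ecost p (\<lambda>x. c * f x) = (\<integral>\<^sup>+x. ennreal (norm c powr p) * ennreal (norm (f x) powr p) \<partial>lebesgue)"
    unfolding ecost_def by (intro nn_integral_cong) (simp add: norm_mult powr_mult ennreal_mult)
  also have "\<dots> = ennreal (norm c powr p) * ecost p f"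
    unfolding ecost_def by (rule nn_integral_cmult) measurable
  finally show ?thesis .
qed

lemma ecost_minus: "ecost p (\<lambda>x. - f x) = ecost p f"
  by (simp add: ecost_def)

lemma ecost_shift:
  assumes [measurable]: "f \<in> borel_measurable lebesgue"
  shows "ecost p (\<lambda>x. f (x - a)) = ecost p f"
proof -
  have "ecost p f = ennreal \<bar>1\<bar> * (\<integral>\<^sup>+x. ennreal (norm (f (- a + 1 * x)) powr p) \<partial>lebesgue)"
    unfolding ecost_def by (rule nn_integral_real_affine_lebesgue) (use assms in \<open>auto intro!: measurable_compose[OF assms]\<close>)
  then show ?thesis by (simp add: ecost_def)
qed

lemma continuous_borel_measurable_lebesgue:
  fixes f :: "real \<Rightarrow> 'b::topological_space"
  assumes "continuous_on UNIV f"
  shows "f \<in> borel_measurable lebesgue"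
  using borel_measurable_continuous_onI[OF assms] by (simp add: measurable_completion)

lemma ecost_le_bounded:
  assumes "\<And>x. norm (f x) \<le> C" "\<And>x. x \<notin> {a..b} \<Longrightarrow> f x = 0" "a \<le> b" "0 < p"
  shows "ecost p f \<le> ennreal (C powr p * (b - a))"
proof -
  have "ecost p f \<le> (\<integral>\<^sup>+x. ennreal (C powr p) * indicator {a..b} x \<partial>lebesgue)"
    unfolding ecost_def
  proof (rule nn_integral_mono)
    fix x
    show "ennreal (norm (f x) powr p) \<le> ennreal (C powr p) * indicator {a..b} x"
      by (cases "x \<in> {a..b}") (use assms in \<open>auto intro!: ennreal_leI powr_mono2\<close>)
  qed
  also have "\<dots> = ennreal (C powr p) * emeasure lebesgue {a..b}"
    by (rule nn_integral_cmult_indicator) auto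
  also have "\<dots> = ennreal (C powr p * (b - a))" using assms by (simp add: ennreal_mult)
  finally show ?thesis .
qed

lemma Lp_fun_iff: "f \<in> Lp_fun p \<longleftrightarrow> f \<in> borel_measurable lebesgue \<and> ecost p f < \<infinity>"
proof (cases "f \<in> borel_measurable lebesgue")
  case True
  then have "(\<lambda>x. norm (f x) powr p) \<in> borel_measurable lebesgue" by measurable
  then show ?thesis using True
    unfolding Lp_fun_def ecost_def by (auto simp: integrable_iff_bounded)
qed (simp add: Lp_fun_def)

lemma Lp_norm_nonneg: "0 \<le> Lp_norm p f"
  by (simp add: Lp_norm_def)

lemma ecost_eq:
  assumes "0 < p" "f \<in> Lp_fun p"
  shows "ecost p f = ennreal (Lp_norm p f powr p)"
proof -
  have i: "integrable lebesgue (\<lambda>x. norm (f x) powr p)" using assms by (simp add: Lp_fun_def)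
  have "ecost p f = ennreal (\<integral>x. norm (f x) powr p \<partial>lebesgue)"
    unfolding ecost_def by (rule nn_integral_eq_integral[OF i]) auto
  moreover have "(\<integral>x. norm (f x) powr p \<partial>lebesgue) \<ge> 0" by (rule integral_nonneg_AE) auto
  ultimately show ?thesis using assms by (simp add: Lp_norm_def powr_powr)
qed

lemma Lp_norm_le_iff:
  assumes "0 < p" "f \<in> Lp_fun p" "0 \<le> c"
  shows "Lp_norm p f \<le> c \<longleftrightarrow> ecost p f \<le> ennreal (c powr p)"
  using assms Lp_norm_nonneg[of p f] powr_mono2[of p "Lp_norm p f" c]
    powr_less_mono2[of p c "Lp_norm p f"]
  by (auto simp: ecost_eq not_le[symmetric])

lemma Lp_fun_bound:
  assumes "0 < p" "f \<in> borel_measurable lebesgue" "ecost p f \<le> ennreal (c powr p)" "0 \<le> c"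
  shows "f \<in> Lp_fun p" "Lp_norm p f \<le> c"
proof -
  show f: "f \<in> Lp_fun p" using assms by (simp add: Lp_fun_iff le_less_trans)
  show "Lp_norm p f \<le> c" using assms Lp_norm_le_iff[OF _ f] by simp
qed

lemma Lp_fun_add:
  assumes "0 < p" "p \<le> 1" "f \<in> Lp_fun p" "g \<in> Lp_fun p"
  shows "(\<lambda>x. f x + g x) \<in> Lp_fun p"
  using assms ecost_add[of p f g] by (auto simp: Lp_fun_iff intro: le_less_trans)

lemma Lp_fun_cmult: "f \<in> Lp_fun p \<Longrightarrow> (\<lambda>x. c * f x) \<in> Lp_fun p"
  by (auto simp: Lp_fun_iff ecost_cmult ennreal_mult_less_top)

lemma Lp_fun_diff:
  assumes "0 < p" "p \<le> 1" "f \<in> Lp_fun p" "g \<in> Lp_fun p"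
  shows "(\<lambda>x. f x - g x) \<in> Lp_fun p"
  using Lp_fun_add[OF assms(1,2,3) Lp_fun_cmult[OF assms(4), of "- 1"]] by simp

lemma Lp_fun_zero: "(\<lambda>x. 0) \<in> Lp_fun p"
  by (simp add: Lp_fun_def)

lemma Lp_norm_powr_add:
  assumes "0 < p" "p \<le> 1" "f \<in> Lp_fun p" "g \<in> Lp_fun p"
  shows "Lp_norm p (\<lambda>x. f x + g x) powr p \<le> Lp_norm p f powr p + Lp_norm p g powr p"
proof -
  have "f \<in> borel_measurable lebesgue" "g \<in> borel_measurable lebesgue"
    using assms by (auto simp: Lp_fun_iff)
  from ecost_add[OF assms(1,2) this]
  have "ennreal (Lp_norm p (\<lambda>x. f x + g x) powr p) \<le> ennreal (Lp_norm p f powr p) + ennreal (Lp_norm p g powr p)"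
    unfolding ecost_eq[OF assms(1) Lp_fun_add[OF assms]] ecost_eq[OF assms(1,3)] ecost_eq[OF assms(1,4)] .
  then show ?thesis by (simp add: ennreal_plus[symmetric] del: ennreal_plus)
qed

lemma Lp_norm_cmult:
  assumes "0 < p"
  shows "Lp_norm p (\<lambda>x. c * f x) = norm c * Lp_norm p f"
proof -
  have "0 \<le> (\<integral>x. norm (f x) powr p \<partial>lebesgue)" by (rule integral_nonneg_AE) auto
  then show ?thesis using assms
    unfolding Lp_norm_def by (simp add: norm_mult powr_mult powr_powr)
qed

text \<open>A function with all its derivatives as explicit data. Sums, multiples, translates and
  shifts of towers are towers, which avoids computing with \<open>nderiv\<close>.\<close>

definition tower :: "(nat \<Rightarrow> real \<Rightarrow> complex) \<Rightarrow> bool" where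
  "tower H \<longleftrightarrow> (\<forall>n x. (H n has_vector_derivative H (Suc n) x) (at x))"

lemma tower_continuous: "tower H \<Longrightarrow> continuous_on S (H n)"
  unfolding tower_def
  by (meson continuous_at_imp_continuous_on has_vector_derivative_continuous)

lemma tower_measurable: "tower H \<Longrightarrow> H n \<in> borel_measurable lebesgue"
  by (intro continuous_borel_measurable_lebesgue tower_continuous)

lemma tower_nderiv:
  assumes "tower H"
  shows "nderiv n (H 0) = H n"
proof (induction n)
  case (Suc n)
  have "nderiv (Suc n) (H 0) = (\<lambda>x. vector_derivative (nderiv n (H 0)) (at x))" by (simp add: nderiv_def)
  also have "\<dots> = H (Suc n)" unfolding Suc using assms by (auto simp: tower_def vector_derivative_at)
  finally show ?case .
qed (simp add: nderiv_def)

lemma tower_smooth: "tower H \<Longrightarrow> smooth (H 0)"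
  unfolding smooth_def using tower_nderiv[of H] by (auto simp: tower_def intro: differentiableI_vector)

lemma smooth_tower:
  assumes "smooth f"
  shows "tower (\<lambda>n. nderiv n f)"
  unfolding tower_def
proof (intro allI)
  fix n x
  have "(nderiv n f has_vector_derivative vector_derivative (nderiv n f) (at x)) (at x)"
    using assms by (simp add: smooth_def vector_derivative_works[symmetric])
  then show "(nderiv n f has_vector_derivative nderiv (Suc n) f x) (at x)" by (simp add: nderiv_def)
qed

lemma tower_add: "tower F \<Longrightarrow> tower G \<Longrightarrow> tower (\<lambda>n x. F n x + G n x)"
  unfolding tower_def by (auto intro!: has_vector_derivative_add)

lemma tower_cmult: "tower F \<Longrightarrow> tower (\<lambda>n x. c * F n x)"
  unfolding tower_def by (auto intro!: has_vector_derivative_mult_right)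

lemma tower_diff: "tower F \<Longrightarrow> tower G \<Longrightarrow> tower (\<lambda>n x. F n x - G n x)"
  unfolding tower_def by (auto intro!: has_vector_derivative_diff)

lemma tower_shift:
  assumes "tower F"
  shows "tower (\<lambda>n x. F n (x - a))"
  unfolding tower_def
proof (intro allI)
  fix n x
  have "((F n \<circ> (\<lambda>x. x - a)) has_vector_derivative 1 *\<^sub>R F (Suc n) (x - a)) (at x)"
    by (rule vector_diff_chain_at) (use assms in \<open>auto simp: tower_def intro!: derivative_eq_intros\<close>)
  then show "((\<lambda>x. F n (x - a)) has_vector_derivative F (Suc n) (x - a)) (at x)" by (simp add: o_def)
qed

lemma tower_Suc: "tower F \<Longrightarrow> tower (\<lambda>n. F (Suc n))"
  by (simp add: tower_def)

context halving_widths
begin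

lemma step_deriv_tower: "tower (\<lambda>k x. complex_of_real (step_deriv k n x))"
  unfolding tower_def by (auto intro: has_vector_derivative_of_real simp: step_deriv_DERIV
      has_real_derivative_iff_has_vector_derivative[symmetric] simp del: step_deriv.simps)

text \<open>This derivative is a combination of 2^k translates of the first derivative of step
  \<open>n + k\<close>, which is at most \<open>1 / a (n + k)\<close> and lives on an interval of
  length \<open>2 * a (n + k)\<close>. Since \<open>p\<close>-th powers are subadditive, the costs
  of the translates add: the last width enters with the favourable exponent \<open>1 - p\<close>,
  all others with \<open>- p\<close>.\<close>

lemma step_deriv_cost:
  assumes "0 < p" "p \<le> 1"
  shows "ecost p (\<lambda>x. complex_of_real (step_deriv (Suc k) n x))
    \<le> ennreal (2 ^ k * (\<Prod>i\<le>k. 1 / a (n + i) powr p) * (2 * a (n + k)))"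
proof (induction k arbitrary: n)
  case 0
  have "ecost p (\<lambda>x. complex_of_real (step_deriv (Suc 0) n x)) \<le> ennreal ((1 / a n) powr p * (2 * a n - 0))"
  proof (rule ecost_le_bounded)
    fix x
    have "\<bar>smooth_step (Suc n) x - smooth_step (Suc n) (x - a n)\<bar> \<le> 1"
      using smooth_step_bounds[of "Suc n" x] smooth_step_bounds[of "Suc n" "x - a n"] by linarith
    then show "norm (complex_of_real (step_deriv (Suc 0) n x)) \<le> 1 / a n"
      using a_pos[of n] by (simp only: norm_of_real step_deriv.simps abs_divide abs_of_pos divide_right_mono)
    assume "x \<notin> {0..2 * a n}"
    then show "complex_of_real (step_deriv (Suc 0) n x) = 0"
      using step_deriv_zero[of x "Suc 0" n] step_deriv_right[of n x 0] by auto
  qed (use a_pos[of n] assms in auto)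
  then show ?case using a_pos[of n] by (simp add: powr_divide)
next
  case (Suc k)
  let ?h = "\<lambda>x. complex_of_real (step_deriv (Suc k) (Suc n) x)"
  let ?B = "2 ^ k * (\<Prod>i\<le>k. 1 / a (Suc n + i) powr p) * (2 * a (Suc n + k))"
  have m: "?h \<in> borel_measurable lebesgue" by (rule tower_measurable[OF step_deriv_tower])
  have m': "(\<lambda>x. ?h (x - a n)) \<in> borel_measurable lebesgue"
    by (rule tower_measurable[OF tower_shift[OF step_deriv_tower]])
  have B0: "0 \<le> ?B" using a_pos by (intro mult_nonneg_nonneg prod_nonneg) (auto simp: less_imp_le)
  have "ecost p (\<lambda>x. complex_of_real (step_deriv (Suc (Suc k)) n x))
     = ecost p (\<lambda>x. complex_of_real (1 / a n) * (?h x + (- 1) * ?h (x - a n)))"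
    by (intro arg_cong[of _ _ "ecost p"] ext, subst step_deriv.simps(2)) (simp add: diff_divide_distrib del: step_deriv.simps)
  also have "\<dots> = ennreal (norm (complex_of_real (1 / a n)) powr p) * ecost p (\<lambda>x. ?h x + (- 1) * ?h (x - a n))"
    by (rule ecost_cmult) (use m m' in measurable)
  also have "\<dots> \<le> ennreal (norm (complex_of_real (1 / a n)) powr p) * (ecost p ?h + ecost p (\<lambda>x. (-1) * ?h (x - a n)))"
    by (intro mult_left_mono ecost_add assms m borel_measurable_times[OF borel_measurable_const m']) simp
  also have "ecost p (\<lambda>x. (-1) * ?h (x - a n)) = ecost p ?h"
    using ecost_shift[OF m, of p "a n"] ecost_minus[of p "\<lambda>x. ?h (x - a n)"]
    by (simp del: step_deriv.simps)
  also have "ennreal (norm (complex_of_real (1 / a n)) powr p) * (ecost p ?h + ecost p ?h)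
      \<le> ennreal (norm (complex_of_real (1 / a n)) powr p) * (ennreal ?B + ennreal ?B)"
    by (intro mult_left_mono add_mono Suc.IH) auto
  also have "\<dots> = ennreal ((1 / a n) powr p * (2 * ?B))"
  proof -
    have "ennreal z + ennreal z = ennreal (2 * z)" if "0 \<le> z" for z using that by (metis ennreal_plus mult_2)
    from this[OF B0] have "ennreal ?B + ennreal ?B = ennreal (2 * ?B)" .
    moreover have "norm (complex_of_real (1 / a n)) = 1 / a n" using a_pos[of n] by (simp only: norm_of_real abs_of_pos zero_less_divide_1_iff)
    ultimately show ?thesis using B0 by (simp only: ennreal_mult powr_ge_zero mult_nonneg_nonneg zero_le_numeral)
  qed
  also have "(1 / a n) powr p * (2 * ?B) = 2 ^ Suc k * (\<Prod>i\<le>Suc k. 1 / a (n + i) powr p) * (2 * a (n + Suc k))"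
    using a_pos[of n] by (subst prod.atMost_Suc_shift) (simp add: powr_divide)
  finally show ?case .
qed

end

section \<open>Jumps smoothed with the greedy widths\<close>

context width_selection
begin

lemma halving_exp_b: "halving_widths (\<lambda>i. exp (- b D i))"
proof
  fix n
  have "exp (- b D (Suc n)) \<le> exp (- b D n - ln 2)" using b_Suc_ge[of D n] K_ge by simp
  then show "exp (- b D (Suc n)) \<le> exp (- b D n) / 2" by (simp add: exp_diff)
qed simp

definition ramp :: "real \<Rightarrow> nat \<Rightarrow> real \<Rightarrow> complex" where
  "ramp D n x = complex_of_real (halving_widths.step_deriv (\<lambda>i. exp (- b D i)) n 0 x)"

lemma ramp_tower: "tower (ramp D)"
  using halving_widths.step_deriv_tower[OF halving_exp_b[of D], of 0] unfolding ramp_def .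

lemma ramp_zero: "x \<le> 0 \<Longrightarrow> ramp D n x = 0"
  using halving_widths.step_deriv_zero[OF halving_exp_b] by (simp add: ramp_def)

lemma ramp_one: "2 * exp (- b D 0) \<le> x \<Longrightarrow> ramp D 0 x = 1"
  using halving_widths.smooth_step_one[OF halving_exp_b]
  by (simp add: ramp_def halving_widths.step_deriv.simps[OF halving_exp_b])

lemma ramp_right: "2 * exp (- b D 0) \<le> x \<Longrightarrow> ramp D (Suc n) x = 0"
  using halving_widths.step_deriv_right[OF halving_exp_b] by (simp add: ramp_def)

lemma ramp_le_1: "norm (ramp D 0 x) \<le> 1"
  using halving_widths.smooth_step_bounds[OF halving_exp_b]
  by (simp add: ramp_def halving_widths.step_deriv.simps[OF halving_exp_b])

lemma prod_exp_b: "(\<Prod>i<n. exp (- b D i)) = exp (- B D n)"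
  by (simp add: B_sum exp_sum sum_negf[symmetric])

lemma ramp_bound: "norm (ramp D (Suc n) x) \<le> 2 ^ Suc n * exp (B D (Suc n))"
proof -
  have "norm (ramp D (Suc n) x) \<le> 2 ^ Suc n / (\<Prod>i<Suc n. exp (- b D (0 + i)))"
    unfolding ramp_def norm_of_real by (rule halving_widths.step_deriv_bound[OF halving_exp_b])
  also have "\<dots> = 2 ^ Suc n * exp (B D (Suc n))"
    unfolding add_0 prod_exp_b by (simp add: exp_minus field_simps)
  finally show ?thesis .
qed

text \<open>The last window contributes \<open>exp (p * b D n)\<close> by height and
  \<open>exp (- b D n)\<close> by length, together \<open>exp (- q * b D n)\<close>. The greedy
  width was chosen to make this compensate the remaining factors.\<close>

lemma ramp_cost: "ecost p (ramp D (Suc n)) \<le> ennreal (exp (p * L n - D + X))"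
proof -
  have "ecost p (ramp D (Suc n)) \<le> ennreal (2 ^ n * (\<Prod>i\<le>n. 1 / exp (- b D (0 + i)) powr p) * (2 * exp (- b D (0 + n))))"
    unfolding ramp_def by (rule halving_widths.step_deriv_cost[OF halving_exp_b]) (use p_pos p_less_1 in auto)
  also have "(\<Prod>i\<le>n. 1 / exp (- b D (0 + i)) powr p) = exp (p * B D (Suc n))"
    unfolding B_sum lessThan_Suc_atMost
    by (simp add: powr_def exp_sum[symmetric] exp_minus[symmetric] sum_distrib_left divide_inverse)
  also have "(2::real) ^ n * exp (p * B D (Suc n)) * (2 * exp (- b D (0 + n))) = exp (ln 2 * (real n + 1) + p * B D n - q * b D n)"
  proof -
    have "(2::real) ^ n * 2 = exp (ln 2 * (real n + 1))"
    proof -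
      have "exp (ln 2 * (real n + 1)) = exp (real (Suc n) * ln 2)" by (simp add: algebra_simps)
      also have "\<dots> = exp (ln 2) ^ Suc n" by (rule exp_of_nat_mult)
      finally show ?thesis by simp
    qed
    moreover have "exp (p * B D (Suc n)) * exp (- b D n) = exp (p * B D n - q * b D n)"
      by (simp add: exp_add[symmetric] B_Suc q_def algebra_simps)
    ultimately show ?thesis
      by (simp add: exp_add exp_diff field_simps)
  qed
  also have "ennreal \<dots> \<le> ennreal (exp (p * L n - D + X))"
    using b_ge_cost[of D n] by (intro ennreal_leI) (simp add: algebra_simps)
  finally show ?thesis .
qed

end

section \<open>Absorbing the integral of a function by staircases\<close>

definition sup_on :: "real \<Rightarrow> real \<Rightarrow> (real \<Rightarrow> complex) \<Rightarrow> real" where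
  "sup_on u v f = (SUP x\<in>{u..v}. norm (f x))"

lemma sup_on_attained:
  assumes "u \<le> v" "continuous_on {u..v} f"
  obtains x where "x \<in> {u..v}" "sup_on u v f = norm (f x)"
proof -
  have "continuous_on {u..v} (\<lambda>x. norm (f x))" by (intro continuous_intros assms)
  then obtain x where x: "x \<in> {u..v}" "\<And>y. y \<in> {u..v} \<Longrightarrow> norm (f y) \<le> norm (f x)"
    using continuous_attains_sup[of "{u..v}" "\<lambda>x. norm (f x)"] assms by auto
  have "sup_on u v f = norm (f x)"
    unfolding sup_on_def by (rule cSup_eq_maximum) (use x in auto)
  with x show ?thesis using that by blast
qed

lemma norm_le_sup_on:
  assumes "continuous_on {u..v} f" "x \<in> {u..v}"
  shows "norm (f x) \<le> sup_on u v f"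
proof -
  have "compact ((\<lambda>x. norm (f x)) ` {u..v})"
    by (intro compact_continuous_image continuous_intros assms) auto
  then show ?thesis unfolding sup_on_def
    by (intro cSUP_upper assms bounded_imp_bdd_above compact_imp_bounded)
qed

lemma norm_powr_continuous:
  fixes f :: "real \<Rightarrow> complex"
  assumes "continuous_on S f" "0 < p"
  shows "continuous_on S (\<lambda>x. norm (f x) powr p)"
  by (intro continuous_on_powr' continuous_intros assms) (use assms in auto)

lemma FTC_bound:
  assumes H: "tower H" and x: "x \<in> {u..v}" and y: "y \<in> {u..v}"
  shows "norm (H n x - H n y) \<le> integral {u..v} (\<lambda>t. norm (H (Suc n) t))"
proof -
  have cn: "continuous_on S (\<lambda>t. norm (H (Suc n) t))" for S
    by (intro continuous_intros tower_continuous[OF H])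
  have *: "norm (H n t - H n s) \<le> integral {u..v} (\<lambda>t. norm (H (Suc n) t))"
    if "s \<le> t" "s \<in> {u..v}" "t \<in> {u..v}" for s t
  proof -
    have "(H (Suc n) has_integral (H n t - H n s)) {s..t}"
      by (rule fundamental_theorem_of_calculus[OF that(1)])
        (use H in \<open>auto simp: tower_def intro: has_vector_derivative_at_within\<close>)
    then have eq: "H n t - H n s = integral {s..t} (H (Suc n))" by (simp add: integral_unique)
    have "norm (integral {s..t} (H (Suc n))) \<le> integral {s..t} (\<lambda>t. norm (H (Suc n) t))"
      by (rule integral_norm_bound_integral) (auto intro!: integrable_continuous_real cn tower_continuous[OF H])
    also have "\<dots> \<le> integral {u..v} (\<lambda>t. norm (H (Suc n) t))"
      by (rule integral_subset_le) (use that in \<open>auto intro!: integrable_continuous_real cn\<close>)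
    finally show ?thesis using eq by simp
  qed
  show ?thesis
    using *[of y x] *[of x y] x y by (cases "y \<le> x") (auto simp: norm_minus_commute)
qed

text \<open>First-order Taylor expansion at \<open>x\<close> towards a point at distance exactly
  \<open>h\<close>. Since \<open>h\<close> is at most half the length, such a point exists on one
  side of \<open>x\<close>.\<close>

lemma landau_pointwise:
  assumes f: "\<And>x. x \<in> {u..v} \<Longrightarrow> (f has_vector_derivative f' x) (at x within {u..v})"
    and df': "\<And>x. x \<in> {u..v} \<Longrightarrow> (f' has_vector_derivative f'' x) (at x within {u..v})"
    and A: "\<And>x y. x \<in> {u..v} \<Longrightarrow> y \<in> {u..v} \<Longrightarrow> norm (f x - f y) \<le> A"
    and s: "\<And>x. x \<in> {u..v} \<Longrightarrow> norm (f'' x) \<le> s"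
    and x: "x \<in> {u..v}" and h: "0 < h" "h \<le> (v - u) / 2"
  shows "h * norm (f' x) \<le> A + h\<^sup>2 * s"
proof -
  obtain y where y: "y \<in> {u..v}" "\<bar>y - x\<bar> = h"
    using x h that[of "x + h"] that[of "x - h"] by (cases "x + h \<le> v") (auto simp: field_simps)
  define S where "S = closed_segment x y"
  have S: "S \<subseteq> {u..v}" using x y by (auto simp: S_def closed_segment_eq_real_ivl split: if_splits)
  have lip: "norm (f' z - f' x) \<le> s * h" if z: "z \<in> S" for z
  proof -
    have "norm (f' z - f' x) \<le> s * norm (z - x)"
    proof (rule differentiable_bound[where S = "{u..v}" and f' = "\<lambda>x h. h *\<^sub>R f'' x"])
      fix w assume "w \<in> {u..v}"
      then show "(f' has_derivative (\<lambda>h. h *\<^sub>R f'' w)) (at w within {u..v})"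
        using df' by (simp add: has_vector_derivative_def)
      show "onorm (\<lambda>h. h *\<^sub>R f'' w) \<le> s"
        using s[OF \<open>w \<in> {u..v}\<close>] by (intro onorm_le) (simp add: mult.commute[of s] mult_left_mono)
    qed (use z S x in auto)
    also have "\<dots> \<le> s * h"
    proof (rule mult_left_mono)
      show "norm (z - x) \<le> h" using segment_bound1[of z x y] z y by (simp add: S_def)
      show "0 \<le> s" using s[OF x] norm_ge_zero[of "f'' x"] by linarith
    qed
    finally show ?thesis .
  qed
  have fS: "(f has_vector_derivative f' z) (at z within S)" if "z \<in> S" for z
    using has_vector_derivative_within_subset[OF f S] that S by blast
  have "norm (f y - f x - (y - x) *\<^sub>R f' x) \<le> norm (y - x) * (s * h)"
    by (rule vector_differentiable_bound_linearization[OF fS _ lip]) (auto simp: S_def)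
  moreover have "norm ((y - x) *\<^sub>R f' x) \<le> norm (f y - f x) + norm (f y - f x - (y - x) *\<^sub>R f' x)"
    using norm_triangle_ineq4[of "f y - f x" "f y - f x - (y - x) *\<^sub>R f' x"] by simp
  moreover have "norm (f y - f x) \<le> A" using A y x by simp
  ultimately show ?thesis using y by (simp add: power2_eq_square mult_ac)
qed

text \<open>The choice \<open>h = 4 * A / norm (f' x)\<close> in \<open>landau_pointwise\<close>;
  the lower bound on \<open>f' x\<close> says exactly that this \<open>h\<close> is at most half the
  length of the interval.\<close>

lemma landau_interval:
  assumes uv: "u < v"
    and f: "\<And>x. x \<in> {u..v} \<Longrightarrow> (f has_vector_derivative f' x) (at x within {u..v})"
    and df': "\<And>x. x \<in> {u..v} \<Longrightarrow> (f' has_vector_derivative f'' x) (at x within {u..v})"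
    and A: "\<And>x y. x \<in> {u..v} \<Longrightarrow> y \<in> {u..v} \<Longrightarrow> norm (f x - f y) \<le> 2 * A"
    and s: "\<And>x. x \<in> {u..v} \<Longrightarrow> norm (f'' x) \<le> s"
    and x: "x \<in> {u..v}" and large: "8 / (v - u) * A \<le> norm (f' x)"
  shows "(norm (f' x))\<^sup>2 \<le> 8 * A * s"
proof -
  let ?N = "norm (f' x)"
  have A0: "0 \<le> A" using A[OF x x] by simp
  have s0: "0 \<le> s" using s[OF x] norm_ge_zero[of "f'' x"] by linarith
  have L: "h * ?N \<le> 2 * A + h\<^sup>2 * s" if "0 < h" "h \<le> (v - u) / 2" for h
    by (rule landau_pointwise[OF f df' A s x that])
  show ?thesis
  proof (cases "A = 0")
    case True
    have "?N = 0"
    proof (rule ccontr)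
      assume "?N \<noteq> 0"
      then have N: "0 < ?N" by simp
      \<comment> \<open>For \<open>A = 0\<close> the quotient \<open>4 * A / norm (f' x)\<close> is
        no step size; instead, any positive admissible \<open>h\<close> with
        \<open>h * s < norm (f' x)\<close> gives a contradiction.\<close>
      define h where "h = min ((v - u) / 2) (?N / (2 * (s + 1)))"
      have h: "0 < h" "h \<le> (v - u) / 2" using uv N s0 unfolding h_def by (simp_all only: min.cobounded1) simp
      have "h * ?N \<le> h\<^sup>2 * s" using L[OF h] True by simp
      then have "?N \<le> h * s" using h by (simp add: power2_eq_square mult.assoc)
      also have "\<dots> \<le> ?N / (2 * (s + 1)) * (s + 1)"
        using s0 h N by (intro mult_mono) (auto simp: h_def)
      also have "\<dots> = ?N / 2" using s0 by (simp add: field_simps)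
      finally show False using N by simp
    qed
    then show ?thesis using True by simp
  next
    case False
    then have Apos: "0 < A" using A0 by simp
    then have N: "0 < ?N" using large uv by (smt (verit) divide_pos_pos mult_pos_pos)
    define h where "h = 4 * A / ?N"
    have h: "0 < h" "h \<le> (v - u) / 2"
      using large uv N Apos by (auto simp: h_def field_simps)
    have "h * ?N \<le> 2 * A + h\<^sup>2 * s" using L[OF h] by simp
    then have "4 * A \<le> 2 * A + (4 * A / ?N)\<^sup>2 * s" using N unfolding h_def by simp
    then have "2 * A \<le> 16 * A\<^sup>2 * s / ?N\<^sup>2" by (simp add: power_divide power2_eq_square)
    then have "2 * A * ?N\<^sup>2 \<le> 16 * A\<^sup>2 * s" using N by (simp add: field_simps)
    then have "(2 * A) * ?N\<^sup>2 \<le> (2 * A) * (8 * A * s)" by (simp add: power2_eq_square)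
    then show ?thesis using Apos by simp
  qed
qed

lemma integral_norm_le_sup_powr:
  assumes f: "continuous_on {u..v} f" and p: "0 < p" "p < 1"
  shows "integral {u..v} (\<lambda>x. norm (f x)) \<le> sup_on u v f powr (1 - p) * integral {u..v} (\<lambda>x. norm (f x) powr p)"
proof -
  have "integral {u..v} (\<lambda>x. norm (f x)) \<le> integral {u..v} (\<lambda>x. sup_on u v f powr (1 - p) * norm (f x) powr p)"
  proof (rule integral_le)
    show "(\<lambda>x. norm (f x)) integrable_on {u..v}" by (intro integrable_continuous_real continuous_intros f)
    show "(\<lambda>x. sup_on u v f powr (1 - p) * norm (f x) powr p) integrable_on {u..v}"
      by (intro integrable_continuous_real continuous_intros norm_powr_continuous f p)
    fix x assume x: "x \<in> {u..v}"
    have "norm (f x) = norm (f x) powr (1 - p) * norm (f x) powr p" by (simp add: powr_add[symmetric])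
    also have "\<dots> \<le> sup_on u v f powr (1 - p) * norm (f x) powr p"
      by (intro mult_right_mono powr_mono2 norm_le_sup_on f x) (use p in auto)
    finally show "norm (f x) \<le> sup_on u v f powr (1 - p) * norm (f x) powr p" .
  qed
  then show ?thesis by simp
qed

text \<open>\<open>G\<close> is the tower of g, \<open>exp (L k)\<close> stands for M_(k+1), and
  \<open>\<Psi>\<close> is the distribution function of the measure A, so that
  \<open>\<Psi> v - \<Psi> u\<close> is the measure of the interval.\<close>

locale piece_data = width_selection p L for p L +
  fixes G :: "nat \<Rightarrow> real \<Rightarrow> complex" and \<Psi> :: "real \<Rightarrow> real"
  assumes G_tower: "tower G"
    and \<Psi>_mono: "u \<le> v \<Longrightarrow> \<Psi> u \<le> \<Psi> v"
    and \<Psi>_cost: "u \<le> v \<Longrightarrow>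
      integral {u..v} (\<lambda>x. norm (G k x) powr p) \<le> 2 ^ (k + 1) * exp (p * L k) * (\<Psi> v - \<Psi> u)"
begin

definition mass :: "real \<Rightarrow> real \<Rightarrow> real" where
  "mass u v = integral {u..v} (\<lambda>x. norm (G 0 x))"

definition good :: "real \<Rightarrow> real \<Rightarrow> bool" where
  "good u v \<longleftrightarrow> (v - u) * mass u v powr p \<le> \<Psi> v - \<Psi> u"

definition profile :: "real \<Rightarrow> real \<Rightarrow> nat \<Rightarrow> real" where
  "profile u v n = (case n of 0 \<Rightarrow> mass u v | Suc k \<Rightarrow> sup_on u v (G k))"

lemma G_cont: "continuous_on S (G k)"
  by (rule tower_continuous[OF G_tower])

lemma mass_nonneg: "0 \<le> mass u v"
  unfolding mass_def by (intro integral_nonneg integrable_continuous_real continuous_intros G_cont) auto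

lemma sup_on_G_nonneg: "u \<le> v \<Longrightarrow> 0 \<le> sup_on u v (G k)"
  using norm_le_sup_on[OF G_cont, of u u v k] norm_ge_zero[of "G k u"] by (simp add: order_trans[OF norm_ge_zero])

lemma bad_chain:
  assumes uv: "u < v" and bad: "\<not> good u v"
  shows "integral {u..v} (\<lambda>x. norm (G k x))
    \<le> 2 ^ (k + 1) * exp (p * L k) * (v - u) * mass u v powr p * sup_on u v (G k) powr q"
proof -
  have "integral {u..v} (\<lambda>x. norm (G k x)) \<le> sup_on u v (G k) powr q * integral {u..v} (\<lambda>x. norm (G k x) powr p)"
    unfolding q_def by (rule integral_norm_le_sup_powr) (use G_cont p_pos p_less_1 in auto)
  also have "\<dots> \<le> sup_on u v (G k) powr q * (2 ^ (k + 1) * exp (p * L k) * (\<Psi> v - \<Psi> u))"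
    by (intro mult_left_mono \<Psi>_cost) (use uv in auto)
  also have "\<dots> \<le> sup_on u v (G k) powr q * (2 ^ (k + 1) * exp (p * L k) * ((v - u) * mass u v powr p))"
    by (intro mult_left_mono) (use bad in \<open>auto simp: good_def\<close>)
  finally show ?thesis by (simp add: mult_ac)
qed

text \<open>If |g^(k)| stays above \<open>c\<close>, its cost is at least the length of the interval
  times \<open>c powr p\<close>. Badness bounds this cost by a multiple of the same length, which
  cancels.\<close>

lemma bad_min:
  assumes uv: "u < v" and bad: "\<not> good u v" and c: "\<And>x. x \<in> {u..v} \<Longrightarrow> c \<le> norm (G k x)" "0 < c"
  shows "c \<le> exp (L k + (real k + 1) / p * ln 2) * mass u v"
proof -
  have "(v - u) * c powr p = integral {u..v} (\<lambda>x. c powr p)" using uv by simp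
  also have "\<dots> \<le> integral {u..v} (\<lambda>x. norm (G k x) powr p)"
    by (rule integral_le)
      (use c p_pos in \<open>auto intro!: integrable_continuous_real norm_powr_continuous G_cont powr_mono2\<close>)
  also have "\<dots> \<le> 2 ^ (k + 1) * exp (p * L k) * (\<Psi> v - \<Psi> u)" by (rule \<Psi>_cost) (use uv in simp)
  also have "\<dots> \<le> 2 ^ (k + 1) * exp (p * L k) * ((v - u) * mass u v powr p)"
    by (intro mult_left_mono) (use bad in \<open>auto simp: good_def\<close>)
  finally have "(v - u) * c powr p \<le> (v - u) * (2 ^ (k + 1) * exp (p * L k) * mass u v powr p)"
    by (simp add: mult_ac)
  then have "c powr p \<le> 2 ^ (k + 1) * exp (p * L k) * mass u v powr p" using uv by simp
  then have "(c powr p) powr (1 / p) \<le> (2 ^ (k + 1) * exp (p * L k) * mass u v powr p) powr (1 / p)"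
    by (rule powr_mono2[rotated 2]) (use p_pos in auto)
  moreover have "(2 ^ (k + 1) * exp (p * L k) * mass u v powr p) powr (1 / p)
      = exp (L k + (real k + 1) / p * ln 2) * mass u v"
  proof -
    have "(2::real) ^ (k + 1) = exp ((real k + 1) * ln 2)"
      using exp_of_nat_mult[of "k + 1" "ln 2 :: real"] by (simp add: algebra_simps)
    then have "(2 ^ (k + 1) * exp (p * L k)) powr (1 / p) = exp (((real k + 1) * ln 2 + p * L k) / p)"
      by (simp add: exp_add[symmetric] powr_def)
    also have "((real k + 1) * ln 2 + p * L k) / p = L k + (real k + 1) / p * ln 2"
      using p_pos by (simp add: field_simps)
    finally show ?thesis using p_pos mass_nonneg[of u v] by (simp add: powr_mult powr_powr)
  qed
  ultimately show ?thesis using c p_pos by (simp add: powr_powr)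
qed

text \<open>Two cases for each derivative. If its maximum is at most twice its minimum,
  \<open>bad_min\<close> bounds it by the integral of |g|. Otherwise at least half of the maximum is
  oscillation, hence bounded by the integral of the next derivative, and \<open>bad_chain\<close>
  applies. The last clause is \<open>landau_interval\<close>.\<close>

lemma bad_profile:
  assumes uv: "u < v" and bad: "\<not> good u v"
  shows "sup_profile (ln (1 / (v - u))) (profile u v)"
proof -
  let ?D = "ln (1 / (v - u))"
  have eD: "exp (- ?D) = v - u" "exp ?D = 1 / (v - u)" using uv by (simp_all add: ln_div exp_minus divide_inverse)
  have pos: "0 < mass u v"
  proof (rule ccontr)
    assume "\<not> 0 < mass u v"
    then have "mass u v = 0" using mass_nonneg[of u v] by simp
    then show False using bad \<Psi>_mono[of u v] uv p_pos by (simp add: good_def)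
  qed
  have pow2: "(2::real) ^ j = exp (real j * ln 2)" for j using exp_of_nat_mult[of j "ln 2 :: real"] by simp
  \<comment> \<open>The factor \<open>c\<close> is 1 for the integral of |g| and 2 for derivatives,
    where half of the maximum is lost; doubling the exponent of 2 covers both.\<close>
  have coeff: "c * 2 ^ (k + 1) * exp (p * L k) * (v - u) \<le> exp (2 * ln 2 * (real k + 1) + p * L k - ?D)"
    if "c \<le> 2" "0 \<le> c" for c k
  proof -
    have "c * 2 ^ (k + 1) \<le> 2 ^ (2 * (k + 1))"
    proof -
      have "c * 2 ^ (k + 1) \<le> 2 ^ (k + 1) * (2 ^ (k + 1) :: real)"
        by (rule mult_right_mono) (use that order_trans[OF that(1), of "2 * 2 ^ k"] one_le_power[of "2::real" k] in auto)
      then show ?thesis by (simp only: mult_2 power_add)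
    qed
    then have "c * 2 ^ (k + 1) \<le> exp (2 * ln 2 * (real k + 1))" unfolding pow2 by (simp add: algebra_simps)
    then have "c * 2 ^ (k + 1) * (exp (p * L k) * (v - u)) \<le> exp (2 * ln 2 * (real k + 1)) * (exp (p * L k) * (v - u))"
      by (rule mult_right_mono) (use uv in auto)
    moreover have "exp (2 * ln 2 * (real k + 1) + p * L k - ?D) = exp (2 * ln 2 * (real k + 1)) * (exp (p * L k) * exp (- ?D))"
      by (simp only: exp_add[symmetric] add.assoc diff_conv_add_uminus)
    ultimately show ?thesis unfolding eD(1) by (simp only: mult.assoc)
  qed
  show ?thesis
    unfolding sup_profile_def
  proof (intro conjI allI impI)
    show "0 < profile u v 0" using pos by (simp add: profile_def)
    show "0 \<le> profile u v n" for n
      using sup_on_G_nonneg uv mass_nonneg by (auto simp: profile_def split: nat.split)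
    have "mass u v \<le> 1 * 2 ^ (0 + 1) * exp (p * L 0) * (v - u) * (mass u v powr p * sup_on u v (G 0) powr q)"
      using bad_chain[OF uv bad, of 0] by (simp add: mass_def mult_ac)
    also have "\<dots> \<le> exp (2 * ln 2 * (real 0 + 1) + p * L 0 - ?D) * (mass u v powr p * sup_on u v (G 0) powr q)"
      by (rule mult_right_mono[OF coeff]) auto
    finally show "profile u v 0 \<le> exp (2 * ln 2 + p * L 0 - ?D) * profile u v 0 powr p * profile u v (Suc 0) powr q"
      by (simp add: profile_def mult_ac)
  next
    fix n
    have "continuous_on {u..v} (\<lambda>x. norm (G n x))" by (intro continuous_intros G_cont)
    then obtain x0 where x0: "x0 \<in> {u..v}" "\<And>y. y \<in> {u..v} \<Longrightarrow> norm (G n x0) \<le> norm (G n y)"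
      using continuous_attains_inf[of "{u..v}" "\<lambda>x. norm (G n x)"] uv by auto
    obtain x1 where x1: "x1 \<in> {u..v}" "sup_on u v (G n) = norm (G n x1)"
      using sup_on_attained[OF _ G_cont] uv by (metis less_imp_le)
    have "norm (G n x1) \<le> norm (G n x0) + norm (G n x1 - G n x0)" using norm_triangle_sub by blast
    also have "norm (G n x1 - G n x0) \<le> integral {u..v} (\<lambda>t. norm (G (Suc n) t))"
      by (rule FTC_bound[OF G_tower x1(1) x0(1)])
    finally have le: "sup_on u v (G n) \<le> norm (G n x0) + integral {u..v} (\<lambda>t. norm (G (Suc n) t))"
      using x1 by simp
    show "profile u v (Suc n) \<le> exp (L n + chain_const * (real n + 1)) * profile u v 0 \<or>
        profile u v (Suc n) \<le> exp (2 * ln 2 * (real n + 2) + p * L (Suc n) - ?D) * profile u v 0 powr p *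
          profile u v (Suc (Suc n)) powr q"
    proof (cases "sup_on u v (G n) \<le> 2 * norm (G n x0)")
      case True
      have "norm (G n x0) \<le> exp (L n + (real n + 1) / p * ln 2) * mass u v"
      proof (cases "norm (G n x0) = 0")
        case False
        then show ?thesis by (intro bad_min[OF uv bad]) (use x0 in auto)
      qed (use mass_nonneg in simp)
      then have "sup_on u v (G n) \<le> 2 * exp (L n + (real n + 1) / p * ln 2) * mass u v" using True by simp
      also have "\<dots> \<le> exp (L n + chain_const * (real n + 1)) * mass u v"
      proof (rule mult_right_mono[OF _ mass_nonneg])
        have "2 * exp (L n + (real n + 1) / p * ln 2) = exp (ln 2 + (L n + (real n + 1) / p * ln 2))"
          by (subst exp_add) simp
        also have "\<dots> \<le> exp (L n + chain_const * (real n + 1))"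
          unfolding chain_const_def by (simp add: algebra_simps add_divide_distrib)
        finally show "2 * exp (L n + (real n + 1) / p * ln 2) \<le> exp (L n + chain_const * (real n + 1))" .
      qed
      finally show ?thesis by (simp add: profile_def)
    next
      case False
      then have "sup_on u v (G n) \<le> 2 * integral {u..v} (\<lambda>t. norm (G (Suc n) t))" using le by linarith
      also have "\<dots> \<le> 2 * (2 ^ (Suc n + 1) * exp (p * L (Suc n)) * (v - u) * mass u v powr p * sup_on u v (G (Suc n)) powr q)"
        by (intro mult_left_mono bad_chain[OF uv bad]) simp
      also have "\<dots> = (2 * 2 ^ (Suc n + 1) * exp (p * L (Suc n)) * (v - u)) * (mass u v powr p * sup_on u v (G (Suc n)) powr q)"
        by (simp only: mult_ac)
      also have "\<dots> \<le> exp (2 * ln 2 * (real (Suc n) + 1) + p * L (Suc n) - ?D) * (mass u v powr p * sup_on u v (G (Suc n)) powr q)"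
        by (rule mult_right_mono[OF coeff]) auto
      also have "2 * ln 2 * (real (Suc n) + 1) = 2 * ln 2 * (real n + 2)" by simp
      finally show ?thesis by (simp add: profile_def mult_ac)
    qed
  next
    fix n
    assume large: "8 * exp ?D * profile u v n \<le> profile u v (Suc n)"
    obtain x1 where x1: "x1 \<in> {u..v}" "sup_on u v (G n) = norm (G n x1)"
      using sup_on_attained[OF _ G_cont] uv by (metis less_imp_le)
    \<comment> \<open>An antiderivative of \<open>G n\<close>: the preceding member of the tower, or
      for \<open>n = 0\<close> the primitive of g, whose values are bounded by
      \<open>mass u v\<close>.\<close>
    define f where "f = (case n of 0 \<Rightarrow> (\<lambda>x. integral {u..x} (G 0)) | Suc k \<Rightarrow> G k)"
    have G_der: "(G k has_vector_derivative G (Suc k) x) (at x within S)" for k x S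
      using G_tower by (auto simp: tower_def intro: has_vector_derivative_at_within)
    have "(norm (G n x1))\<^sup>2 \<le> 8 * profile u v n * sup_on u v (G (Suc n))"
    proof (rule landau_interval[OF uv, where f = f and f' = "G n" and f'' = "G (Suc n)"])
      fix x assume x: "x \<in> {u..v}"
      show "(f has_vector_derivative G n x) (at x within {u..v})"
        using x by (auto simp: f_def G_der intro: integral_has_vector_derivative G_cont split: nat.split)
      show "(G n has_vector_derivative G (Suc n) x) (at x within {u..v})" by (rule G_der)
      show "norm (G (Suc n) x) \<le> sup_on u v (G (Suc n))" by (rule norm_le_sup_on[OF G_cont x])
      fix y assume y: "y \<in> {u..v}"
      show "norm (f x - f y) \<le> 2 * profile u v n"
      proof (cases n)
        case 0
        have b: "norm (integral {u..z} (G 0)) \<le> mass u v" if "z \<in> {u..v}" for z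
        proof -
          have "norm (integral {u..z} (G 0)) \<le> integral {u..z} (\<lambda>t. norm (G 0 t))"
            by (rule integral_norm_bound_integral) (auto intro!: integrable_continuous_real continuous_intros G_cont)
          also have "\<dots> \<le> mass u v" unfolding mass_def
            by (rule integral_subset_le) (use that in \<open>auto intro!: integrable_continuous_real continuous_intros G_cont\<close>)
          finally show ?thesis .
        qed
        show ?thesis using b[OF x] b[OF y] norm_triangle_ineq4[of "f x" "f y"] 0 by (simp add: f_def profile_def)
      next
        case (Suc k)
        show ?thesis
          using norm_le_sup_on[OF G_cont x, of k] norm_le_sup_on[OF G_cont y, of k]
            norm_triangle_ineq4[of "f x" "f y"] Suc by (simp add: f_def profile_def)
      qed
    next
      show "8 / (v - u) * profile u v n \<le> norm (G n x1)" using large x1 eD(2) by (simp add: profile_def)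
    qed (use x1 in auto)
    then show "(profile u v (Suc n))\<^sup>2 \<le> 8 * profile u v n * profile u v (Suc (Suc n))"
      using x1 by (simp add: profile_def)
  qed
qed

text \<open>For \<open>l \<ge> 1\<close>, \<open>exp (- level_D l)\<close> is the length of the parent of a dyadic interval of length
  \<open>1 / 2 ^ l\<close>.\<close>

definition level_D :: "nat \<Rightarrow> real" where "level_D l = real (l - 1) * ln 2"

text \<open>An interval that the stopping time can reach: the root, or a half of a bad interval.
  Badness is known for the parent only, so it is the parent to which the growth comparison is
  applied. The disjunct \<open>l = 0\<close> keeps \<open>l - 1\<close> meaningful.\<close>

definition admissible :: "nat \<Rightarrow> real \<Rightarrow> bool" where
  "admissible l u \<longleftrightarrow> l = 0 \<or>
     (\<exists>w. \<not> good w (w + 1 / 2 ^ (l - 1)) \<and> w \<le> u \<and> u + 1 / 2 ^ l \<le> w + 1 / 2 ^ (l - 1))"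

text \<open>A staircase carries the whole increment of the primitive of \<open>G 0\<close> over \<open>{u..v}\<close>, so that the
  primitive minus the staircase is supported in \<open>{u..v}\<close>.\<close>

definition staircase :: "(nat \<Rightarrow> ereal) \<Rightarrow> real \<Rightarrow> real \<Rightarrow> (nat \<Rightarrow> real \<Rightarrow> complex) \<Rightarrow> bool" where
  "staircase Z u v H \<longleftrightarrow> tower H \<and> (\<forall>n. \<forall>x\<le>u. H n x = 0) \<and>
     (\<forall>x\<ge>v. H 0 x = integral {u..v} (G 0)) \<and> (\<forall>n. \<forall>x\<ge>v. H (Suc n) x = 0) \<and>
     (\<forall>n. ecost p (H (Suc n)) \<le> ennreal (2 * exp X * exp (p * L n) * (\<Psi> v - \<Psi> u))) \<and>
     (\<forall>n x. ereal (norm (H (Suc n) x)) \<le> Z n) \<and>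
     (\<integral>\<^sup>+x\<in>{u..v}. ennreal (norm (integral {u..x} (G 0) - H 0 x) powr p) \<partial>lebesgue) \<le> ennreal (2 * (\<Psi> v - \<Psi> u))"

text \<open>\<open>level_D\<close> belongs to the parent, which is twice as long. With this bound
  the ramp still fits into the interval itself, see \<open>level_ramp_width\<close>.\<close>

lemma K_ge_2: "2 * ln 2 \<le> K"
proof -
  have "q * p \<le> 1 * 1" using p_pos p_less_1 q_pos q_less_1 by (intro mult_mono) auto
  moreover have "0 < p * chain_const" using p_pos chain_const_pos by simp
  ultimately have "2 * (ln 2 + p * chain_const) * (q * p) \<le> 2 * (ln 2 + p * chain_const) * 1"
    by (intro mult_left_mono) auto
  then have "2 * (ln 2 + p * chain_const) \<le> 2 * (ln 2 + p * chain_const) / (q * p)"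
    using p_pos q_pos by (simp add: field_simps)
  then show ?thesis using \<open>0 < p * chain_const\<close> unfolding K_def by (smt (verit) ln_gt_zero)
qed

lemma exp_level_D: "exp (- level_D l) \<le> 2 / 2 ^ l"
proof (cases l)
  case (Suc k)
  have "exp (- level_D l) = 1 / exp (ln 2) ^ k" using Suc exp_of_nat_mult[of k "ln 2 :: real"]
    by (simp add: level_D_def exp_minus divide_inverse)
  then show ?thesis using Suc by simp
qed (simp add: level_D_def)

lemma level_ramp_width: "2 * exp (- b (level_D l) 0) \<le> 1 / 2 ^ l"
proof -
  have "level_D l + 2 * ln 2 \<le> b (level_D l) 0" using b_ge[of "level_D l" 0] K_ge_2 by simp
  then have "exp (- b (level_D l) 0) \<le> exp (- level_D l - 2 * ln 2)" by simp
  also have "\<dots> = exp (- level_D l) / 4"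
    using exp_of_nat_mult[of 2 "ln 2 :: real"] by (simp add: exp_diff power2_eq_square)
  also have "\<dots> \<le> 2 / 2 ^ l / 4" by (intro divide_right_mono exp_level_D) auto
  finally show ?thesis by simp
qed

lemma norm_integral_le_mass:
  assumes "u \<le> x" "x \<le> v"
  shows "norm (integral {u..x} (G 0)) \<le> mass u v"
proof -
  have "norm (integral {u..x} (G 0)) \<le> integral {u..x} (\<lambda>t. norm (G 0 t))"
    by (rule integral_norm_bound_integral) (auto intro!: integrable_continuous_real continuous_intros G_cont)
  also have "\<dots> \<le> mass u v" unfolding mass_def
    by (rule integral_subset_le) (use assms in \<open>auto intro!: integrable_continuous_real continuous_intros G_cont\<close>)
  finally show ?thesis .
qed

text \<open>One ramp carries the whole increment \<open>c\<close> of the primitive. Up to constants,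
  both its relative cost and its distance from the primitive are the length times
  \<open>mass u v powr p\<close>, which goodness bounds by the measure of the interval.\<close>

lemma staircase_single:
  assumes l: "v = u + 1 / 2 ^ l" and g: "good u v"
    and Z: "\<And>n. ereal (mass u v * (2 ^ Suc n * exp (B (level_D l) (Suc n)))) \<le> Z n"
  shows "\<exists>H. staircase Z u v H"
proof -
  define c where "c = integral {u..v} (G 0)"
  define D where "D = level_D l"
  define H where "H n x = c * ramp D n (x - u)" for n x
  have uv: "u < v" using l by simp
  have c: "norm c \<le> mass u v" unfolding c_def by (rule norm_integral_le_mass) (use uv in auto)
  have tow: "tower (\<lambda>n x. ramp D n (x - u))" by (rule tower_shift[OF ramp_tower])
  have H_tower: "tower H" unfolding H_def by (rule tower_cmult[OF tow])
  have w: "2 * exp (- b D 0) \<le> x - u" if "v \<le> x" for x using level_ramp_width[of l] that l by (simp add: D_def)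
  have cp: "norm c powr p / 2 ^ l \<le> \<Psi> v - \<Psi> u"
  proof -
    have "(v - u) * norm c powr p \<le> (v - u) * mass u v powr p"
      by (intro mult_left_mono powr_mono2) (use c p_pos uv in auto)
    then show ?thesis using g l by (simp add: good_def)
  qed
  have cost: "ecost p (H (Suc n)) \<le> ennreal (2 * exp X * exp (p * L n) * (\<Psi> v - \<Psi> u))" for n
  proof -
    have "ecost p (H (Suc n)) = ennreal (norm c powr p) * ecost p (\<lambda>x. ramp D (Suc n) (x - u))"
      unfolding H_def by (rule ecost_cmult[OF tower_measurable[OF tow]])
    also have "ecost p (\<lambda>x. ramp D (Suc n) (x - u)) = ecost p (ramp D (Suc n))"
      by (rule ecost_shift[OF tower_measurable[OF ramp_tower]])
    also have "ennreal (norm c powr p) * ecost p (ramp D (Suc n)) \<le> ennreal (norm c powr p) * ennreal (exp (p * L n - D + X))"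
      by (intro mult_left_mono ramp_cost) auto
    also have "\<dots> = ennreal (norm c powr p * exp (p * L n - D + X))" by (simp add: ennreal_mult)
    also have "\<dots> \<le> ennreal (2 * exp X * exp (p * L n) * (\<Psi> v - \<Psi> u))"
    proof (rule ennreal_leI)
      have "norm c powr p * exp (p * L n - D + X) = exp X * exp (p * L n) * (norm c powr p * exp (- D))"
        by (simp add: exp_add exp_diff exp_minus field_simps)
      also have "\<dots> \<le> exp X * exp (p * L n) * (norm c powr p * (2 / 2 ^ l))"
        unfolding D_def by (intro mult_left_mono exp_level_D) auto
      also have "\<dots> = exp X * exp (p * L n) * 2 * (norm c powr p / 2 ^ l)" by simp
      also have "\<dots> \<le> exp X * exp (p * L n) * 2 * (\<Psi> v - \<Psi> u)" by (intro mult_left_mono cp) auto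
      finally show "norm c powr p * exp (p * L n - D + X) \<le> 2 * exp X * exp (p * L n) * (\<Psi> v - \<Psi> u)"
        by (simp add: mult_ac)
    qed
    finally show ?thesis .
  qed
  have sup: "ereal (norm (H (Suc n) x)) \<le> Z n" for n x
  proof -
    have "norm (H (Suc n) x) \<le> mass u v * (2 ^ Suc n * exp (B D (Suc n)))"
      unfolding H_def norm_mult by (intro mult_mono c ramp_bound mass_nonneg) auto
    then have "ereal (norm (H (Suc n) x)) \<le> ereal (mass u v * (2 ^ Suc n * exp (B D (Suc n))))" by simp
    then show ?thesis using Z[of n] unfolding D_def by (rule order_trans)
  qed
  have close: "(\<integral>\<^sup>+x\<in>{u..v}. ennreal (norm (integral {u..x} (G 0) - H 0 x) powr p) \<partial>lebesgue) \<le> ennreal (2 * (\<Psi> v - \<Psi> u))"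
  proof -
    have "(\<integral>\<^sup>+x\<in>{u..v}. ennreal (norm (integral {u..x} (G 0) - H 0 x) powr p) \<partial>lebesgue)
      \<le> (\<integral>\<^sup>+x. ennreal ((2 * mass u v) powr p) * indicator {u..v} x \<partial>lebesgue)"
    proof (rule nn_integral_mono)
      fix x
      show "ennreal (norm (integral {u..x} (G 0) - H 0 x) powr p) * indicator {u..v} x \<le>
        ennreal ((2 * mass u v) powr p) * indicator {u..v} x"
      proof (cases "x \<in> {u..v}")
        case True
        have "norm (H 0 x) \<le> mass u v * 1" unfolding H_def norm_mult by (intro mult_mono c ramp_le_1 mass_nonneg) auto
        then have "norm (integral {u..x} (G 0) - H 0 x) \<le> 2 * mass u v"
          using norm_integral_le_mass[of u x v] True norm_triangle_ineq4[of "integral {u..x} (G 0)" "H 0 x"] by auto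
        then show ?thesis using True p_pos by (auto intro!: ennreal_leI powr_mono2)
      qed simp
    qed
    also have "\<dots> = ennreal ((2 * mass u v) powr p) * emeasure lebesgue {u..v}"
      by (rule nn_integral_cmult_indicator) auto
    also have "\<dots> = ennreal ((2 * mass u v) powr p * (v - u))" using uv by (simp add: ennreal_mult)
    also have "\<dots> \<le> ennreal (2 * (\<Psi> v - \<Psi> u))"
    proof (rule ennreal_leI)
      have "(2::real) powr p \<le> 2 powr 1" using p_less_1 by (intro powr_mono) auto
      then have "2 powr p * ((v - u) * mass u v powr p) \<le> 2 * (\<Psi> v - \<Psi> u)"
        using g uv by (intro mult_mono) (auto simp: good_def)
      then show "(2 * mass u v) powr p * (v - u) \<le> 2 * (\<Psi> v - \<Psi> u)"
        using mass_nonneg[of u v] by (simp add: powr_mult mult_ac)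
    qed
    finally show ?thesis .
  qed
  show ?thesis
    unfolding staircase_def
  proof (intro exI[of _ H] conjI allI impI)
    show "H n x = 0" if "x \<le> u" for n x using that by (simp add: H_def ramp_zero)
    show "H 0 x = integral {u..v} (G 0)" if "v \<le> x" for x using w[OF that] by (simp add: H_def ramp_one c_def)
    show "H (Suc n) x = 0" if "v \<le> x" for n x using w[OF that] by (simp add: H_def ramp_right)
  qed (fact H_tower cost sup close)+
qed

text \<open>The budgets are increments of \<open>\<Psi>\<close> and add up exactly. The sup bounds
  do not add, because at each point at most one of the two staircases has nonzero
  derivatives.\<close>

lemma staircase_join:
  assumes uw: "u \<le> w" and wv: "w \<le> v" and H1: "staircase Z u w H1" and H2: "staircase Z w v H2"
  shows "staircase Z u v (\<lambda>n x. H1 n x + H2 n x)"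
proof -
  have t: "tower H1" "tower H2" using H1 H2 by (auto simp: staircase_def)
  have comb: "integral {u..w} (G 0) + integral {w..x} (G 0) = integral {u..x} (G 0)" if "w \<le> x" for x
    by (rule Henstock_Kurzweil_Integration.integral_combine[OF uw that]) (auto intro!: integrable_continuous_real G_cont)
  show ?thesis
    unfolding staircase_def
  proof (intro conjI allI impI)
    show "tower (\<lambda>n x. H1 n x + H2 n x)" by (rule tower_add[OF t])
    show "H1 n x + H2 n x = 0" if "x \<le> u" for n x using H1 H2 that uw by (simp add: staircase_def)
    show "H1 0 x + H2 0 x = integral {u..v} (G 0)" if "v \<le> x" for x
      using H1 H2 that wv comb[of v] by (simp add: staircase_def)
    show "H1 (Suc n) x + H2 (Suc n) x = 0" if "v \<le> x" for n x
      using H1 H2 that wv by (simp add: staircase_def)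
    show "ereal (norm (H1 (Suc n) x + H2 (Suc n) x)) \<le> Z n" for n x
      using H1 H2 by (cases "x \<le> w") (auto simp: staircase_def)
    show "ecost p (\<lambda>x. H1 (Suc n) x + H2 (Suc n) x) \<le> ennreal (2 * exp X * exp (p * L n) * (\<Psi> v - \<Psi> u))" for n
    proof -
      have "ecost p (\<lambda>x. H1 (Suc n) x + H2 (Suc n) x) \<le> ecost p (H1 (Suc n)) + ecost p (H2 (Suc n))"
        by (rule ecost_add) (use t p_pos p_less_1 in \<open>auto intro: tower_measurable\<close>)
      also have "\<dots> \<le> ennreal (2 * exp X * exp (p * L n) * (\<Psi> w - \<Psi> u)) + ennreal (2 * exp X * exp (p * L n) * (\<Psi> v - \<Psi> w))"
        using H1 H2 unfolding staircase_def by (blast intro: add_mono)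
      also have "\<dots> = ennreal (2 * exp X * exp (p * L n) * (\<Psi> w - \<Psi> u) + 2 * exp X * exp (p * L n) * (\<Psi> v - \<Psi> w))"
        by (rule ennreal_plus[symmetric]) (use \<Psi>_mono uw wv in auto)
      finally show ?thesis by (simp add: algebra_simps)
    qed
    let ?f = "\<lambda>x. ennreal (norm (integral {u..x} (G 0) - (H1 0 x + H2 0 x)) powr p)"
    let ?f1 = "\<lambda>x. ennreal (norm (integral {u..x} (G 0) - H1 0 x) powr p) * indicator {u..w} x"
    let ?f2 = "\<lambda>x. ennreal (norm (integral {w..x} (G 0) - H2 0 x) powr p) * indicator {w..v} x"
    have cont: "continuous_on {a..c} (\<lambda>x. integral {a..x} (G 0))" for a c
      by (intro indefinite_integral_continuous_1 integrable_continuous_real G_cont)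
    have meas: "(\<lambda>x. ennreal (norm (integral {a..x} (G 0) - H 0 x) powr p) * indicator {a..c} x) \<in> borel_measurable lebesgue"
      if "tower H" for a c H
    proof -
      have "continuous_on {a..c} (\<lambda>x. norm (integral {a..x} (G 0) - H 0 x) powr p)"
        by (intro norm_powr_continuous continuous_on_diff cont tower_continuous[OF that] p_pos)
      then have "(\<lambda>x. indicator {a..c} x *\<^sub>R (norm (integral {a..x} (G 0) - H 0 x) powr p)) \<in> borel_measurable borel"
        by (intro borel_measurable_continuous_on_indicator) auto
      then have "(\<lambda>x. indicator {a..c} x *\<^sub>R (norm (integral {a..x} (G 0) - H 0 x) powr p)) \<in> borel_measurable lebesgue"
        by (simp add: measurable_completion)
      then have "(\<lambda>x. ennreal (indicator {a..c} x *\<^sub>R (norm (integral {a..x} (G 0) - H 0 x) powr p))) \<in> borel_measurable lebesgue"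
        by measurable
      also have "(\<lambda>x. ennreal (indicator {a..c} x *\<^sub>R (norm (integral {a..x} (G 0) - H 0 x) powr p))) =
         (\<lambda>x. ennreal (norm (integral {a..x} (G 0) - H 0 x) powr p) * indicator {a..c} x)"
        by (auto simp: indicator_def)
      finally show ?thesis .
    qed
    have "(\<integral>\<^sup>+x. ?f x * indicator {u..v} x \<partial>lebesgue) \<le> (\<integral>\<^sup>+x. ?f1 x + ?f2 x \<partial>lebesgue)"
    proof (rule nn_integral_mono)
      fix x
      have "?f x = ?f1 x" if "x \<in> {u..w}" using that H2 by (simp add: staircase_def)
      moreover have "?f x = ?f2 x" if "x \<in> {w..v}" 
      proof -
        have "H1 0 x = integral {u..w} (G 0)" using that H1 by (simp add: staircase_def)
        moreover have "integral {u..x} (G 0) = integral {u..w} (G 0) + integral {w..x} (G 0)"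
          using that comb[of x] by simp
        ultimately have "integral {u..x} (G 0) - (H1 0 x + H2 0 x) = integral {w..x} (G 0) - H2 0 x" by simp
        then show ?thesis using that by (simp only: indicator_simps mult_1_right)
      qed
      ultimately show "?f x * indicator {u..v} x \<le> ?f1 x + ?f2 x"
        by (cases "x \<in> {u..w}"; cases "x \<in> {w..v}") (auto simp: indicator_def)
    qed
    also have "\<dots> = (\<integral>\<^sup>+x. ?f1 x \<partial>lebesgue) + (\<integral>\<^sup>+x. ?f2 x \<partial>lebesgue)"
      by (rule nn_integral_add) (rule meas[OF t(1)], rule meas[OF t(2)])
    also have "\<dots> \<le> ennreal (2 * (\<Psi> w - \<Psi> u)) + ennreal (2 * (\<Psi> v - \<Psi> w))"
      using H1 H2 unfolding staircase_def by (blast intro: add_mono)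
    also have "\<dots> = ennreal (2 * (\<Psi> w - \<Psi> u) + 2 * (\<Psi> v - \<Psi> w))"
      by (rule ennreal_plus[symmetric]) (use \<Psi>_mono uw wv in auto)
    finally show "(\<integral>\<^sup>+x\<in>{u..v}. ?f x \<partial>lebesgue) \<le> ennreal (2 * (\<Psi> v - \<Psi> u))"
      by (simp add: algebra_simps)
  qed
qed

text \<open>Induction on the number \<open>j\<close> of halvings after which all subintervals are
  good. The hypothesis on \<open>Z\<close> ranges over all admissible good subintervals, so it
  passes to both halves unchanged.\<close>

lemma staircase_refine:
  assumes "\<And>w. u \<le> w \<Longrightarrow> w + 1 / 2 ^ (l + j) \<le> u + 1 / 2 ^ l \<Longrightarrow> good w (w + 1 / 2 ^ (l + j))"
    and "admissible l u"
    and Z: "\<And>k w n. u \<le> w \<Longrightarrow> w + 1 / 2 ^ k \<le> u + 1 / 2 ^ l \<Longrightarrow> admissible k w \<Longrightarrow> good w (w + 1 / 2 ^ k) \<Longrightarrow>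
      ereal (mass w (w + 1 / 2 ^ k) * (2 ^ Suc n * exp (B (level_D k) (Suc n)))) \<le> Z n"
  shows "\<exists>H. staircase Z u (u + 1 / 2 ^ l) H"
  using assms
proof (induction j arbitrary: l u)
  case 0
  show ?case
    by (rule staircase_single[OF refl]) (use "0.prems"(1)[of u] "0.prems"(2) "0.prems"(3)[of u l] in auto)
next
  case (Suc j)
  show ?case
  proof (cases "good u (u + 1 / 2 ^ l)")
    case True
    show ?thesis by (rule staircase_single[OF refl True]) (use Suc.prems(2) Suc.prems(3)[of u l] True in auto)
  next
    case False
    let ?w = "u + 1 / 2 ^ Suc l"
    have half: "1 / 2 ^ Suc l + 1 / 2 ^ Suc l = (1 / 2 ^ l :: real)" by simp
    have v: "u + 1 / 2 ^ l = ?w + 1 / 2 ^ Suc l" using half by linarith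
    have pos: "0 < (1 / 2 ^ Suc l :: real)" by simp
    have "\<exists>H. staircase Z u (u + 1 / 2 ^ Suc l) H"
    proof (rule Suc.IH)
      show "good w (w + 1 / 2 ^ (Suc l + j))" if "u \<le> w" "w + 1 / 2 ^ (Suc l + j) \<le> u + 1 / 2 ^ Suc l" for w
        unfolding add_Suc_shift
      proof (rule Suc.prems(1))
        show "u \<le> w" using that pos by linarith
        show "w + 1 / 2 ^ (l + Suc j) \<le> u + 1 / 2 ^ l" using that v pos unfolding add_Suc_shift by linarith
      qed
      show "admissible (Suc l) u" unfolding admissible_def diff_Suc_1
      proof (intro disjI2 exI[of _ u] conjI)
        show "\<not> good u (u + 1 / 2 ^ l)" by (rule False)
      qed (use v pos in linarith)+
      show "ereal (mass w (w + 1 / 2 ^ k) * (2 ^ Suc n * exp (B (level_D k) (Suc n)))) \<le> Z n"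
        if "u \<le> w" "w + 1 / 2 ^ k \<le> u + 1 / 2 ^ Suc l" "admissible k w" "good w (w + 1 / 2 ^ k)" for k w n
        by (rule Suc.prems(3)) (use that v pos in linarith)+
    qed
    moreover have "\<exists>H. staircase Z ?w (?w + 1 / 2 ^ Suc l) H"
    proof (rule Suc.IH)
      show "good w (w + 1 / 2 ^ (Suc l + j))" if "?w \<le> w" "w + 1 / 2 ^ (Suc l + j) \<le> ?w + 1 / 2 ^ Suc l" for w
        unfolding add_Suc_shift
      proof (rule Suc.prems(1))
        show "u \<le> w" using that pos by linarith
        show "w + 1 / 2 ^ (l + Suc j) \<le> u + 1 / 2 ^ l" using that v pos unfolding add_Suc_shift by linarith
      qed
      show "admissible (Suc l) ?w" unfolding admissible_def diff_Suc_1
      proof (intro disjI2 exI[of _ u] conjI)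
        show "\<not> good u (u + 1 / 2 ^ l)" by (rule False)
      qed (use v pos in linarith)+
      show "ereal (mass w (w + 1 / 2 ^ k) * (2 ^ Suc n * exp (B (level_D k) (Suc n)))) \<le> Z n"
        if "?w \<le> w" "w + 1 / 2 ^ k \<le> ?w + 1 / 2 ^ Suc l" "admissible k w" "good w (w + 1 / 2 ^ k)" for k w n
        by (rule Suc.prems(3)) (use that v pos in linarith)+
    qed
    ultimately obtain H1 H2 where H: "staircase Z u ?w H1" "staircase Z ?w (u + 1 / 2 ^ l) H2" unfolding v by blast
    have "u \<le> ?w" "?w \<le> u + 1 / 2 ^ l" using pos v by linarith+
    from staircase_join[OF this H] show ?thesis by blast
  qed
qed

end

section \<open>Almost primitives\<close>

text \<open>The weights \<open>1 / (2 ^ (k + 1) * exp (p * L k))\<close> make the sum of the costs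
  converge. The arctangent adds a finite measure of positive density, which makes all sufficiently
  short intervals in a bounded region good.\<close>

lemma (in width_selection) cost_potential:
  assumes G: "tower G" and Lp: "\<And>k. G k \<in> Lp_fun p" and bd: "\<And>k. Lp_norm p (G k) \<le> c0 * exp (L k)" and c0: "0 \<le> c0"
  obtains \<Psi> S where "piece_data p L G \<Psi>" "\<And>x. \<bar>\<Psi> x\<bar> \<le> S"
    "\<And>u v. u \<le> v \<Longrightarrow> arctan v - arctan u \<le> \<Psi> v - \<Psi> u"
proof -
  define f where "f k x = norm (G k x) powr p" for k x
  define w where "w k = 1 / (2 ^ (k + 1) * exp (p * L k))" for k
  define F where "F k x = integral {..x} (f k)" for k x
  have wpos: "0 < w k" for k by (simp add: w_def)
  have ai: "f k absolutely_integrable_on UNIV" for k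
    using Lp[of k] unfolding Lp_fun_def f_def set_integrable_def by simp
  have int: "f k integrable_on A" if "A \<in> sets lebesgue" for k A
    using set_integrable_subset[OF ai that] set_lebesgue_integral_eq_integral(1) by auto
  have F0: "0 \<le> F k x" for k x unfolding F_def by (rule integral_nonneg) (auto intro: int simp: f_def)
  have Fbd: "w k * F k x \<le> c0 powr p * (1 / 2) ^ (k + 1)" for k x
  proof -
    have "F k x \<le> integral UNIV (f k)"
      unfolding F_def by (rule integral_subset_le) (auto intro: int simp: f_def)
    also have "\<dots> = (\<integral>x. f k x \<partial>lebesgue)"
      by (rule integral_lebesgue) (use ai[of k] in \<open>simp add: set_integrable_def\<close>)
    also have "\<dots> = Lp_norm p (G k) powr p"
      using p_pos integral_nonneg_AE[of "f k" lebesgue] by (simp add: Lp_norm_def f_def powr_powr)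
    also have "\<dots> \<le> (c0 * exp (L k)) powr p" by (rule powr_mono2) (use p_pos bd Lp_norm_nonneg in auto)
    also have "\<dots> = c0 powr p * exp (p * L k)" using c0 by (simp add: powr_mult exp_powr_real mult.commute)
    finally have "w k * F k x \<le> w k * (c0 powr p * exp (p * L k))" by (rule mult_left_mono) (simp add: wpos less_imp_le)
    also have "\<dots> = c0 powr p * (1 / 2) ^ (k + 1)" by (simp add: w_def power_one_over)
    finally show ?thesis .
  qed
  have sg: "summable (\<lambda>k. c0 powr p * (1 / 2) ^ (k + 1))"
    by (intro summable_mult) (simp add: summable_geometric)
  have summ: "summable (\<lambda>k. w k * F k x)" for x
    by (rule summable_comparison_test'[OF sg, of 0]) (use Fbd F0 wpos in \<open>auto simp: less_imp_le\<close>)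
  have Fdiff: "F k v = F k u + integral {u..v} (f k)" if "u \<le> v" for k u v
  proof -
    have "{..v} = {..u} \<union> {u..v}" using that by auto
    moreover have "{..u} \<inter> {u..v} = {u}" using that by auto
    ultimately show ?thesis unfolding F_def by (simp add: int integral_Un)
  qed
  define \<Psi> where "\<Psi> x = (\<Sum>k. w k * F k x) + arctan x" for x
  have diff: "\<Psi> v - \<Psi> u = (\<Sum>k. w k * integral {u..v} (f k)) + (arctan v - arctan u)"
    and sumd: "summable (\<lambda>k. w k * integral {u..v} (f k))" if "u \<le> v" for u v
  proof -
    have e: "w k * F k v - w k * F k u = w k * integral {u..v} (f k)" for k
      using Fdiff[OF that, of k] by (simp add: algebra_simps)
    show "\<Psi> v - \<Psi> u = (\<Sum>k. w k * integral {u..v} (f k)) + (arctan v - arctan u)"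
      unfolding \<Psi>_def using suminf_diff[OF summ[of v] summ[of u]] by (simp add: e)
    show "summable (\<lambda>k. w k * integral {u..v} (f k))"
      using summable_diff[OF summ[of v] summ[of u]] by (simp add: e)
  qed
  have nn: "0 \<le> w k * integral {u..v} (f k)" for k u v
    using wpos[of k] by (intro mult_nonneg_nonneg integral_nonneg) (auto intro: int simp: f_def less_imp_le)
  have atan: "arctan v - arctan u \<le> \<Psi> v - \<Psi> u" if "u \<le> v" for u v
    using suminf_nonneg[OF sumd[OF that] nn] diff[OF that] by simp
  have amono: "arctan u \<le> arctan v" if "u \<le> v" for u v :: real using that by (simp add: arctan_le_iff)
  have pd: "piece_data p L G \<Psi>"
  proof
    show "tower G" by (rule G)
    show "\<Psi> u \<le> \<Psi> v" if "u \<le> v" for u v using atan[OF that] amono[OF that] by linarith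
    show "integral {u..v} (\<lambda>x. norm (G k x) powr p) \<le> 2 ^ (k + 1) * exp (p * L k) * (\<Psi> v - \<Psi> u)" if "u \<le> v" for u v k
    proof -
      have "w k * integral {u..v} (f k) \<le> (\<Sum>k. w k * integral {u..v} (f k))"
        using sum_le_suminf[OF sumd[OF that], of "{k}"] nn by auto
      also have "\<dots> \<le> \<Psi> v - \<Psi> u" using diff[OF that] amono[OF that] by linarith
      finally have "integral {u..v} (f k) \<le> 2 ^ (k + 1) * exp (p * L k) * (\<Psi> v - \<Psi> u)"
        by (simp add: w_def field_simps)
      then show ?thesis by (simp add: f_def[abs_def])
    qed
  qed
  have "\<bar>\<Psi> x\<bar> \<le> (\<Sum>k. c0 powr p * (1 / 2) ^ (k + 1)) + pi" for x
  proof -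
    have "0 \<le> (\<Sum>k. w k * F k x)" by (rule suminf_nonneg[OF summ]) (use F0 wpos in \<open>auto simp: less_imp_le\<close>)
    moreover have "(\<Sum>k. w k * F k x) \<le> (\<Sum>k. c0 powr p * (1 / 2) ^ (k + 1))"
      by (rule suminf_le[OF Fbd summ sg])
    moreover have "\<bar>arctan x\<bar> \<le> pi" using arctan_bounded[of x] pi_gt_zero by (simp add: abs_le_iff)
    ultimately show ?thesis unfolding \<Psi>_def by linarith
  qed
  then show ?thesis by (rule that[OF pd _ atan])
qed


text \<open>Monotone convergence along symmetric windows. The bound \<open>C\<close> is asked for
  symmetric finite sums because these telescope in the applications.\<close>

lemma nn_integral_unit_intervals:
  fixes f :: "real \<Rightarrow> ennreal" and \<kappa> :: "int \<Rightarrow> real"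
  assumes f: "f \<in> borel_measurable lebesgue"
    and \<kappa>: "\<And>j. (\<integral>\<^sup>+x\<in>{real_of_int j..<real_of_int j + 1}. f x \<partial>lebesgue) \<le> ennreal (\<kappa> j)" "\<And>j. 0 \<le> \<kappa> j"
    and C: "\<And>N. (\<Sum>j\<in>{- int N..<int N}. \<kappa> j) \<le> C"
  shows "(\<integral>\<^sup>+x. f x \<partial>lebesgue) \<le> ennreal C"
proof -
  let ?I = "\<lambda>N::nat. {- real N..<real N}"
  have floor_in: "x \<in> ?I N \<longleftrightarrow> \<lfloor>x\<rfloor> \<in> {- int N..<int N}" for x N
    by (auto simp: le_floor_iff floor_less_iff)
  have eq: "f x * indicator (?I N) x = (\<Sum>j\<in>{- int N..<int N}. f x * indicator {real_of_int j..<real_of_int j + 1} x)" for x N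
  proof -
    have "(\<Sum>j\<in>{- int N..<int N}. f x * indicator {real_of_int j..<real_of_int j + 1} x)
      = (\<Sum>j\<in>{- int N..<int N}. if j = \<lfloor>x\<rfloor> then f x else 0)"
      by (intro sum.cong refl) (auto simp: indicator_def floor_eq_iff, linarith+)
    also have "\<dots> = (if \<lfloor>x\<rfloor> \<in> {- int N..<int N} then f x else 0)" by (subst sum.delta) auto
    finally show ?thesis using floor_in[of x N] by (simp add: indicator_def)
  qed
  have le: "(\<integral>\<^sup>+x. f x * indicator (?I N) x \<partial>lebesgue) \<le> ennreal C" for N
  proof -
    have "(\<integral>\<^sup>+x. f x * indicator (?I N) x \<partial>lebesgue) = (\<Sum>j\<in>{- int N..<int N}. \<integral>\<^sup>+x\<in>{real_of_int j..<real_of_int j + 1}. f x \<partial>lebesgue)"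
      unfolding eq by (intro nn_integral_sum borel_measurable_times_ennreal f borel_measurable_indicator) simp
    also have "\<dots> \<le> (\<Sum>j\<in>{- int N..<int N}. ennreal (\<kappa> j))" by (rule sum_mono) (rule \<kappa>)
    also have "\<dots> = ennreal (\<Sum>j\<in>{- int N..<int N}. \<kappa> j)" by (rule sum_ennreal) (rule \<kappa>)
    also have "\<dots> \<le> ennreal C" by (rule ennreal_leI) (rule C)
    finally show ?thesis .
  qed
  have SUP: "f x = (SUP N. f x * indicator (?I N) x)" for x
  proof (rule antisym)
    obtain N :: nat where "\<bar>x\<bar> < real N" using reals_Archimedean2 by blast
    then have "x \<in> ?I N" by auto
    then have "f x = f x * indicator (?I N) x" by simp
    also have "\<dots> \<le> (SUP N. f x * indicator (?I N) x)" by (rule SUP_upper) simp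
    finally show "f x \<le> (SUP N. f x * indicator (?I N) x)" .
    show "(SUP N. f x * indicator (?I N) x) \<le> f x" by (rule SUP_least) (simp add: indicator_def)
  qed
  have "(\<integral>\<^sup>+x. f x \<partial>lebesgue) = (\<integral>\<^sup>+x. (SUP N. f x * indicator (?I N) x) \<partial>lebesgue)"
    by (rule nn_integral_cong) (rule SUP)
  also have "\<dots> = (SUP N. \<integral>\<^sup>+x. f x * indicator (?I N) x \<partial>lebesgue)"
  proof (rule nn_integral_monotone_convergence_SUP)
    show "incseq (\<lambda>N x. f x * indicator (?I N) x)"
      by (intro monoI le_funI mult_left_mono) (auto split: split_indicator)
    show "(\<lambda>x. f x * indicator (?I N) x) \<in> borel_measurable lebesgue" for N
      by (intro borel_measurable_times_ennreal f borel_measurable_indicator) simp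
  qed
  also have "\<dots> \<le> ennreal C" by (rule SUP_least) (rule le)
  finally show ?thesis .
qed

lemma sum_int_telescope:
  fixes f :: "real \<Rightarrow> real"
  shows "(\<Sum>j\<in>{- int N..<int N}. f (real_of_int j + 1) - f (real_of_int j)) = f (real N) - f (- real N)"
proof (induction N)
  case (Suc N)
  have "{- int (Suc N)..<int (Suc N)} = insert (- int (Suc N)) (insert (int N) {- int N..<int N})" by auto
  then show ?case using Suc by (simp add: algebra_simps)
qed simp

text \<open>Constants and powers of 2 that enter once, rather than at every step of the recursion,
  are harmless: \<open>n * q ^ n\<close> tends to 0, so an arbitrarily small \<open>e\<close>
  absorbs them.\<close>

lemma eventually_const_pow2_le:
  fixes c q e :: real
  assumes "0 < q" "q < 1" "0 < e"
  shows "\<forall>\<^sub>F n in sequentially. c * 2 ^ Suc n \<le> exp (e / q ^ n)"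
proof -
  have nq: "norm q < 1" using assms by simp
  have "(\<lambda>n. real n * q ^ n) \<longlonglongrightarrow> 0" using powser_times_n_limit_0[OF nq] by simp
  moreover have "(\<lambda>n. q ^ n) \<longlonglongrightarrow> 0" by (rule LIMSEQ_power_zero[OF nq])
  ultimately have "(\<lambda>n. ln (max c 1) * q ^ n + ln 2 * q ^ n + ln 2 * (real n * q ^ n)) \<longlonglongrightarrow> ln (max c 1) * 0 + ln 2 * 0 + ln 2 * 0"
    by (intro tendsto_add tendsto_mult_left)
  then have "\<forall>\<^sub>F n in sequentially. ln (max c 1) * q ^ n + ln 2 * q ^ n + ln 2 * (real n * q ^ n) < e"
    using assms(3) by (intro order_tendstoD(2)[where y = "ln (max c 1) * 0 + ln 2 * 0 + ln 2 * 0"]) auto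
  then show ?thesis
  proof eventually_elim
    case (elim n)
    have "c * 2 ^ Suc n \<le> max c 1 * 2 ^ Suc n" by (rule mult_right_mono) auto
    also have "\<dots> = exp (ln (max c 1) + real (Suc n) * ln 2)"
      using exp_of_nat_mult[of "Suc n" "ln 2 :: real"] by (simp add: exp_add)
    also have "ln (max c 1) + real (Suc n) * ln 2 \<le> e / q ^ n"
      using elim assms(1) by (simp add: field_simps)
    finally show ?case by simp
  qed
qed

context width_selection
begin

lemmas eventually_pow2_le = eventually_const_pow2_le[OF q_pos q_less_1]

end

section \<open>Staircases over all dyadic scales\<close>

context piece_data
begin

text \<open>One bound for all staircases together: the supremum of the ramp bounds over every place
  and level at which the stopping time may stop.\<close>

definition envelope :: "nat \<Rightarrow> ereal" where
  "envelope n = (SUP (k, w)\<in>{(k, w). admissible k w \<and> good w (w + 1 / 2 ^ k)}.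
     ereal (mass w (w + 1 / 2 ^ k) * (2 ^ Suc n * exp (B (level_D k) (Suc n)))))"

lemma level_D_nonneg: "0 \<le> level_D k" by (simp add: level_D_def)

lemma mass_mono: "u' \<le> u \<Longrightarrow> v \<le> v' \<Longrightarrow> mass u v \<le> mass u' v'"
  unfolding mass_def
  by (rule integral_subset_le) (auto intro!: integrable_continuous_real continuous_intros G_cont)

text \<open>For levels beyond \<open>k0\<close> the parent is bad and \<open>level_D k\<close> is
  large enough for \<open>growth_uniform\<close>, which compares the ramp with the derivatives of g.
  On each of the finitely many other levels \<open>D\<close> is fixed: goodness bounds the mass, and
  \<open>q ^ n * B D n\<close> tends to 0.\<close>

lemma envelope_tame:
  assumes S: "\<And>x. \<bar>\<Psi> x\<bar> \<le> S" and \<theta>: "0 \<le> \<theta>" and e: "0 < e"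
    and tame: "\<And>e. e > 0 \<Longrightarrow> \<forall>\<^sub>F n in sequentially. \<forall>x. norm (G n x) \<le> exp ((\<theta> + e) / q ^ n)"
  shows "\<forall>\<^sub>F n in sequentially. envelope n \<le> ereal (exp ((\<theta> + e) / q ^ n))"
proof -
  \<comment> \<open>One third of \<open>e\<close> each for the bound on g, the growth comparison and
    the powers of 2.\<close>
  have e3: "e / 3 > 0" using e by simp
  obtain n1 where n1: "\<And>n x. n \<ge> n1 \<Longrightarrow> norm (G n x) \<le> exp ((\<theta> + e / 3) / q ^ n)"
    using tame[OF e3] by (auto simp: eventually_sequentially)
  obtain D0 where D0': "\<forall>D\<ge>D0. \<forall>S \<Theta>. sup_profile D S \<longrightarrow> 0 \<le> \<Theta> \<longrightarrow>
      (\<forall>n\<ge>n1. S (Suc n) \<le> exp (\<Theta> / q ^ n)) \<longrightarrow> (\<forall>n\<ge>n1. S 0 * exp (B D (Suc n)) \<le> exp ((\<Theta> + e / 3) / q ^ n))"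
    using growth_uniform[OF e3, of n1] by blast
  have D0: "\<forall>n\<ge>n1. S 0 * exp (B D (Suc n)) \<le> exp ((\<theta> + e / 3 + e / 3) / q ^ n)"
    if "D \<ge> D0" "sup_profile D S" "\<forall>n\<ge>n1. S (Suc n) \<le> exp ((\<theta> + e / 3) / q ^ n)" for D S
  proof -
    have "0 \<le> \<theta> + e / 3" using \<theta> e by simp
    with D0' that show ?thesis by blast
  qed
  obtain k0 :: nat where k0: "D0 / ln 2 < real k0" using reals_Archimedean2 by blast
  have lvl: "D0 \<le> level_D k" if "k > k0" for k
  proof -
    have "D0 / ln 2 \<le> real (k - 1)" using k0 that by linarith
    then show ?thesis by (simp add: level_D_def field_simps)
  qed
  have mass_le: "mass w (w + 1 / 2 ^ k) \<le> (2 ^ k * (2 * S)) powr (1 / p)" if "good w (w + 1 / 2 ^ k)" for k w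
  proof -
    have "1 / 2 ^ k * mass w (w + 1 / 2 ^ k) powr p \<le> 2 * S"
      using that S[of w] S[of "w + 1 / 2 ^ k"] by (simp add: good_def)
    then have "mass w (w + 1 / 2 ^ k) powr p \<le> 2 ^ k * (2 * S)" by (simp add: field_simps)
    then have "(mass w (w + 1 / 2 ^ k) powr p) powr (1 / p) \<le> (2 ^ k * (2 * S)) powr (1 / p)"
      by (rule powr_mono2[rotated 2]) (use p_pos in auto)
    then show ?thesis using p_pos mass_nonneg by (simp add: powr_powr)
  qed
  have small: "\<forall>\<^sub>F n in sequentially. (2 ^ k * (2 * S)) powr (1 / p) * (2 ^ Suc n * exp (B (level_D k) (Suc n))) \<le> exp ((\<theta> + e) / q ^ n)" for k
  proof -
    have "(\<lambda>n. q ^ Suc n * B (level_D k) (Suc n)) \<longlonglongrightarrow> 0"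
      using scaled_B_tendsto_0[OF level_D_nonneg] LIMSEQ_Suc by blast
    then have "\<forall>\<^sub>F n in sequentially. q ^ Suc n * B (level_D k) (Suc n) < q * (e / 2)"
      using e q_pos by (intro order_tendstoD(2)) auto
    moreover have "\<forall>\<^sub>F n in sequentially. (2 ^ k * (2 * S)) powr (1 / p) * 2 ^ Suc n \<le> exp ((e / 2) / q ^ n)"
      by (rule eventually_pow2_le) (use e in simp)
    ultimately show ?thesis
    proof eventually_elim
      case (elim n)
      have "B (level_D k) (Suc n) \<le> (e / 2) / q ^ n" using elim(1) q_pos by (simp add: field_simps)
      then have "(2 ^ k * (2 * S)) powr (1 / p) * 2 ^ Suc n * exp (B (level_D k) (Suc n)) \<le> exp ((e / 2) / q ^ n) * exp ((e / 2) / q ^ n)"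
        using elim(2) by (intro mult_mono) auto
      also have "\<dots> = exp (e / q ^ n)" by (simp add: exp_add[symmetric] add_divide_distrib[symmetric])
      also have "\<dots> \<le> exp ((\<theta> + e) / q ^ n)" using \<theta> q_pos by (simp add: divide_right_mono)
      finally show ?case by (simp add: mult.assoc)
    qed
  qed
  have "\<forall>\<^sub>F n in sequentially. \<forall>k\<in>{..k0}. (2 ^ k * (2 * S)) powr (1 / p) * (2 ^ Suc n * exp (B (level_D k) (Suc n))) \<le> exp ((\<theta> + e) / q ^ n)"
    by (rule eventually_ball_finite) (use small in auto)
  moreover have "\<forall>\<^sub>F n in sequentially. n \<ge> n1" by (rule eventually_ge_at_top)
  moreover have "\<forall>\<^sub>F n in sequentially. 1 * 2 ^ Suc n \<le> exp ((e / 3) / q ^ n)" by (rule eventually_pow2_le[OF e3])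
  ultimately show ?thesis
  proof eventually_elim
    case (elim n)
    show ?case unfolding envelope_def
    proof (rule SUP_least, clarify)
      fix k w assume adm: "admissible k w" and g: "good w (w + 1 / 2 ^ k)"
      have "mass w (w + 1 / 2 ^ k) * (2 ^ Suc n * exp (B (level_D k) (Suc n))) \<le> exp ((\<theta> + e) / q ^ n)"
      proof (cases "k \<le> k0")
        case True
        have "mass w (w + 1 / 2 ^ k) * (2 ^ Suc n * exp (B (level_D k) (Suc n)))
          \<le> (2 ^ k * (2 * S)) powr (1 / p) * (2 ^ Suc n * exp (B (level_D k) (Suc n)))"
          by (intro mult_right_mono mass_le g) auto
        also have "\<dots> \<le> exp ((\<theta> + e) / q ^ n)" using elim True by blast
        finally show ?thesis .
      next
        case False
        then obtain w' where w': "\<not> good w' (w' + 1 / 2 ^ (k - 1))" "w' \<le> w" "w + 1 / 2 ^ k \<le> w' + 1 / 2 ^ (k - 1)"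
          using adm by (auto simp: admissible_def)
        define v' where "v' = w' + 1 / 2 ^ (k - 1)"
        have lt: "w' < v'" by (simp add: v'_def)
        have D: "ln (1 / (v' - w')) = level_D k"
          by (simp add: v'_def level_D_def ln_realpow)
        have prof: "sup_profile (level_D k) (profile w' v')"
          using bad_profile[OF lt] w'(1) unfolding v'_def[symmetric] D .
        have "\<forall>n\<ge>n1. profile w' v' (Suc n) \<le> exp ((\<theta> + e / 3) / q ^ n)"
        proof (intro allI impI)
          fix n assume "n \<ge> n1"
          obtain x where "sup_on w' v' (G n) = norm (G n x)"
            using sup_on_attained[OF _ G_cont] lt by (metis less_imp_le)
          then show "profile w' v' (Suc n) \<le> exp ((\<theta> + e / 3) / q ^ n)"
            using n1[OF \<open>n \<ge> n1\<close>] by (simp add: profile_def)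
        qed
        from D0[OF lvl prof this] False elim(2)
        have bd: "mass w' v' * exp (B (level_D k) (Suc n)) \<le> exp ((\<theta> + e / 3 + e / 3) / q ^ n)"
          by (simp add: profile_def)
        have "mass w (w + 1 / 2 ^ k) * (2 ^ Suc n * exp (B (level_D k) (Suc n)))
          \<le> mass w' v' * (2 ^ Suc n * exp (B (level_D k) (Suc n)))"
          by (intro mult_right_mono mass_mono) (use w' in \<open>auto simp: v'_def\<close>)
        also have "\<dots> = 2 ^ Suc n * (mass w' v' * exp (B (level_D k) (Suc n)))" by simp
        also have "\<dots> \<le> exp ((e / 3) / q ^ n) * exp ((\<theta> + e / 3 + e / 3) / q ^ n)"
          using elim(3) by (intro mult_mono bd) (auto intro: mult_nonneg_nonneg mass_nonneg)
        also have "\<dots> = exp ((\<theta> + e) / q ^ n)"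
        proof -
          have "(e / 3) / q ^ n + (\<theta> + e / 3 + e / 3) / q ^ n = (\<theta> + e) / q ^ n"
            using q_pos by (simp add: field_simps)
          then show ?thesis by (simp add: exp_add[symmetric])
        qed
        finally show ?thesis .
      qed
      then show "ereal (mass w (w + 1 / 2 ^ k) * (2 ^ Suc n * exp (B (level_D k) (Suc n)))) \<le> ereal (exp ((\<theta> + e) / q ^ n))"
        by simp
    qed
  qed
qed

text \<open>The halving stops. On an interval of length \<open>h\<close> the mass is at most
  \<open>h\<close> times the maximum of |g|, so its \<open>p\<close>-th power tends to 0 with
  \<open>h\<close>, while the arctangent gives the interval measure at least
  \<open>h / (1 + R\<^sup>2)\<close>.\<close>

lemma unit_staircase:
  assumes atan: "\<And>u v. u \<le> v \<Longrightarrow> arctan v - arctan u \<le> \<Psi> v - \<Psi> u"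
  shows "\<exists>H. staircase envelope u (u + 1) H"
proof -
  define R where "R = \<bar>u\<bar> + 1"
  define s where "s = sup_on u (u + 1) (G 0)"
  have s: "norm (G 0 x) \<le> s" if "x \<in> {u..u + 1}" for x unfolding s_def by (rule norm_le_sup_on[OF G_cont that])
  then have s0: "0 \<le> s" using s[of u] norm_ge_zero[of "G 0 u"] by (meson atLeastAtMost_iff le_add_same_cancel1 order_refl order_trans zero_le_one)
  have "(\<lambda>j. (1 / 2 powr p) ^ j) \<longlonglongrightarrow> 0"
    by (rule LIMSEQ_power_zero) (use p_pos powr_less_mono[of 0 p 2] in auto)
  then have "(\<lambda>j. (1 / 2 powr p) ^ j * s powr p) \<longlonglongrightarrow> 0 * s powr p" by (rule tendsto_mult_right)
  moreover have "0 < 1 / (1 + R\<^sup>2)" by (simp add: add_pos_nonneg)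
  ultimately have "\<forall>\<^sub>F j in sequentially. (1 / 2 powr p) ^ j * s powr p < 1 / (1 + R\<^sup>2)"
    by (intro order_tendstoD(2)[where y = "0 * s powr p"]) auto
  then obtain j where j: "(1 / 2 powr p) ^ j * s powr p < 1 / (1 + R\<^sup>2)" by (auto simp: eventually_sequentially)
  have good: "good w (w + 1 / 2 ^ (0 + j))" if "u \<le> w" "w + 1 / 2 ^ (0 + j) \<le> u + 1 / 2 ^ 0" for w
  proof -
    define h :: real where "h = 1 / 2 ^ j"
    have h: "0 < h" by (simp add: h_def)
    have "mass w (w + h) \<le> integral {w..w + h} (\<lambda>x. s)" unfolding mass_def
      by (rule integral_le) (use that s in \<open>auto intro!: integrable_continuous_real continuous_intros G_cont simp: h_def\<close>)
    also have "\<dots> = h * s" using h by simp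
    finally have "mass w (w + h) powr p \<le> (h * s) powr p" by (intro powr_mono2) (use p_pos mass_nonneg in auto)
    also have "\<dots> = (1 / 2 powr p) ^ j * s powr p"
    proof -
      have "h powr p = (1 / 2 powr p) ^ j"
        unfolding h_def by (simp add: powr_divide power_one_over powr_powr powr_realpow[symmetric] mult.commute)
      then show ?thesis using h s0 by (simp add: powr_mult)
    qed
    finally have m: "mass w (w + h) powr p \<le> 1 / (1 + R\<^sup>2)" using j by simp
    obtain z where z: "w < z" "z < w + h" "arctan (w + h) - arctan w = (w + h - w) * inverse (1 + z\<^sup>2)"
      using MVT2[of w "w + h" arctan "\<lambda>x. inverse (1 + x\<^sup>2)"] h DERIV_arctan by auto
    have "\<bar>z\<bar> \<le> \<bar>R\<bar>" using z that h by (auto simp: R_def h_def)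
    then have "z\<^sup>2 \<le> R\<^sup>2" by (rule abs_le_square_iff[THEN iffD1])
    then have "1 / (1 + R\<^sup>2) \<le> inverse (1 + z\<^sup>2)" by (simp add: inverse_eq_divide frac_le add_pos_nonneg)
    then have "h * mass w (w + h) powr p \<le> h * inverse (1 + z\<^sup>2)" using m h by (intro mult_left_mono) auto
    also have "\<dots> \<le> \<Psi> (w + h) - \<Psi> w" using z(3) atan[of w "w + h"] h by simp
    finally show ?thesis by (simp add: good_def h_def)
  qed
  have "\<exists>H. staircase envelope u (u + 1 / 2 ^ 0) H"
  proof (rule staircase_refine[OF good])
    show "admissible 0 u" by (simp add: admissible_def)
    fix k w n assume "admissible k w" "good w (w + 1 / 2 ^ k)"
    then show "ereal (mass w (w + 1 / 2 ^ k) * (2 ^ Suc n * exp (B (level_D k) (Suc n)))) \<le> envelope n"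
      unfolding envelope_def by (intro SUP_upper2[of "(k, w)"]) auto
  qed
  then show ?thesis by simp
qed



text \<open>The unit pieces \<open>H j\<close> are glued together. Far from the origin they are the staircases just
  constructed; the finitely many others use a single ramp, with \<open>D\<close> as large as needed.\<close>

lemma lift_exists_aux:
  assumes S: "\<And>x. \<bar>\<Psi> x\<bar> \<le> S" and \<theta>: "0 \<le> \<theta>" and \<epsilon>: "0 < \<epsilon>"
    and tame: "\<And>e. e > 0 \<Longrightarrow> \<forall>\<^sub>F n in sequentially. \<forall>x. norm (G n x) \<le> exp ((\<theta> + e) / q ^ n)"
    and atan: "\<And>u v. u \<le> v \<Longrightarrow> arctan v - arctan u \<le> \<Psi> v - \<Psi> u"
  shows "\<exists>U. tower U \<and> U 0 \<in> Lp_fun p \<and> (\<forall>n. ecost p (\<lambda>x. U (Suc n) x - G n x) \<le> ennreal (\<epsilon> * exp (p * L n))) \<and>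
    (\<forall>e>0. \<forall>\<^sub>F n in sequentially. \<forall>x. norm (U (Suc n) x - G n x) \<le> exp ((\<theta> + e) / q ^ n))"
proof -
  define c where "c = 2 * exp X"
  define \<delta> where "\<delta> = \<epsilon> / (4 * c)"
  have c: "0 < c" by (simp add: c_def)
  have \<delta>: "0 < \<delta>" using \<epsilon> c by (simp add: \<delta>_def)
  define ad where "ad j = arctan (real_of_int j + 1) - arctan (real_of_int j)" for j :: int
  have ad: "0 < ad j" for j by (simp add: ad_def arctan_less_iff)
  \<comment> \<open>Staircases cost a fixed multiple of the measure, so they are affordable only
    where little of it is left, outside [-J, J].\<close>
  obtain J :: nat where J: "\<And>N. \<Psi> (max N (real J)) - \<Psi> (real J) \<le> \<delta>" "\<And>N. \<Psi> (- real J) - \<Psi> (min N (- real J)) \<le> \<delta>"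
  proof -
    have bdd: "bdd_above (range \<Psi>)" "bdd_below (range \<Psi>)"
      using S by (auto intro!: bdd_aboveI2[of _ _ S] bdd_belowI2[of _ "- S"] simp: abs_le_iff minus_le_iff)
    have "\<exists>z\<in>range \<Psi>. Sup (range \<Psi>) - \<delta> < z" by (rule less_cSupD) (use \<delta> in auto)
    then obtain x where x: "Sup (range \<Psi>) - \<delta> < \<Psi> x" by blast
    have "\<exists>z\<in>range \<Psi>. z < Inf (range \<Psi>) + \<delta>" by (rule cInf_lessD) (use \<delta> in auto)
    then obtain y where y: "\<Psi> y < Inf (range \<Psi>) + \<delta>" by blast
    obtain J :: nat where J: "max \<bar>x\<bar> \<bar>y\<bar> < real J" using reals_Archimedean2 by blast
    show ?thesis
    proof (rule that)
      fix N
      have "\<Psi> (max N (real J)) \<le> Sup (range \<Psi>)" "Inf (range \<Psi>) \<le> \<Psi> (min N (- real J))"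
        using bdd by (auto intro: cSup_upper cInf_lower)
      moreover have "\<Psi> x \<le> \<Psi> (real J)" "\<Psi> (- real J) \<le> \<Psi> y" using J by (auto intro!: \<Psi>_mono)
      ultimately show "\<Psi> (max N (real J)) - \<Psi> (real J) \<le> \<delta>" "\<Psi> (- real J) - \<Psi> (min N (- real J)) \<le> \<delta>"
        using x y by linarith+
    qed
  qed
  define near where "near = {- int J..<int J}"
  define I where "I j = integral {real_of_int j..real_of_int j + 1} (G 0)" for j
  define ms where "ms j = mass (real_of_int j) (real_of_int j + 1)" for j
  have I: "norm (I j) \<le> ms j" for j unfolding I_def ms_def by (rule norm_integral_le_mass) auto
  \<comment> \<open>The sum dominates the requirement of each near piece, and
    \<open>D \<le> exp D\<close> turns it into the factor \<open>exp (- D)\<close> that is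
    wanted.\<close>
  define D where "D = (\<Sum>j\<in>near. ms j powr p * exp X / (\<epsilon> / 8 * ad j))"
  have fin: "finite near" by (simp add: near_def)
  have D_nn: "0 \<le> D" unfolding D_def using \<epsilon> ad by (intro sum_nonneg) (auto simp: less_imp_le)
  have D: "ms j powr p * exp (X - D) \<le> \<epsilon> / 8 * ad j" if "j \<in> near" for j
  proof -
    have "ms j powr p * exp X / (\<epsilon> / 8 * ad j) \<le> D" unfolding D_def
      by (rule member_le_sum[OF that _ fin]) (use \<epsilon> ad in \<open>auto simp: less_imp_le\<close>)
    also have "D \<le> exp D" using exp_ge_add_one_self[of D] by linarith
    finally show ?thesis using \<epsilon> ad[of j] by (simp add: exp_diff field_simps)
  qed
  obtain Hf where Hf: "\<And>u. staircase envelope u (u + 1) (Hf u)" using unit_staircase[OF atan] by metis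
  define H where "H j n x = (if j \<in> near then I j * ramp D n (x - real_of_int j) else Hf (real_of_int j) n x)" for j n x
  have w: "2 * exp (- b D 0) \<le> 1"
  proof -
    have "2 * ln 2 \<le> b D 0" using b_ge[of D 0] K_ge_2 D_nn by simp
    then have "exp (- b D 0) \<le> exp (- (2 * ln 2))" by simp
    also have "\<dots> = 1 / 4" using exp_of_nat_mult[of 2 "ln 2 :: real"] by (simp add: exp_minus power2_eq_square)
    finally show ?thesis by simp
  qed
  have tw: "tower (\<lambda>n x. ramp D n (x - a))" for a by (rule tower_shift[OF ramp_tower])
  have H_tower: "tower (H j)" for j
    unfolding H_def using tower_cmult[OF tw] Hf[of "real_of_int j"] by (cases "j \<in> near") (auto simp: staircase_def)
  have H_left: "H j n x = 0" if "x \<le> real_of_int j" for j n x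
    using that Hf[of "real_of_int j"] by (simp add: H_def staircase_def ramp_zero)
  have H_right: "H j 0 x = I j" "H j (Suc n) x = 0" if "real_of_int j + 1 \<le> x" for j n x
  proof -
    have "2 * exp (- b D 0) \<le> x - real_of_int j" using that w by simp
    then show "H j 0 x = I j" "H j (Suc n) x = 0"
      using that Hf[of "real_of_int j"] by (simp_all add: H_def I_def staircase_def ramp_one ramp_right)
  qed
  \<comment> \<open>\<open>\<Psi>\<close> frozen on [-J, J]: outside, the increments are those of
    \<open>\<Psi>\<close>, and the total increase is at most \<open>2 * \<delta>\<close>.\<close>
  define T where "T x = \<Psi> (max x (real J)) + \<Psi> (min x (- real J))" for x
  define \<eta> where "\<eta> j = \<epsilon> / 8 * ad j + c * (T (real_of_int j + 1) - T (real_of_int j))" for j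
  have T_mono: "T x \<le> T y" if "x \<le> y" for x y unfolding T_def by (intro add_mono \<Psi>_mono) (use that in auto)
  have \<eta>0: "0 \<le> \<eta> j" for j unfolding \<eta>_def using \<epsilon> ad[of j] c T_mono[of "real_of_int j" "real_of_int j + 1"] by simp
  have far: "T (real_of_int j + 1) - T (real_of_int j) = \<Psi> (real_of_int j + 1) - \<Psi> (real_of_int j)" if "j \<notin> near" for j
  proof (cases "int J \<le> j")
    case True
    then have "real J \<le> real_of_int j" by linarith
    then have "max (real_of_int j + 1) (real J) = real_of_int j + 1" "max (real_of_int j) (real J) = real_of_int j"
      "min (real_of_int j + 1) (- real J) = - real J" "min (real_of_int j) (- real J) = - real J" by linarith+
    then show ?thesis by (simp add: T_def)
  next
    case False
    then have "real_of_int j + 1 \<le> - real J" using that unfolding near_def by simp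
    then have "max (real_of_int j + 1) (real J) = real J" "max (real_of_int j) (real J) = real J"
      "min (real_of_int j + 1) (- real J) = real_of_int j + 1" "min (real_of_int j) (- real J) = real_of_int j" by linarith+
    then show ?thesis by (simp add: T_def)
  qed
  have H_cost: "ecost p (H j (Suc n)) \<le> ennreal (exp (p * L n) * \<eta> j)" for j n
  proof (cases "j \<in> near")
    case True
    have "H j (Suc n) = (\<lambda>x. I j * ramp D (Suc n) (x - real_of_int j))" using True by (simp add: H_def fun_eq_iff)
    then have "ecost p (H j (Suc n)) = ennreal (norm (I j) powr p) * ecost p (\<lambda>x. ramp D (Suc n) (x - real_of_int j))"
      using ecost_cmult[OF tower_measurable[OF tw]] by simp
    also have "ecost p (\<lambda>x. ramp D (Suc n) (x - real_of_int j)) = ecost p (ramp D (Suc n))"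
      by (rule ecost_shift[OF tower_measurable[OF ramp_tower]])
    also have "ennreal (norm (I j) powr p) * ecost p (ramp D (Suc n)) \<le> ennreal (ms j powr p) * ennreal (exp (p * L n - D + X))"
      by (intro mult_mono ramp_cost ennreal_leI powr_mono2 I) (use p_pos in auto)
    also have "\<dots> = ennreal (exp (p * L n) * (ms j powr p * exp (X - D)))"
      by (simp add: ennreal_mult[symmetric] exp_add exp_diff field_simps)
    also have "\<dots> \<le> ennreal (exp (p * L n) * \<eta> j)"
    proof (intro ennreal_leI mult_left_mono)
      show "ms j powr p * exp (X - D) \<le> \<eta> j"
        using D[OF True] c T_mono[of "real_of_int j" "real_of_int j + 1"] unfolding \<eta>_def
        by (smt (verit) mult_nonneg_nonneg)
    qed simp
    finally show ?thesis .
  next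
    case False
    have "ecost p (H j (Suc n)) = ecost p (Hf (real_of_int j) (Suc n))" using False by (simp add: H_def ecost_def)
    also have "\<dots> \<le> ennreal (2 * exp X * exp (p * L n) * (\<Psi> (real_of_int j + 1) - \<Psi> (real_of_int j)))"
      using Hf[of "real_of_int j"] by (auto simp: staircase_def)
    also have "\<dots> \<le> ennreal (exp (p * L n) * \<eta> j)"
      unfolding \<eta>_def far[OF False] c_def using \<epsilon> ad[of j] by (intro ennreal_leI) (simp add: algebra_simps)
    finally show ?thesis .
  qed
  \<comment> \<open>Unlike the costs of the derivatives, the size of \<open>U 0\<close> need only be
    finite. The bounds for the near pieces are written as multiples of arctangent increments, whose
    sum is at most 4.\<close>
  define k0 where "k0 = (\<Sum>j\<in>near. (2 * ms j) powr p / ad j)"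
  define \<kappa> where "\<kappa> j = 2 * (\<Psi> (real_of_int j + 1) - \<Psi> (real_of_int j)) + k0 * ad j" for j
  have k0: "0 \<le> k0" unfolding k0_def using ad by (intro sum_nonneg) (auto simp: less_imp_le)
  have \<kappa>0: "0 \<le> \<kappa> j" for j unfolding \<kappa>_def using k0 ad[of j] \<Psi>_mono[of "real_of_int j" "real_of_int j + 1"] by simp
  have close: "(\<integral>\<^sup>+x\<in>{real_of_int j..real_of_int j + 1}. ennreal (norm (integral {real_of_int j..x} (G 0) - H j 0 x) powr p) \<partial>lebesgue) \<le> ennreal (\<kappa> j)" for j
  proof (cases "j \<in> near")
    case True
    have "(\<integral>\<^sup>+x\<in>{real_of_int j..real_of_int j + 1}. ennreal (norm (integral {real_of_int j..x} (G 0) - H j 0 x) powr p) \<partial>lebesgue)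
      \<le> (\<integral>\<^sup>+x. ennreal ((2 * ms j) powr p) * indicator {real_of_int j..real_of_int j + 1} x \<partial>lebesgue)"
    proof (rule nn_integral_mono)
      fix x
      show "ennreal (norm (integral {real_of_int j..x} (G 0) - H j 0 x) powr p) * indicator {real_of_int j..real_of_int j + 1} x \<le>
        ennreal ((2 * ms j) powr p) * indicator {real_of_int j..real_of_int j + 1} x"
      proof (cases "x \<in> {real_of_int j..real_of_int j + 1}")
        case xin: True
        have "norm (H j 0 x) \<le> ms j * 1" using True unfolding H_def
          by (simp only: if_True norm_mult) (intro mult_mono I ramp_le_1, auto simp: ms_def mass_nonneg)
        moreover have "norm (integral {real_of_int j..x} (G 0)) \<le> ms j"
          unfolding ms_def by (rule norm_integral_le_mass) (use xin in auto)
        ultimately have "norm (integral {real_of_int j..x} (G 0) - H j 0 x) \<le> 2 * ms j"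
          using norm_triangle_ineq4[of "integral {real_of_int j..x} (G 0)" "H j 0 x"] by linarith
        then show ?thesis using xin p_pos by (auto intro!: ennreal_leI powr_mono2)
      qed simp
    qed
    also have "\<dots> = ennreal ((2 * ms j) powr p) * emeasure lebesgue {real_of_int j..real_of_int j + 1}"
      by (rule nn_integral_cmult_indicator) auto
    also have "\<dots> = ennreal ((2 * ms j) powr p)" by simp
    also have "\<dots> \<le> ennreal (\<kappa> j)"
    proof (rule ennreal_leI)
      have "(2 * ms j) powr p / ad j \<le> k0" unfolding k0_def
        by (rule member_le_sum[OF True _ fin]) (use ad in \<open>auto simp: less_imp_le\<close>)
      then have "(2 * ms j) powr p \<le> k0 * ad j" using ad[of j] by (simp add: field_simps)
      then show "(2 * ms j) powr p \<le> \<kappa> j" unfolding \<kappa>_def using \<Psi>_mono[of "real_of_int j" "real_of_int j + 1"] by simp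
    qed
    finally show ?thesis .
  next
    case False
    have "(\<integral>\<^sup>+x\<in>{real_of_int j..real_of_int j + 1}. ennreal (norm (integral {real_of_int j..x} (G 0) - H j 0 x) powr p) \<partial>lebesgue)
      \<le> ennreal (2 * (\<Psi> (real_of_int j + 1) - \<Psi> (real_of_int j)))"
      using Hf[of "real_of_int j"] False by (auto simp: H_def staircase_def)
    also have "\<dots> \<le> ennreal (\<kappa> j)" unfolding \<kappa>_def using k0 ad[of j] by (intro ennreal_leI) simp
    finally show ?thesis .
  qed
  \<comment> \<open>On every unit interval the primitive of g starts anew at 0, and the piece
    subtracted removes its whole increment, so that everything fits together at the
    integers.\<close>
  define U where "U n x = (case n of 0 \<Rightarrow> integral {real_of_int \<lfloor>x\<rfloor>..x} (G 0) - H \<lfloor>x\<rfloor> 0 x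
     | Suc n \<Rightarrow> G n x - H \<lfloor>x\<rfloor> (Suc n) x)" for n x
  have comb: "integral {u..w} (G 0) + integral {w..x} (G 0) = integral {u..x} (G 0)" if "u \<le> w" "w \<le> x" for u w x
    by (rule Henstock_Kurzweil_Integration.integral_combine[OF that]) (auto intro!: integrable_continuous_real G_cont)
  \<comment> \<open>One formula across the integer \<open>j\<close>: to its right the left piece has
    reached its final value \<open>I (j - 1)\<close>, which joins the two primitives, and to its
    left the right piece is still 0.\<close>
  have local0: "U 0 y = integral {real_of_int j - 1..y} (G 0) - H (j - 1) 0 y - H j 0 y"
    and localS: "U (Suc n) y = G n y - H (j - 1) (Suc n) y - H j (Suc n) y"
    if "y \<in> {real_of_int j - 1<..<real_of_int j + 1}" for j y n
  proof -
    have "U 0 y = integral {real_of_int j - 1..y} (G 0) - H (j - 1) 0 y - H j 0 y \<and>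
      U (Suc n) y = G n y - H (j - 1) (Suc n) y - H j (Suc n) y"
    proof (cases "real_of_int j \<le> y")
      case True
      then have fl: "\<lfloor>y\<rfloor> = j" using that by (auto simp: floor_eq_iff)
      have r: "H (j - 1) 0 y = I (j - 1)" "H (j - 1) (Suc n) y = 0"
        using H_right[of "j - 1" y] True by auto
      have "I (j - 1) + integral {real_of_int j..y} (G 0) = integral {real_of_int j - 1..y} (G 0)"
        unfolding I_def using comb[of "real_of_int j - 1" "real_of_int j" y] True by simp
      then show ?thesis unfolding U_def fl using r by (simp add: algebra_simps)
    next
      case False
      then have fl: "\<lfloor>y\<rfloor> = j - 1" using that by (auto simp: floor_eq_iff)
      have "H j n y = 0" for n by (rule H_left) (use False in simp)
      then show ?thesis unfolding U_def fl by simp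
    qed
    then show "U 0 y = integral {real_of_int j - 1..y} (G 0) - H (j - 1) 0 y - H j 0 y"
      "U (Suc n) y = G n y - H (j - 1) (Suc n) y - H j (Suc n) y" by auto
  qed
  have der: "(H j n has_vector_derivative H j (Suc n) x) (at x)" "(G n has_vector_derivative G (Suc n) x) (at x)" for j n x
    using H_tower[of j] G_tower by (auto simp: tower_def)
  have U_tower: "tower U"
    unfolding tower_def
  proof (intro allI)
    fix n and x :: real
    define j where "j = \<lfloor>x\<rfloor>"
    have xin: "x \<in> {real_of_int j - 1<..<real_of_int j + 1}"
      using floor_correct[of x] unfolding j_def by (simp, linarith)
    show "(U n has_vector_derivative U (Suc n) x) (at x)"
    proof (cases n)
      case 0
      have "((\<lambda>y. integral {real_of_int j - 1..y} (G 0)) has_vector_derivative G 0 x) (at x within {real_of_int j - 1..real_of_int j + 1})"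
        by (rule integral_has_vector_derivative) (use xin G_cont in auto)
      then have "((\<lambda>y. integral {real_of_int j - 1..y} (G 0)) has_vector_derivative G 0 x) (at x within {real_of_int j - 1<..<real_of_int j + 1})"
        by (rule has_vector_derivative_within_subset) auto
      then have d: "((\<lambda>y. integral {real_of_int j - 1..y} (G 0)) has_vector_derivative G 0 x) (at x)"
        using at_within_open[OF xin] by simp
      have "((\<lambda>y. integral {real_of_int j - 1..y} (G 0) - H (j - 1) 0 y - H j 0 y) has_vector_derivative
          G 0 x - H (j - 1) (Suc 0) x - H j (Suc 0) x) (at x)"
        by (intro has_vector_derivative_diff d der)
      then have "((\<lambda>y. integral {real_of_int j - 1..y} (G 0) - H (j - 1) 0 y - H j 0 y) has_vector_derivative U (Suc 0) x) (at x)"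
        using localS[OF xin, of 0] by simp
      then show ?thesis unfolding 0
        by (rule has_vector_derivative_transform_within_open[OF _ open_greaterThanLessThan xin]) (simp add: local0)
    next
      case (Suc m)
      have "((\<lambda>y. G m y - H (j - 1) (Suc m) y - H j (Suc m) y) has_vector_derivative
          G (Suc m) x - H (j - 1) (Suc (Suc m)) x - H j (Suc (Suc m)) x) (at x)"
        by (intro has_vector_derivative_diff der)
      then have "((\<lambda>y. G m y - H (j - 1) (Suc m) y - H j (Suc m) y) has_vector_derivative U (Suc (Suc m)) x) (at x)"
        using localS[OF xin, of "Suc m"] by simp
      then show ?thesis unfolding Suc
        by (rule has_vector_derivative_transform_within_open[OF _ open_greaterThanLessThan xin]) (simp add: localS)
    qed
  qed
  have U_diff: "U (Suc n) x - G n x = - H \<lfloor>x\<rfloor> (Suc n) x" for n x by (simp add: U_def)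
  have fl: "\<lfloor>x\<rfloor> = j" if "x \<in> {real_of_int j..<real_of_int j + 1}" for x j using that by (auto simp: floor_eq_iff)
  have cost: "ecost p (\<lambda>x. U (Suc n) x - G n x) \<le> ennreal (\<epsilon> * exp (p * L n))" for n
    unfolding ecost_def
  proof (rule nn_integral_unit_intervals[where \<kappa> = "\<lambda>j. exp (p * L n) * \<eta> j"])
    have "(\<lambda>x. U (Suc n) x - G n x) \<in> borel_measurable lebesgue"
      by (intro borel_measurable_diff tower_measurable U_tower G_tower)
    then show "(\<lambda>x. ennreal (norm (U (Suc n) x - G n x) powr p)) \<in> borel_measurable lebesgue" by measurable
    show "0 \<le> exp (p * L n) * \<eta> j" for j using \<eta>0 by simp
    show "(\<integral>\<^sup>+x\<in>{real_of_int j..<real_of_int j + 1}. ennreal (norm (U (Suc n) x - G n x) powr p) \<partial>lebesgue) \<le> ennreal (exp (p * L n) * \<eta> j)" for j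
    proof -
      have "(\<integral>\<^sup>+x\<in>{real_of_int j..<real_of_int j + 1}. ennreal (norm (U (Suc n) x - G n x) powr p) \<partial>lebesgue)
        \<le> ecost p (H j (Suc n))"
        unfolding ecost_def by (rule nn_integral_mono) (use fl in \<open>auto simp: U_diff indicator_def\<close>)
      also have "\<dots> \<le> ennreal (exp (p * L n) * \<eta> j)" by (rule H_cost)
      finally show ?thesis .
    qed
    show "(\<Sum>j\<in>{- int N..<int N}. exp (p * L n) * \<eta> j) \<le> \<epsilon> * exp (p * L n)" for N
    proof -
      have "(\<Sum>j\<in>{- int N..<int N}. \<eta> j) = \<epsilon> / 8 * (\<Sum>j\<in>{- int N..<int N}. ad j) + c * (\<Sum>j\<in>{- int N..<int N}. T (real_of_int j + 1) - T (real_of_int j))"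
        unfolding \<eta>_def by (simp add: sum.distrib sum_distrib_left)
      also have "\<dots> = \<epsilon> / 8 * (arctan (real N) - arctan (- real N)) + c * (T (real N) - T (- real N))"
        unfolding ad_def sum_int_telescope ..
      \<comment> \<open>The arctangent increases by at most pi < 4, and \<open>\<delta>\<close> is
        \<open>\<epsilon> / (4 * c)\<close>; each summand is half of
        \<open>\<epsilon>\<close>.\<close>
      also have "\<dots> \<le> \<epsilon> / 8 * 4 + c * (2 * \<delta>)"
      proof (intro add_mono mult_left_mono)
        show "arctan (real N) - arctan (- real N) \<le> 4"
          using arctan_bounded[of "real N"] arctan_bounded[of "- real N"] pi_less_4 by linarith
        show "T (real N) - T (- real N) \<le> 2 * \<delta>"
          using J(1)[of "real N"] J(2)[of "- real N"] \<Psi>_mono[of "real J" "max (- real N) (real J)"]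
            \<Psi>_mono[of "min (real N) (- real J)" "- real J"] unfolding T_def by simp
      qed (use \<epsilon> c in auto)
      also have "\<dots> = \<epsilon>" using c by (simp add: \<delta>_def)
      finally have "exp (p * L n) * (\<Sum>j\<in>{- int N..<int N}. \<eta> j) \<le> exp (p * L n) * \<epsilon>" by (rule mult_left_mono) simp
      then show ?thesis by (simp add: sum_distrib_left mult.commute)
    qed
  qed
  have U0: "U 0 \<in> Lp_fun p"
  proof -
    have m: "U 0 \<in> borel_measurable lebesgue" by (rule tower_measurable[OF U_tower])
    have "ecost p (U 0) \<le> ennreal (2 * (2 * S) + k0 * 4)"
      unfolding ecost_def
    proof (rule nn_integral_unit_intervals[where \<kappa> = \<kappa>])
      show "(\<lambda>x. ennreal (norm (U 0 x) powr p)) \<in> borel_measurable lebesgue" using m by measurable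
      show "0 \<le> \<kappa> j" for j by (rule \<kappa>0)
      show "(\<integral>\<^sup>+x\<in>{real_of_int j..<real_of_int j + 1}. ennreal (norm (U 0 x) powr p) \<partial>lebesgue) \<le> ennreal (\<kappa> j)" for j
      proof -
        have "(\<integral>\<^sup>+x\<in>{real_of_int j..<real_of_int j + 1}. ennreal (norm (U 0 x) powr p) \<partial>lebesgue)
          \<le> (\<integral>\<^sup>+x\<in>{real_of_int j..real_of_int j + 1}. ennreal (norm (integral {real_of_int j..x} (G 0) - H j 0 x) powr p) \<partial>lebesgue)"
          by (rule nn_integral_mono) (use fl in \<open>auto simp: U_def indicator_def\<close>)
        also have "\<dots> \<le> ennreal (\<kappa> j)" by (rule close)
        finally show ?thesis .
      qed
      show "(\<Sum>j\<in>{- int N..<int N}. \<kappa> j) \<le> 2 * (2 * S) + k0 * 4" for N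
      proof -
        have "(\<Sum>j\<in>{- int N..<int N}. \<kappa> j) = 2 * (\<Sum>j\<in>{- int N..<int N}. \<Psi> (real_of_int j + 1) - \<Psi> (real_of_int j)) + k0 * (\<Sum>j\<in>{- int N..<int N}. ad j)"
          unfolding \<kappa>_def by (simp add: sum.distrib sum_distrib_left)
        also have "\<dots> = 2 * (\<Psi> (real N) - \<Psi> (- real N)) + k0 * (arctan (real N) - arctan (- real N))"
          unfolding ad_def sum_int_telescope ..
        also have "\<dots> \<le> 2 * (2 * S) + k0 * 4"
        proof (intro add_mono mult_left_mono)
          show "\<Psi> (real N) - \<Psi> (- real N) \<le> 2 * S" using S[of "real N"] S[of "- real N"] by linarith
          show "arctan (real N) - arctan (- real N) \<le> 4"
            using arctan_bounded[of "real N"] arctan_bounded[of "- real N"] pi_less_4 by linarith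
        qed (use k0 in auto)
        finally show ?thesis .
      qed
    qed
    then show ?thesis using m by (simp add: Lp_fun_iff le_less_trans)
  qed
  have tame_diff: "\<forall>\<^sub>F n in sequentially. \<forall>x. norm (U (Suc n) x - G n x) \<le> exp ((\<theta> + e) / q ^ n)" if e: "e > 0" for e
  proof -
    define C0 where "C0 = (\<Sum>j\<in>near. ms j)"
    have env: "\<forall>\<^sub>F n in sequentially. envelope n \<le> ereal (exp ((\<theta> + e) / q ^ n))"
      by (rule envelope_tame[OF S \<theta> e tame])
    have "(\<lambda>n. q ^ Suc n * B D (Suc n)) \<longlonglongrightarrow> 0"
      using scaled_B_tendsto_0[OF D_nn] LIMSEQ_Suc by blast
    then have B: "\<forall>\<^sub>F n in sequentially. q ^ Suc n * B D (Suc n) < q * (e / 2)"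
      using e q_pos by (intro order_tendstoD(2)) auto
    have P: "\<forall>\<^sub>F n in sequentially. C0 * 2 ^ Suc n \<le> exp ((e / 2) / q ^ n)"
      by (rule eventually_pow2_le) (use e in simp)
    show ?thesis using env B P
    proof eventually_elim
      case (elim n)
      show ?case
      proof
        fix x :: real
        define j where "j = \<lfloor>x\<rfloor>"
        have "norm (H j (Suc n) x) \<le> exp ((\<theta> + e) / q ^ n)"
        proof (cases "j \<in> near")
          case True
          have "norm (H j (Suc n) x) \<le> ms j * (2 ^ Suc n * exp (B D (Suc n)))"
            using True unfolding H_def
            by (simp only: if_True norm_mult) (intro mult_mono I ramp_bound, auto simp: ms_def mass_nonneg)
          also have "\<dots> \<le> C0 * (2 ^ Suc n * exp (B D (Suc n)))"
          proof (rule mult_right_mono)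
            show "ms j \<le> C0" unfolding C0_def by (rule member_le_sum[OF True _ fin]) (simp add: ms_def mass_nonneg)
          qed simp
          also have "\<dots> \<le> exp ((e / 2) / q ^ n) * exp ((e / 2) / q ^ n)"
          proof -
            have "B D (Suc n) \<le> (e / 2) / q ^ n" using elim(2) q_pos by (simp add: field_simps)
            then have "C0 * 2 ^ Suc n * exp (B D (Suc n)) \<le> exp ((e / 2) / q ^ n) * exp ((e / 2) / q ^ n)"
              using elim(3) by (intro mult_mono) auto
            then show ?thesis by (simp only: mult.assoc)
          qed
          also have "\<dots> = exp (e / q ^ n)" by (simp add: exp_add[symmetric] add_divide_distrib[symmetric])
          also have "\<dots> \<le> exp ((\<theta> + e) / q ^ n)" using \<theta> q_pos by (simp add: divide_right_mono)
          finally show ?thesis .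
        next
          case False
          have "ereal (norm (H j (Suc n) x)) \<le> envelope n"
            using Hf[of "real_of_int j"] False by (simp add: H_def staircase_def)
          also note elim(1)
          finally show ?thesis by simp
        qed
        then show "norm (U (Suc n) x - G n x) \<le> exp ((\<theta> + e) / q ^ n)" by (simp add: U_diff j_def)
      qed
    qed
  qed
  show ?thesis using U_tower U0 cost tame_diff by blast
qed

end

context width_selection
begin

theorem lift_exists:
  assumes G: "tower G" and Lp: "\<And>k. G k \<in> Lp_fun p" and bd: "\<And>k. Lp_norm p (G k) \<le> c0 * exp (L k)" and c0: "0 \<le> c0"
    and \<theta>: "0 \<le> \<theta>" and \<epsilon>: "0 < \<epsilon>"
    and tame: "\<And>e. e > 0 \<Longrightarrow> \<forall>\<^sub>F n in sequentially. \<forall>x. norm (G n x) \<le> exp ((\<theta> + e) / q ^ n)"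
  shows "\<exists>U. tower U \<and> U 0 \<in> Lp_fun p \<and> (\<forall>n. ecost p (\<lambda>x. U (Suc n) x - G n x) \<le> ennreal (\<epsilon> * exp (p * L n))) \<and>
    (\<forall>e>0. \<forall>\<^sub>F n in sequentially. \<forall>x. norm (U (Suc n) x - G n x) \<le> exp ((\<theta> + e) / q ^ n))"
proof -
  obtain \<Psi> S where P: "piece_data p L G \<Psi>" "\<And>x. \<bar>\<Psi> x\<bar> \<le> S"
    "\<And>u v. u \<le> v \<Longrightarrow> arctan v - arctan u \<le> \<Psi> v - \<Psi> u"
    using cost_potential[OF G Lp bd c0] by blast
  interpret piece_data p L G \<Psi> by (rule P(1))
  show ?thesis by (rule lift_exists_aux[OF P(2) \<theta> \<epsilon> tame P(3)])
qed

end

section \<open>Functions with almost vanishing derivatives\<close>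

lemma ecost_dominated:
  assumes F: "\<And>n. F n \<in> borel_measurable lebesgue" and f: "f \<in> Lp_fun p" and w: "w \<in> Lp_fun p" and p: "0 < p" "p \<le> 1"
    and le: "\<And>n x. norm (F n x) \<le> norm (w x)"
    and lim: "AE x in lebesgue. (\<lambda>n. F n x) \<longlonglongrightarrow> f x"
  shows "(\<lambda>n. ecost p (\<lambda>x. F n x - f x)) \<longlonglongrightarrow> 0"
proof -
  have [measurable]: "\<And>n. F n \<in> borel_measurable lebesgue" "f \<in> borel_measurable lebesgue" "w \<in> borel_measurable lebesgue"
    using F f w by (auto simp: Lp_fun_iff)
  have "(\<lambda>n. \<integral>\<^sup>+x. ennreal (norm (F n x - f x) powr p) \<partial>lebesgue) \<longlonglongrightarrow> (\<integral>\<^sup>+(x::real). 0 \<partial>lebesgue)"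
  proof (rule nn_integral_dominated_convergence[where u = "\<lambda>n x. ennreal (norm (F n x - f x) powr p)" and u' = "\<lambda>x. 0" and w = "\<lambda>x. ennreal (norm (w x) powr p) + ennreal (norm (f x) powr p)"])
    show "AE x in lebesgue. ennreal (norm (F n x - f x) powr p) \<le> ennreal (norm (w x) powr p) + ennreal (norm (f x) powr p)" for n
    proof (rule AE_I2)
      fix x
      have "norm (F n x - f x) powr p \<le> (norm (w x) + norm (f x)) powr p"
        using le[of n x] norm_triangle_ineq4[of "F n x" "f x"] p by (intro powr_mono2) auto
      also have "\<dots> \<le> norm (w x) powr p + norm (f x) powr p" by (rule powr_add_le) (use p in auto)
      finally show "ennreal (norm (F n x - f x) powr p) \<le> ennreal (norm (w x) powr p) + ennreal (norm (f x) powr p)"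
        by (simp add: ennreal_plus[symmetric] del: ennreal_plus)
    qed
    show "(\<integral>\<^sup>+x. ennreal (norm (w x) powr p) + ennreal (norm (f x) powr p) \<partial>lebesgue) < \<infinity>"
      using f w by (subst nn_integral_add) (auto simp: Lp_fun_iff ecost_def ennreal_add_eq_top less_top)
    show "AE x in lebesgue. (\<lambda>n. ennreal (norm (F n x - f x) powr p)) \<longlonglongrightarrow> 0"
      using lim
    proof eventually_elim
      case (elim x)
      have "(\<lambda>n. norm (F n x - f x)) \<longlonglongrightarrow> 0" using elim by (simp add: LIM_zero tendsto_norm_zero)
      then have "(\<lambda>n. norm (F n x - f x) powr p) \<longlonglongrightarrow> 0"
        by (rule tendsto_zero_powrI[OF _ tendsto_const]) (use p in auto)
      then show ?case using tendsto_ennrealI[of _ 0] by simp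
    qed
  qed measurable
  then show ?thesis by (simp add: ecost_def)
qed

context width_selection
begin

text \<open>The derivatives cost at most \<open>\<epsilon>\<close> relative to the weights, and
  their sup-norms obey the growth condition with rate 0. Adding such a tower disturbs neither the
  cost nor the rate of another one.\<close>

definition flat :: "(nat \<Rightarrow> real \<Rightarrow> complex) \<Rightarrow> real \<Rightarrow> bool" where
  "flat h \<epsilon> \<longleftrightarrow> tower h \<and> h 0 \<in> Lp_fun p \<and> (\<forall>n. ecost p (h (Suc n)) \<le> ennreal (\<epsilon> * exp (p * L n))) \<and>
    (\<forall>e>0. \<forall>\<^sub>F n in sequentially. \<forall>x. norm (h (Suc n) x) \<le> exp (e / q ^ n))"

text \<open>Arbitrarily cheap flat approximations are required. The property passes to linear
  combinations and to dominated limits almost everywhere, so indicators of intervals generate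
  everything.\<close>

definition approximable :: "(real \<Rightarrow> complex) set" where
  "approximable = {f \<in> Lp_fun p. \<forall>\<epsilon>>0. \<exists>h. flat h \<epsilon> \<and> ecost p (\<lambda>x. h 0 x - f x) \<le> ennreal \<epsilon>}"

lemma flat_tame: "flat h \<epsilon> \<Longrightarrow> e > 0 \<Longrightarrow> \<forall>\<^sub>F n in sequentially. \<forall>x. norm (h (Suc n) x) \<le> exp (e / q ^ n)"
  by (simp add: flat_def)

lemma approximable_zero: "(\<lambda>x. 0) \<in> approximable"
  unfolding approximable_def flat_def
  by (auto intro!: exI[of _ "\<lambda>n x. 0"] simp: Lp_fun_zero tower_def ecost_def p_pos)

lemma approximable_add:
  assumes "f \<in> approximable" "g \<in> approximable"
  shows "(\<lambda>x. f x + g x) \<in> approximable"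
proof -
  have fL: "f \<in> Lp_fun p" and gL: "g \<in> Lp_fun p" using assms by (auto simp: approximable_def)
  have "\<exists>h. flat h \<epsilon> \<and> ecost p (\<lambda>x. h 0 x - (f x + g x)) \<le> ennreal \<epsilon>" if "\<epsilon> > 0" for \<epsilon>
  proof -
    have e2: "\<epsilon> / 2 > 0" using that by simp
    obtain u where u: "flat u (\<epsilon> / 2)" "ecost p (\<lambda>x. u 0 x - f x) \<le> ennreal (\<epsilon> / 2)"
      using assms(1) e2 unfolding approximable_def by blast
    obtain v where v: "flat v (\<epsilon> / 2)" "ecost p (\<lambda>x. v 0 x - g x) \<le> ennreal (\<epsilon> / 2)"
      using assms(2) e2 unfolding approximable_def by blast
    have tu: "tower u" and tv: "tower v" using u v by (auto simp: flat_def)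
    have Lp: "u 0 \<in> Lp_fun p" "v 0 \<in> Lp_fun p" using u v by (auto simp: flat_def)
    have m: "f \<in> borel_measurable lebesgue" "g \<in> borel_measurable lebesgue" using fL gL by (auto simp: Lp_fun_iff)
    define h where "h n x = u n x + v n x" for n x
    have "ecost p (\<lambda>x. (u 0 x - f x) + (v 0 x - g x)) \<le> ecost p (\<lambda>x. u 0 x - f x) + ecost p (\<lambda>x. v 0 x - g x)"
      by (rule ecost_add) (use p_pos p_less_1 m tower_measurable[OF tu] tower_measurable[OF tv] in auto)
    also have "\<dots> \<le> ennreal (\<epsilon> / 2) + ennreal (\<epsilon> / 2)" by (intro add_mono u v)
    also have "\<dots> = ennreal \<epsilon>" using that by (simp add: ennreal_plus[symmetric] del: ennreal_plus)
    finally have 1: "ecost p (\<lambda>x. h 0 x - (f x + g x)) \<le> ennreal \<epsilon>" by (simp add: h_def algebra_simps)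
    have 2: "ecost p (h (Suc n)) \<le> ennreal (\<epsilon> * exp (p * L n))" for n
    proof -
      have "ecost p (h (Suc n)) \<le> ecost p (u (Suc n)) + ecost p (v (Suc n))" unfolding h_def
        by (rule ecost_add) (use p_pos p_less_1 tower_measurable[OF tu] tower_measurable[OF tv] in auto)
      also have "\<dots> \<le> ennreal (\<epsilon> / 2 * exp (p * L n)) + ennreal (\<epsilon> / 2 * exp (p * L n))"
        using u v by (intro add_mono) (auto simp: flat_def)
      also have "\<dots> = ennreal (\<epsilon> * exp (p * L n))" using that by (simp add: ennreal_plus[symmetric] del: ennreal_plus)
      finally show ?thesis .
    qed
    have 3: "\<forall>\<^sub>F n in sequentially. \<forall>x. norm (h (Suc n) x) \<le> exp (e / q ^ n)" if "e > 0" for e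
    proof -
      have e2: "e / 2 > 0" using that by simp
      have "\<forall>\<^sub>F n in sequentially. \<forall>x. norm (u (Suc n) x) \<le> exp ((e / 2) / q ^ n)"
        "\<forall>\<^sub>F n in sequentially. \<forall>x. norm (v (Suc n) x) \<le> exp ((e / 2) / q ^ n)"
        "\<forall>\<^sub>F n in sequentially. 1 * 2 ^ Suc n \<le> exp ((e / 2) / q ^ n)"
        by (rule flat_tame[OF u(1) e2] flat_tame[OF v(1) e2] eventually_pow2_le[OF e2])+
      then show ?thesis
      proof eventually_elim
        case (elim n)
        show ?case
        proof
          fix x
          have "norm (h (Suc n) x) \<le> 2 * exp ((e / 2) / q ^ n)"
            unfolding h_def using elim(1,2) norm_triangle_ineq[of "u (Suc n) x" "v (Suc n) x"]
            by (smt (verit))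
          also have "\<dots> \<le> exp ((e / 2) / q ^ n) * exp ((e / 2) / q ^ n)"
          proof (rule mult_right_mono)
            have "(1::real) \<le> 2 ^ n" by simp
            then show "2 \<le> exp ((e / 2) / q ^ n)" using elim(3) unfolding power_Suc by linarith
          qed simp
          also have "\<dots> = exp (e / q ^ n)" by (simp add: exp_add[symmetric] add_divide_distrib[symmetric])
          finally show "norm (h (Suc n) x) \<le> exp (e / q ^ n)" .
        qed
      qed
    qed
    have "tower h" unfolding h_def by (rule tower_add[OF tu tv])
    moreover have "h 0 \<in> Lp_fun p" unfolding h_def using Lp_fun_add[OF p_pos _ Lp] p_less_1 by simp
    ultimately have "flat h \<epsilon>" using 2 3 by (simp add: flat_def)
    then show ?thesis using 1 by blast
  qed
  moreover have "(\<lambda>x. f x + g x) \<in> Lp_fun p" using Lp_fun_add[OF p_pos _ fL gL] p_less_1 by simp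
  ultimately show ?thesis by (simp add: approximable_def)
qed

lemma approximable_sum: "(\<And>i. i \<in> A \<Longrightarrow> f i \<in> approximable) \<Longrightarrow> (\<lambda>x. \<Sum>i\<in>A. f i x) \<in> approximable"
proof (induction A rule: infinite_finite_induct)
  case (insert a A)
  have "(\<lambda>x. f a x + (\<Sum>i\<in>A. f i x)) \<in> approximable" by (intro approximable_add insert) auto
  then show ?case using insert by simp
qed (auto simp: approximable_zero)

lemma approximable_cmult:
  assumes "f \<in> approximable"
  shows "(\<lambda>x. c * f x) \<in> approximable"
proof -
  have fL: "f \<in> Lp_fun p" using assms by (auto simp: approximable_def)
  have "\<exists>h. flat h \<epsilon> \<and> ecost p (\<lambda>x. h 0 x - c * f x) \<le> ennreal \<epsilon>" if "\<epsilon> > 0" for \<epsilon>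
  proof -
    define d where "d = norm c powr p"
    have d: "0 \<le> d" by (simp add: d_def)
    define \<epsilon>' where "\<epsilon>' = \<epsilon> / (d + 1)"
    have e': "\<epsilon>' > 0" using that d by (simp add: \<epsilon>'_def)
    have de: "d * \<epsilon>' \<le> \<epsilon>" using that d by (simp add: \<epsilon>'_def field_simps)
    obtain u where u: "flat u \<epsilon>'" "ecost p (\<lambda>x. u 0 x - f x) \<le> ennreal \<epsilon>'"
      using assms e' unfolding approximable_def by blast
    have tu: "tower u" using u by (auto simp: flat_def)
    have m: "f \<in> borel_measurable lebesgue" using fL by (auto simp: Lp_fun_iff)
    define h where "h n x = c * u n x" for n x
    have "ecost p (\<lambda>x. c * (u 0 x - f x)) = ennreal d * ecost p (\<lambda>x. u 0 x - f x)" unfolding d_def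
      by (rule ecost_cmult) (use m tower_measurable[OF tu] in auto)
    also have "\<dots> \<le> ennreal d * ennreal \<epsilon>'" by (intro mult_left_mono u) simp
    also have "\<dots> = ennreal (d * \<epsilon>')" using d e' by (simp add: ennreal_mult)
    also have "\<dots> \<le> ennreal \<epsilon>" by (rule ennreal_leI[OF de])
    finally have 1: "ecost p (\<lambda>x. h 0 x - c * f x) \<le> ennreal \<epsilon>" by (simp add: h_def algebra_simps)
    have 2: "ecost p (h (Suc n)) \<le> ennreal (\<epsilon> * exp (p * L n))" for n
    proof -
      have "ecost p (h (Suc n)) = ennreal d * ecost p (u (Suc n))" unfolding h_def d_def
        by (rule ecost_cmult) (use tower_measurable[OF tu] in auto)
      also have "\<dots> \<le> ennreal d * ennreal (\<epsilon>' * exp (p * L n))"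
        using u by (intro mult_left_mono) (auto simp: flat_def)
      also have "\<dots> = ennreal (d * \<epsilon>' * exp (p * L n))" using d e' by (simp add: ennreal_mult[symmetric] mult.assoc)
      also have "\<dots> \<le> ennreal (\<epsilon> * exp (p * L n))" by (intro ennreal_leI mult_right_mono de) simp
      finally show ?thesis .
    qed
    have 3: "\<forall>\<^sub>F n in sequentially. \<forall>x. norm (h (Suc n) x) \<le> exp (e / q ^ n)" if "e > 0" for e
    proof -
      have e2: "e / 2 > 0" using that by simp
      have "\<forall>\<^sub>F n in sequentially. \<forall>x. norm (u (Suc n) x) \<le> exp ((e / 2) / q ^ n)"
        "\<forall>\<^sub>F n in sequentially. norm c * 2 ^ Suc n \<le> exp ((e / 2) / q ^ n)"
        by (rule flat_tame[OF u(1) e2] eventually_pow2_le[OF e2])+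
      then show ?thesis
      proof eventually_elim
        case (elim n)
        show ?case
        proof
          fix x
          have "norm c \<le> norm c * 2 ^ Suc n" using mult_left_mono[OF one_le_power[of "2::real" "Suc n"], of "norm c"] by simp
          then have "norm (h (Suc n) x) \<le> exp ((e / 2) / q ^ n) * exp ((e / 2) / q ^ n)"
            unfolding h_def norm_mult using elim by (intro mult_mono) auto
          also have "\<dots> = exp (e / q ^ n)" by (simp add: exp_add[symmetric] add_divide_distrib[symmetric])
          finally show "norm (h (Suc n) x) \<le> exp (e / q ^ n)" .
        qed
      qed
    qed
    have "tower h" unfolding h_def by (rule tower_cmult[OF tu])
    moreover have "h 0 \<in> Lp_fun p" unfolding h_def using Lp_fun_cmult u by (auto simp: flat_def)
    ultimately have "flat h \<epsilon>" using 2 3 by (simp add: flat_def)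
    then show ?thesis using 1 by blast
  qed
  then show ?thesis using Lp_fun_cmult[OF fL] by (simp add: approximable_def)
qed

lemma approximable_limit:
  assumes F: "\<And>n. F n \<in> approximable" and f: "f \<in> Lp_fun p" and w: "w \<in> Lp_fun p"
    and le: "\<And>n x. norm (F n x) \<le> norm (w x)"
    and lim: "AE x in lebesgue. (\<lambda>n. F n x) \<longlonglongrightarrow> f x"
  shows "f \<in> approximable"
proof -
  have m: "F n \<in> borel_measurable lebesgue" "f \<in> borel_measurable lebesgue" for n using F f by (auto simp: approximable_def Lp_fun_iff)
  have lim0: "(\<lambda>n. ecost p (\<lambda>x. F n x - f x)) \<longlonglongrightarrow> 0"
    by (rule ecost_dominated[OF m(1) f w p_pos _ le lim]) (use p_less_1 in simp)
  have "\<exists>h. flat h \<epsilon> \<and> ecost p (\<lambda>x. h 0 x - f x) \<le> ennreal \<epsilon>" if "\<epsilon> > 0" for \<epsilon>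
  proof -
    have e2: "\<epsilon> / 2 > 0" using that by simp
    have "\<forall>\<^sub>F n in sequentially. ecost p (\<lambda>x. F n x - f x) < ennreal (\<epsilon> / 2)"
      by (rule order_tendstoD(2)[OF lim0]) (use e2 in simp)
    then obtain n where n: "ecost p (\<lambda>x. F n x - f x) < ennreal (\<epsilon> / 2)" by (auto simp: eventually_sequentially)
    obtain u where u: "flat u (\<epsilon> / 2)" "ecost p (\<lambda>x. u 0 x - F n x) \<le> ennreal (\<epsilon> / 2)"
      using F[of n] e2 unfolding approximable_def by blast
    have tu: "tower u" using u by (auto simp: flat_def)
    have "ecost p (\<lambda>x. (u 0 x - F n x) + (F n x - f x)) \<le> ecost p (\<lambda>x. u 0 x - F n x) + ecost p (\<lambda>x. F n x - f x)"
      by (rule ecost_add) (use p_pos p_less_1 m tower_measurable[OF tu] in auto)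
    also have "\<dots> \<le> ennreal (\<epsilon> / 2) + ennreal (\<epsilon> / 2)" using u n by (intro add_mono) auto
    also have "\<dots> = ennreal \<epsilon>" using that by (simp add: ennreal_plus[symmetric] del: ennreal_plus)
    finally have "ecost p (\<lambda>x. u 0 x - f x) \<le> ennreal \<epsilon>" by simp
    moreover have "flat u \<epsilon>"
      using u(1) that unfolding flat_def
      by (auto elim!: allE order_trans intro!: ennreal_leI mult_right_mono)
    ultimately show ?thesis by blast
  qed
  then show ?thesis using f by (simp add: approximable_def)
qed

text \<open>The difference of two translated ramps with the same large \<open>D\<close>. It deviates
  from the indicator only on two intervals of length at most \<open>2 * exp (- D)\<close>, and its
  derivatives cost a multiple of \<open>exp (- D)\<close>.\<close>

lemma approximable_interval:
  assumes ab: "a \<le> b'"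
  shows "(\<lambda>x. indicator {a..<b'} x :: complex) \<in> approximable"
proof -
  define I where "I x = (indicator {a..<b'} x :: complex)" for x
  define s where "s x = (indicator {0..} x :: complex)" for x :: real
  have I: "I x = s (x - a) - s (x - b')" for x using ab by (auto simp: I_def s_def indicator_def)
  have sm: "s \<in> borel_measurable lebesgue" unfolding s_def by (intro borel_measurable_indicator) simp
  have Im: "I \<in> borel_measurable lebesgue" unfolding I_def by (intro borel_measurable_indicator) simp
  have Ic: "ecost p I \<le> ennreal (1 powr p * (b' - a))"
    by (rule ecost_le_bounded) (use ab p_pos in \<open>auto simp: I_def indicator_def\<close>)
  then have IL: "I \<in> Lp_fun p" using Im by (auto simp: Lp_fun_iff intro: le_less_trans)
  have "\<exists>h. flat h \<epsilon> \<and> ecost p (\<lambda>x. h 0 x - I x) \<le> ennreal \<epsilon>" if \<epsilon>: "\<epsilon> > 0" for \<epsilon>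
  proof -
    define D where "D = max 0 (max (ln (8 / \<epsilon>)) (ln (2 * exp X / \<epsilon>)))"
    have D0: "0 \<le> D" by (simp add: D_def)
    have "8 / \<epsilon> = exp (ln (8 / \<epsilon>))" using \<epsilon> by simp
    also have "\<dots> \<le> exp D" unfolding exp_le_cancel_iff by (simp add: D_def)
    finally have D1: "8 * exp (- D) \<le> \<epsilon>" using \<epsilon> by (simp add: exp_minus field_simps)
    have "2 * exp X / \<epsilon> = exp (ln (2 * exp X / \<epsilon>))" using \<epsilon> by simp
    also have "\<dots> \<le> exp D" unfolding exp_le_cancel_iff by (simp add: D_def)
    finally have D2: "2 * exp (X - D) \<le> \<epsilon>" using \<epsilon> by (simp add: exp_diff field_simps)
    have rm: "ramp D n \<in> borel_measurable lebesgue" for n by (rule tower_measurable[OF ramp_tower])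
    have tw: "tower (\<lambda>n x. ramp D n (x - a))" for a by (rule tower_shift[OF ramp_tower])
    have rms: "(\<lambda>x. ramp D n (x - a)) \<in> borel_measurable lebesgue" for n a by (rule tower_measurable[OF tw])
    define r where "r x = ramp D 0 x - s x" for x
    have rmm: "r \<in> borel_measurable lebesgue" unfolding r_def by (intro borel_measurable_diff rm sm)
    define W where "W = 2 * exp (- b D 0)"
    have W: "W \<le> 2 * exp (- D)" using b_ge[of D 0] K_pos by (simp add: W_def)
    have rc: "ecost p r \<le> ennreal (4 * exp (- D))"
    proof -
      have "ecost p r \<le> ennreal (2 powr p * (W - 0))"
      proof (rule ecost_le_bounded)
        show "norm (r x) \<le> 2" for x
          using norm_triangle_ineq4[of "ramp D 0 x" "s x"] ramp_le_1[of D x] unfolding r_def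
          by (auto simp: s_def indicator_def split: if_splits)
        show "r x = 0" if "x \<notin> {0..W}" for x
          using that ramp_zero[of x D 0] ramp_one[of D x] by (auto simp: r_def s_def W_def indicator_def)
      qed (use p_pos in \<open>auto simp: W_def\<close>)
      also have "2 powr p * (W - 0) \<le> 2 * (2 * exp (- D))"
        using W p_less_1 powr_mono[of p 1 2] by (intro mult_mono) (auto simp: W_def)
      finally show ?thesis by (simp add: ennreal_leI)
    qed
    have rmc: "(\<lambda>x. r (x - c)) \<in> borel_measurable lebesgue" for c
    proof -
      have "(\<lambda>x. s (x - c)) \<in> borel_measurable lebesgue"
      proof -
        have "(\<lambda>x. s (x - c)) = indicator {c..}" by (auto simp: s_def indicator_def fun_eq_iff)
        then show ?thesis by (simp only:) (intro borel_measurable_indicator, simp)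
      qed
      then show ?thesis unfolding r_def using rms by (intro borel_measurable_diff)
    qed
    define h where "h n x = ramp D n (x - a) - ramp D n (x - b')" for n x
    have th: "tower h" unfolding h_def by (rule tower_diff[OF tw tw])
    have cost_diff: "ecost p (\<lambda>x. u x - v x) \<le> ecost p u + ecost p v"
      if "u \<in> borel_measurable lebesgue" "v \<in> borel_measurable lebesgue" for u v
      using ecost_add[OF p_pos less_imp_le[OF p_less_1] that(1) borel_measurable_uminus[OF that(2)]] by (simp add: ecost_minus)
    have "ecost p (\<lambda>x. r (x - a) - r (x - b')) \<le> ecost p (\<lambda>x. r (x - a)) + ecost p (\<lambda>x. r (x - b'))"
      by (rule cost_diff) (rule rmc)+
    also have "\<dots> = ecost p r + ecost p r" by (simp only: ecost_shift[OF rmm])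
    also have "\<dots> \<le> ennreal (4 * exp (- D)) + ennreal (4 * exp (- D))" by (intro add_mono rc)
    also have "\<dots> = ennreal (8 * exp (- D))" by (simp add: ennreal_plus[symmetric] del: ennreal_plus)
    also have "\<dots> \<le> ennreal \<epsilon>" by (rule ennreal_leI[OF D1])
    finally have 1: "ecost p (\<lambda>x. h 0 x - I x) \<le> ennreal \<epsilon>" by (simp add: h_def r_def I algebra_simps)
    have 2: "ecost p (h (Suc n)) \<le> ennreal (\<epsilon> * exp (p * L n))" for n
    proof -
      have "ecost p (h (Suc n)) \<le> ecost p (\<lambda>x. ramp D (Suc n) (x - a)) + ecost p (\<lambda>x. ramp D (Suc n) (x - b'))"
        unfolding h_def by (rule cost_diff) (rule rms)+
      also have "\<dots> = ecost p (ramp D (Suc n)) + ecost p (ramp D (Suc n))" by (simp only: ecost_shift[OF rm])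
      also have "\<dots> \<le> ennreal (exp (p * L n - D + X)) + ennreal (exp (p * L n - D + X))" by (intro add_mono ramp_cost)
      also have "\<dots> = ennreal (2 * exp (X - D) * exp (p * L n))"
        by (simp add: ennreal_plus[symmetric] exp_add[symmetric] algebra_simps del: ennreal_plus)
      also have "\<dots> \<le> ennreal (\<epsilon> * exp (p * L n))" by (intro ennreal_leI mult_right_mono D2) simp
      finally show ?thesis .
    qed
    have 3: "\<forall>\<^sub>F n in sequentially. \<forall>x. norm (h (Suc n) x) \<le> exp (e / q ^ n)" if e: "e > 0" for e
    proof -
      have "(\<lambda>n. q ^ Suc n * B D (Suc n)) \<longlonglongrightarrow> 0"
        using scaled_B_tendsto_0[OF D0] LIMSEQ_Suc by blast
      then have B: "\<forall>\<^sub>F n in sequentially. q ^ Suc n * B D (Suc n) < q * (e / 2)"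
        using e q_pos by (intro order_tendstoD(2)) auto
      have P: "\<forall>\<^sub>F n in sequentially. 2 * 2 ^ Suc n \<le> exp ((e / 2) / q ^ n)"
        by (rule eventually_pow2_le) (use e in simp)
      show ?thesis using B P
      proof eventually_elim
        case (elim n)
        show ?case
        proof
          fix x
          have "norm (h (Suc n) x) \<le> 2 * 2 ^ Suc n * exp (B D (Suc n))"
            using norm_triangle_ineq4[of "ramp D (Suc n) (x - a)" "ramp D (Suc n) (x - b')"]
              ramp_bound[of D n "x - a"] ramp_bound[of D n "x - b'"] unfolding h_def by linarith
          also have "\<dots> \<le> exp ((e / 2) / q ^ n) * exp ((e / 2) / q ^ n)"
          proof -
            have "B D (Suc n) \<le> (e / 2) / q ^ n" using elim(1) q_pos by (simp add: field_simps)
            then show ?thesis using elim(2) by (intro mult_mono) auto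
          qed
          also have "\<dots> = exp (e / q ^ n)" by (simp add: exp_add[symmetric] add_divide_distrib[symmetric])
          finally show "norm (h (Suc n) x) \<le> exp (e / q ^ n)" .
        qed
      qed
    qed
    have "h 0 \<in> Lp_fun p"
    proof -
      have "(\<lambda>x. h 0 x - I x) \<in> borel_measurable lebesgue"
        by (intro borel_measurable_diff Im tower_measurable[OF th])
      then have "(\<lambda>x. h 0 x - I x) \<in> Lp_fun p" using 1 by (auto simp: Lp_fun_iff intro: le_less_trans)
      from Lp_fun_add[OF p_pos _ this IL] show ?thesis using p_less_1 by simp
    qed
    then have "flat h \<epsilon>" using th 2 3 by (simp add: flat_def)
    then show ?thesis using 1 by blast
  qed
  then show ?thesis using IL by (simp add: approximable_def I_def[abs_def])
qed

section \<open>From indicators of intervals to all of \<open>L^p\<close>\<close>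

abbreviation "window R x \<equiv> (indicator {- real R..<real R} x :: complex)"

lemma window_Lp: "(\<lambda>x. c * window R x) \<in> Lp_fun p"
  using approximable_cmult[OF approximable_interval[of "- real R" "real R"], of c] by (simp add: approximable_def)

lemma approximable_step:
  "(\<lambda>x. g (real_of_int \<lfloor>real (Suc k) * x\<rfloor> / real (Suc k)) * window R x) \<in> approximable"
proof -
  let ?A = "{- int R * int (Suc k)..<int R * int (Suc k)}"
  define M where "M = real (Suc k)"
  have M: "M > 0" by (simp add: M_def)
  have eq: "g (real_of_int \<lfloor>M * x\<rfloor> / M) * window R x =
      (\<Sum>j\<in>?A. g (real_of_int j / M) * indicator {real_of_int j / M..<real_of_int (j + 1) / M} x)" for x
  proof -
    have "(\<Sum>j\<in>?A. g (real_of_int j / M) * indicator {real_of_int j / M..<real_of_int (j + 1) / M} x)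
      = (\<Sum>j\<in>?A. if j = \<lfloor>M * x\<rfloor> then g (real_of_int j / M) else 0)"
    proof (intro sum.cong refl)
      fix j
      have "x \<in> {real_of_int j / M..<real_of_int (j + 1) / M} \<longleftrightarrow> j = \<lfloor>M * x\<rfloor>"
        using M floor_eq_iff[of "M * x" j] by (auto simp: field_simps)
      then show "g (real_of_int j / M) * indicator {real_of_int j / M..<real_of_int (j + 1) / M} x
        = (if j = \<lfloor>M * x\<rfloor> then g (real_of_int j / M) else 0)" by (simp add: indicator_def)
    qed
    also have "\<dots> = (if \<lfloor>M * x\<rfloor> \<in> ?A then g (real_of_int \<lfloor>M * x\<rfloor> / M) else 0)"
      by (subst sum.delta) auto
    also have "\<lfloor>M * x\<rfloor> \<in> ?A \<longleftrightarrow> x \<in> {- real R..<real R}"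
    proof -
      have "\<lfloor>M * x\<rfloor> \<in> ?A \<longleftrightarrow> - (real R * M) \<le> M * x \<and> M * x < real R * M"
        by (simp add: le_floor_iff floor_less_iff M_def)
      also have "\<dots> \<longleftrightarrow> M * - real R \<le> M * x \<and> M * x < M * real R" by (simp add: mult.commute)
      also have "\<dots> \<longleftrightarrow> - real R \<le> x \<and> x < real R" using M by (simp only: mult_le_cancel_left_pos mult_less_cancel_left_pos)
      finally show ?thesis by simp
    qed
    finally show ?thesis by (simp add: indicator_def)
  qed
  have "(\<lambda>x. \<Sum>j\<in>?A. g (real_of_int j / M) * indicator {real_of_int j / M..<real_of_int (j + 1) / M} x) \<in> approximable"
    by (intro approximable_sum approximable_cmult approximable_interval) (use M in \<open>auto simp: divide_right_mono\<close>)
  then show ?thesis unfolding M_def[symmetric] eq .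
qed

lemma approximable_continuous:
  assumes g: "continuous_on UNIV g" and bd: "\<And>x. norm (g x) \<le> C"
  shows "(\<lambda>x. g x * window R x) \<in> approximable"
proof (rule approximable_limit)
  have C: "0 \<le> C" using bd[of 0] norm_ge_zero[of "g 0"] by linarith
  show "(\<lambda>x. g (real_of_int \<lfloor>real (Suc k) * x\<rfloor> / real (Suc k)) * window R x) \<in> approximable" for k by (rule approximable_step)
  show w: "(\<lambda>x. of_real C * window R x) \<in> Lp_fun p" by (rule window_Lp)
  show "norm (g (real_of_int \<lfloor>real (Suc k) * x\<rfloor> / real (Suc k)) * window R x) \<le> norm (of_real C * window R x)" for k x
    using bd C by (auto simp: norm_mult indicator_def)
  have gm: "(\<lambda>x. g x * window R x) \<in> borel_measurable lebesgue"
    by (intro borel_measurable_times continuous_borel_measurable_lebesgue[OF g] borel_measurable_indicator) simp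
  have "ecost p (\<lambda>x. g x * window R x) \<le> ecost p (\<lambda>x. of_real C * window R x)"
    unfolding ecost_def by (intro nn_integral_mono ennreal_leI powr_mono2) (use p_pos bd C in \<open>auto simp: norm_mult indicator_def\<close>)
  then show "(\<lambda>x. g x * window R x) \<in> Lp_fun p" using gm w by (auto simp: Lp_fun_iff intro: le_less_trans)
  have "(\<lambda>k. g (real_of_int \<lfloor>real (Suc k) * x\<rfloor> / real (Suc k)) * window R x) \<longlonglongrightarrow> g x * window R x" for x
  proof (intro tendsto_mult tendsto_const)
    have "(\<lambda>k. real_of_int \<lfloor>real (Suc k) * x\<rfloor> / real (Suc k)) \<longlonglongrightarrow> x"
    proof (rule tendsto_sandwich)
      have "x - 1 / real (Suc k) \<le> real_of_int \<lfloor>real (Suc k) * x\<rfloor> / real (Suc k)" for k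
      proof -
        have "real (Suc k) * x - 1 \<le> real_of_int \<lfloor>real (Suc k) * x\<rfloor>" by linarith
        then have "(real (Suc k) * x - 1) / real (Suc k) \<le> real_of_int \<lfloor>real (Suc k) * x\<rfloor> / real (Suc k)"
          by (rule divide_right_mono) simp
        then show ?thesis by (simp add: diff_divide_distrib)
      qed
      then show "\<forall>\<^sub>F k in sequentially. x - 1 / real (Suc k) \<le> real_of_int \<lfloor>real (Suc k) * x\<rfloor> / real (Suc k)" by simp
      have "real_of_int \<lfloor>real (Suc k) * x\<rfloor> / real (Suc k) \<le> x" for k
      proof -
        have "real_of_int \<lfloor>real (Suc k) * x\<rfloor> \<le> real (Suc k) * x" by linarith
        then have "real_of_int \<lfloor>real (Suc k) * x\<rfloor> / real (Suc k) \<le> (real (Suc k) * x) / real (Suc k)"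
          by (rule divide_right_mono) simp
        then show ?thesis by simp
      qed
      then show "\<forall>\<^sub>F k in sequentially. real_of_int \<lfloor>real (Suc k) * x\<rfloor> / real (Suc k) \<le> x" by simp
      have "(\<lambda>k. x - 1 / real (Suc k)) \<longlonglongrightarrow> x - 0"
        using LIMSEQ_inverse_real_of_nat by (intro tendsto_diff tendsto_const) (simp add: inverse_eq_divide)
      then show "(\<lambda>k. x - 1 / real (Suc k)) \<longlonglongrightarrow> x" by simp
    qed simp
    then show "(\<lambda>k. g (real_of_int \<lfloor>real (Suc k) * x\<rfloor> / real (Suc k))) \<longlonglongrightarrow> g x"
      using continuous_on_tendsto_compose[OF g] by simp
  qed
  then show "AE x in lebesgue. (\<lambda>k. g (real_of_int \<lfloor>real (Suc k) * x\<rfloor> / real (Suc k)) * window R x) \<longlonglongrightarrow> g x * window R x"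
    by simp
qed

text \<open>A measurable function is an almost everywhere limit of continuous ones. Projection onto
  the ball of radius \<open>C\<close> is continuous and fixes the values of \<open>f\<close>, so it
  makes the approximations bounded without changing the limit.\<close>

lemma approximable_bounded:
  assumes f: "f \<in> borel_measurable lebesgue" and bd: "\<And>x. norm (f x) \<le> C"
  shows "(\<lambda>x. f x * window R x) \<in> approximable"
proof -
  have C: "0 \<le> C" using bd[of 0] norm_ge_zero[of "f 0"] by linarith
  let ?c = "closest_point (cball (0::complex) C)"
  have ne: "cball (0::complex) C \<noteq> {}" using C by simp
  obtain N g where N: "negligible N" and g: "\<And>n. continuous_on UNIV (g n)"
    and lim: "\<And>x. x \<notin> N \<Longrightarrow> (\<lambda>n. g n x) \<longlonglongrightarrow> f x"
    using lebesgue_measurable_imp_measurable_on[OF f, of UNIV] unfolding measurable_on_def by auto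
  have cc: "continuous_on UNIV ?c"
    by (rule continuous_on_closest_point[OF convex_cball closed_cball ne])
  have cn: "norm (?c z) \<le> C" for z using closest_point_in_set[OF closed_cball ne, of z] by simp
  have cg: "continuous_on UNIV (\<lambda>x. ?c (g n x))" for n
    by (rule continuous_on_compose2[OF cc g]) simp
  show ?thesis
  proof (rule approximable_limit)
    show "(\<lambda>x. ?c (g n x) * window R x) \<in> approximable" for n by (rule approximable_continuous[OF cg cn])
    show w: "(\<lambda>x. of_real C * window R x) \<in> Lp_fun p" by (rule window_Lp)
    show "norm (?c (g n x) * window R x) \<le> norm (of_real C * window R x)" for n x
      using cn C by (auto simp: norm_mult indicator_def)
    have gm: "(\<lambda>x. f x * window R x) \<in> borel_measurable lebesgue"
      by (intro borel_measurable_times f borel_measurable_indicator) simp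
    have "ecost p (\<lambda>x. f x * window R x) \<le> ecost p (\<lambda>x. of_real C * window R x)"
      unfolding ecost_def by (intro nn_integral_mono ennreal_leI powr_mono2) (use p_pos bd C in \<open>auto simp: norm_mult indicator_def\<close>)
    then show "(\<lambda>x. f x * window R x) \<in> Lp_fun p" using gm w by (auto simp: Lp_fun_iff intro: le_less_trans)
    have "N \<in> null_sets lebesgue" using N by (simp add: negligible_iff_null_sets)
    moreover have "(\<lambda>n. ?c (g n x) * window R x) \<longlonglongrightarrow> f x * window R x" if "x \<notin> N" for x
    proof (intro tendsto_mult tendsto_const)
      have "(\<lambda>n. ?c (g n x)) \<longlonglongrightarrow> ?c (f x)"
        using continuous_on_tendsto_compose[OF cc lim[OF that]] by simp
      then show "(\<lambda>n. ?c (g n x)) \<longlonglongrightarrow> f x" using closest_point_self[of "f x" "cball 0 C"] bd by simp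
    qed
    ultimately show "AE x in lebesgue. (\<lambda>n. ?c (g n x) * window R x) \<longlonglongrightarrow> f x * window R x"
      by (intro AE_I'[of N]) auto
  qed
qed

theorem approximable_Lp:
  assumes f: "f \<in> Lp_fun p"
  shows "f \<in> approximable"
proof (rule approximable_limit[OF _ f f])
  define F where "F R x = (if norm (f x) \<le> real R then f x else 0)" for R x
  have fm: "f \<in> borel_measurable lebesgue" using f by (simp add: Lp_fun_iff)
  have Fm: "F R \<in> borel_measurable lebesgue" for R
    unfolding F_def using fm by measurable
  show "(\<lambda>x. F R x * window R x) \<in> approximable" for R
    by (rule approximable_bounded[OF Fm, of _ "real R"]) (simp add: F_def)
  show "norm (F R x * window R x) \<le> norm (f x)" for R x by (simp add: F_def norm_mult indicator_def)
  have "(\<lambda>R. F R x * window R x) \<longlonglongrightarrow> f x" for x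
  proof (rule tendsto_eventually)
    obtain R0 :: nat where "max \<bar>x\<bar> (norm (f x)) < real R0" using reals_Archimedean2 by blast
    then have "F R x * window R x = f x" if "R0 \<le> R" for R
      using that by (auto simp: F_def indicator_def)
    then show "\<forall>\<^sub>F R in sequentially. F R x * window R x = f x" by (auto simp: eventually_sequentially)
  qed
  then show "AE x in lebesgue. (\<lambda>R. F R x * window R x) \<longlonglongrightarrow> f x" by simp
qed

text \<open>\<open>lift_exists\<close> provides \<open>V\<close> with derivatives close to g but
  without control of \<open>V 0\<close> itself. The defect \<open>f - V 0\<close> lies in
  \<open>L^p\<close> and is supplied by a flat function, whose derivatives are negligible.\<close>

theorem simultaneous_approximation:
  assumes f: "f \<in> Lp_fun p" and G: "tower G" and Lp: "\<And>k. G k \<in> Lp_fun p"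
    and bd: "\<And>k. Lp_norm p (G k) \<le> c0 * exp (L k)" and c0: "0 \<le> c0"
    and \<theta>: "0 \<le> \<theta>" and \<epsilon>: "0 < \<epsilon>"
    and tame: "\<And>e. e > 0 \<Longrightarrow> \<forall>\<^sub>F n in sequentially. \<forall>x. norm (G n x) \<le> exp ((\<theta> + e) / q ^ n)"
  shows "\<exists>U. tower U \<and> ecost p (\<lambda>x. U 0 x - f x) \<le> ennreal \<epsilon> \<and>
    (\<forall>n. ecost p (\<lambda>x. U (Suc n) x - G n x) \<le> ennreal (\<epsilon> * exp (p * L n))) \<and>
    (\<forall>e>0. \<forall>\<^sub>F n in sequentially. \<forall>x. norm (U (Suc n) x) \<le> exp ((\<theta> + e) / q ^ n))"
proof -
  have e2: "\<epsilon> / 2 > 0" using \<epsilon> by simp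
  obtain V where V: "tower V" "V 0 \<in> Lp_fun p" "\<And>n. ecost p (\<lambda>x. V (Suc n) x - G n x) \<le> ennreal (\<epsilon> / 2 * exp (p * L n))"
    "\<And>e. e > 0 \<Longrightarrow> \<forall>\<^sub>F n in sequentially. \<forall>x. norm (V (Suc n) x - G n x) \<le> exp ((\<theta> + e) / q ^ n)"
    using lift_exists[OF G Lp bd c0 \<theta> e2 tame] by blast
  have "(\<lambda>x. f x - V 0 x) \<in> approximable"
    by (rule approximable_Lp) (rule Lp_fun_diff[OF p_pos less_imp_le[OF p_less_1] f V(2)])
  then obtain h where h: "flat h (\<epsilon> / 2)" "ecost p (\<lambda>x. h 0 x - (f x - V 0 x)) \<le> ennreal (\<epsilon> / 2)"
    using e2 unfolding approximable_def by blast
  have th: "tower h" using h by (simp add: flat_def)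
  define U where "U n x = V n x + h n x" for n x
  have "tower U" unfolding U_def by (rule tower_add[OF V(1) th])
  moreover have "ecost p (\<lambda>x. U 0 x - f x) \<le> ennreal \<epsilon>"
  proof -
    have "(\<lambda>x. h 0 x - (f x - V 0 x)) = (\<lambda>x. U 0 x - f x)" by (auto simp: U_def)
    with h(2) have "ecost p (\<lambda>x. U 0 x - f x) \<le> ennreal (\<epsilon> / 2)" by simp
    also have "\<dots> \<le> ennreal \<epsilon>" using \<epsilon> by (intro ennreal_leI) simp
    finally show ?thesis .
  qed
  moreover have "ecost p (\<lambda>x. U (Suc n) x - G n x) \<le> ennreal (\<epsilon> * exp (p * L n))" for n
  proof -
    have "(\<lambda>x. U (Suc n) x - G n x) = (\<lambda>x. (V (Suc n) x - G n x) + h (Suc n) x)" by (auto simp: U_def)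
    then have "ecost p (\<lambda>x. U (Suc n) x - G n x) = ecost p (\<lambda>x. (V (Suc n) x - G n x) + h (Suc n) x)" by simp
    also have "\<dots> \<le> ecost p (\<lambda>x. V (Suc n) x - G n x) + ecost p (h (Suc n))"
      by (rule ecost_add[OF p_pos less_imp_le[OF p_less_1] borel_measurable_diff])
        (rule tower_measurable[OF V(1)] tower_measurable[OF G] tower_measurable[OF th])+
    also have "\<dots> \<le> ennreal (\<epsilon> / 2 * exp (p * L n)) + ennreal (\<epsilon> / 2 * exp (p * L n))"
      using h by (intro add_mono V) (simp add: flat_def)
    also have "\<dots> = ennreal (\<epsilon> * exp (p * L n))" using \<epsilon> by (simp add: ennreal_plus[symmetric] del: ennreal_plus)
    finally show ?thesis .
  qed
  moreover have "\<forall>\<^sub>F n in sequentially. \<forall>x. norm (U (Suc n) x) \<le> exp ((\<theta> + e) / q ^ n)" if e: "e > 0" for e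
  proof -
    have e2: "e / 2 > 0" using e by simp
    have "\<forall>\<^sub>F n in sequentially. 2 * 2 ^ Suc n \<le> exp ((e / 2) / q ^ n)" by (rule eventually_pow2_le[OF e2])
    with V(4)[OF e2] flat_tame[OF h(1) e2] tame[OF e2] show ?thesis
    proof eventually_elim
      case (elim n)
      show ?case
      proof
        fix x
        have le: "exp ((e / 2) / q ^ n) \<le> exp ((\<theta> + e / 2) / q ^ n)"
          unfolding exp_le_cancel_iff by (rule divide_right_mono) (use \<theta> q_pos in auto)
        have "norm (U (Suc n) x) \<le> norm (V (Suc n) x - G n x) + norm (h (Suc n) x) + norm (G n x)"
          using norm_triangle_ineq[of "(V (Suc n) x - G n x) + h (Suc n) x" "G n x"]
            norm_triangle_ineq[of "V (Suc n) x - G n x" "h (Suc n) x"] unfolding U_def by (simp add: algebra_simps)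
        also have "\<dots> \<le> 4 * exp ((\<theta> + e / 2) / q ^ n)"
          using spec[OF elim(1), of x] spec[OF elim(2), of x] spec[OF elim(3), of x] le exp_ge_zero[of "(\<theta> + e / 2) / q ^ n"] by linarith
        also have "\<dots> \<le> exp ((e / 2) / q ^ n) * exp ((\<theta> + e / 2) / q ^ n)"
        proof (rule mult_right_mono)
          have "(1::real) \<le> 2 ^ n" by simp
          then show "4 \<le> exp ((e / 2) / q ^ n)" using elim(4) unfolding power_Suc by linarith
        qed simp
        also have "\<dots> = exp ((\<theta> + e) / q ^ n)" using q_pos by (simp add: exp_add[symmetric] field_simps)
        finally show "norm (U (Suc n) x) \<le> exp ((\<theta> + e) / q ^ n)" .
      qed
    qed
  qed
  ultimately show ?thesis by blast
qed

end

section \<open>Completeness of \<open>L\<^sup>p\<close>\<close>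

lemma Lp_norm_diff_triangle:
  assumes "0 < p" "p \<le> 1" "f \<in> Lp_fun p" "g \<in> Lp_fun p" "h \<in> Lp_fun p"
  shows "Lp_norm p (\<lambda>x. f x - h x) powr p \<le> Lp_norm p (\<lambda>x. f x - g x) powr p + Lp_norm p (\<lambda>x. g x - h x) powr p"
  using Lp_norm_powr_add[OF assms(1,2) Lp_fun_diff[OF assms(1,2,3,4)] Lp_fun_diff[OF assms(1,2,4,5)]] by simp

lemma Lp_norm_diff_commute: "Lp_norm p (\<lambda>x. f x - g x) = Lp_norm p (\<lambda>x. g x - f x)"
  by (simp add: Lp_norm_def norm_minus_commute)

lemma Lp_norm_cong_AE:
  assumes "f \<in> borel_measurable lebesgue" "g \<in> borel_measurable lebesgue" "AE x in lebesgue. f x = g x"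
  shows "Lp_norm p f = Lp_norm p g"
proof -
  have "(\<integral>x. norm (f x) powr p \<partial>lebesgue) = (\<integral>x. norm (g x) powr p \<partial>lebesgue)"
    by (rule integral_cong_AE) (use assms in \<open>measurable, auto\<close>)
  then show ?thesis by (simp add: Lp_norm_def)
qed

lemma Lp_norm_eq_0:
  assumes "0 < p" "f \<in> Lp_fun p" "Lp_norm p f = 0"
  shows "AE x in lebesgue. f x = 0"
proof -
  have m[measurable]: "f \<in> borel_measurable lebesgue" using assms by (simp add: Lp_fun_iff)
  have "ecost p f = 0" using ecost_eq[OF assms(1,2)] assms by simp
  then have "AE x in lebesgue. ennreal (norm (f x) powr p) = 0"
    unfolding ecost_def by (subst (asm) nn_integral_0_iff_AE) auto
  then show ?thesis by eventually_elim (auto simp: ennreal_eq_0_iff powr_nonneg_iff)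
qed

text \<open>Along a subsequence whose increments \<open>a k\<close> have summable cost, the sums of
  |a_k|^p converge almost everywhere. The terms are eventually below 1, where |a_k| <= |a_k|^p, so
  the increments themselves are absolutely summable. Fatou's lemma then yields convergence of the
  full sequence.\<close>

theorem Lp_complete:
  assumes p: "0 < p" "p \<le> 1" and s: "\<And>k. s k \<in> Lp_fun p"
    and cauchy: "\<And>\<epsilon>. 0 < \<epsilon> \<Longrightarrow> \<exists>N. \<forall>j\<ge>N. \<forall>k\<ge>N. Lp_norm p (\<lambda>x. s j x - s k x) < \<epsilon>"
  shows "\<exists>f\<in>Lp_fun p. (\<lambda>k. Lp_norm p (\<lambda>x. s k x - f x)) \<longlonglongrightarrow> 0"
proof -
  have m[measurable]: "s k \<in> borel_measurable lebesgue" for k using s[of k] by (simp add: Lp_fun_iff)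
  have dL: "(\<lambda>x. s j x - s k x) \<in> Lp_fun p" for j k by (rule Lp_fun_diff[OF p s s])
  have ec: "\<exists>N. \<forall>j\<ge>N. \<forall>k\<ge>N. ecost p (\<lambda>x. s j x - s k x) \<le> ennreal \<epsilon>" if "\<epsilon> > 0" for \<epsilon>
  proof -
    obtain N where N: "\<And>j k. j \<ge> N \<Longrightarrow> k \<ge> N \<Longrightarrow> Lp_norm p (\<lambda>x. s j x - s k x) < \<epsilon> powr (1 / p)"
      using cauchy[of "\<epsilon> powr (1 / p)"] \<open>\<epsilon> > 0\<close> by auto
    have "ecost p (\<lambda>x. s j x - s k x) \<le> ennreal \<epsilon>" if "j \<ge> N" "k \<ge> N" for j k
      using Lp_norm_le_iff[OF p(1) dL[of j k], of "\<epsilon> powr (1 / p)"] N[OF that] \<open>\<epsilon> > 0\<close> p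
      by (simp add: powr_powr)
    then show ?thesis by blast
  qed
  have "\<exists>N. \<forall>k. \<forall>j\<ge>N k. \<forall>i\<ge>N k. ecost p (\<lambda>x. s j x - s i x) \<le> ennreal ((1 / 2) ^ k)"
    by (intro choice allI ec) simp
  then obtain N where N: "\<And>k j i. j \<ge> N k \<Longrightarrow> i \<ge> N k \<Longrightarrow> ecost p (\<lambda>x. s j x - s i x) \<le> ennreal ((1 / 2) ^ k)"
    by blast
  \<comment> \<open>Summing the thresholds makes \<open>r\<close> monotone; the extra
    \<open>k\<close> makes it unbounded.\<close>
  define r where "r k = (\<Sum>i\<le>k. N i) + k" for k
  have rN: "N k \<le> r k" for k unfolding r_def using member_le_sum[of k "{..k}" N] by auto
  have rS: "r k \<le> r (Suc k)" for k by (simp add: r_def)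
  have rk: "k \<le> r k" for k by (simp add: r_def)
  define a where "a k x = s (r (Suc k)) x - s (r k) x" for k x
  have am[measurable]: "a k \<in> borel_measurable lebesgue" for k unfolding a_def by measurable
  have ac: "ecost p (a k) \<le> ennreal ((1 / 2) ^ k)" for k
    unfolding a_def using rN[of k] rS[of k] by (intro N) auto
  have "(\<integral>\<^sup>+x. (\<Sum>k. ennreal (norm (a k x) powr p)) \<partial>lebesgue) = (\<Sum>k. ecost p (a k))"
    unfolding ecost_def by (rule nn_integral_suminf) measurable
  also have "\<dots> \<le> (\<Sum>k. ennreal ((1 / 2) ^ k))" by (intro suminf_le ac) auto
  also have "\<dots> = ennreal (\<Sum>k. (1 / 2) ^ k)" by (rule suminf_ennreal2) (auto intro: summable_geometric)
  also have "\<dots> < \<infinity>" by simp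
  finally have "(\<integral>\<^sup>+x. (\<Sum>k. ennreal (norm (a k x) powr p)) \<partial>lebesgue) \<noteq> \<infinity>" by simp
  then have AE_fin: "AE x in lebesgue. (\<Sum>k. ennreal (norm (a k x) powr p)) \<noteq> \<infinity>"
    by (intro nn_integral_PInf_AE) measurable
  define f where "f x = lim (\<lambda>k. s (r k) x)" for x
  have fm[measurable]: "f \<in> borel_measurable lebesgue" unfolding f_def by measurable
  have conv: "AE x in lebesgue. (\<lambda>k. s (r k) x) \<longlonglongrightarrow> f x"
    using AE_fin
  proof eventually_elim
    case (elim x)
    have "summable (\<lambda>k. norm (a k x) powr p)"
      by (rule summable_suminf_not_top) (use elim in auto)
    then have sm: "summable (\<lambda>k. norm (a k x) powr p)" .
    have "\<forall>\<^sub>F k in sequentially. norm (a k x) powr p < 1"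
      by (rule order_tendstoD(2)[OF summable_LIMSEQ_zero[OF sm]]) simp
    then obtain k0 where k0: "\<And>k. k \<ge> k0 \<Longrightarrow> norm (a k x) powr p < 1" by (auto simp: eventually_sequentially)
    have "summable (\<lambda>k. a k x)"
    proof (rule summable_comparison_test'[OF sm])
      fix k assume "k \<ge> k0"
      then have "norm (a k x) \<le> 1"
        using k0[of k] powr_mono2[of p 1 "norm (a k x)"] p by (cases "norm (a k x) \<le> 1") auto
      then show "norm (a k x) \<le> norm (a k x) powr p"
        using powr_mono'[of p 1 "norm (a k x)"] p by (cases "a k x = 0") auto
    qed
    then have "convergent (\<lambda>n. \<Sum>k<n. a k x)" by (simp add: summable_iff_convergent)
    moreover have "(\<Sum>k<n. a k x) = s (r n) x - s (r 0) x" for n by (induction n) (auto simp: a_def)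
    ultimately have "convergent (\<lambda>n. s (r n) x - s (r 0) x)" by simp
    then have "convergent (\<lambda>n. s (r n) x)" by (simp add: convergent_diff_const_right_iff)
    then show ?case unfolding f_def by (simp add: convergent_LIMSEQ_iff)
  qed
  have fat: "ecost p (\<lambda>x. s j x - f x) \<le> ennreal \<epsilon>" if "\<And>k. k \<ge> N0 \<Longrightarrow> ecost p (\<lambda>x. s j x - s k x) \<le> ennreal \<epsilon>" for j \<epsilon> N0
  proof -
    have "ecost p (\<lambda>x. s j x - f x) = (\<integral>\<^sup>+x. liminf (\<lambda>k. ennreal (norm (s j x - s (r k) x) powr p)) \<partial>lebesgue)"
      unfolding ecost_def
    proof (rule nn_integral_cong_AE)
      show "AE x in lebesgue. ennreal (norm (s j x - f x) powr p) = liminf (\<lambda>k. ennreal (norm (s j x - s (r k) x) powr p))"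
        using conv
      proof eventually_elim
        case (elim x)
        have "(\<lambda>k. norm (s j x - s (r k) x) powr p) \<longlonglongrightarrow> norm (s j x - f x) powr p"
          by (rule tendsto_powr2) (use p in \<open>auto intro!: tendsto_intros elim\<close>)
        then have "(\<lambda>k. ennreal (norm (s j x - s (r k) x) powr p)) \<longlonglongrightarrow> ennreal (norm (s j x - f x) powr p)"
          by (rule tendsto_ennrealI)
        then show ?case by (rule lim_imp_Liminf[OF trivial_limit_sequentially, symmetric])
      qed
    qed
    also have "\<dots> \<le> liminf (\<lambda>k. ecost p (\<lambda>x. s j x - s (r k) x))"
      unfolding ecost_def by (rule nn_integral_liminf) measurable
    also have "\<dots> \<le> liminf (\<lambda>k. ennreal \<epsilon>)"
    proof (rule Liminf_mono)
      show "\<forall>\<^sub>F k in sequentially. ecost p (\<lambda>x. s j x - s (r k) x) \<le> ennreal \<epsilon>"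
        unfolding eventually_sequentially using that rk by (intro exI[of _ N0]) (auto intro: order_trans)
    qed
    also have "\<dots> = ennreal \<epsilon>" by (simp add: Liminf_const)
    finally show ?thesis .
  qed
  obtain N1 where N1: "\<And>j k. j \<ge> N1 \<Longrightarrow> k \<ge> N1 \<Longrightarrow> ecost p (\<lambda>x. s j x - s k x) \<le> ennreal 1"
    using ec[of 1] by auto
  have "ecost p (\<lambda>x. s N1 x - f x) \<le> ennreal 1" by (rule fat[of N1]) (rule N1, auto)
  then have "(\<lambda>x. s N1 x - f x) \<in> Lp_fun p"
    using borel_measurable_diff[OF m fm] by (simp add: Lp_fun_iff le_less_trans)
  from Lp_fun_diff[OF p s[of N1] this] have fL: "f \<in> Lp_fun p" by simp
  have "(\<lambda>k. Lp_norm p (\<lambda>x. s k x - f x)) \<longlonglongrightarrow> 0"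
  proof (rule LIMSEQ_I)
    fix \<epsilon> :: real assume e: "0 < \<epsilon>"
    then have "0 < (\<epsilon> / 2) powr p" by simp
    then obtain N2 where N2: "\<And>j k. j \<ge> N2 \<Longrightarrow> k \<ge> N2 \<Longrightarrow> ecost p (\<lambda>x. s j x - s k x) \<le> ennreal ((\<epsilon> / 2) powr p)"
      using ec by blast
    have "norm (Lp_norm p (\<lambda>x. s j x - f x) - 0) < \<epsilon>" if "j \<ge> N2" for j
    proof -
      have "ecost p (\<lambda>x. s j x - f x) \<le> ennreal ((\<epsilon> / 2) powr p)" by (rule fat[of N2]) (rule N2[OF that])
      then have "Lp_norm p (\<lambda>x. s j x - f x) \<le> \<epsilon> / 2"
        using Lp_norm_le_iff[OF p(1) Lp_fun_diff[OF p s fL], of "\<epsilon> / 2" j] e by simp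
      then show ?thesis using e Lp_norm_nonneg[of p "\<lambda>x. s j x - f x"] by simp
    qed
    then show "\<exists>no. \<forall>n\<ge>no. norm (Lp_norm p (\<lambda>x. s n x - f x) - 0) < \<epsilon>" by blast
  qed
  then show ?thesis using fL by blast
qed

section \<open>The quotient space of classes\<close>

lemma equiv_ae_rel: "equiv (Lp_fun p) (ae_rel p)"
proof (rule equivI)
  show "trans (ae_rel p)"
    unfolding trans_def ae_rel_def by (auto elim: eventually_elim2)
qed (auto simp: refl_on_def sym_def ae_rel_def)

lemma rep_in: "A \<noteq> {} \<Longrightarrow> rep A \<in> A"
  unfolding rep_def by (simp add: some_in_eq)

lemma Lp_class_in_car: "f \<in> Lp_fun p \<Longrightarrow> Lp_class p f \<in> car (Lp p)"
  by (simp add: Lp_def Lp_class_def quotientI)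

lemma Lp_class_eq_iff:
  "f \<in> Lp_fun p \<Longrightarrow> g \<in> Lp_fun p \<Longrightarrow> Lp_class p f = Lp_class p g \<longleftrightarrow> (AE x in lebesgue. f x = g x)"
  unfolding Lp_class_def using eq_equiv_class_iff[OF equiv_ae_rel] by (auto simp: ae_rel_def)

lemma rep_Lp_class:
  assumes "f \<in> Lp_fun p"
  shows "rep (Lp_class p f) \<in> Lp_fun p" "AE x in lebesgue. rep (Lp_class p f) x = f x"
proof -
  have "f \<in> Lp_class p f" using assms by (simp add: Lp_class_def ae_rel_def)
  then have "rep (Lp_class p f) \<in> Lp_class p f" by (intro rep_in) auto
  then have *: "rep (Lp_class p f) \<in> Lp_fun p" "AE x in lebesgue. f x = rep (Lp_class p f) x" by (auto simp: Lp_class_def ae_rel_def)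
  show "rep (Lp_class p f) \<in> Lp_fun p" by (rule *)
  show "AE x in lebesgue. rep (Lp_class p f) x = f x" using *(2) by eventually_elim simp
qed

lemma Lp_class_rep:
  assumes "A \<in> car (Lp p)"
  shows "rep A \<in> Lp_fun p" "Lp_class p (rep A) = A"
proof -
  obtain f where f: "f \<in> Lp_fun p" "A = Lp_class p f"
    using assms by (auto simp: Lp_def Lp_class_def elim: quotientE)
  show 1: "rep A \<in> Lp_fun p" unfolding f by (rule rep_Lp_class[OF f(1)])
  show "Lp_class p (rep A) = A"
    using Lp_class_eq_iff[OF 1 f(1)] rep_Lp_class(2)[OF f(1)] f(2) by simp
qed

lemma Lp_add_class:
  assumes "0 < p" "p \<le> 1" "f \<in> Lp_fun p" "g \<in> Lp_fun p"
  shows "add (Lp p) (Lp_class p f) (Lp_class p g) = Lp_class p (\<lambda>x. f x + g x)"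
proof -
  have "AE x in lebesgue. rep (Lp_class p f) x + rep (Lp_class p g) x = f x + g x"
    using rep_Lp_class(2)[OF assms(3)] rep_Lp_class(2)[OF assms(4)] by eventually_elim simp
  then show ?thesis
    using Lp_class_eq_iff[OF Lp_fun_add[OF assms(1,2) rep_Lp_class(1)[OF assms(3)] rep_Lp_class(1)[OF assms(4)]] Lp_fun_add[OF assms]]
    by (simp add: Lp_def)
qed

lemma Lp_smul_class:
  assumes "f \<in> Lp_fun p"
  shows "smul (Lp p) c (Lp_class p f) = Lp_class p (\<lambda>x. c * f x)"
proof -
  have "AE x in lebesgue. c * rep (Lp_class p f) x = c * f x"
    using rep_Lp_class(2)[OF assms] by eventually_elim simp
  then show ?thesis
    using Lp_class_eq_iff[OF Lp_fun_cmult[OF rep_Lp_class(1)[OF assms]] Lp_fun_cmult[OF assms]]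
    by (simp add: Lp_def)
qed

lemma Lp_qnorm_class:
  assumes "f \<in> Lp_fun p"
  shows "qnorm (Lp p) (Lp_class p f) = Lp_norm p f"
  using Lp_norm_cong_AE[OF _ _ rep_Lp_class(2)[OF assms]] rep_Lp_class(1)[OF assms] assms
  by (simp add: Lp_def Lp_fun_iff)

lemma Lp_qdiff_class:
  assumes "0 < p" "p \<le> 1" "f \<in> Lp_fun p" "g \<in> Lp_fun p"
  shows "qdiff (Lp p) (Lp_class p f) (Lp_class p g) = Lp_class p (\<lambda>x. f x - g x)"
  using Lp_add_class[OF assms(1,2,3) Lp_fun_cmult[OF assms(4), of "- 1"]]
  by (simp add: qdiff_def Lp_smul_class[OF assms(4)])

lemma Lp_dist_class:
  assumes "0 < p" "p \<le> 1" "f \<in> Lp_fun p" "g \<in> Lp_fun p"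
  shows "qnorm (Lp p) (qdiff (Lp p) (Lp_class p f) (Lp_class p g)) = Lp_norm p (\<lambda>x. f x - g x)"
  using Lp_qnorm_class[OF Lp_fun_diff[OF assms]] Lp_qdiff_class[OF assms] by simp

section \<open>Completions of quasinormed function spaces\<close>

lemma lipschitz_continuous_map:
  assumes f: "\<And>x. x \<in> car V \<Longrightarrow> f x \<in> car U" and C: "0 \<le> C"
    and lip: "\<And>x y. x \<in> car V \<Longrightarrow> y \<in> car V \<Longrightarrow> qnorm U (qdiff U (f x) (f y)) \<le> C * qnorm V (qdiff V x y)"
  shows "continuous_map (qtop V) (qtop U) f"
  unfolding continuous_map
proof (intro conjI allI impI)
  show "f ` topspace (qtop V) \<subseteq> topspace (qtop U)" using f by auto
next
  fix O' assume O': "openin (qtop U) O'"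
  show "openin (qtop V) {x \<in> topspace (qtop V). f x \<in> O'}"
    unfolding openin_qtop
  proof (intro conjI ballI)
    fix x assume x: "x \<in> {x \<in> topspace (qtop V). f x \<in> O'}"
    then obtain r where r: "r > 0" "{y \<in> car U. qnorm U (qdiff U y (f x)) < r} \<subseteq> O'"
      using O' unfolding openin_qtop by blast
    have "y \<in> {x \<in> topspace (qtop V). f x \<in> O'}" if y: "y \<in> car V" "qnorm V (qdiff V y x) < r / (C + 1)" for y
    proof -
      have "qnorm U (qdiff U (f y) (f x)) \<le> C * qnorm V (qdiff V y x)" using lip y x by simp
      also have "\<dots> \<le> C * (r / (C + 1))" using y C by (intro mult_left_mono) auto
      also have "\<dots> < r" using r C by (simp add: field_simps)
      finally show ?thesis using r f y by auto
    qed
    then show "\<exists>r>0. {y \<in> car V. qnorm V (qdiff V y x) < r} \<subseteq> {x \<in> topspace (qtop V). f x \<in> O'}"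
      using r C by (intro exI[of _ "r / (C + 1)"]) auto
  qed auto
qed

text \<open>The \<open>p\<close>-th power of the distance is a metric, and its balls are the balls
  of the quasinorm with other radii, so the two topologies agree.\<close>

lemma Hausdorff_qtop:
  assumes p: "0 < p"
    and nonneg: "\<And>x y. x \<in> car V \<Longrightarrow> y \<in> car V \<Longrightarrow> 0 \<le> qnorm V (qdiff V x y)"
    and commute: "\<And>x y. x \<in> car V \<Longrightarrow> y \<in> car V \<Longrightarrow> qnorm V (qdiff V x y) = qnorm V (qdiff V y x)"
    and zero: "\<And>x y. x \<in> car V \<Longrightarrow> y \<in> car V \<Longrightarrow> qnorm V (qdiff V x y) = 0 \<longleftrightarrow> x = y"
    and triangle: "\<And>x y z. x \<in> car V \<Longrightarrow> y \<in> car V \<Longrightarrow> z \<in> car V \<Longrightarrow>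
      qnorm V (qdiff V x z) powr p \<le> qnorm V (qdiff V x y) powr p + qnorm V (qdiff V y z) powr p"
  shows "Hausdorff_space (qtop V)"
proof -
  \<comment> \<open>\<open>Metric_space\<close> demands symmetry and nonnegativity also off the
    carrier, hence the value 0 there.\<close>
  define d where "d x y = (if x \<in> car V \<and> y \<in> car V then qnorm V (qdiff V x y) powr p else 0)" for x y
  have M: "Metric_space (car V) d"
  proof
    show "0 \<le> d x y" for x y by (simp add: d_def)
    show "d x y = d y x" for x y unfolding d_def using commute[of x y] by simp
    show "d x y = 0 \<longleftrightarrow> x = y" if "x \<in> car V" "y \<in> car V" for x y
      unfolding d_def using zero[OF that] that by simp
    show "d x z \<le> d x y + d y z" if "x \<in> car V" "y \<in> car V" "z \<in> car V" for x y z
      unfolding d_def using triangle[OF that] that by simp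
  qed
  then interpret D: Metric_space "car V" d .
  have ball: "{y \<in> car V. qnorm V (qdiff V y x) < r} = D.mball x (r powr p)" if "x \<in> car V" "r > 0" for x r
  proof -
    have "qnorm V (qdiff V y x) < r \<longleftrightarrow> d x y < r powr p" if "y \<in> car V" for y
    proof -
      have "qnorm V (qdiff V y x) < r \<longleftrightarrow> qnorm V (qdiff V y x) powr p < r powr p"
      proof
        show "qnorm V (qdiff V y x) powr p < r powr p" if "qnorm V (qdiff V y x) < r"
          by (rule powr_less_mono2[OF p nonneg[OF \<open>y \<in> car V\<close> \<open>x \<in> car V\<close>] that])
        show "qnorm V (qdiff V y x) < r" if "qnorm V (qdiff V y x) powr p < r powr p"
          using powr_mono2[of p r "qnorm V (qdiff V y x)"] p \<open>r > 0\<close> that by linarith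
      qed
      then show ?thesis unfolding d_def commute[OF that \<open>x \<in> car V\<close>] using that \<open>x \<in> car V\<close> by simp
    qed
    then show ?thesis using \<open>x \<in> car V\<close> unfolding D.mball_def by blast
  qed
  have "openin (qtop V) O' \<longleftrightarrow> openin D.mtopology O'" for O'
    unfolding openin_qtop D.openin_mtopology
  proof (intro conj_cong refl)
    assume sub: "O' \<subseteq> car V"
    have "(\<exists>r>0. {y \<in> car V. qnorm V (qdiff V y x) < r} \<subseteq> O') \<longleftrightarrow> (\<exists>r>0. D.mball x r \<subseteq> O')" if "x \<in> O'" for x
    proof
      have xV: "x \<in> car V" using sub that by blast
      assume "\<exists>r>0. {y \<in> car V. qnorm V (qdiff V y x) < r} \<subseteq> O'"
      then obtain r where r: "r > 0" "{y \<in> car V. qnorm V (qdiff V y x) < r} \<subseteq> O'" by blast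
      have "D.mball x (r powr p) \<subseteq> O'" using r(2) unfolding ball[OF xV r(1)] .
      moreover have "r powr p > 0" using r by simp
      ultimately show "\<exists>r>0. D.mball x r \<subseteq> O'" by blast
    next
      have xV: "x \<in> car V" using sub that by blast
      assume "\<exists>r>0. D.mball x r \<subseteq> O'"
      then obtain r where r: "r > 0" "D.mball x r \<subseteq> O'" by blast
      have r': "r powr (1 / p) > 0" using r by simp
      have "(r powr (1 / p)) powr p = r" using r p by (simp add: powr_powr)
      then have "{y \<in> car V. qnorm V (qdiff V y x) < r powr (1 / p)} \<subseteq> O'"
        using r(2) unfolding ball[OF xV r'] by simp
      with r' show "\<exists>r>0. {y \<in> car V. qnorm V (qdiff V y x) < r} \<subseteq> O'" by blast
    qed
    then show "(\<forall>x\<in>O'. \<exists>r>0. {y \<in> car V. qnorm V (qdiff V y x) < r} \<subseteq> O') \<longleftrightarrow>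
      (\<forall>x. x \<in> O' \<longrightarrow> (\<exists>r>0. D.mball x r \<subseteq> O'))" by auto
  qed
  then have "qtop V = D.mtopology" by (simp add: topology_eq)
  then show ?thesis using D.Hausdorff_space_mtopology by simp
qed

lemma powr_tendsto_0_iff:
  fixes a :: "nat \<Rightarrow> real"
  assumes "0 < p" "\<And>k. 0 \<le> a k"
  shows "(\<lambda>k. a k powr p) \<longlonglongrightarrow> 0 \<longleftrightarrow> a \<longlonglongrightarrow> 0"
proof
  assume "(\<lambda>k. a k powr p) \<longlonglongrightarrow> 0"
  then have "(\<lambda>k. (a k powr p) powr (1 / p)) \<longlonglongrightarrow> 0"
    by (rule tendsto_zero_powrI[OF _ tendsto_const]) (use assms in auto)
  then show "a \<longlonglongrightarrow> 0" using assms by (simp add: powr_powr)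
next
  assume "a \<longlonglongrightarrow> 0"
  then show "(\<lambda>k. a k powr p) \<longlonglongrightarrow> 0"
    by (rule tendsto_zero_powrI[OF _ tendsto_const]) (use assms in auto)
qed

lemma tendsto_powr_iff_nonneg:
  fixes a :: "nat \<Rightarrow> real"
  assumes "0 < p" "\<And>k. 0 \<le> a k" "0 \<le> l"
  shows "(\<lambda>k. a k powr p) \<longlonglongrightarrow> l powr p \<longleftrightarrow> a \<longlonglongrightarrow> l"
proof
  assume "(\<lambda>k. a k powr p) \<longlonglongrightarrow> l powr p"
  then have "(\<lambda>k. (a k powr p) powr (1 / p)) \<longlonglongrightarrow> (l powr p) powr (1 / p)"
    by (rule tendsto_powr2[OF _ tendsto_const]) (use assms in auto)
  then show "a \<longlonglongrightarrow> l" using assms by (simp add: powr_powr)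
next
  assume "a \<longlonglongrightarrow> l"
  then show "(\<lambda>k. a k powr p) \<longlonglongrightarrow> l powr p"
    by (rule tendsto_powr2[OF _ tendsto_const]) (use assms in auto)
qed

lemma powr_subadditive_tendsto_0:
  fixes a b c :: "nat \<Rightarrow> real"
  assumes p: "0 < p" and nn: "\<And>k. 0 \<le> a k" "\<And>k. 0 \<le> b k" "\<And>k. 0 \<le> c k"
    and le: "\<And>k. c k powr p \<le> a k powr p + b k powr p" and a: "a \<longlonglongrightarrow> 0" and b: "b \<longlonglongrightarrow> 0"
  shows "c \<longlonglongrightarrow> 0"
proof -
  have "(\<lambda>k. a k powr p + b k powr p) \<longlonglongrightarrow> 0 + 0"
    by (rule tendsto_add[OF iffD2[OF powr_tendsto_0_iff[OF p nn(1)] a] iffD2[OF powr_tendsto_0_iff[OF p nn(2)] b]])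
  then have "(\<lambda>k. a k powr p + b k powr p) \<longlonglongrightarrow> 0" by simp
  then have "(\<lambda>k. c k powr p) \<longlonglongrightarrow> 0"
    by (rule tendsto_sandwich[OF always_eventually always_eventually tendsto_const, rotated 2]) (use le in auto)
  then show ?thesis by (rule iffD1[OF powr_tendsto_0_iff[OF p nn(3)]])
qed

text \<open>Covers the test classes as well as \<open>L^p\<close> before the passage to classes:
  \<open>qnorm\<close> may vanish on nonzero functions. Pointwise operations provide the vector
  space laws.\<close>

locale p_normed_functions =
  fixes V :: "('b \<Rightarrow> complex) qspace" and p :: real
  assumes p: "0 < p" "p \<le> 1"
    and add_V: "add V = (\<lambda>f g x. f x + g x)" and smul_V: "smul V = (\<lambda>c f x. c * f x)"
    and zero_closed: "(\<lambda>x. 0) \<in> car V"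
    and add_closed: "f \<in> car V \<Longrightarrow> g \<in> car V \<Longrightarrow> (\<lambda>x. f x + g x) \<in> car V"
    and smul_closed: "f \<in> car V \<Longrightarrow> (\<lambda>x. c * f x) \<in> car V"
    and nonneg: "f \<in> car V \<Longrightarrow> 0 \<le> qnorm V f"
    and homogeneous: "f \<in> car V \<Longrightarrow> qnorm V (\<lambda>x. c * f x) = norm c * qnorm V f"
    and subadditive: "f \<in> car V \<Longrightarrow> g \<in> car V \<Longrightarrow>
      qnorm V (\<lambda>x. f x + g x) powr p \<le> qnorm V f powr p + qnorm V g powr p"
begin

lemma diff_closed: "f \<in> car V \<Longrightarrow> g \<in> car V \<Longrightarrow> (\<lambda>x. f x - g x) \<in> car V"
  using add_closed[of f "\<lambda>x. - 1 * g x"] smul_closed[of g "- 1"] by simp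

lemma qdiff_V: "qdiff V f g = (\<lambda>x. f x - g x)"
  by (simp add: qdiff_def add_V smul_V)

abbreviation dist_V :: "('b \<Rightarrow> complex) \<Rightarrow> ('b \<Rightarrow> complex) \<Rightarrow> real" where
  "dist_V f g \<equiv> qnorm V (\<lambda>x. f x - g x)"

lemma dist_nonneg: "f \<in> car V \<Longrightarrow> g \<in> car V \<Longrightarrow> 0 \<le> dist_V f g"
  by (rule nonneg[OF diff_closed])

lemma dist_commute: "f \<in> car V \<Longrightarrow> g \<in> car V \<Longrightarrow> dist_V f g = dist_V g f"
  using homogeneous[OF diff_closed[of g f], of "- 1"] by simp

lemma qnorm_zero [simp]: "qnorm V (\<lambda>x. 0) = 0"
  using homogeneous[OF zero_closed, of 0] by simp

lemma dist_triangle: "f \<in> car V \<Longrightarrow> g \<in> car V \<Longrightarrow> h \<in> car V \<Longrightarrow>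
    dist_V f h powr p \<le> dist_V f g powr p + dist_V g h powr p"
  using subadditive[OF diff_closed[of f g] diff_closed[of g h]] by simp

lemma dist_add: "f \<in> car V \<Longrightarrow> f' \<in> car V \<Longrightarrow> g \<in> car V \<Longrightarrow> g' \<in> car V \<Longrightarrow>
    dist_V (\<lambda>x. f x + g x) (\<lambda>x. f' x + g' x) powr p \<le> dist_V f f' powr p + dist_V g g' powr p"
  using subadditive[OF diff_closed[of f f'] diff_closed[of g g']] by (simp add: algebra_simps)

lemma dist_cmult: "f \<in> car V \<Longrightarrow> g \<in> car V \<Longrightarrow>
    dist_V (\<lambda>x. c * f x) (\<lambda>x. c * g x) = norm c * dist_V f g"
  using homogeneous[OF diff_closed[of f g], of c] by (simp add: algebra_simps)

lemma norm_diff_le: "f \<in> car V \<Longrightarrow> g \<in> car V \<Longrightarrow> \<bar>qnorm V f powr p - qnorm V g powr p\<bar> \<le> dist_V f g powr p"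
  using subadditive[OF diff_closed[of f g], of g] subadditive[OF diff_closed[of g f], of f] dist_commute[of f g]
  by (simp add: abs_le_iff)

lemma cauchy_car: "s \<in> cauchy_seqs V \<Longrightarrow> s k \<in> car V"
  by (simp add: cauchy_seqs_def)

lemma cauchy_seqs_powr: "s \<in> cauchy_seqs V \<longleftrightarrow> (\<forall>k. s k \<in> car V) \<and>
    (\<forall>\<epsilon>>0. \<exists>N. \<forall>j\<ge>N. \<forall>k\<ge>N. dist_V (s j) (s k) powr p < \<epsilon>)"
proof (cases "\<forall>k. s k \<in> car V")
  case True
  then have nn: "0 \<le> dist_V (s j) (s k)" for j k by (simp add: dist_nonneg)
  have lt: "dist_V (s j) (s k) powr p < \<epsilon> powr p \<longleftrightarrow> dist_V (s j) (s k) < \<epsilon>" if "\<epsilon> > 0" for j k \<epsilon>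
    using powr_less_mono2[OF p(1) nn, of j k \<epsilon>] powr_mono2[of p \<epsilon> "dist_V (s j) (s k)"] p that
    by linarith
  have "(\<forall>\<epsilon>>0. \<exists>N. \<forall>j\<ge>N. \<forall>k\<ge>N. dist_V (s j) (s k) < \<epsilon>) \<longleftrightarrow>
    (\<forall>\<epsilon>>0. \<exists>N. \<forall>j\<ge>N. \<forall>k\<ge>N. dist_V (s j) (s k) powr p < \<epsilon>)"
  proof (intro iffI allI impI)
    fix \<epsilon> :: real
    assume a: "\<forall>\<epsilon>>0. \<exists>N. \<forall>j\<ge>N. \<forall>k\<ge>N. dist_V (s j) (s k) < \<epsilon>" and e: "\<epsilon> > 0"
    have e': "\<epsilon> powr (1 / p) > 0" "(\<epsilon> powr (1 / p)) powr p = \<epsilon>" using e p by (simp_all add: powr_powr)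
    obtain N where "\<forall>j\<ge>N. \<forall>k\<ge>N. dist_V (s j) (s k) < \<epsilon> powr (1 / p)" using a e'(1) by blast
    then show "\<exists>N. \<forall>j\<ge>N. \<forall>k\<ge>N. dist_V (s j) (s k) powr p < \<epsilon>"
      using lt[OF e'(1)] unfolding e'(2) by blast
  next
    fix \<epsilon> :: real
    assume a: "\<forall>\<epsilon>>0. \<exists>N. \<forall>j\<ge>N. \<forall>k\<ge>N. dist_V (s j) (s k) powr p < \<epsilon>" and e: "\<epsilon> > 0"
    then have "\<epsilon> powr p > 0" by simp
    with a obtain N where "\<forall>j\<ge>N. \<forall>k\<ge>N. dist_V (s j) (s k) powr p < \<epsilon> powr p" by blast
    then show "\<exists>N. \<forall>j\<ge>N. \<forall>k\<ge>N. dist_V (s j) (s k) < \<epsilon>" using lt[OF e] by blast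
  qed
  then show ?thesis using True unfolding cauchy_seqs_def qdiff_V by simp
qed (unfold cauchy_seqs_def, blast)

lemma cauchy_const: "f \<in> car V \<Longrightarrow> (\<lambda>_. f) \<in> cauchy_seqs V"
  by (simp add: cauchy_seqs_def qdiff_V)

lemma cauchy_add:
  assumes "s \<in> cauchy_seqs V" "t \<in> cauchy_seqs V"
  shows "(\<lambda>k x. s k x + t k x) \<in> cauchy_seqs V"
  unfolding cauchy_seqs_powr
proof (intro conjI allI impI)
  show "(\<lambda>x. s k x + t k x) \<in> car V" for k using assms by (simp add: cauchy_car add_closed)
  fix \<epsilon> :: real assume "\<epsilon> > 0"
  then have e2: "\<epsilon> / 2 > 0" by simp
  obtain N where N: "\<And>j k. j \<ge> N \<Longrightarrow> k \<ge> N \<Longrightarrow> dist_V (s j) (s k) powr p < \<epsilon> / 2"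
    using assms(1) e2 unfolding cauchy_seqs_powr by blast
  obtain N' where N': "\<And>j k. j \<ge> N' \<Longrightarrow> k \<ge> N' \<Longrightarrow> dist_V (t j) (t k) powr p < \<epsilon> / 2"
    using assms(2) e2 unfolding cauchy_seqs_powr by blast
  have "dist_V (\<lambda>x. s j x + t j x) (\<lambda>x. s k x + t k x) powr p < \<epsilon>" if "j \<ge> max N N'" "k \<ge> max N N'" for j k
    using dist_add[OF cauchy_car[OF assms(1), of j] cauchy_car[OF assms(1), of k] cauchy_car[OF assms(2), of j] cauchy_car[OF assms(2), of k]]
      N[of j k] N'[of j k] that by simp
  then show "\<exists>N. \<forall>j\<ge>N. \<forall>k\<ge>N. dist_V (\<lambda>x. s j x + t j x) (\<lambda>x. s k x + t k x) powr p < \<epsilon>" by blast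
qed

lemma cauchy_cmult:
  assumes s: "s \<in> cauchy_seqs V"
  shows "(\<lambda>k x. c * s k x) \<in> cauchy_seqs V"
proof -
  have "\<exists>N. \<forall>j\<ge>N. \<forall>k\<ge>N. dist_V (\<lambda>x. c * s j x) (\<lambda>x. c * s k x) < \<epsilon>" if e: "\<epsilon> > 0" for \<epsilon>
  proof -
    have "\<epsilon> / (norm c + 1) > 0" using e by (simp add: add_nonneg_pos)
    then obtain N where N: "\<And>j k. j \<ge> N \<Longrightarrow> k \<ge> N \<Longrightarrow> dist_V (s j) (s k) < \<epsilon> / (norm c + 1)"
      using s unfolding cauchy_seqs_def qdiff_V by blast
    have "dist_V (\<lambda>x. c * s j x) (\<lambda>x. c * s k x) < \<epsilon>" if "j \<ge> N" "k \<ge> N" for j k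
    proof -
      have "norm c * dist_V (s j) (s k) \<le> (norm c + 1) * dist_V (s j) (s k)"
        using dist_nonneg cauchy_car[OF s] by (intro mult_right_mono) auto
      also have "\<dots> < (norm c + 1) * (\<epsilon> / (norm c + 1))"
        using N[OF that] by (intro mult_strict_left_mono) (auto simp: add_nonneg_pos)
      also have "\<dots> = \<epsilon>"
      proof -
        have "norm c + 1 \<noteq> 0" using norm_ge_zero[of c] by linarith
        then show ?thesis by simp
      qed
      finally show ?thesis using dist_cmult cauchy_car[OF s] by simp
    qed
    then show ?thesis by blast
  qed
  then show ?thesis using s by (simp add: cauchy_seqs_def qdiff_V smul_closed)
qed

lemma cauchy_diff:
  assumes "s \<in> cauchy_seqs V" "t \<in> cauchy_seqs V"
  shows "(\<lambda>k x. s k x - t k x) \<in> cauchy_seqs V"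
  using cauchy_add[OF assms(1) cauchy_cmult[OF assms(2), of "- 1"]] by simp

lemma null_rel_iff: "(s, t) \<in> null_rel V \<longleftrightarrow> s \<in> cauchy_seqs V \<and> t \<in> cauchy_seqs V \<and> (\<lambda>k. dist_V (s k) (t k)) \<longlonglongrightarrow> 0"
  by (simp add: null_rel_def qdiff_V)

lemma null_trans:
  assumes "s \<in> cauchy_seqs V" "t \<in> cauchy_seqs V" "u \<in> cauchy_seqs V"
    and "(\<lambda>k. dist_V (s k) (t k)) \<longlonglongrightarrow> 0" "(\<lambda>k. dist_V (t k) (u k)) \<longlonglongrightarrow> 0"
  shows "(\<lambda>k. dist_V (s k) (u k)) \<longlonglongrightarrow> 0"
proof -
  note c = cauchy_car[OF assms(1)] cauchy_car[OF assms(2)] cauchy_car[OF assms(3)]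
  show ?thesis
    by (rule powr_subadditive_tendsto_0[OF p(1) dist_nonneg[OF c(1,2)] dist_nonneg[OF c(2,3)] dist_nonneg[OF c(1,3)]
      dist_triangle[OF c] assms(4,5)])
qed

section \<open>Points of the completion as classes of Cauchy sequences\<close>

lemma equiv_null_rel: "equiv (cauchy_seqs V) (null_rel V)"
proof (rule equivI)
  show "trans (null_rel V)" unfolding trans_def null_rel_iff using null_trans by blast
  show "sym (null_rel V)"
  proof (rule symI)
    fix s t assume st: "(s, t) \<in> null_rel V"
    then have "dist_V (t k) (s k) = dist_V (s k) (t k)" for k
      by (intro dist_commute) (auto simp: null_rel_iff cauchy_car)
    then show "(t, s) \<in> null_rel V" using st by (simp add: null_rel_iff)
  qed
qed (auto simp: refl_on_def null_rel_iff cauchy_car)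

text \<open>Names a point of the completion by any Cauchy sequence; the lemmas that follow replace
  the arbitrary choice made by \<open>rep\<close>.\<close>

definition limit_class :: "(nat \<Rightarrow> 'b \<Rightarrow> complex) \<Rightarrow> (nat \<Rightarrow> 'b \<Rightarrow> complex) set" where
  "limit_class s = null_rel V `` {s}"

lemma qembed_eq: "qembed V f = limit_class (\<lambda>_. f)"
  by (simp add: qembed_def limit_class_def)

lemma limit_class_in_car: "s \<in> cauchy_seqs V \<Longrightarrow> limit_class s \<in> car (qcompletion V)"
  by (simp add: qcompletion_def limit_class_def quotientI)

lemma limit_class_cases:
  assumes "A \<in> car (qcompletion V)"
  obtains s where "s \<in> cauchy_seqs V" "A = limit_class s"
  using assms by (auto simp: qcompletion_def limit_class_def elim: quotientE)

lemma limit_class_eq_iff: "s \<in> cauchy_seqs V \<Longrightarrow> t \<in> cauchy_seqs V \<Longrightarrow>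
    limit_class s = limit_class t \<longleftrightarrow> (\<lambda>k. dist_V (s k) (t k)) \<longlonglongrightarrow> 0"
  unfolding limit_class_def using eq_equiv_class_iff[OF equiv_null_rel] by (auto simp: null_rel_iff)

lemma rep_limit_class:
  assumes "s \<in> cauchy_seqs V"
  shows "rep (limit_class s) \<in> cauchy_seqs V" "(\<lambda>k. dist_V (rep (limit_class s) k) (s k)) \<longlonglongrightarrow> 0"
proof -
  have "s \<in> limit_class s" using assms by (simp add: limit_class_def null_rel_iff cauchy_car)
  then have "rep (limit_class s) \<in> limit_class s" by (intro rep_in) auto
  then have "(s, rep (limit_class s)) \<in> null_rel V" by (simp add: limit_class_def)
  then have "(rep (limit_class s), s) \<in> null_rel V" using equiv_null_rel by (meson equivE symE)
  then show "rep (limit_class s) \<in> cauchy_seqs V" "(\<lambda>k. dist_V (rep (limit_class s) k) (s k)) \<longlonglongrightarrow> 0"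
    by (auto simp: null_rel_iff)
qed

lemma add_limit_class:
  assumes s: "s \<in> cauchy_seqs V" and t: "t \<in> cauchy_seqs V"
  shows "add (qcompletion V) (limit_class s) (limit_class t) = limit_class (\<lambda>k x. s k x + t k x)"
proof -
  let ?s = "rep (limit_class s)" and ?t = "rep (limit_class t)"
  note r = rep_limit_class[OF s] rep_limit_class[OF t]
  note c = cauchy_car[OF r(1)] cauchy_car[OF s] cauchy_car[OF r(3)] cauchy_car[OF t]
  have "(\<lambda>k. dist_V (\<lambda>x. ?s k x + ?t k x) (\<lambda>x. s k x + t k x)) \<longlonglongrightarrow> 0"
    by (rule powr_subadditive_tendsto_0[OF p(1) dist_nonneg[OF c(1,2)] dist_nonneg[OF c(3,4)]
      dist_nonneg[OF add_closed[OF c(1,3)] add_closed[OF c(2,4)]] dist_add[OF c] r(2,4)])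
  then have "limit_class (\<lambda>k x. ?s k x + ?t k x) = limit_class (\<lambda>k x. s k x + t k x)"
    using limit_class_eq_iff[OF cauchy_add[OF r(1,3)] cauchy_add[OF s t]] by simp
  then show ?thesis by (simp add: qcompletion_def add_V limit_class_def)
qed

lemma smul_limit_class:
  assumes s: "s \<in> cauchy_seqs V"
  shows "smul (qcompletion V) c (limit_class s) = limit_class (\<lambda>k x. c * s k x)"
proof -
  let ?s = "rep (limit_class s)"
  note r = rep_limit_class[OF s]
  have "(\<lambda>k. norm c * dist_V (?s k) (s k)) \<longlonglongrightarrow> norm c * 0" by (intro tendsto_mult tendsto_const r)
  then have "(\<lambda>k. dist_V (\<lambda>x. c * ?s k x) (\<lambda>x. c * s k x)) \<longlonglongrightarrow> 0"
    using dist_cmult cauchy_car[OF r(1)] cauchy_car[OF s] by simp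
  then have "limit_class (\<lambda>k x. c * ?s k x) = limit_class (\<lambda>k x. c * s k x)"
    using limit_class_eq_iff[OF cauchy_cmult[OF r(1)] cauchy_cmult[OF s]] by simp
  then show ?thesis by (simp add: qcompletion_def smul_V limit_class_def)
qed

lemma norm_convergent:
  assumes s: "s \<in> cauchy_seqs V"
  obtains l where "0 \<le> l" "(\<lambda>k. qnorm V (s k)) \<longlonglongrightarrow> l"
proof -
  have "Cauchy (\<lambda>k. qnorm V (s k) powr p)"
  proof (rule metric_CauchyI)
    fix e :: real assume "e > 0"
    then obtain N where N: "\<And>j k. j \<ge> N \<Longrightarrow> k \<ge> N \<Longrightarrow> dist_V (s j) (s k) powr p < e"
      using s unfolding cauchy_seqs_powr by blast
    have "dist (qnorm V (s j) powr p) (qnorm V (s k) powr p) < e" if "j \<ge> N" "k \<ge> N" for j k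
      using norm_diff_le[OF cauchy_car[OF s, of j] cauchy_car[OF s, of k]] N[OF that] by (simp add: dist_real_def)
    then show "\<exists>M. \<forall>m\<ge>M. \<forall>n\<ge>M. dist (qnorm V (s m) powr p) (qnorm V (s n) powr p) < e" by blast
  qed
  then obtain l where l: "(\<lambda>k. qnorm V (s k) powr p) \<longlonglongrightarrow> l" using Cauchy_convergent convergentD by blast
  have l0: "0 \<le> l" by (rule LIMSEQ_le_const[OF l]) auto
  have "(\<lambda>k. qnorm V (s k) powr p) \<longlonglongrightarrow> (l powr (1 / p)) powr p" using l l0 p by (simp add: powr_powr)
  then have "(\<lambda>k. qnorm V (s k)) \<longlonglongrightarrow> l powr (1 / p)"
    by (rule iffD1[OF tendsto_powr_iff_nonneg[OF p(1) nonneg[OF cauchy_car[OF s]]], rotated]) simp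
  then show ?thesis by (rule that[rotated]) simp
qed

lemma qnorm_limit_class:
  assumes s: "s \<in> cauchy_seqs V"
  shows "(\<lambda>k. qnorm V (s k)) \<longlonglongrightarrow> qnorm (qcompletion V) (limit_class s)"
proof -
  let ?s = "rep (limit_class s)"
  note r = rep_limit_class[OF s]
  obtain l where l: "0 \<le> l" "(\<lambda>k. qnorm V (s k)) \<longlonglongrightarrow> l" using norm_convergent[OF s] .
  note c = cauchy_car[OF r(1)] cauchy_car[OF s]
  have lp: "(\<lambda>k. qnorm V (s k) powr p) \<longlonglongrightarrow> l powr p"
    by (rule iffD2[OF tendsto_powr_iff_nonneg[OF p(1) nonneg[OF c(2)] l(1)] l(2)])
  have "(\<lambda>k. dist_V (?s k) (s k) powr p) \<longlonglongrightarrow> 0"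
    by (rule iffD2[OF powr_tendsto_0_iff[OF p(1) dist_nonneg[OF c]] r(2)])
  then have "(\<lambda>k. qnorm V (?s k) powr p - qnorm V (s k) powr p) \<longlonglongrightarrow> 0"
    by (rule Lim_null_comparison[rotated]) (simp add: norm_diff_le[OF c])
  from tendsto_add[OF this lp] have "(\<lambda>k. qnorm V (?s k) powr p) \<longlonglongrightarrow> l powr p" by simp
  then have "(\<lambda>k. qnorm V (?s k)) \<longlonglongrightarrow> l"
    by (rule iffD1[OF tendsto_powr_iff_nonneg[OF p(1) nonneg[OF c(1)] l(1)]])
  then have "qnorm (qcompletion V) (limit_class s) = l" by (simp add: qcompletion_def limI)
  then show ?thesis using l by simp
qed

lemma qdiff_limit_class:
  assumes s: "s \<in> cauchy_seqs V" and t: "t \<in> cauchy_seqs V"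
  shows "qdiff (qcompletion V) (limit_class s) (limit_class t) = limit_class (\<lambda>k x. s k x - t k x)"
  unfolding qdiff_def using add_limit_class[OF s cauchy_cmult[OF t, of "- 1"]] by (simp add: smul_limit_class[OF t])

lemma dist_limit_class:
  assumes s: "s \<in> cauchy_seqs V" and t: "t \<in> cauchy_seqs V"
  shows "(\<lambda>k. dist_V (s k) (t k)) \<longlonglongrightarrow> qnorm (qcompletion V) (qdiff (qcompletion V) (limit_class s) (limit_class t))"
  using qnorm_limit_class[OF cauchy_diff[OF s t]] qdiff_limit_class[OF s t] by simp

lemma completion_nonneg: "A \<in> car (qcompletion V) \<Longrightarrow> B \<in> car (qcompletion V) \<Longrightarrow>
    0 \<le> qnorm (qcompletion V) (qdiff (qcompletion V) A B)"
proof (elim limit_class_cases)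
  fix s t assume st: "s \<in> cauchy_seqs V" "A = limit_class s" "t \<in> cauchy_seqs V" "B = limit_class t"
  show "0 \<le> qnorm (qcompletion V) (qdiff (qcompletion V) A B)" unfolding st(2,4)
    by (rule LIMSEQ_le_const[OF dist_limit_class[OF st(1,3)]]) (use dist_nonneg cauchy_car st in blast)
qed

lemma Hausdorff_completion: "Hausdorff_space (qtop (qcompletion V))"
proof (rule Hausdorff_qtop[OF p(1) completion_nonneg])
  let ?W = "qcompletion V"
  fix A B assume AB: "A \<in> car ?W" "B \<in> car ?W"
  obtain s where s: "s \<in> cauchy_seqs V" "A = limit_class s" using AB(1) by (rule limit_class_cases)
  obtain t where t: "t \<in> cauchy_seqs V" "B = limit_class t" using AB(2) by (rule limit_class_cases)
  note dst = dist_limit_class[OF s(1) t(1)]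
  have "(\<lambda>k. dist_V (t k) (s k)) = (\<lambda>k. dist_V (s k) (t k))"
    using dist_commute[OF cauchy_car[OF t(1)] cauchy_car[OF s(1)]] by (rule ext)
  with dist_limit_class[OF t(1) s(1)]
  show "qnorm ?W (qdiff ?W A B) = qnorm ?W (qdiff ?W B A)"
    unfolding s(2) t(2) by (intro LIMSEQ_unique[OF dst]) simp
  show "qnorm ?W (qdiff ?W A B) = 0 \<longleftrightarrow> A = B"
    unfolding s(2) t(2) limit_class_eq_iff[OF s(1) t(1)] using dst LIMSEQ_unique[OF dst, of 0] by auto
  fix C assume C: "C \<in> car ?W"
  obtain u where u: "u \<in> cauchy_seqs V" "C = limit_class u" using C by (rule limit_class_cases)
  have lim: "(\<lambda>k. dist_V (v k) (w k) powr p) \<longlonglongrightarrow> qnorm ?W (qdiff ?W (limit_class v) (limit_class w)) powr p"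
    if "v \<in> cauchy_seqs V" "w \<in> cauchy_seqs V" for v w
    by (rule iffD2[OF tendsto_powr_iff_nonneg[OF p(1) dist_nonneg[OF cauchy_car[OF that(1)] cauchy_car[OF that(2)]]
        completion_nonneg[OF limit_class_in_car limit_class_in_car, OF that]] dist_limit_class[OF that]])
  show "qnorm ?W (qdiff ?W A C) powr p \<le> qnorm ?W (qdiff ?W A B) powr p + qnorm ?W (qdiff ?W B C) powr p"
    unfolding s(2) t(2) u(2)
    by (rule LIMSEQ_le[OF lim[OF s(1) u(1)] tendsto_add[OF lim[OF s(1) t(1)] lim[OF t(1) u(1)]]])
      (intro exI allI impI dist_triangle cauchy_car s t u)
qed

lemma qembed_limit:
  assumes s: "s \<in> cauchy_seqs V"
  shows "limitin (qtop (qcompletion V)) (\<lambda>k. qembed V (s k)) (limit_class s) sequentially"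
  unfolding limitin_def
proof (intro conjI allI impI)
  let ?W = "qcompletion V"
  show "limit_class s \<in> topspace (qtop ?W)" using limit_class_in_car[OF s] by simp
  fix O' assume "openin (qtop ?W) O' \<and> limit_class s \<in> O'"
  then obtain r where r: "r > 0" "{B \<in> car ?W. qnorm ?W (qdiff ?W B (limit_class s)) < r} \<subseteq> O'"
    unfolding openin_qtop by blast
  have "r / 2 > 0" using r by simp
  then obtain N where N: "\<And>j k. j \<ge> N \<Longrightarrow> k \<ge> N \<Longrightarrow> dist_V (s j) (s k) < r / 2"
    using s unfolding cauchy_seqs_def qdiff_V by blast
  have "qembed V (s j) \<in> O'" if "j \<ge> N" for j
  proof -
    have c: "(\<lambda>_. s j) \<in> cauchy_seqs V" by (rule cauchy_const[OF cauchy_car[OF s]])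
    have "qnorm ?W (qdiff ?W (qembed V (s j)) (limit_class s)) \<le> r / 2"
      unfolding qembed_eq using dist_limit_class[OF c s]
      by (rule LIMSEQ_le_const2) (use N that in \<open>auto intro!: exI[of _ N] less_imp_le\<close>)
    then show ?thesis using r limit_class_in_car[OF c] by (auto simp: qembed_eq)
  qed
  then show "\<forall>\<^sub>F k in sequentially. qembed V (s k) \<in> O'" by (auto simp: eventually_sequentially)
qed

text \<open>Evaluates the definite description. A Lipschitz map with the right values on embedded
  points is a continuous extension; any other one agrees with it, since by
  \<open>qembed_limit\<close> the embedded points are dense and limits in \<open>U\<close> are
  unique.\<close>

lemma cont_extension_eq:
  assumes U: "Hausdorff_space (qtop U)" and F: "\<And>A. A \<in> car (qcompletion V) \<Longrightarrow> F A \<in> car U" and C: "0 \<le> C"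
    and lip: "\<And>A B. A \<in> car (qcompletion V) \<Longrightarrow> B \<in> car (qcompletion V) \<Longrightarrow>
      qnorm U (qdiff U (F A) (F B)) \<le> C * qnorm (qcompletion V) (qdiff (qcompletion V) A B)"
    and ext: "\<And>x. x \<in> car V \<Longrightarrow> F (qembed V x) = T x"
    and A: "A \<in> car (qcompletion V)"
  shows "cont_extension V U T A = F A"
proof -
  let ?W = "qcompletion V"
  let ?F = "restrict F (car ?W)"
  have cont: "continuous_map (qtop ?W) (qtop U) ?F"
    by (rule lipschitz_continuous_map[OF _ C]) (use F lip in auto)
  have emb: "qembed V x \<in> car ?W" if "x \<in> car V" for x
    unfolding qembed_eq by (rule limit_class_in_car[OF cauchy_const[OF that]])
  have "cont_extension V U T = ?F"
    unfolding cont_extension_def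
  proof (rule the_equality)
    show "?F \<in> extensional (car ?W) \<and> continuous_map (qtop ?W) (qtop U) ?F \<and> (\<forall>x\<in>car V. ?F (qembed V x) = T x)"
      using cont ext emb by simp
  next
    fix F' assume F': "F' \<in> extensional (car ?W) \<and> continuous_map (qtop ?W) (qtop U) F' \<and> (\<forall>x\<in>car V. F' (qembed V x) = T x)"
    show "F' = ?F"
    proof (rule extensionalityI[of _ "car ?W"])
      fix B assume "B \<in> car ?W"
      then obtain s where s: "s \<in> cauchy_seqs V" "B = limit_class s" using limit_class_cases by blast
      have "limitin (qtop U) (F' \<circ> (\<lambda>k. qembed V (s k))) (F' B) sequentially"
        "limitin (qtop U) (?F \<circ> (\<lambda>k. qembed V (s k))) (?F B) sequentially"
        unfolding s(2) using F' by (blast intro: continuous_map_limit[OF _ qembed_limit[OF s(1)]] cont)+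
      moreover have "F' \<circ> (\<lambda>k. qembed V (s k)) = ?F \<circ> (\<lambda>k. qembed V (s k))"
        using F' ext emb cauchy_car[OF s(1)] by (auto simp: fun_eq_iff)
      ultimately show "F' B = ?F B" using limitin_Hausdorff_unique[OF _ _ _ U] by fastforce
    qed (use F' in auto)
  qed
  then show ?thesis using A by simp
qed

end

section \<open>The test classes\<close>

text \<open>The growth condition of the test class freed from logarithms and extended reals; see
  \<open>limsup_eln_le_iff\<close>.\<close>

definition tame :: "real \<Rightarrow> real \<Rightarrow> (nat \<Rightarrow> real \<Rightarrow> complex) \<Rightarrow> bool" where
  "tame q \<theta> H \<longleftrightarrow> (\<forall>e>0. \<forall>\<^sub>F n in sequentially. \<forall>x. norm (H n x) \<le> exp ((\<theta> + e) / q ^ n))"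

lemma tame_add:
  assumes q: "0 < q" "q < 1" and \<theta>: "0 \<le> \<theta>" and F: "tame q \<theta> F" and G: "tame q \<theta> G"
  shows "tame q \<theta> (\<lambda>n x. F n x + G n x)"
  unfolding tame_def
proof (intro allI impI)
  fix e :: real assume e: "e > 0"
  then have e2: "e / 2 > 0" by simp
  have "\<forall>\<^sub>F n in sequentially. \<forall>x. norm (F n x) \<le> exp ((\<theta> + e / 2) / q ^ n)"
    "\<forall>\<^sub>F n in sequentially. \<forall>x. norm (G n x) \<le> exp ((\<theta> + e / 2) / q ^ n)"
    "\<forall>\<^sub>F n in sequentially. 1 * 2 ^ Suc n \<le> exp ((e / 2) / q ^ n)"
    using F G e2 eventually_const_pow2_le[OF q e2] unfolding tame_def by blast+
  then show "\<forall>\<^sub>F n in sequentially. \<forall>x. norm (F n x + G n x) \<le> exp ((\<theta> + e) / q ^ n)"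
  proof eventually_elim
    case (elim n)
    show ?case
    proof
      fix x
      have "norm (F n x + G n x) \<le> 2 * exp ((\<theta> + e / 2) / q ^ n)"
        using norm_triangle_ineq[of "F n x" "G n x"] spec[OF elim(1), of x] spec[OF elim(2), of x] by linarith
      also have "\<dots> \<le> exp ((e / 2) / q ^ n) * exp ((\<theta> + e / 2) / q ^ n)"
      proof (rule mult_right_mono)
        have "(1::real) \<le> 2 ^ n" by simp
        then show "2 \<le> exp ((e / 2) / q ^ n)" using elim(3) unfolding power_Suc by linarith
      qed simp
      also have "\<dots> = exp ((\<theta> + e) / q ^ n)" using q by (simp add: exp_add[symmetric] field_simps)
      finally show "norm (F n x + G n x) \<le> exp ((\<theta> + e) / q ^ n)" .
    qed
  qed
qed

lemma tame_cmult:
  assumes q: "0 < q" "q < 1" and F: "tame q \<theta> F"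
  shows "tame q \<theta> (\<lambda>n x. c * F n x)"
  unfolding tame_def
proof (intro allI impI)
  fix e :: real assume e: "e > 0"
  then have e2: "e / 2 > 0" by simp
  have "\<forall>\<^sub>F n in sequentially. \<forall>x. norm (F n x) \<le> exp ((\<theta> + e / 2) / q ^ n)"
    "\<forall>\<^sub>F n in sequentially. norm c * 2 ^ Suc n \<le> exp ((e / 2) / q ^ n)"
    using F e2 eventually_const_pow2_le[OF q e2] unfolding tame_def by blast+
  then show "\<forall>\<^sub>F n in sequentially. \<forall>x. norm (c * F n x) \<le> exp ((\<theta> + e) / q ^ n)"
  proof eventually_elim
    case (elim n)
    show ?case
    proof
      fix x
      have "norm c \<le> norm c * 2 ^ Suc n" using mult_left_mono[OF one_le_power[of "2::real" "Suc n"], of "norm c"] by simp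
      then have "norm (c * F n x) \<le> exp ((e / 2) / q ^ n) * exp ((\<theta> + e / 2) / q ^ n)"
        unfolding norm_mult using elim by (intro mult_mono) auto
      also have "\<dots> = exp ((\<theta> + e) / q ^ n)" using q by (simp add: exp_add[symmetric] field_simps)
      finally show "norm (c * F n x) \<le> exp ((\<theta> + e) / q ^ n)" .
    qed
  qed
qed

text \<open>One derivative replaces \<open>1 / q ^ n\<close> by \<open>1 / q ^ Suc n\<close>, which
  is the origin of \<open>\<theta> / (1 - p)\<close>; the arbitrary \<open>e\<close> is merely
  rescaled.\<close>

lemma tame_Suc_iff:
  assumes q: "0 < q"
  shows "tame q (\<theta> / q) (\<lambda>n. H (Suc n)) \<longleftrightarrow> tame q \<theta> H"
proof -
  have eq: "(\<theta> + q * e) / q ^ Suc n = (\<theta> / q + e) / q ^ n" for e n using q by (simp add: field_simps)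
  show ?thesis
  proof
    assume t: "tame q (\<theta> / q) (\<lambda>n. H (Suc n))"
    show "tame q \<theta> H" unfolding tame_def
    proof (intro allI impI)
      fix e :: real assume "e > 0"
      then have "e / q > 0" using q by simp
      then have "\<forall>\<^sub>F n in sequentially. \<forall>x. norm (H (Suc n) x) \<le> exp ((\<theta> + q * (e / q)) / q ^ Suc n)"
        using t unfolding tame_def eq by blast
      then have "\<forall>\<^sub>F n in sequentially. \<forall>x. norm (H (Suc n) x) \<le> exp ((\<theta> + e) / q ^ Suc n)" using q by simp
      then show "\<forall>\<^sub>F n in sequentially. \<forall>x. norm (H n x) \<le> exp ((\<theta> + e) / q ^ n)"
        using eventually_sequentially_Suc[of "\<lambda>n. \<forall>x. norm (H n x) \<le> exp ((\<theta> + e) / q ^ n)"] by blast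
    qed
  next
    assume t: "tame q \<theta> H"
    show "tame q (\<theta> / q) (\<lambda>n. H (Suc n))" unfolding tame_def eq[symmetric]
    proof (intro allI impI)
      fix e :: real assume "e > 0"
      then have "q * e > 0" using q by simp
      then have "\<forall>\<^sub>F n in sequentially. \<forall>x. norm (H n x) \<le> exp ((\<theta> + q * e) / q ^ n)"
        using t unfolding tame_def by blast
      then show "\<forall>\<^sub>F n in sequentially. \<forall>x. norm (H (Suc n) x) \<le> exp ((\<theta> + q * e) / q ^ Suc n)"
        using eventually_sequentially_Suc[of "\<lambda>n. \<forall>x. norm (H n x) \<le> exp ((\<theta> + q * e) / q ^ n)"] by blast
    qed
  qed
qed

lemma eln_sup_norm_le_iff:
  assumes a: "0 < a"
  shows "ereal a * eln (sup_norm g) \<le> ereal t \<longleftrightarrow> (\<forall>x. norm (g x) \<le> exp (t / a))"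
proof -
  have "(\<forall>x. norm (g x) \<le> exp (t / a)) \<longleftrightarrow> sup_norm g \<le> ereal (exp (t / a))"
    by (simp add: sup_norm_def SUP_le_iff)
  also have "\<dots> \<longleftrightarrow> ereal a * eln (sup_norm g) \<le> ereal t"
  proof (cases "sup_norm g")
    case (real r)
    have "ereal (norm (g 0)) \<le> sup_norm g" unfolding sup_norm_def by (rule SUP_upper) simp
    then have "0 \<le> norm (g 0)" "norm (g 0) \<le> r" using real by auto
    then have r: "0 \<le> r" by linarith
    show ?thesis
    proof (cases "r = 0")
      case False
      then have "r \<le> exp (t / a) \<longleftrightarrow> ln r \<le> t / a" using r ln_ge_iff by (metis exp_gt_zero exp_le_cancel_iff exp_ln_iff order_le_less)
      also have "\<dots> \<longleftrightarrow> a * ln r \<le> t" using a by (simp add: field_simps)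
      finally show ?thesis using real False by (simp add: eln_def)
    qed (use real a in \<open>simp add: eln_def zero_ereal_def[symmetric]\<close>)
  next
    case MInf
    have "ereal (norm (g 0)) \<le> sup_norm g" unfolding sup_norm_def by (rule SUP_upper) simp
    then show ?thesis using MInf by simp
  qed (use a in \<open>simp add: eln_def\<close>)
  finally show ?thesis by simp
qed

lemma limsup_eln_le_iff:
  assumes q: "0 < q"
  shows "limsup (\<lambda>n. ereal (q ^ n) * eln (sup_norm (H n))) \<le> ereal \<theta> \<longleftrightarrow> tame q \<theta> H"
proof -
  have iff: "ereal (q ^ n) * eln (sup_norm (H n)) \<le> ereal t \<longleftrightarrow> (\<forall>x. norm (H n x) \<le> exp (t / q ^ n))" for n t
    by (rule eln_sup_norm_le_iff) (use q in simp)
  show ?thesis unfolding tame_def iff[symmetric] Limsup_le_iff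
  proof (intro iffI allI impI)
    fix e :: real
    assume a: "\<forall>y>ereal \<theta>. \<forall>\<^sub>F n in sequentially. ereal (q ^ n) * eln (sup_norm (H n)) < y" and e: "e > 0"
    then have "\<forall>\<^sub>F n in sequentially. ereal (q ^ n) * eln (sup_norm (H n)) < ereal (\<theta> + e)" by simp
    then show "\<forall>\<^sub>F n in sequentially. ereal (q ^ n) * eln (sup_norm (H n)) \<le> ereal (\<theta> + e)"
      by eventually_elim simp
  next
    fix y
    assume a: "\<forall>e>0. \<forall>\<^sub>F n in sequentially. ereal (q ^ n) * eln (sup_norm (H n)) \<le> ereal (\<theta> + e)" and y: "ereal \<theta> < y"
    obtain z where z: "ereal \<theta> < ereal z" "ereal z < y" using ereal_dense2[OF y] by blast
    then have "\<forall>\<^sub>F n in sequentially. ereal (q ^ n) * eln (sup_norm (H n)) \<le> ereal (\<theta> + (z - \<theta>))"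
      using spec[OF a, of "z - \<theta>"] by simp
    then show "\<forall>\<^sub>F n in sequentially. ereal (q ^ n) * eln (sup_norm (H n)) < y"
      by eventually_elim (use z in auto)
  qed
qed

lemma nderiv_0 [simp]: "nderiv 0 f = f"
  by (simp add: nderiv_def)

lemma nderiv_nderiv: "nderiv n (nderiv 1 f) = nderiv (Suc n) f"
  by (simp add: nderiv_def funpow_Suc_right del: funpow.simps)

lemmas nderiv_nderiv' = nderiv_nderiv[unfolded One_nat_def]

lemma nderiv_add: "smooth f \<Longrightarrow> smooth g \<Longrightarrow> nderiv n (\<lambda>x. f x + g x) = (\<lambda>x. nderiv n f x + nderiv n g x)"
  using tower_nderiv[OF tower_add[OF smooth_tower smooth_tower], of f g n] by simp

lemma nderiv_cmult: "smooth f \<Longrightarrow> nderiv n (\<lambda>x. c * f x) = (\<lambda>x. c * nderiv n f x)"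
  using tower_nderiv[OF tower_cmult[OF smooth_tower], of f n c] by simp

lemma smooth_add: "smooth f \<Longrightarrow> smooth g \<Longrightarrow> smooth (\<lambda>x. f x + g x)"
  using tower_smooth[OF tower_add[OF smooth_tower smooth_tower], of f g] by simp

lemma smooth_cmult: "smooth f \<Longrightarrow> smooth (\<lambda>x. c * f x)"
  using tower_smooth[OF tower_cmult[OF smooth_tower], of f c] by simp

lemma smooth_nderiv: "smooth f \<Longrightarrow> smooth (nderiv 1 f)"
  using tower_smooth[OF tower_Suc[OF smooth_tower], of f] by simp

locale carleman =
  fixes p \<theta> :: real and M :: "nat \<Rightarrow> real"
  assumes p_pos: "0 < p" and p_less_1: "p < 1" and \<theta>: "0 \<le> \<theta>" and M_pos: "\<And>n. 0 < M n"
begin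

abbreviation "test \<equiv> carleman_test p \<theta> M"

lemma q: "0 < 1 - p" "1 - p < 1" using p_pos p_less_1 by auto

lemma p1: "p \<le> 1" using p_less_1 by simp

lemma test_iff: "f \<in> car test \<longleftrightarrow> smooth f \<and> (\<forall>n. nderiv n f \<in> Lp_fun p) \<and>
    (\<exists>c. \<forall>n. Lp_norm p (nderiv n f) \<le> c * M n) \<and> tame (1 - p) \<theta> (\<lambda>n. nderiv n f)"
proof -
  have "bdd_above (range (\<lambda>n. Lp_norm p (nderiv n f) / M n)) \<longleftrightarrow> (\<exists>c. \<forall>n. Lp_norm p (nderiv n f) \<le> c * M n)"
    using M_pos by (auto simp: bdd_above_def pos_divide_le_eq)
  then show ?thesis by (simp add: carleman_test_def limsup_eln_le_iff[OF q(1)])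
qed

lemma test_smooth: "f \<in> car test \<Longrightarrow> smooth f"
  and test_Lp: "f \<in> car test \<Longrightarrow> nderiv n f \<in> Lp_fun p"
  by (simp_all add: test_iff)

lemma test_norm_bound:
  assumes "f \<in> car test"
  shows "Lp_norm p (nderiv n f) \<le> qnorm test f * M n"
proof -
  have "Lp_norm p (nderiv n f) / M n \<le> qnorm test f"
    using assms unfolding carleman_test_def by (auto intro: cSUP_upper)
  then show ?thesis using M_pos by (simp add: pos_divide_le_eq)
qed

lemma test_norm_leI: "(\<And>n. Lp_norm p (nderiv n f) \<le> c * M n) \<Longrightarrow> qnorm test f \<le> c"
  unfolding carleman_test_def using M_pos by (auto intro!: cSUP_least simp: pos_divide_le_eq)

sublocale test: p_normed_functions test p
proof
  show "0 < p" "p \<le> 1" using p_pos p1 by auto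
  show "add test = (\<lambda>f g x. f x + g x)" "smul test = (\<lambda>c f x. c * f x)" by (simp_all add: carleman_test_def)
  have z: "tower (\<lambda>n x. 0)" by (simp add: tower_def)
  have nz: "nderiv n (\<lambda>x. 0) = (\<lambda>x. 0)" for n using tower_nderiv[OF z, of n] by simp
  show "(\<lambda>x. 0) \<in> car test" unfolding test_iff nz
    using tower_smooth[OF z] by (auto simp: Lp_fun_zero tame_def Lp_norm_def intro!: exI[of _ 0])
  fix f assume f: "f \<in> car test"
  show fn: "0 \<le> qnorm test f"
    using test_norm_bound[OF f, of 0] Lp_norm_nonneg[of p "nderiv 0 f"] M_pos[of 0]
    by (metis mult_less_0_iff not_le order_trans)
  show cl: "(\<lambda>x. c * f x) \<in> car test" for c
    unfolding test_iff nderiv_cmult[OF test_smooth[OF f]]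
  proof (intro conjI allI)
    show "smooth (\<lambda>x. c * f x)" by (rule smooth_cmult[OF test_smooth[OF f]])
    show "(\<lambda>x. c * nderiv n f x) \<in> Lp_fun p" for n by (rule Lp_fun_cmult[OF test_Lp[OF f]])
    show "tame (1 - p) \<theta> (\<lambda>n x. c * nderiv n f x)" by (rule tame_cmult[OF q]) (use f in \<open>simp add: test_iff\<close>)
    have "Lp_norm p (\<lambda>x. c * nderiv n f x) \<le> (norm c * qnorm test f) * M n" for n
      unfolding Lp_norm_cmult[OF p_pos] mult.assoc by (intro mult_left_mono test_norm_bound[OF f]) simp
    then show "\<exists>c'. \<forall>n. Lp_norm p (\<lambda>x. c * nderiv n f x) \<le> c' * M n" by blast
  qed
  have le: "qnorm test (\<lambda>x. c * f x) \<le> norm c * qnorm test f" for c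
    by (rule test_norm_leI)
      (unfold nderiv_cmult[OF test_smooth[OF f]] Lp_norm_cmult[OF p_pos] mult.assoc, intro mult_left_mono test_norm_bound[OF f], simp)
  show "qnorm test (\<lambda>x. c * f x) = norm c * qnorm test f" for c
  proof (rule antisym[OF le])
    show "norm c * qnorm test f \<le> qnorm test (\<lambda>x. c * f x)"
    proof (cases "c = 0")
      case True
      have "0 \<le> Lp_norm p (nderiv 0 (\<lambda>x. c * f x)) / M 0" using Lp_norm_nonneg M_pos[of 0] by (simp add: divide_nonneg_pos)
      also have "\<dots> \<le> qnorm test (\<lambda>x. c * f x)"
        using test_norm_bound[OF cl[of c], of 0] M_pos[of 0] by (simp add: pos_divide_le_eq)
      finally show ?thesis using True by simp
    next
      case False
      have "qnorm test f \<le> qnorm test (\<lambda>x. c * f x) / norm c"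
      proof (rule test_norm_leI)
        fix n
        have "norm c * Lp_norm p (nderiv n f) \<le> qnorm test (\<lambda>x. c * f x) * M n"
          using test_norm_bound[OF cl[of c], of n] unfolding nderiv_cmult[OF test_smooth[OF f]] Lp_norm_cmult[OF p_pos] .
        then show "Lp_norm p (nderiv n f) \<le> qnorm test (\<lambda>x. c * f x) / norm c * M n"
          using False by (simp add: field_simps)
      qed
      then show ?thesis using False by (simp add: field_simps)
    qed
  qed
  fix g assume g: "g \<in> car test"
  have gn: "0 \<le> qnorm test g"
    using test_norm_bound[OF g, of 0] Lp_norm_nonneg[of p "nderiv 0 g"] M_pos[of 0]
    by (metis mult_less_0_iff not_le order_trans)
  define c where "c = (qnorm test f powr p + qnorm test g powr p) powr (1 / p)"
  have c: "c powr p = qnorm test f powr p + qnorm test g powr p"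
    using p_pos by (simp add: c_def powr_powr)
  have bd: "Lp_norm p (nderiv n (\<lambda>x. f x + g x)) \<le> c * M n" for n
  proof -
    have "Lp_norm p (nderiv n (\<lambda>x. f x + g x)) powr p \<le> Lp_norm p (nderiv n f) powr p + Lp_norm p (nderiv n g) powr p"
      unfolding nderiv_add[OF test_smooth[OF f] test_smooth[OF g]]
      by (rule Lp_norm_powr_add[OF p_pos p1 test_Lp[OF f] test_Lp[OF g]])
    also have "\<dots> \<le> (qnorm test f * M n) powr p + (qnorm test g * M n) powr p"
      by (intro add_mono powr_mono2 test_norm_bound f g) (use p_pos Lp_norm_nonneg in auto)
    also have "\<dots> = (c * M n) powr p"
    proof -
      have "0 \<le> c" by (simp add: c_def)
      then show ?thesis using fn gn M_pos[of n] by (simp add: powr_mult c algebra_simps)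
    qed
    finally have *: "Lp_norm p (nderiv n (\<lambda>x. f x + g x)) powr p \<le> (c * M n) powr p" .
    have "0 \<le> c * M n" using M_pos[of n] by (simp add: c_def)
    then show ?thesis using * powr_less_mono2[OF p_pos, of "c * M n" "Lp_norm p (nderiv n (\<lambda>x. f x + g x))"] by linarith
  qed
  show ad: "(\<lambda>x. f x + g x) \<in> car test"
    unfolding test_iff
  proof (intro conjI allI)
    show "smooth (\<lambda>x. f x + g x)" by (rule smooth_add[OF test_smooth[OF f] test_smooth[OF g]])
    show "nderiv n (\<lambda>x. f x + g x) \<in> Lp_fun p" for n
      unfolding nderiv_add[OF test_smooth[OF f] test_smooth[OF g]]
      by (rule Lp_fun_add[OF p_pos p1 test_Lp[OF f] test_Lp[OF g]])
    show "tame (1 - p) \<theta> (\<lambda>n. nderiv n (\<lambda>x. f x + g x))"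
      unfolding nderiv_add[OF test_smooth[OF f] test_smooth[OF g]]
      by (rule tame_add[OF q \<theta>]) (use f g in \<open>simp_all add: test_iff\<close>)
    show "\<exists>c. \<forall>n. Lp_norm p (nderiv n (\<lambda>x. f x + g x)) \<le> c * M n" using bd by blast
  qed
  have "qnorm test (\<lambda>x. f x + g x) \<le> c" by (rule test_norm_leI[OF bd])
  moreover have "0 \<le> qnorm test (\<lambda>x. f x + g x)"
    using test_norm_bound[OF ad, of 0] Lp_norm_nonneg[of p "nderiv 0 (\<lambda>x. f x + g x)"] M_pos[of 0]
    by (metis mult_less_0_iff not_le order_trans)
  ultimately have "qnorm test (\<lambda>x. f x + g x) powr p \<le> c powr p" using p_pos by (intro powr_mono2) auto
  then show "qnorm test (\<lambda>x. f x + g x) powr p \<le> qnorm test f powr p + qnorm test g powr p" by (simp add: c)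
qed

abbreviation "test' \<equiv> carleman_test p (\<theta> / (1 - p)) (shift_seq M)"

lemma carleman_shift: "carleman p (\<theta> / (1 - p)) (shift_seq M)"
  by unfold_locales (use p_pos p_less_1 \<theta> M_pos in \<open>auto simp: shift_seq_def\<close>)

end

context p_normed_functions
begin

lemma norm_tendsto:
  assumes s: "\<And>k. s k \<in> car V" and f: "f \<in> car V" and lim: "(\<lambda>k. dist_V (s k) f) \<longlonglongrightarrow> 0"
  shows "(\<lambda>k. qnorm V (s k)) \<longlonglongrightarrow> qnorm V f"
proof -
  have "(\<lambda>k. dist_V (s k) f powr p) \<longlonglongrightarrow> 0"
    by (rule iffD2[OF powr_tendsto_0_iff[OF p(1) dist_nonneg[OF s f]] lim])
  then have "(\<lambda>k. qnorm V (s k) powr p - qnorm V f powr p) \<longlonglongrightarrow> 0"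
    by (rule Lim_null_comparison[rotated]) (simp add: norm_diff_le[OF s f])
  then have "(\<lambda>k. qnorm V (s k) powr p) \<longlonglongrightarrow> qnorm V f powr p" by (rule LIM_zero_cancel)
  then show ?thesis by (rule iffD1[OF tendsto_powr_iff_nonneg[OF p(1) nonneg[OF s] nonneg[OF f]]])
qed

lemma add_tendsto:
  assumes "\<And>k. s k \<in> car V" "f \<in> car V" "\<And>k. t k \<in> car V" "g \<in> car V"
    and "(\<lambda>k. dist_V (s k) f) \<longlonglongrightarrow> 0" "(\<lambda>k. dist_V (t k) g) \<longlonglongrightarrow> 0"
  shows "(\<lambda>k. dist_V (\<lambda>x. s k x + t k x) (\<lambda>x. f x + g x)) \<longlonglongrightarrow> 0"
  by (rule powr_subadditive_tendsto_0[OF p(1) dist_nonneg[OF assms(1,2)] dist_nonneg[OF assms(3,4)]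
    dist_nonneg[OF add_closed[OF assms(1,3)] add_closed[OF assms(2,4)]] dist_add[OF assms(1,2,3,4)] assms(5,6)])

lemma cmult_tendsto:
  assumes "\<And>k. s k \<in> car V" "f \<in> car V" "(\<lambda>k. dist_V (s k) f) \<longlonglongrightarrow> 0"
  shows "(\<lambda>k. dist_V (\<lambda>x. c * s k x) (\<lambda>x. c * f x)) \<longlonglongrightarrow> 0"
  unfolding dist_cmult[OF assms(1,2)] using tendsto_mult[OF tendsto_const assms(3), of "norm c"] by simp

lemma dist_tendsto:
  assumes "\<And>k. s k \<in> car V" "f \<in> car V" "\<And>k. t k \<in> car V" "g \<in> car V"
    and "(\<lambda>k. dist_V (s k) f) \<longlonglongrightarrow> 0" "(\<lambda>k. dist_V (t k) g) \<longlonglongrightarrow> 0"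
  shows "(\<lambda>k. dist_V (s k) (t k)) \<longlonglongrightarrow> dist_V f g"
proof (rule norm_tendsto[OF diff_closed[OF assms(1,3)] diff_closed[OF assms(2,4)]])
  show "(\<lambda>k. dist_V (\<lambda>x. s k x - t k x) (\<lambda>x. f x - g x)) \<longlonglongrightarrow> 0"
    using add_tendsto[OF assms(1,2) smul_closed[OF assms(3)] smul_closed[OF assms(4)] assms(5) cmult_tendsto[OF assms(3,4,6)], of "- 1"]
    by simp
qed

lemma tendsto_trans:
  assumes "\<And>k. s k \<in> car V" "\<And>k. t k \<in> car V" "f \<in> car V"
    and "(\<lambda>k. dist_V (s k) (t k)) \<longlonglongrightarrow> 0" "(\<lambda>k. dist_V (t k) f) \<longlonglongrightarrow> 0"
  shows "(\<lambda>k. dist_V (s k) f) \<longlonglongrightarrow> 0"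
  by (rule powr_subadditive_tendsto_0[OF p(1) dist_nonneg[OF assms(1,2)] dist_nonneg[OF assms(2,3)] dist_nonneg[OF assms(1,3)]
    dist_triangle[OF assms(1-3)] assms(4,5)])

lemma cauchy_close:
  assumes s: "\<And>k. s k \<in> car V" and t: "t \<in> cauchy_seqs V" and lim: "(\<lambda>k. dist_V (s k) (t k)) \<longlonglongrightarrow> 0"
  shows "s \<in> cauchy_seqs V"
  unfolding cauchy_seqs_powr
proof (intro conjI allI impI s)
  fix \<epsilon> :: real assume "\<epsilon> > 0"
  then have e3: "\<epsilon> / 3 > 0" by simp
  note tc = cauchy_car[OF t]
  have "(\<lambda>k. dist_V (s k) (t k) powr p) \<longlonglongrightarrow> 0"
    by (rule iffD2[OF powr_tendsto_0_iff[OF p(1) dist_nonneg[OF s tc]] lim])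
  from order_tendstoD(2)[OF this e3] obtain N where N: "\<And>k. k \<ge> N \<Longrightarrow> dist_V (s k) (t k) powr p < \<epsilon> / 3"
    by (auto simp: eventually_sequentially)
  obtain N' where N': "\<And>j k. j \<ge> N' \<Longrightarrow> k \<ge> N' \<Longrightarrow> dist_V (t j) (t k) powr p < \<epsilon> / 3"
    using t e3 unfolding cauchy_seqs_powr by blast
  have "dist_V (s j) (s k) powr p < \<epsilon>" if "j \<ge> max N N'" "k \<ge> max N N'" for j k
    using dist_triangle[OF s[of j] tc[of j] s[of k]] dist_triangle[OF tc[of j] tc[of k] s[of k]]
      N[of j] N[of k] N'[of j k] that unfolding dist_commute[OF tc[of k] s[of k]] by simp
  then show "\<exists>N. \<forall>j\<ge>N. \<forall>k\<ge>N. dist_V (s j) (s k) powr p < \<epsilon>" by blast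
qed

lemma completion_dist_eq_0:
  assumes AB: "A \<in> car (qcompletion V)" "B \<in> car (qcompletion V)" "qnorm (qcompletion V) (qdiff (qcompletion V) A B) = 0"
  shows "A = B"
proof -
  obtain s where s: "s \<in> cauchy_seqs V" "A = limit_class s" using AB(1) by (rule limit_class_cases)
  obtain t where t: "t \<in> cauchy_seqs V" "B = limit_class t" using AB(2) by (rule limit_class_cases)
  show ?thesis using dist_limit_class[OF s(1) t(1)] AB(3) unfolding s(2) t(2) limit_class_eq_iff[OF s(1) t(1)] by simp
qed

end

lemma powr_powr_inverse: "0 \<le> x \<Longrightarrow> 0 < p \<Longrightarrow> (x powr p) powr (1 / p) = (x::real)"
  by (simp add: powr_powr)

lemma bilipschitz_homeomorphic_map:
  assumes f: "bij_betw f (car V) (car U)" and C: "0 \<le> C"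
    and lip: "\<And>x y. x \<in> car V \<Longrightarrow> y \<in> car V \<Longrightarrow> qnorm U (qdiff U (f x) (f y)) \<le> C * qnorm V (qdiff V x y)"
    and lip': "\<And>x y. x \<in> car V \<Longrightarrow> y \<in> car V \<Longrightarrow> qnorm V (qdiff V x y) \<le> C * qnorm U (qdiff U (f x) (f y))"
  shows "homeomorphic_map (qtop V) (qtop U) f"
proof -
  let ?g = "inv_into (car V) f"
  have g: "?g y \<in> car V" "f (?g y) = y" if "y \<in> car U" for y
    using that f by (auto simp: bij_betw_def inv_into_into f_inv_into_f)
  have "continuous_map (qtop V) (qtop U) f"
    by (rule lipschitz_continuous_map[OF _ C lip]) (use f in \<open>auto simp: bij_betw_def\<close>)
  moreover have "continuous_map (qtop U) (qtop V) ?g"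
  proof (rule lipschitz_continuous_map[OF g(1) C])
    fix x y assume xy: "x \<in> car U" "y \<in> car U"
    show "qnorm V (qdiff V (?g x) (?g y)) \<le> C * qnorm U (qdiff U x y)"
      using lip'[OF g(1) g(1), OF xy] by (simp add: g(2) xy)
  qed
  moreover have "?g (f x) = x" if "x \<in> car V" for x using f that by (simp add: bij_betw_def)
  ultimately have "homeomorphic_maps (qtop V) (qtop U) f ?g" unfolding homeomorphic_maps_def using g by auto
  then show ?thesis unfolding homeomorphic_map_maps by blast
qed

text \<open>\<open>L^p\<close> without identification almost everywhere, so that limits can be
  computed on representatives.\<close>

definition Lp_functions :: "real \<Rightarrow> (real \<Rightarrow> complex) qspace" where
  "Lp_functions p = \<lparr>car = Lp_fun p, add = (\<lambda>f g x. f x + g x), smul = (\<lambda>c f x. c * f x), qnorm = Lp_norm p\<rparr>"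

lemma p_normed_Lp_functions:
  assumes "0 < p" "p \<le> 1"
  shows "p_normed_functions (Lp_functions p) p"
  by unfold_locales (use assms in \<open>auto simp: Lp_functions_def Lp_fun_zero Lp_fun_add Lp_fun_cmult Lp_norm_nonneg Lp_norm_cmult Lp_norm_powr_add\<close>)

lemma Lp_functions_simps [simp]: "car (Lp_functions p) = Lp_fun p" "qnorm (Lp_functions p) = Lp_norm p"
  by (simp_all add: Lp_functions_def)

lemma Lp_dist_rep:
  assumes "0 < p" "p \<le> 1" "A \<in> car (Lp p)" "B \<in> car (Lp p)"
  shows "qnorm (Lp p) (qdiff (Lp p) A B) = Lp_norm p (\<lambda>x. rep A x - rep B x)"
  using Lp_dist_class[OF assms(1,2) Lp_class_rep(1)[OF assms(3)] Lp_class_rep(1)[OF assms(4)]]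
  by (simp add: Lp_class_rep(2) assms)

lemma Lp_metric:
  assumes p: "0 < p" "p \<le> 1" and A: "A \<in> car (Lp p)" and B: "B \<in> car (Lp p)" and C: "C \<in> car (Lp p)"
  shows Lp_dist_nonneg: "0 \<le> qnorm (Lp p) (qdiff (Lp p) A B)"
    and Lp_dist_commute: "qnorm (Lp p) (qdiff (Lp p) A B) = qnorm (Lp p) (qdiff (Lp p) B A)"
    and Lp_dist_eq_0: "qnorm (Lp p) (qdiff (Lp p) A B) = 0 \<longleftrightarrow> A = B"
    and Lp_dist_triangle: "qnorm (Lp p) (qdiff (Lp p) A C) powr p \<le>
      qnorm (Lp p) (qdiff (Lp p) A B) powr p + qnorm (Lp p) (qdiff (Lp p) B C) powr p"
    and Lp_dist_norm: "qnorm (Lp p) (qdiff (Lp p) A B) powr p \<le> qnorm (Lp p) A powr p + qnorm (Lp p) B powr p"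
proof -
  note r = Lp_class_rep(1)[OF A] Lp_class_rep(1)[OF B] Lp_class_rep(1)[OF C]
  note d = Lp_dist_rep[OF p A B] Lp_dist_rep[OF p B A] Lp_dist_rep[OF p A C] Lp_dist_rep[OF p B C]
  show "0 \<le> qnorm (Lp p) (qdiff (Lp p) A B)" unfolding d by (rule Lp_norm_nonneg)
  show "qnorm (Lp p) (qdiff (Lp p) A B) = qnorm (Lp p) (qdiff (Lp p) B A)" unfolding d by (rule Lp_norm_diff_commute)
  show "qnorm (Lp p) (qdiff (Lp p) A C) powr p \<le>
      qnorm (Lp p) (qdiff (Lp p) A B) powr p + qnorm (Lp p) (qdiff (Lp p) B C) powr p"
    unfolding d by (rule Lp_norm_diff_triangle[OF p r])
  show "qnorm (Lp p) (qdiff (Lp p) A B) powr p \<le> qnorm (Lp p) A powr p + qnorm (Lp p) B powr p"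
    using Lp_norm_powr_add[OF p r(1) Lp_fun_cmult[OF r(2), of "- 1"]] unfolding d Lp_norm_cmult[OF p(1)]
    by (simp add: Lp_def)
  show "qnorm (Lp p) (qdiff (Lp p) A B) = 0 \<longleftrightarrow> A = B"
  proof
    assume "qnorm (Lp p) (qdiff (Lp p) A B) = 0"
    from Lp_norm_eq_0[OF p(1) Lp_fun_diff[OF p r(1,2)] this[unfolded d]]
    have "AE x in lebesgue. rep A x = rep B x" by simp
    then have "Lp_class p (rep A) = Lp_class p (rep B)" using Lp_class_eq_iff[OF r(1,2)] by simp
    then show "A = B" by (simp add: Lp_class_rep(2) A B)
  next
    assume "A = B"
    then show "qnorm (Lp p) (qdiff (Lp p) A B) = 0" unfolding d(1) by (simp add: Lp_norm_def)
  qed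
qed

lemma Hausdorff_Lp:
  assumes "0 < p" "p \<le> 1"
  shows "Hausdorff_space (qtop (Lp p))"
  by (rule Hausdorff_qtop[OF assms(1)]) (intro Lp_metric[OF assms]; assumption)+

lemma Hausdorff_linf_Lp:
  assumes p: "0 < p" "p \<le> 1" and M: "\<And>n. 0 < M n"
  shows "Hausdorff_space (qtop (linf_Lp p M))"
proof -
  let ?N = "qnorm (Lp p)" and ?d = "\<lambda>A B. qnorm (Lp p) (qdiff (Lp p) A B)"
  define d where "d F G = qnorm (linf_Lp p M) (qdiff (linf_Lp p M) F G)" for F G
  have d: "d F G = (SUP n. ?d (F n) (G n) / M n)" for F G
    by (simp add: d_def linf_Lp_def qdiff_def)
  have car: "F n \<in> car (Lp p)" if "F \<in> car (linf_Lp p M)" for F n using that by (simp add: linf_Lp_def)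
  have bdd: "bdd_above (range (\<lambda>n. ?d (F n) (G n) / M n))" if F: "F \<in> car (linf_Lp p M)" and G: "G \<in> car (linf_Lp p M)" for F G
  proof -
    obtain a where a: "\<And>n. ?N (F n) / M n \<le> a" using F by (auto simp: linf_Lp_def bdd_above_def)
    obtain b where b: "\<And>n. ?N (G n) / M n \<le> b" using G by (auto simp: linf_Lp_def bdd_above_def)
    have N0: "0 \<le> ?N A" for A by (simp add: Lp_def Lp_norm_nonneg)
    have "?d (F n) (G n) / M n \<le> (a powr p + b powr p) powr (1 / p)" for n
    proof -
      have "(?d (F n) (G n) / M n) powr p = ?d (F n) (G n) powr p / M n powr p"
        using Lp_dist_nonneg[OF p car[OF F] car[OF G] car[OF G]] M[of n] by (simp add: powr_divide)
      also have "\<dots> \<le> (?N (F n) powr p + ?N (G n) powr p) / M n powr p"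
        by (intro divide_right_mono Lp_dist_norm[OF p car[OF F] car[OF G] car[OF G]]) simp
      also have "\<dots> = (?N (F n) / M n) powr p + (?N (G n) / M n) powr p"
        using N0 M[of n] by (simp add: powr_divide add_divide_distrib)
      also have "\<dots> \<le> a powr p + b powr p"
        using N0 M[of n] p by (intro add_mono powr_mono2 a b) auto
      finally have "((?d (F n) (G n) / M n) powr p) powr (1 / p) \<le> (a powr p + b powr p) powr (1 / p)"
        using p by (intro powr_mono2) auto
      then show ?thesis using Lp_dist_nonneg[OF p car[OF F] car[OF G] car[OF G], of n n] M[of n] p by (simp add: powr_powr)
    qed
    then show ?thesis by (auto simp: bdd_above_def)
  qed
  have le: "?d (F n) (G n) / M n \<le> d F G" if "F \<in> car (linf_Lp p M)" "G \<in> car (linf_Lp p M)" for F G n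
    unfolding d by (rule cSUP_upper[OF UNIV_I bdd[OF that]])
  have nn: "0 \<le> ?d (F n) (G n) / M n" if "F \<in> car (linf_Lp p M)" "G \<in> car (linf_Lp p M)" for F G n
    using Lp_dist_nonneg[OF p car[OF that(1)] car[OF that(2)] car[OF that(2)]] M[of n] by (simp add: less_imp_le)
  have nonneg: "0 \<le> d F G" if "F \<in> car (linf_Lp p M)" "G \<in> car (linf_Lp p M)" for F G
    using nn[OF that, of 0] le[OF that, of 0] by linarith
  show ?thesis
  proof (rule Hausdorff_qtop[OF p(1)]; (unfold d_def[symmetric])?)
    fix F G assume F: "F \<in> car (linf_Lp p M)" and G: "G \<in> car (linf_Lp p M)"
    show "0 \<le> d F G" by (rule nonneg[OF F G])
    show "d F G = d G F" unfolding d using Lp_dist_commute[OF p car[OF F] car[OF G] car[OF G]] by simp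
    show "d F G = 0 \<longleftrightarrow> F = G"
    proof
      assume 0: "d F G = 0"
      have "?d (F n) (G n) = 0" for n
        using le[OF F G, of n] nn[OF F G, of n] M[of n] unfolding 0 by simp
      then have "F n = G n" for n using Lp_dist_eq_0[OF p car[OF F] car[OF G] car[OF G]] by blast
      then show "F = G" by (rule ext)
    next
      assume "F = G"
      then have "?d (F n) (G n) = 0" for n using Lp_dist_eq_0[OF p car[OF F] car[OF G] car[OF G]] by simp
      then show "d F G = 0" unfolding d by simp
    qed
    fix H assume H: "H \<in> car (linf_Lp p M)"
    have "?d (F n) (H n) / M n \<le> (d F G powr p + d G H powr p) powr (1 / p)" for n
    proof -
      have "(?d (F n) (H n) / M n) powr p = ?d (F n) (H n) powr p / M n powr p"
        using Lp_dist_nonneg[OF p car[OF F] car[OF H] car[OF G]] M[of n] by (simp add: powr_divide)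
      also have "\<dots> \<le> (?d (F n) (G n) powr p + ?d (G n) (H n) powr p) / M n powr p"
        by (intro divide_right_mono Lp_dist_triangle[OF p car[OF F] car[OF G] car[OF H]]) simp
      also have "\<dots> = (?d (F n) (G n) / M n) powr p + (?d (G n) (H n) / M n) powr p"
        using Lp_dist_nonneg[OF p car[OF F] car[OF G] car[OF G]] Lp_dist_nonneg[OF p car[OF G] car[OF H] car[OF G]] M[of n]
        by (simp add: powr_divide add_divide_distrib)
      also have "\<dots> \<le> d F G powr p + d G H powr p"
        using nn[OF F G] nn[OF G H] p by (intro add_mono powr_mono2 le F G H) auto
      finally have "((?d (F n) (H n) / M n) powr p) powr (1 / p) \<le> (d F G powr p + d G H powr p) powr (1 / p)"
        using p by (intro powr_mono2) auto
      then show ?thesis unfolding powr_powr_inverse[OF nn[OF F H] p(1)] .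
    qed
    then have "d F H \<le> (d F G powr p + d G H powr p) powr (1 / p)" unfolding d[of F H] by (intro cSUP_least) auto
    then have "d F H powr p \<le> ((d F G powr p + d G H powr p) powr (1 / p)) powr p"
      using nonneg[OF F H] p by (intro powr_mono2) auto
    then show "d F H powr p \<le> d F G powr p + d G H powr p" using p by (simp add: powr_powr)
  qed
qed

lemma (in p_normed_functions) limit_unique:
  assumes "\<And>k. s k \<in> car V" "f \<in> car V" "g \<in> car V"
    and "(\<lambda>k. dist_V (s k) f) \<longlonglongrightarrow> 0" "(\<lambda>k. dist_V (s k) g) \<longlonglongrightarrow> 0"
  shows "dist_V f g = 0"
proof -
  have "(\<lambda>k. dist_V (s k) (s k)) \<longlonglongrightarrow> dist_V f g" by (rule dist_tendsto[OF assms(1,2,1,3,4,5)])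
  then show ?thesis by (simp add: LIMSEQ_const_iff)
qed

section \<open>Explicit forms of the maps alpha, delta and pi\<close>

context carleman
begin

abbreviation "W \<equiv> carleman_space p \<theta> M"
abbreviation "W' \<equiv> carleman_space p (\<theta> / (1 - p)) (shift_seq M)"

interpretation L: p_normed_functions "Lp_functions p" p
  by (rule p_normed_Lp_functions[OF p_pos p1])

interpretation S: carleman p "\<theta> / (1 - p)" "shift_seq M"
  by (rule carleman_shift)

lemma nderiv_diff: "f \<in> car test \<Longrightarrow> g \<in> car test \<Longrightarrow> nderiv n (\<lambda>x. f x - g x) = (\<lambda>x. nderiv n f x - nderiv n g x)"
  using nderiv_add[OF test_smooth test_smooth, of f "\<lambda>x. - 1 * g x" n] nderiv_cmult[OF test_smooth, of g n "- 1"]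
    test.smul_closed[of g "- 1"] by simp

lemma component_dist_le:
  assumes "f \<in> car test" "g \<in> car test"
  shows "Lp_norm p (\<lambda>x. nderiv n f x - nderiv n g x) \<le> M n * test.dist_V f g"
  using test_norm_bound[OF test.diff_closed[OF assms], of n] by (simp add: nderiv_diff[OF assms] mult.commute)

lemma nderiv_test:
  assumes "u \<in> car test"
  shows "nderiv 1 u \<in> car test'"
  unfolding S.test_iff nderiv_nderiv
proof (intro conjI allI)
  show "smooth (nderiv 1 u)" by (rule smooth_nderiv[OF test_smooth[OF assms]])
  show "nderiv (Suc n) u \<in> Lp_fun p" for n by (rule test_Lp[OF assms])
  show "\<exists>c. \<forall>n. Lp_norm p (nderiv (Suc n) u) \<le> c * shift_seq M n"
    using test_norm_bound[OF assms] by (auto simp: shift_seq_def)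
  show "tame (1 - p) (\<theta> / (1 - p)) (\<lambda>n. nderiv (Suc n) u)"
    using tame_Suc_iff[OF q(1), of \<theta> "\<lambda>n. nderiv n u"] assms by (simp add: test_iff)
qed

lemma qnorm_nderiv_le: "u \<in> car test \<Longrightarrow> qnorm test' (nderiv 1 u) \<le> qnorm test u"
  by (rule S.test_norm_leI) (use test_norm_bound in \<open>simp add: nderiv_nderiv' shift_seq_def\<close>)

text \<open>The supremum over all derivatives splits into the term of index 0 and the shifted
  quasinorm of the derivative. This makes the pair of alpha and delta bounded below.\<close>

lemma qnorm_le_max: "u \<in> car test \<Longrightarrow> qnorm test u \<le> max (Lp_norm p u / M 0) (qnorm test' (nderiv 1 u))"
proof (rule test_norm_leI)
  fix n assume u: "u \<in> car test"
  show "Lp_norm p (nderiv n u) \<le> max (Lp_norm p u / M 0) (qnorm test' (nderiv 1 u)) * M n"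
  proof (cases n)
    case 0
    have "Lp_norm p u = Lp_norm p u / M 0 * M 0" using M_pos[of 0] by simp
    also have "\<dots> \<le> max (Lp_norm p u / M 0) (qnorm test' (nderiv 1 u)) * M 0"
      by (rule mult_right_mono) (use M_pos[of 0] in auto)
    finally show ?thesis by (simp add: 0)
  next
    case (Suc k)
    have "Lp_norm p (nderiv n u) \<le> qnorm test' (nderiv 1 u) * M n"
      using S.test_norm_bound[OF nderiv_test[OF u], of k] by (simp add: nderiv_nderiv' Suc shift_seq_def)
    also have "\<dots> \<le> max (Lp_norm p u / M 0) (qnorm test' (nderiv 1 u)) * M n"
      by (rule mult_right_mono) (use M_pos[of n] in auto)
    finally show ?thesis .
  qed
qed

lemma dist_nderiv_le:
  assumes "u \<in> car test" "v \<in> car test"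
  shows "S.test.dist_V (nderiv 1 u) (nderiv 1 v) \<le> test.dist_V u v"
  using qnorm_nderiv_le[OF test.diff_closed[OF assms]] by (simp add: nderiv_diff[OF assms])

lemma dist_le_max:
  assumes "u \<in> car test" "v \<in> car test"
  shows "test.dist_V u v \<le> max (Lp_norm p (\<lambda>x. u x - v x) / M 0) (S.test.dist_V (nderiv 1 u) (nderiv 1 v))"
  using qnorm_le_max[OF test.diff_closed[OF assms]] by (simp add: nderiv_diff[OF assms])

lemma nderiv_cauchy:
  assumes s: "s \<in> cauchy_seqs test"
  shows "(\<lambda>k. nderiv n (s k)) \<in> cauchy_seqs (Lp_functions p)"
proof -
  note c = test.cauchy_car[OF s]
  have "\<exists>N. \<forall>j\<ge>N. \<forall>k\<ge>N. Lp_norm p (\<lambda>x. nderiv n (s j) x - nderiv n (s k) x) < \<epsilon>" if e: "\<epsilon> > 0" for \<epsilon>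
  proof -
    have "\<epsilon> / M n > 0" using e M_pos by simp
    then obtain N where N: "\<And>j k. j \<ge> N \<Longrightarrow> k \<ge> N \<Longrightarrow> test.dist_V (s j) (s k) < \<epsilon> / M n"
      using s unfolding cauchy_seqs_def test.qdiff_V by blast
    have "Lp_norm p (\<lambda>x. nderiv n (s j) x - nderiv n (s k) x) < \<epsilon>" if "j \<ge> N" "k \<ge> N" for j k
    proof -
      have "M n * test.dist_V (s j) (s k) < M n * (\<epsilon> / M n)"
        by (rule mult_strict_left_mono[OF N[OF that] M_pos])
      also have "\<dots> = \<epsilon>" using M_pos[of n] by simp
      finally show ?thesis using component_dist_le[OF c[of j] c[of k], of n] by linarith
    qed
    then show ?thesis by blast
  qed
  then show ?thesis by (simp add: cauchy_seqs_def L.qdiff_V test_Lp[OF c])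
qed

lemma nderiv_cauchy':
  assumes s: "s \<in> cauchy_seqs test"
  shows "(\<lambda>k. nderiv 1 (s k)) \<in> cauchy_seqs test'"
proof -
  note c = test.cauchy_car[OF s]
  show ?thesis
    unfolding cauchy_seqs_def S.test.qdiff_V mem_Collect_eq
  proof (intro conjI allI impI nderiv_test[OF c])
    fix \<epsilon> :: real assume "\<epsilon> > 0"
    then obtain N where N: "\<And>j k. j \<ge> N \<Longrightarrow> k \<ge> N \<Longrightarrow> test.dist_V (s j) (s k) < \<epsilon>"
      using s unfolding cauchy_seqs_def test.qdiff_V by blast
    have "S.test.dist_V (nderiv 1 (s j)) (nderiv 1 (s k)) < \<epsilon>" if "j \<ge> N" "k \<ge> N" for j k
      using dist_nderiv_le[OF c[of j] c[of k]] N[OF that] by linarith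
    then show "\<exists>N. \<forall>j\<ge>N. \<forall>k\<ge>N. S.test.dist_V (nderiv 1 (s j)) (nderiv 1 (s k)) < \<epsilon>" by blast
  qed
qed

lemma Lp_limit_ex:
  assumes s: "s \<in> cauchy_seqs (Lp_functions p)"
  shows "\<exists>f\<in>Lp_fun p. (\<lambda>k. Lp_norm p (\<lambda>x. s k x - f x)) \<longlonglongrightarrow> 0"
  by (rule Lp_complete[OF p_pos p1]) (use s in \<open>auto simp: cauchy_seqs_def L.qdiff_V\<close>)

text \<open>The \<open>n\<close>-th entry of pi, as the limit of \<open>n\<close>-th derivatives
  along a representative. It exists by completeness of \<open>L^p\<close>, and by
  \<open>component_eqI\<close> any other Cauchy sequence in the class gives the same value.\<close>

definition component :: "nat \<Rightarrow> (nat \<Rightarrow> real \<Rightarrow> complex) set \<Rightarrow> (real \<Rightarrow> complex) set" where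
  "component n A = Lp_class p (SOME f. f \<in> Lp_fun p \<and> (\<lambda>k. Lp_norm p (\<lambda>x. nderiv n (rep A k) x - f x)) \<longlonglongrightarrow> 0)"

lemma component_limit:
  assumes s: "s \<in> cauchy_seqs test"
  shows "\<exists>f\<in>Lp_fun p. component n (test.limit_class s) = Lp_class p f \<and> (\<lambda>k. Lp_norm p (\<lambda>x. nderiv n (s k) x - f x)) \<longlonglongrightarrow> 0"
proof -
  let ?r = "rep (test.limit_class s)"
  note r = test.rep_limit_class[OF s]
  let ?P = "\<lambda>f. f \<in> Lp_fun p \<and> (\<lambda>k. Lp_norm p (\<lambda>x. nderiv n (?r k) x - f x)) \<longlonglongrightarrow> 0"
  define f where "f = (SOME f. ?P f)"
  have "\<exists>f. ?P f" using Lp_limit_ex[OF nderiv_cauchy[OF r(1)]] by blast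
  then have "?P f" unfolding f_def by (rule someI_ex)
  then have f: "f \<in> Lp_fun p" "(\<lambda>k. Lp_norm p (\<lambda>x. nderiv n (?r k) x - f x)) \<longlonglongrightarrow> 0" by auto
  have "(\<lambda>k. M n * test.dist_V (?r k) (s k)) \<longlonglongrightarrow> M n * 0" by (rule tendsto_mult_left[OF r(2)])
  then have lim: "(\<lambda>k. M n * test.dist_V (s k) (?r k)) \<longlonglongrightarrow> 0"
    unfolding test.dist_commute[OF test.cauchy_car[OF s] test.cauchy_car[OF r(1)]] by simp
  have "(\<lambda>k. Lp_norm p (\<lambda>x. nderiv n (s k) x - nderiv n (?r k) x)) \<longlonglongrightarrow> 0"
    by (rule tendsto_sandwich[OF always_eventually always_eventually tendsto_const lim])
      (intro allI Lp_norm_nonneg component_dist_le test.cauchy_car s r)+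
  then have "(\<lambda>k. Lp_norm p (\<lambda>x. nderiv n (s k) x - f x)) \<longlonglongrightarrow> 0"
    using L.tendsto_trans[of "\<lambda>k. nderiv n (s k)" "\<lambda>k. nderiv n (?r k)" f] f
    by (simp add: test_Lp test.cauchy_car[OF s] test.cauchy_car[OF r(1)])
  then show ?thesis using f(1) unfolding component_def f_def by blast
qed

lemma component_eqI:
  assumes s: "s \<in> cauchy_seqs test" and f: "f \<in> Lp_fun p" and lim: "(\<lambda>k. Lp_norm p (\<lambda>x. nderiv n (s k) x - f x)) \<longlonglongrightarrow> 0"
  shows "component n (test.limit_class s) = Lp_class p f"
proof -
  obtain g where g: "g \<in> Lp_fun p" "component n (test.limit_class s) = Lp_class p g"
    "(\<lambda>k. Lp_norm p (\<lambda>x. nderiv n (s k) x - g x)) \<longlonglongrightarrow> 0" using component_limit[OF s] by blast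
  have "Lp_norm p (\<lambda>x. g x - f x) = 0"
    using L.limit_unique[of "\<lambda>k. nderiv n (s k)" g f] g f lim by (simp add: test_Lp test.cauchy_car[OF s])
  from Lp_norm_eq_0[OF p_pos Lp_fun_diff[OF p_pos p1 g(1) f] this]
  show ?thesis unfolding g(2) Lp_class_eq_iff[OF g(1) f] by simp
qed

lemma component_in_Lp: "A \<in> car W \<Longrightarrow> component n A \<in> car (Lp p)"
  unfolding carleman_space_def 
  by (erule test.limit_class_cases, drule component_limit[where n = n]) (auto simp: Lp_class_in_car)

lemma component_add:
  assumes s: "s \<in> cauchy_seqs test" and t: "t \<in> cauchy_seqs test"
  shows "component n (test.limit_class (\<lambda>k x. s k x + t k x)) =
    add (Lp p) (component n (test.limit_class s)) (component n (test.limit_class t))"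
proof -
  note c = test.cauchy_car[OF s] test.cauchy_car[OF t]
  obtain f where f: "f \<in> Lp_fun p" "component n (test.limit_class s) = Lp_class p f"
    "(\<lambda>k. Lp_norm p (\<lambda>x. nderiv n (s k) x - f x)) \<longlonglongrightarrow> 0" using component_limit[OF s] by blast
  obtain g where g: "g \<in> Lp_fun p" "component n (test.limit_class t) = Lp_class p g"
    "(\<lambda>k. Lp_norm p (\<lambda>x. nderiv n (t k) x - g x)) \<longlonglongrightarrow> 0" using component_limit[OF t] by blast
  have "component n (test.limit_class (\<lambda>k x. s k x + t k x)) = Lp_class p (\<lambda>x. f x + g x)"
  proof (rule component_eqI[OF test.cauchy_add[OF s t] Lp_fun_add[OF p_pos p1 f(1) g(1)]])
    show "(\<lambda>k. Lp_norm p (\<lambda>x. nderiv n (\<lambda>x. s k x + t k x) x - (f x + g x))) \<longlonglongrightarrow> 0"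
      unfolding nderiv_add[OF test_smooth[OF c(1)] test_smooth[OF c(2)]]
      using L.add_tendsto[of "\<lambda>k. nderiv n (s k)" f "\<lambda>k. nderiv n (t k)" g] f g by (simp add: test_Lp c)
  qed
  then show ?thesis unfolding f(2) g(2) Lp_add_class[OF p_pos p1 f(1) g(1)] .
qed

lemma component_smul:
  assumes s: "s \<in> cauchy_seqs test"
  shows "component n (test.limit_class (\<lambda>k x. c * s k x)) = smul (Lp p) c (component n (test.limit_class s))"
proof -
  note sc = test.cauchy_car[OF s]
  obtain f where f: "f \<in> Lp_fun p" "component n (test.limit_class s) = Lp_class p f"
    "(\<lambda>k. Lp_norm p (\<lambda>x. nderiv n (s k) x - f x)) \<longlonglongrightarrow> 0" using component_limit[OF s] by blast
  have "component n (test.limit_class (\<lambda>k x. c * s k x)) = Lp_class p (\<lambda>x. c * f x)"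
  proof (rule component_eqI[OF test.cauchy_cmult[OF s] Lp_fun_cmult[OF f(1)]])
    show "(\<lambda>k. Lp_norm p (\<lambda>x. nderiv n (\<lambda>x. c * s k x) x - c * f x)) \<longlonglongrightarrow> 0"
      unfolding nderiv_cmult[OF test_smooth[OF sc]]
      using L.cmult_tendsto[of "\<lambda>k. nderiv n (s k)" f c] f by (simp add: test_Lp sc)
  qed
  then show ?thesis unfolding f(2) Lp_smul_class[OF f(1)] .
qed

lemma component_qembed: "f \<in> car test \<Longrightarrow> component n (qembed test f) = Lp_class p (nderiv n f)"
  unfolding test.qembed_eq
  by (rule component_eqI[OF test.cauchy_const test_Lp]) (simp_all add: Lp_norm_def)

lemma component_dist_tendsto:
  assumes s: "s \<in> cauchy_seqs test" and t: "t \<in> cauchy_seqs test"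
  shows "(\<lambda>k. Lp_norm p (\<lambda>x. nderiv n (s k) x - nderiv n (t k) x)) \<longlonglongrightarrow>
    qnorm (Lp p) (qdiff (Lp p) (component n (test.limit_class s)) (component n (test.limit_class t)))"
proof -
  note c = test.cauchy_car[OF s] test.cauchy_car[OF t]
  obtain f where f: "f \<in> Lp_fun p" "component n (test.limit_class s) = Lp_class p f"
    "(\<lambda>k. Lp_norm p (\<lambda>x. nderiv n (s k) x - f x)) \<longlonglongrightarrow> 0" using component_limit[OF s] by blast
  obtain g where g: "g \<in> Lp_fun p" "component n (test.limit_class t) = Lp_class p g"
    "(\<lambda>k. Lp_norm p (\<lambda>x. nderiv n (t k) x - g x)) \<longlonglongrightarrow> 0" using component_limit[OF t] by blast
  show ?thesis unfolding f(2) g(2) Lp_dist_class[OF p_pos p1 f(1) g(1)]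
    using L.dist_tendsto[of "\<lambda>k. nderiv n (s k)" f "\<lambda>k. nderiv n (t k)" g] f g by (simp add: test_Lp c)
qed

lemma component_lipschitz:
  assumes "A \<in> car W" "B \<in> car W"
  shows "qnorm (Lp p) (qdiff (Lp p) (component n A) (component n B)) \<le> M n * qnorm W (qdiff W A B)"
  using assms unfolding carleman_space_def
proof (elim test.limit_class_cases)
  fix s t assume st: "s \<in> cauchy_seqs test" "A = test.limit_class s" "t \<in> cauchy_seqs test" "B = test.limit_class t"
  show "qnorm (Lp p) (qdiff (Lp p) (component n A) (component n B)) \<le>
      M n * qnorm (qcompletion test) (qdiff (qcompletion test) A B)"
    unfolding st(2,4)
    by (rule LIMSEQ_le[OF component_dist_tendsto[OF st(1,3)] tendsto_mult_left[OF test.dist_limit_class[OF st(1,3)]]])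
      (intro exI allI impI component_dist_le test.cauchy_car st)
qed

lemma component_bounded:
  assumes "A \<in> car W"
  shows "bdd_above (range (\<lambda>n. qnorm (Lp p) (component n A) / M n))"
  using assms unfolding carleman_space_def
proof (elim test.limit_class_cases)
  fix s assume s: "s \<in> cauchy_seqs test" "A = test.limit_class s"
  note c = test.cauchy_car[OF s(1)]
  have "qnorm (Lp p) (component n A) \<le> M n * qnorm (qcompletion test) A" for n
  proof -
    obtain f where f: "f \<in> Lp_fun p" "component n (test.limit_class s) = Lp_class p f"
      "(\<lambda>k. Lp_norm p (\<lambda>x. nderiv n (s k) x - f x)) \<longlonglongrightarrow> 0" using component_limit[OF s(1)] by blast
    have "(\<lambda>k. Lp_norm p (nderiv n (s k))) \<longlonglongrightarrow> Lp_norm p f"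
      using L.norm_tendsto[of "\<lambda>k. nderiv n (s k)" f] f by (simp add: test_Lp c)
    moreover have "(\<lambda>k. M n * qnorm test (s k)) \<longlonglongrightarrow> M n * qnorm (qcompletion test) A"
      unfolding s(2) by (rule tendsto_mult_left[OF test.qnorm_limit_class[OF s(1)]])
    ultimately have "Lp_norm p f \<le> M n * qnorm (qcompletion test) A"
      by (rule LIMSEQ_le) (use test_norm_bound[OF c] in \<open>auto simp: mult.commute\<close>)
    then show ?thesis unfolding s(2) f(2) Lp_qnorm_class[OF f(1)] .
  qed
  then have "qnorm (Lp p) (component n A) / M n \<le> qnorm (qcompletion test) A" for n
    using M_pos[of n] by (simp add: pos_divide_le_eq mult.commute)
  then show ?thesis by (rule bdd_aboveI2)
qed

lemma alpha_map_eq: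
  assumes "A \<in> car W"
  shows "alpha_map p \<theta> M A = component 0 A"
  unfolding alpha_map_def
proof (rule test.cont_extension_eq[OF Hausdorff_Lp[OF p_pos p1]]; (fold carleman_space_def)?)
  show "component 0 A \<in> car (Lp p)" if "A \<in> car W" for A by (rule component_in_Lp[OF that])
  show "0 \<le> M 0" using M_pos[of 0] by simp
  show "qnorm (Lp p) (qdiff (Lp p) (component 0 A) (component 0 B)) \<le> M 0 * qnorm W (qdiff W A B)"
    if "A \<in> car W" "B \<in> car W" for A B by (rule component_lipschitz[OF that])
  show "component 0 (qembed test f) = Lp_class p f" if "f \<in> car test" for f using component_qembed[OF that, of 0] by simp
  show "A \<in> car W" by (rule assms)
qed

lemma pi_map_eq:
  assumes "A \<in> car W"
  shows "pi_map p \<theta> M A = (\<lambda>n. component n A)"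
  unfolding pi_map_def
proof (rule test.cont_extension_eq[OF Hausdorff_linf_Lp[OF p_pos p1 M_pos]]; (fold carleman_space_def)?)
  show "(\<lambda>n. component n A) \<in> car (linf_Lp p M)" if "A \<in> car W" for A
    using component_in_Lp[OF that] component_bounded[OF that] by (simp add: linf_Lp_def)
  show "qnorm (linf_Lp p M) (qdiff (linf_Lp p M) (\<lambda>n. component n A) (\<lambda>n. component n B)) \<le> 1 * qnorm W (qdiff W A B)"
    if "A \<in> car W" "B \<in> car W" for A B
  proof -
    have "qnorm (Lp p) (qdiff (Lp p) (component n A) (component n B)) / M n \<le> qnorm W (qdiff W A B)" for n
      using component_lipschitz[OF that, of n] M_pos[of n] by (simp add: pos_divide_le_eq mult.commute)
    then have "(SUP n. qnorm (Lp p) (qdiff (Lp p) (component n A) (component n B)) / M n) \<le> qnorm W (qdiff W A B)"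
      by (intro cSUP_least) auto
    then show ?thesis by (simp add: linf_Lp_def qdiff_def)
  qed
  show "(\<lambda>n. component n (qembed test f)) = (\<lambda>n. Lp_class p (nderiv n f))" if "f \<in> car test" for f
    using component_qembed[OF that] by simp
  show "A \<in> car W" by (rule assms)
qed simp

definition derivative :: "(nat \<Rightarrow> real \<Rightarrow> complex) set \<Rightarrow> (nat \<Rightarrow> real \<Rightarrow> complex) set" where
  "derivative A = S.test.limit_class (\<lambda>k. nderiv 1 (rep A k))"

lemma derivative_limit:
  assumes s: "s \<in> cauchy_seqs test"
  shows "derivative (test.limit_class s) = S.test.limit_class (\<lambda>k. nderiv 1 (s k))"
  unfolding derivative_def
proof (rule iffD2[OF S.test.limit_class_eq_iff])
  let ?r = "rep (test.limit_class s)"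
  note r = test.rep_limit_class[OF s]
  show "(\<lambda>k. nderiv 1 (?r k)) \<in> cauchy_seqs test'" "(\<lambda>k. nderiv 1 (s k)) \<in> cauchy_seqs test'"
    by (rule nderiv_cauchy'[OF r(1)] nderiv_cauchy'[OF s])+
  show "(\<lambda>k. S.test.dist_V (nderiv 1 (?r k)) (nderiv 1 (s k))) \<longlonglongrightarrow> 0"
    by (rule tendsto_sandwich[OF always_eventually always_eventually tendsto_const r(2)])
      (intro allI S.test.dist_nonneg dist_nderiv_le nderiv_test test.cauchy_car s r)+
qed

lemma derivative_in_space: "A \<in> car W \<Longrightarrow> derivative A \<in> car W'"
  unfolding carleman_space_def
  by (erule test.limit_class_cases) (simp only: derivative_limit S.test.limit_class_in_car nderiv_cauchy')

lemma derivative_lipschitz: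
  assumes "A \<in> car W" "B \<in> car W"
  shows "qnorm W' (qdiff W' (derivative A) (derivative B)) \<le> qnorm W (qdiff W A B)"
  using assms unfolding carleman_space_def
proof (elim test.limit_class_cases)
  fix s t assume st: "s \<in> cauchy_seqs test" "A = test.limit_class s" "t \<in> cauchy_seqs test" "B = test.limit_class t"
  show "qnorm (qcompletion test') (qdiff (qcompletion test') (derivative A) (derivative B)) \<le>
      qnorm (qcompletion test) (qdiff (qcompletion test) A B)"
    unfolding st(2,4) derivative_limit[OF st(1)] derivative_limit[OF st(3)]
    by (rule LIMSEQ_le[OF S.test.dist_limit_class[OF nderiv_cauchy'[OF st(1)] nderiv_cauchy'[OF st(3)]] test.dist_limit_class[OF st(1,3)]])
      (intro exI allI impI dist_nderiv_le test.cauchy_car st)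
qed

lemma delta_map_eq:
  assumes "A \<in> car W"
  shows "delta_map p \<theta> M A = derivative A"
  unfolding delta_map_def
proof (rule test.cont_extension_eq[where C = 1]; (fold carleman_space_def)?)
  show "Hausdorff_space (qtop W')" unfolding carleman_space_def by (rule S.test.Hausdorff_completion)
  show "derivative A \<in> car W'" if "A \<in> car W" for A by (rule derivative_in_space[OF that])
  show "qnorm W' (qdiff W' (derivative A) (derivative B)) \<le> 1 * qnorm W (qdiff W A B)"
    if "A \<in> car W" "B \<in> car W" for A B using derivative_lipschitz[OF that] by simp
  show "derivative (qembed test f) = qembed test' (nderiv 1 f)" if "f \<in> car test" for f
    unfolding test.qembed_eq S.test.qembed_eq by (rule derivative_limit[OF test.cauchy_const[OF that]])
  show "A \<in> car W" by (rule assms)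
qed simp

lemma space_dist_le_max:
  assumes "A \<in> car W" "B \<in> car W"
  shows "qnorm W (qdiff W A B) \<le> max (qnorm (Lp p) (qdiff (Lp p) (component 0 A) (component 0 B)) / M 0)
    (qnorm W' (qdiff W' (derivative A) (derivative B)))"
  using assms unfolding carleman_space_def
proof (elim test.limit_class_cases)
  fix s t assume st: "s \<in> cauchy_seqs test" "A = test.limit_class s" "t \<in> cauchy_seqs test" "B = test.limit_class t"
  have lim1: "(\<lambda>k. max (Lp_norm p (\<lambda>x. nderiv 0 (s k) x - nderiv 0 (t k) x) / M 0) (S.test.dist_V (nderiv 1 (s k)) (nderiv 1 (t k)))) \<longlonglongrightarrow>
    max (qnorm (Lp p) (qdiff (Lp p) (component 0 A) (component 0 B)) / M 0)
      (qnorm (qcompletion test') (qdiff (qcompletion test') (derivative A) (derivative B)))"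
    unfolding st(2,4) derivative_limit[OF st(1)] derivative_limit[OF st(3)]
    using M_pos[of 0] by (intro tendsto_max tendsto_divide tendsto_const component_dist_tendsto[OF st(1,3)]
      S.test.dist_limit_class[OF nderiv_cauchy'[OF st(1)] nderiv_cauchy'[OF st(3)]]) auto
  have lim2: "(\<lambda>k. test.dist_V (s k) (t k)) \<longlonglongrightarrow> qnorm (qcompletion test) (qdiff (qcompletion test) A B)"
    unfolding st(2,4) by (rule test.dist_limit_class[OF st(1,3)])
  show "qnorm (qcompletion test) (qdiff (qcompletion test) A B) \<le>
    max (qnorm (Lp p) (qdiff (Lp p) (component 0 A) (component 0 B)) / M 0)
      (qnorm (qcompletion test') (qdiff (qcompletion test') (derivative A) (derivative B)))"
  proof (rule LIMSEQ_le[OF lim2 lim1], intro exI allI impI)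
    fix k
    show "test.dist_V (s k) (t k) \<le> max (Lp_norm p (\<lambda>x. nderiv 0 (s k) x - nderiv 0 (t k) x) / M 0) (S.test.dist_V (nderiv 1 (s k)) (nderiv 1 (t k)))"
      using dist_le_max[OF test.cauchy_car[OF st(1)] test.cauchy_car[OF st(3)], of k k] by simp
  qed
qed

end

section \<open>Shifted weights\<close>

lemma limsup_PInfty_iff:
  "limsup (\<lambda>n. ereal (X n)) = \<infinity> \<longleftrightarrow> (\<forall>C N. \<exists>n\<ge>N. C < X n)"
proof
  assume inf: "limsup (\<lambda>n. ereal (X n)) = \<infinity>"
  show "\<forall>C N. \<exists>n\<ge>N. C < X n"
  proof (intro allI)
    fix C and N :: nat
    have "(\<infinity>::ereal) \<le> (SUP n\<in>{N..}. ereal (X n))"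
      unfolding inf[symmetric] limsup_INF_SUP by (rule INF_lower) simp
    then have "ereal C < (SUP n\<in>{N..}. ereal (X n))" by simp
    then show "\<exists>n\<ge>N. C < X n" by (auto simp: less_SUP_iff)
  qed
next
  assume unb: "\<forall>C N. \<exists>n\<ge>N. C < X n"
  have "(SUP n\<in>{N..}. ereal (X n)) = \<infinity>" for N
  proof (rule SUP_PInfty)
    fix n :: nat
    obtain k where "k \<ge> N" "real n < X k" using unb by blast
    then show "\<exists>i\<in>{N..}. ereal (real n) \<le> ereal (X i)" by (intro bexI[of _ k]) auto
  qed
  then show "limsup (\<lambda>n. ereal (X n)) = \<infinity>" by (simp add: limsup_INF_SUP)
qed

lemma p_characteristic_shift:
  assumes p: "p < 1" and inf: "p_characteristic p M = \<infinity>"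
  shows "p_characteristic p (shift_seq M) = \<infinity>"
proof -
  define q where "q = 1 - p"
  have q: "0 < q" using p by (simp add: q_def)
  define S where "S n = (\<Sum>j = 1..n. q ^ j * ln (M j))" for n
  have S: "\<forall>C N. \<exists>n\<ge>N. C < S n"
    using inf unfolding p_characteristic_def q_def[symmetric] S_def[symmetric] limsup_PInfty_iff .
  have eq: "S (Suc n) = q * ln (M 1) + q * (\<Sum>j = 1..n. q ^ j * ln (shift_seq M j))" for n
    by (induction n) (simp_all add: S_def shift_seq_def algebra_simps)
  show ?thesis
    unfolding p_characteristic_def q_def[symmetric] limsup_PInfty_iff
  proof (intro allI)
    fix C and N :: nat
    obtain n where n: "n \<ge> Suc N" "q * ln (M 1) + q * C < S n" using S by blast
    then obtain k where k: "n = Suc k" "k \<ge> N" by (cases n) auto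
    have "q * C < q * (\<Sum>j = 1..k. q ^ j * ln (shift_seq M j))" using n(2) unfolding k(1) eq by simp
    then show "\<exists>n\<ge>N. C < (\<Sum>j = 1..n. q ^ j * ln (shift_seq M j))" using q k(2) by auto
  qed
qed

lemma p_regular_shift:
  assumes p: "0 < p" "p < 1" and reg: "p_regular p M"
  shows "p_regular p (shift_seq M)"
proof -
  define q where "q = 1 - p"
  have q: "0 < q" "q < 1" using p by (auto simp: q_def)
  have "weight_sequence (shift_seq M)" "log_convex (shift_seq M)"
    using reg by (auto simp: p_regular_def weight_sequence_def log_convex_def shift_seq_def)
  moreover have "p_characteristic p (shift_seq M) = \<infinity>"
    using reg p by (intro p_characteristic_shift) (auto simp: p_regular_def)
  moreover have "liminf (\<lambda>n. ereal (q ^ n * ln (shift_seq M n))) > 0 \<or>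
      (\<lambda>n. ln (shift_seq M n)) \<in> o(\<lambda>n. 1 / q ^ n) \<and>
      (\<exists>\<delta><1. \<exists>e. e \<longlonglongrightarrow> 0 \<and>
         (\<forall>\<^sub>F n in sequentially. real n * ln (real n) \<le> (\<delta> + e n) * ln (shift_seq M n)))"
  proof -
    consider "liminf (\<lambda>n. ereal (q ^ n * ln (M n))) > 0"
      | \<delta> e where "(\<lambda>n. ln (M n)) \<in> o(\<lambda>n. 1 / q ^ n)" "\<delta> < 1" "e \<longlonglongrightarrow> 0"
        "\<forall>\<^sub>F n in sequentially. real n * ln (real n) \<le> (\<delta> + e n) * ln (M n)"
      using reg unfolding p_regular_def q_def[symmetric] by blast
    then show ?thesis
    proof cases
      case 1
      obtain z where z: "0 < ereal z" "ereal z < liminf (\<lambda>n. ereal (q ^ n * ln (M n)))"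
        using ereal_dense2[OF 1] by blast
      have "\<forall>\<^sub>F n in sequentially. ereal z < ereal (q ^ n * ln (M n))" by (rule less_LiminfD[OF z(2)])
      then have "\<forall>\<^sub>F n in sequentially. ereal z < ereal (q ^ Suc n * ln (M (Suc n)))"
        using eventually_sequentially_Suc[of "\<lambda>n. ereal z < ereal (q ^ n * ln (M n))"] by blast
      then have "\<forall>\<^sub>F n in sequentially. ereal z \<le> ereal (q ^ n * ln (shift_seq M n))"
      proof eventually_elim
        case (elim n)
        \<comment> \<open>The term of index \<open>n\<close> for the shifted sequence is
          \<open>1 / q\<close> times the term of index \<open>n + 1\<close> for \<open>M\<close>. As
          the latter is positive, the shift can only enlarge it.\<close>
        have pos: "0 < q * (q ^ n * ln (shift_seq M n))" using elim z(1) by (simp add: shift_seq_def mult.assoc)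
        then have "0 < q ^ n * ln (shift_seq M n)" using q by (simp add: zero_less_mult_iff)
        then have "q * (q ^ n * ln (shift_seq M n)) \<le> 1 * (q ^ n * ln (shift_seq M n))"
          using q by (intro mult_right_mono) auto
        then show ?case using elim by (simp add: shift_seq_def mult.assoc)
      qed
      then have "ereal z \<le> liminf (\<lambda>n. ereal (q ^ n * ln (shift_seq M n)))" by (rule Liminf_bounded)
      with z(1) have "0 < liminf (\<lambda>n. ereal (q ^ n * ln (shift_seq M n)))" by (rule less_le_trans)
      then show ?thesis ..
    next
      case 2
      have "(\<lambda>n. ln (M n) / (1 / q ^ n)) \<longlonglongrightarrow> 0" by (rule smalloD_tendsto[OF 2(1)])
      then have "(\<lambda>n. ln (M (Suc n)) / (1 / q ^ Suc n)) \<longlonglongrightarrow> 0" by (rule LIMSEQ_Suc)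
      then have "(\<lambda>n. 1 / q * (ln (M (Suc n)) / (1 / q ^ Suc n))) \<longlonglongrightarrow> 1 / q * 0" by (rule tendsto_mult_left)
      then have "(\<lambda>n. ln (shift_seq M n) / (1 / q ^ n)) \<longlonglongrightarrow> 0" using q by (simp add: shift_seq_def)
      then have o: "(\<lambda>n. ln (shift_seq M n)) \<in> o(\<lambda>n. 1 / q ^ n)"
        by (rule smalloI_tendsto) (use q in auto)
      have "\<forall>\<^sub>F n in sequentially. real (Suc n) * ln (real (Suc n)) \<le> (\<delta> + e (Suc n)) * ln (M (Suc n))"
        using 2(4) eventually_sequentially_Suc[of "\<lambda>n. real n * ln (real n) \<le> (\<delta> + e n) * ln (M n)"] by blast
      with eventually_gt_at_top[of 0]
      have "\<forall>\<^sub>F n in sequentially. real n * ln (real n) \<le> (\<delta> + e (Suc n)) * ln (shift_seq M n)"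
      proof eventually_elim
        case (elim n)
        have "real n * ln (real n) \<le> real (Suc n) * ln (real (Suc n))"
          using elim(1) by (intro mult_mono) auto
        then show ?case using elim(2) by (simp add: shift_seq_def)
      qed
      moreover have "(\<lambda>n. e (Suc n)) \<longlonglongrightarrow> 0" by (rule LIMSEQ_Suc[OF 2(3)])
      ultimately show ?thesis using o 2(2) by blast
    qed
  qed
  ultimately show ?thesis by (simp add: p_regular_def q_def)
qed

text \<open>Abel summation turns the sums in the characteristic into weighted sums of the increments
  of log M. The boundary term q^n log M_n is bounded below: by convexity log M_n lies above a linear
  function of n. The index is shifted because derivatives of u' are measured against
  M_(n+1).\<close>

lemma width_selection_shift:
  assumes p: "0 < p" "p < 1" and convex: "log_convex M" and inf: "p_characteristic p M = \<infinity>"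
  shows "width_selection p (\<lambda>n. ln (M (Suc n)))"
proof
  show "0 < p" "p < 1" by (rule p)+
  fix n
  have "2 * ln (M (Suc n + 1)) \<le> ln (M (Suc n)) + ln (M (Suc n + 2))"
    using convex unfolding log_convex_def by blast
  then show "ln (M (Suc (Suc n))) - ln (M (Suc n)) \<le> ln (M (Suc (Suc (Suc n)))) - ln (M (Suc (Suc n)))"
    by simp
next
  fix C
  define q where "q = 1 - p"
  have q: "0 < q" "q < 1" using p by (auto simp: q_def)
  define l where "l n = ln (M n)" for n
  define d where "d = l 1 - l 0"
  have step: "d \<le> l (Suc n) - l n" for n
  proof (induction n)
    case (Suc n)
    have "2 * l (n + 1) \<le> l n + l (n + 2)" using convex unfolding log_convex_def l_def by blast
    then show ?case using Suc by simp
  qed (simp add: d_def)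
  have lin: "l 0 + real n * d \<le> l n" for n
  proof (induction n)
    case (Suc n)
    then show ?case using step[of n] by (simp add: algebra_simps)
  qed simp
  have "(\<lambda>n. real n * q ^ n) \<longlonglongrightarrow> 0" using powser_times_n_limit_0[of q] q by simp
  then have "(\<lambda>n. q ^ n * l 0 + real n * q ^ n * d) \<longlonglongrightarrow> 0 * l 0 + 0 * d"
    using LIMSEQ_power_zero[of q] q by (intro tendsto_add tendsto_mult_right) auto
  then have "Bseq (\<lambda>n. q ^ n * l 0 + real n * q ^ n * d)" by (intro convergent_imp_Bseq convergentI)
  then obtain K where K: "\<And>n. \<bar>q ^ n * l 0 + real n * q ^ n * d\<bar> \<le> K" 
    unfolding Bseq_def real_norm_def by blast
  have low: "- K \<le> q ^ n * l n" for n
  proof -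
    have "q ^ n * (l 0 + real n * d) \<le> q ^ n * l n" using q by (intro mult_left_mono lin) simp
    then show ?thesis using K[of n] by (simp add: algebra_simps abs_le_iff)
  qed
  define S where "S n = (\<Sum>j = 1..n. q ^ j * l j)" for n
  have S: "\<forall>C N. \<exists>n\<ge>N. C < S n"
    using inf unfolding p_characteristic_def q_def[symmetric] S_def[symmetric] l_def[symmetric] limsup_PInfty_iff .
  have abel: "q\<^sup>2 * (\<Sum>i<n. q ^ i * (l (Suc (Suc i)) - l (Suc i))) = p * S n + q ^ Suc n * l (Suc n) - q * l 1" for n
  proof (induction n)
    case (Suc n)
    have "q\<^sup>2 * (\<Sum>i<Suc n. q ^ i * (l (Suc (Suc i)) - l (Suc i)))
      = p * S n + q ^ Suc n * l (Suc n) - q * l 1 + q\<^sup>2 * q ^ n * (l (Suc (Suc n)) - l (Suc n))"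
      using Suc by (simp add: algebra_simps)
    also have "\<dots> = p * (S n + q ^ Suc n * l (Suc n)) + q ^ Suc (Suc n) * l (Suc (Suc n)) - q * l 1
        + (1 - p - q) * (q ^ Suc n * l (Suc n))"
      by (simp add: power2_eq_square algebra_simps)
    also have "\<dots> = p * S (Suc n) + q ^ Suc (Suc n) * l (Suc (Suc n)) - q * l 1" by (simp add: S_def q_def)
    finally show ?case .
  qed (simp add: S_def)
  obtain n where n: "(q\<^sup>2 * C + K + q * l 1) / p < S n" using S by blast
  then have "q\<^sup>2 * C + K + q * l 1 < p * S n" using p by (simp add: field_simps)
  then have "q\<^sup>2 * C < q\<^sup>2 * (\<Sum>i<n. q ^ i * (l (Suc (Suc i)) - l (Suc i)))"
    unfolding abel using low[of "Suc n"] by linarith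
  then show "\<exists>n. C < (\<Sum>i<n. (1 - p) ^ i * (ln (M (Suc (Suc i))) - ln (M (Suc i))))"
    using q by (auto simp: q_def l_def)
qed

section \<open>Density of test pairs and the splitting\<close>

context carleman
begin

interpretation L: p_normed_functions "Lp_functions p" p
  by (rule p_normed_Lp_functions[OF p_pos p1])

interpretation S: carleman p "\<theta> / (1 - p)" "shift_seq M"
  by (rule carleman_shift)

text \<open>\<open>simultaneous_approximation\<close> in terms of quasinorms. It is used with
  \<open>\<epsilon> / 2\<close>, because the supremum over the derivatives keeps only non-strict
  bounds.\<close>

lemma test_dense:
  assumes ws: "width_selection p (\<lambda>n. ln (M (Suc n)))" and f: "f \<in> Lp_fun p" and g: "g \<in> car test'" and \<epsilon>: "0 < \<epsilon>"
  shows "\<exists>u\<in>car test. Lp_norm p (\<lambda>x. u x - f x) < \<epsilon> \<and> S.test.dist_V (nderiv 1 u) g < \<epsilon>"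
proof -
  interpret ws: width_selection p "\<lambda>n. ln (M (Suc n))" by (rule ws)
  have expL: "exp (ln (M (Suc n))) = M (Suc n)" for n using M_pos by simp
  have expL': "exp (p * ln (M (Suc n))) = M (Suc n) powr p" for n using M_pos[of "Suc n"] by (simp add: powr_def)
  have G: "tower (\<lambda>n. nderiv n g)" by (rule smooth_tower[OF S.test_smooth[OF g]])
  have gb: "Lp_norm p (nderiv n g) \<le> qnorm test' g * exp (ln (M (Suc n)))" for n
    unfolding expL using S.test_norm_bound[OF g, of n] by (simp add: shift_seq_def)
  have tg: "tame (1 - p) (\<theta> / (1 - p)) (\<lambda>n. nderiv n g)" using g by (simp add: S.test_iff)
  have \<theta>': "0 \<le> \<theta> / (1 - p)" using \<theta> q by simp
  have e: "0 < (\<epsilon> / 2) powr p" using \<epsilon> by simp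
  have q_eq: "ws.q = 1 - p" by (rule ws.q_def)
  have "\<exists>U. tower U \<and> ecost p (\<lambda>x. U 0 x - f x) \<le> ennreal ((\<epsilon> / 2) powr p) \<and>
    (\<forall>n. ecost p (\<lambda>x. U (Suc n) x - nderiv n g x) \<le> ennreal ((\<epsilon> / 2) powr p * exp (p * ln (M (Suc n))))) \<and>
    (\<forall>e>0. \<forall>\<^sub>F n in sequentially. \<forall>x. norm (U (Suc n) x) \<le> exp ((\<theta> / (1 - p) + e) / ws.q ^ n))"
    by (rule ws.simultaneous_approximation[OF f G S.test_Lp[OF g] gb S.test.nonneg[OF g] \<theta>' e])
      (use tg in \<open>simp add: tame_def q_eq\<close>)
  then obtain U where U: "tower U" "ecost p (\<lambda>x. U 0 x - f x) \<le> ennreal ((\<epsilon> / 2) powr p)"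
    "\<And>n. ecost p (\<lambda>x. U (Suc n) x - nderiv n g x) \<le> ennreal ((\<epsilon> / 2) powr p * exp (p * ln (M (Suc n))))"
    "tame (1 - p) (\<theta> / (1 - p)) (\<lambda>n. U (Suc n))"
    unfolding q_eq tame_def by blast
  define u where "u = U 0"
  have nd: "nderiv n u = U n" for n unfolding u_def by (rule tower_nderiv[OF U(1)])
  have um: "U n \<in> borel_measurable lebesgue" for n by (rule tower_measurable[OF U(1)])
  have m: "f \<in> borel_measurable lebesgue" "nderiv n g \<in> borel_measurable lebesgue" for n
    using f S.test_Lp[OF g, of n] by (auto simp: Lp_fun_iff)
  have e2: "0 \<le> \<epsilon> / 2" using \<epsilon> by simp
  note U0 = Lp_fun_bound[OF p_pos borel_measurable_diff[OF um m(1)] U(2) e2]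
  have bd: "ecost p (\<lambda>x. U (Suc n) x - nderiv n g x) \<le> ennreal ((\<epsilon> / 2 * M (Suc n)) powr p)" for n
  proof -
    have "(\<epsilon> / 2 * M (Suc n)) powr p = (\<epsilon> / 2) powr p * exp (p * ln (M (Suc n)))"
      unfolding expL' by (rule powr_mult)
    then show ?thesis using U(3)[of n] by simp
  qed
  have e2M: "0 \<le> \<epsilon> / 2 * M n" for n using \<epsilon> M_pos[of n] by simp
  note US = Lp_fun_bound[OF p_pos borel_measurable_diff[OF um m(2)] bd e2M]
  have UL: "U n \<in> Lp_fun p" for n
  proof (cases n)
    case 0
    show ?thesis unfolding 0 using Lp_fun_add[OF p_pos p1 U0(1) f] by simp
  next
    case (Suc k)
    show ?thesis unfolding Suc using Lp_fun_add[OF p_pos p1 US(1)[of k] S.test_Lp[OF g, of k]] by simp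
  qed
  \<comment> \<open>By subadditivity of \<open>p\<close>-th powers, a quasinorm bound for anything
    within \<open>\<epsilon> / 2\<close> of \<open>g\<close>; it shows that \<open>u\<close> has
    finite quasinorm.\<close>
  define c where "c = ((\<epsilon> / 2) powr p + qnorm test' g powr p) powr (1 / p)"
  have c: "0 \<le> c" "c powr p = (\<epsilon> / 2) powr p + qnorm test' g powr p" using p_pos by (simp_all add: c_def powr_powr)
  have USn: "Lp_norm p (U (Suc n)) \<le> c * M (Suc n)" for n
  proof -
    have "Lp_norm p (U (Suc n)) powr p \<le> Lp_norm p (\<lambda>x. U (Suc n) x - nderiv n g x) powr p + Lp_norm p (nderiv n g) powr p"
      using Lp_norm_powr_add[OF p_pos p1 US(1)[of n] S.test_Lp[OF g, of n]] by simp
    also have "\<dots> \<le> (\<epsilon> / 2 * M (Suc n)) powr p + (qnorm test' g * M (Suc n)) powr p"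
      using US(2)[of n] gb[of n] p_pos by (intro add_mono powr_mono2) (auto simp: Lp_norm_nonneg expL)
    also have "\<dots> = (c * M (Suc n)) powr p"
      by (simp only: powr_mult c(2) distrib_right)
    finally have "Lp_norm p (U (Suc n)) powr p \<le> (c * M (Suc n)) powr p" .
    then have "(Lp_norm p (U (Suc n)) powr p) powr (1 / p) \<le> ((c * M (Suc n)) powr p) powr (1 / p)"
      by (rule powr_mono2[rotated 2]) (use p_pos in simp_all)
    moreover have "0 \<le> c * M (Suc n)" using c M_pos[of "Suc n"] by simp
    ultimately show ?thesis by (simp only: powr_powr_inverse Lp_norm_nonneg p_pos)
  qed
  have ut: "u \<in> car test"
    unfolding test_iff nd
  proof (intro conjI allI UL)
    show "smooth u" unfolding u_def by (rule tower_smooth[OF U(1)])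
    show "tame (1 - p) \<theta> U" using U(4) tame_Suc_iff[OF q(1), of \<theta> U] by blast
    define c' where "c' = max c (Lp_norm p (U 0) / M 0)"
    have "Lp_norm p (U n) \<le> c' * M n" for n
    proof (cases n)
      case 0
      have "Lp_norm p (U 0) / M 0 \<le> c'" by (simp add: c'_def)
      then show ?thesis unfolding 0 using M_pos[of 0] by (simp add: pos_divide_le_eq)
    next
      case (Suc k)
      have "c * M n \<le> c' * M n" using M_pos[of n] by (intro mult_right_mono) (auto simp: c'_def)
      then show ?thesis using USn[of k] unfolding Suc by linarith
    qed
    then show "\<exists>c. \<forall>n. Lp_norm p (U n) \<le> c * M n" by blast
  qed
  have "Lp_norm p (\<lambda>x. u x - f x) < \<epsilon>" using U0(2) \<epsilon> unfolding u_def by linarith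
  moreover have "S.test.dist_V (nderiv 1 u) g \<le> \<epsilon> / 2"
  proof (rule S.test_norm_leI)
    fix n
    show "Lp_norm p (nderiv n (\<lambda>x. nderiv 1 u x - g x)) \<le> \<epsilon> / 2 * shift_seq M n"
      unfolding S.nderiv_diff[OF nderiv_test[OF ut] g] unfolding nderiv_nderiv unfolding nd using US(2)[of n] by (simp add: shift_seq_def)
  qed
  ultimately show ?thesis using ut \<epsilon> by (intro bexI[of _ u]) auto
qed

text \<open>\<open>u k\<close> approximates the fixed \<open>f\<close> while its derivative
  approximates the \<open>k\<close>-th term of \<open>t\<close>. Then both \<open>u\<close> and its
  derivatives are Cauchy, hence so is \<open>u\<close> in the test class, and its limit realises the
  prescribed pair exactly.\<close>

lemma dense_sequence:
  assumes ws: "width_selection p (\<lambda>n. ln (M (Suc n)))" and f: "f \<in> Lp_fun p" and t: "t \<in> cauchy_seqs test'"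
  obtains u where "u \<in> cauchy_seqs test" "component 0 (test.limit_class u) = Lp_class p f"
    "derivative (test.limit_class u) = S.test.limit_class t"
proof -
  note tc = S.test.cauchy_car[OF t]
  have "\<forall>k. \<exists>u. u \<in> car test \<and> Lp_norm p (\<lambda>x. u x - f x) < 1 / real (Suc k) \<and> S.test.dist_V (nderiv 1 u) (t k) < 1 / real (Suc k)"
    using test_dense[OF ws f tc] by (meson of_nat_0_less_iff zero_less_Suc zero_less_divide_1_iff)
  then obtain u where u: "\<And>k. u k \<in> car test" "\<And>k. Lp_norm p (\<lambda>x. u k x - f x) < 1 / real (Suc k)"
    "\<And>k. S.test.dist_V (nderiv 1 (u k)) (t k) < 1 / real (Suc k)"
    by metis
  note uL = test_Lp[OF u(1), where n = 0, unfolded nderiv_0]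
  have inv: "(\<lambda>k. 1 / real (Suc k)) \<longlonglongrightarrow> 0" using LIMSEQ_inverse_real_of_nat by (simp add: inverse_eq_divide)
  have lim0: "(\<lambda>k. Lp_norm p (\<lambda>x. u k x - f x)) \<longlonglongrightarrow> 0"
    by (rule tendsto_sandwich[OF always_eventually always_eventually tendsto_const inv])
      (use u(2) in \<open>auto simp: Lp_norm_nonneg less_imp_le\<close>)
  have lim1: "(\<lambda>k. S.test.dist_V (nderiv 1 (u k)) (t k)) \<longlonglongrightarrow> 0"
    by (rule tendsto_sandwich[OF always_eventually always_eventually tendsto_const inv])
      (intro allI S.test.dist_nonneg nderiv_test u(1) tc less_imp_le[OF u(3)])+
  have c1: "(\<lambda>k. nderiv 1 (u k)) \<in> cauchy_seqs test'"
    by (rule S.test.cauchy_close[OF nderiv_test[OF u(1)] t lim1])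
  have c0: "u \<in> cauchy_seqs (Lp_functions p)"
  proof (rule L.cauchy_close)
    show "(\<lambda>_. f) \<in> cauchy_seqs (Lp_functions p)" by (rule L.cauchy_const) (simp add: f)
  qed (use uL lim0 in simp_all)
  have uc: "u \<in> cauchy_seqs test"
    unfolding cauchy_seqs_def test.qdiff_V mem_Collect_eq
  proof (intro conjI allI impI u(1))
    fix \<epsilon> :: real assume \<epsilon>: "\<epsilon> > 0"
    then have "\<epsilon> * M 0 > 0" using M_pos[of 0] by simp
    then obtain N where N: "\<And>j k. j \<ge> N \<Longrightarrow> k \<ge> N \<Longrightarrow> Lp_norm p (\<lambda>x. u j x - u k x) < \<epsilon> * M 0"
      using c0 unfolding cauchy_seqs_def L.qdiff_V Lp_functions_simps mem_Collect_eq by blast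
    obtain N' where N': "\<And>j k. j \<ge> N' \<Longrightarrow> k \<ge> N' \<Longrightarrow> S.test.dist_V (nderiv 1 (u j)) (nderiv 1 (u k)) < \<epsilon>"
      using c1 \<epsilon> unfolding cauchy_seqs_def S.test.qdiff_V mem_Collect_eq by blast
    have "test.dist_V (u j) (u k) < \<epsilon>" if "j \<ge> max N N'" "k \<ge> max N N'" for j k
    proof -
      have "Lp_norm p (\<lambda>x. u j x - u k x) / M 0 < \<epsilon>"
        using N[of j k] that M_pos[of 0] by (simp add: pos_divide_less_eq)
      then show ?thesis using dist_le_max[OF u(1)[of j] u(1)[of k]] N'[of j k] that by linarith
    qed
    then show "\<exists>N. \<forall>j\<ge>N. \<forall>k\<ge>N. test.dist_V (u j) (u k) < \<epsilon>" by blast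
  qed
  show ?thesis
  proof (rule that[OF uc])
    show "component 0 (test.limit_class u) = Lp_class p f"
      by (rule component_eqI[OF uc f]) (simp add: lim0)
    show "derivative (test.limit_class u) = S.test.limit_class t"
      unfolding derivative_limit[OF uc] by (rule iffD2[OF S.test.limit_class_eq_iff[OF c1 t] lim1])
  qed
qed

lemma qdiff_direct_sum: "qdiff (direct_sum V U) x y = (qdiff V (fst x) (fst y), qdiff U (snd x) (snd y))"
  by (simp add: qdiff_def direct_sum_def)

text \<open>The quasinorm is a maximum of the two parts, so the map is bilipschitz and in particular
  injective. Surjectivity is \<open>dense_sequence\<close>; pairing an arbitrary class with any
  derivative then shows that alpha is onto.\<close>

theorem splitting:
  assumes ws: "width_selection p (\<lambda>n. ln (M (Suc n)))"
  defines "\<Phi> \<equiv> \<lambda>A. (alpha_map p \<theta> M A, delta_map p \<theta> M A)"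
  shows "linear_homeomorphism W (direct_sum (Lp p) W') \<Phi>" and "alpha_map p \<theta> M ` car W = car (Lp p)"
proof -
  let ?D = "direct_sum (Lp p) W'"
  have \<Phi>: "\<Phi> A = (component 0 A, derivative A)" if "A \<in> car W" for A
    using that by (simp add: \<Phi>_def alpha_map_eq delta_map_eq)
  have carD: "car ?D = car (Lp p) \<times> car W'" by (simp add: direct_sum_def)
  have in_car: "\<Phi> A \<in> car ?D" if "A \<in> car W" for A
    using that by (simp add: \<Phi> carD component_in_Lp derivative_in_space)
  have surj: "\<exists>A\<in>car W. component 0 A = B \<and> derivative A = C" if B: "B \<in> car (Lp p)" and C: "C \<in> car W'" for B C
  proof -
    obtain t where t: "t \<in> cauchy_seqs test'" "C = S.test.limit_class t"
      using C unfolding carleman_space_def by (rule S.test.limit_class_cases)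
    obtain u where u: "u \<in> cauchy_seqs test" "component 0 (test.limit_class u) = Lp_class p (rep B)"
      "derivative (test.limit_class u) = S.test.limit_class t"
      using dense_sequence[OF ws Lp_class_rep(1)[OF B] t(1)] .
    have "test.limit_class u \<in> car W" unfolding carleman_space_def by (rule test.limit_class_in_car[OF u(1)])
    then show ?thesis using u(2,3) t(2) Lp_class_rep(2)[OF B] by (intro bexI[of _ "test.limit_class u"]) auto
  qed
  \<comment> \<open>One constant for both directions: \<open>M 0\<close> bounds alpha, 1 bounds
    delta, and \<open>1 / M 0\<close> enters the inverse.\<close>
  define C where "C = M 0 + 1 + 1 / M 0"
  have C: "0 \<le> C" "M 0 \<le> C" "1 \<le> C" "1 / M 0 \<le> C" using M_pos[of 0] by (auto simp: C_def)
  have dist_nonneg: "0 \<le> qnorm W (qdiff W A B)" if "A \<in> car W" "B \<in> car W" for A B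
    using test.completion_nonneg that unfolding carleman_space_def by blast
  have distD: "qnorm ?D (qdiff ?D (\<Phi> A) (\<Phi> B)) = max (qnorm (Lp p) (qdiff (Lp p) (component 0 A) (component 0 B)))
      (qnorm W' (qdiff W' (derivative A) (derivative B)))" if "A \<in> car W" "B \<in> car W" for A B
    unfolding qdiff_direct_sum \<Phi>[OF that(1)] \<Phi>[OF that(2)] by (simp add: direct_sum_def)
  have upper: "qnorm ?D (qdiff ?D (\<Phi> A) (\<Phi> B)) \<le> C * qnorm W (qdiff W A B)" if AB: "A \<in> car W" "B \<in> car W" for A B
  proof -
    have "M 0 * qnorm W (qdiff W A B) \<le> C * qnorm W (qdiff W A B)" "1 * qnorm W (qdiff W A B) \<le> C * qnorm W (qdiff W A B)"
      by (intro mult_right_mono C dist_nonneg AB)+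
    then show ?thesis unfolding distD[OF AB]
      using component_lipschitz[OF AB, of 0] derivative_lipschitz[OF AB] by simp
  qed
  have lower: "qnorm W (qdiff W A B) \<le> C * qnorm ?D (qdiff ?D (\<Phi> A) (\<Phi> B))" if AB: "A \<in> car W" "B \<in> car W" for A B
  proof -
    let ?a = "qnorm (Lp p) (qdiff (Lp p) (component 0 A) (component 0 B))" and ?b = "qnorm W' (qdiff W' (derivative A) (derivative B))"
    have ca: "component 0 A \<in> car (Lp p)" "component 0 B \<in> car (Lp p)" using AB by (auto simp: component_in_Lp)
    have a: "0 \<le> ?a" by (rule Lp_dist_nonneg[OF p_pos p1 ca ca(1)])
    have "?a / M 0 = 1 / M 0 * ?a" by simp
    also have "\<dots> \<le> C * max ?a ?b" using a C by (intro mult_mono) auto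
    finally have 1: "?a / M 0 \<le> C * max ?a ?b" .
    have "?b \<le> 1 * max ?a ?b" by simp
    also have "\<dots> \<le> C * max ?a ?b" using a C by (intro mult_right_mono) auto
    finally show ?thesis unfolding distD[OF AB] using space_dist_le_max[OF AB] 1 by linarith
  qed
  have bij: "bij_betw \<Phi> (car W) (car ?D)"
    unfolding bij_betw_def
  proof
    show "inj_on \<Phi> (car W)"
    proof (rule inj_onI)
      fix A B assume AB: "A \<in> car W" "B \<in> car W" and eq: "\<Phi> A = \<Phi> B"
      have B0: "qnorm W (qdiff W B B) = 0"
      proof -
        obtain s where s: "s \<in> cauchy_seqs test" "B = test.limit_class s"
          using AB(2) unfolding carleman_space_def by (rule test.limit_class_cases)
        show ?thesis using test.dist_limit_class[OF s(1) s(1)] unfolding s(2) carleman_space_def by (simp add: LIMSEQ_const_iff)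
      qed
      have "qnorm ?D (qdiff ?D (\<Phi> A) (\<Phi> B)) \<le> 0"
        using upper[OF AB(2,2)] unfolding eq B0 by simp
      then have "C * qnorm ?D (qdiff ?D (\<Phi> A) (\<Phi> B)) \<le> C * 0" by (intro mult_left_mono C)
      then have "qnorm W (qdiff W A B) \<le> 0" using lower[OF AB] by linarith
      with dist_nonneg[OF AB] have "qnorm W (qdiff W A B) = 0" by simp
      then show "A = B" using test.completion_dist_eq_0 AB unfolding carleman_space_def by blast
    qed
    show "\<Phi> ` car W = car ?D"
    proof
      show "\<Phi> ` car W \<subseteq> car ?D" using in_car by blast
      show "car ?D \<subseteq> \<Phi> ` car W"
      proof
        fix y assume "y \<in> car ?D"
        then obtain A where "A \<in> car W" "component 0 A = fst y" "derivative A = snd y" using surj[of "fst y" "snd y"] by (auto simp: carD)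
        then show "y \<in> \<Phi> ` car W" by (intro image_eqI[of _ _ A]) (auto simp: \<Phi>)
      qed
    qed
  qed
  have "linear_between W ?D \<Phi>"
    unfolding linear_between_def
  proof (intro conjI ballI allI in_car)
    fix A B assume "A \<in> car W" "B \<in> car W"
    then obtain s t where s: "s \<in> cauchy_seqs test" "A = test.limit_class s" and t: "t \<in> cauchy_seqs test" "B = test.limit_class t"
      unfolding carleman_space_def by (elim test.limit_class_cases)
    note c = test.cauchy_car[OF s(1)] test.cauchy_car[OF t(1)]
    have W: "test.limit_class v \<in> car W" if "v \<in> cauchy_seqs test" for v
      unfolding carleman_space_def by (rule test.limit_class_in_car[OF that])
    note st = test.cauchy_add[OF s(1) t(1)]
    have add: "add W A B = test.limit_class (\<lambda>k x. s k x + t k x)"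
      unfolding carleman_space_def s(2) t(2) by (rule test.add_limit_class[OF s(1) t(1)])
    have "derivative (test.limit_class (\<lambda>k x. s k x + t k x)) = add W' (derivative A) (derivative B)"
      unfolding derivative_limit[OF st] s(2) t(2) derivative_limit[OF s(1)] derivative_limit[OF t(1)] carleman_space_def
        S.test.add_limit_class[OF nderiv_cauchy'[OF s(1)] nderiv_cauchy'[OF t(1)]] nderiv_add[OF test_smooth[OF c(1)] test_smooth[OF c(2)]] ..
    moreover have "component 0 (test.limit_class (\<lambda>k x. s k x + t k x)) = add (Lp p) (component 0 A) (component 0 B)"
      unfolding s(2) t(2) by (rule component_add[OF s(1) t(1)])
    ultimately show "\<Phi> (add W A B) = add ?D (\<Phi> A) (\<Phi> B)"
      unfolding add \<Phi>[OF W[OF st]] unfolding s(2) t(2) \<Phi>[OF W[OF s(1)]] \<Phi>[OF W[OF t(1)]] by (simp add: direct_sum_def)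
  next
    fix c A assume "A \<in> car W"
    then obtain s where s: "s \<in> cauchy_seqs test" "A = test.limit_class s"
      unfolding carleman_space_def by (rule test.limit_class_cases)
    note sc = test.cauchy_car[OF s(1)]
    have W: "test.limit_class v \<in> car W" if "v \<in> cauchy_seqs test" for v
      unfolding carleman_space_def by (rule test.limit_class_in_car[OF that])
    note cs = test.cauchy_cmult[OF s(1), of c]
    have smul: "smul W c A = test.limit_class (\<lambda>k x. c * s k x)"
      unfolding carleman_space_def s(2) by (rule test.smul_limit_class[OF s(1)])
    have "derivative (test.limit_class (\<lambda>k x. c * s k x)) = smul W' c (derivative A)"
      unfolding derivative_limit[OF cs] s(2) derivative_limit[OF s(1)] carleman_space_def
        S.test.smul_limit_class[OF nderiv_cauchy'[OF s(1)]] nderiv_cmult[OF test_smooth[OF sc]] ..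
    moreover have "component 0 (test.limit_class (\<lambda>k x. c * s k x)) = smul (Lp p) c (component 0 A)"
      unfolding s(2) by (rule component_smul[OF s(1)])
    ultimately show "\<Phi> (smul W c A) = smul ?D c (\<Phi> A)"
      unfolding smul \<Phi>[OF W[OF cs]] unfolding s(2) \<Phi>[OF W[OF s(1)]] by (simp add: direct_sum_def)
  qed
  moreover have "homeomorphic_map (qtop W) (qtop ?D) \<Phi>"
    by (rule bilipschitz_homeomorphic_map[OF bij C(1) upper lower])
  ultimately show "linear_homeomorphism W ?D \<Phi>" by (simp add: linear_homeomorphism_def)
  show "alpha_map p \<theta> M ` car W = car (Lp p)"
  proof
    show "alpha_map p \<theta> M ` car W \<subseteq> car (Lp p)" by (auto simp: alpha_map_eq component_in_Lp)
    have ne: "test.limit_class (\<lambda>_ _. 0) \<in> car W" unfolding carleman_space_def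
      by (rule test.limit_class_in_car[OF test.cauchy_const[OF test.zero_closed]])
    show "car (Lp p) \<subseteq> alpha_map p \<theta> M ` car W"
    proof
      fix B assume "B \<in> car (Lp p)"
      then obtain A where "A \<in> car W" "component 0 A = B" using surj[OF _ derivative_in_space[OF ne]] by blast
      then show "B \<in> alpha_map p \<theta> M ` car W" by (intro image_eqI[of _ _ A]) (auto simp: alpha_map_eq)
    qed
  qed
qed

end

theorem theorem0p6p2:
  fixes p \<theta> :: real and M :: "nat \<Rightarrow> real"
  assumes "0 < p" and "p < 1" and "0 \<le> \<theta>"
    and "p_regular p M" and "p_characteristic p M = \<infinity>"
  shows "(\<lambda>f. pi_map p \<theta> M f 0) ` car (carleman_space p \<theta> M) = car (Lp p) \<and>
    (\<forall>f \<in> car (carleman_space p \<theta> M). alpha_map p \<theta> M f = pi_map p \<theta> M f 0) \<and>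
    linear_homeomorphism (carleman_space p \<theta> M)
      (direct_sum (Lp p) (carleman_space p (\<theta> / (1 - p)) (shift_seq M)))
      (\<lambda>f. (alpha_map p \<theta> M f, delta_map p \<theta> M f)) \<and>
    p_regular p (shift_seq M) \<and> p_characteristic p (shift_seq M) = \<infinity>"
proof -
  have "weight_sequence M" and convex: "log_convex M"
    using assms(4) by (auto simp: p_regular_def)
  then interpret carleman p \<theta> M
    by unfold_locales (use assms in \<open>auto simp: weight_sequence_def\<close>)
  note split = splitting[OF width_selection_shift[OF assms(1,2) convex assms(5)]]
  have pi: "pi_map p \<theta> M f 0 = alpha_map p \<theta> M f" if "f \<in> car W" for f
    by (simp add: pi_map_eq[OF that] alpha_map_eq[OF that])
  then have "(\<lambda>f. pi_map p \<theta> M f 0) ` car W = car (Lp p)"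
    unfolding split(2)[symmetric] by (intro image_cong refl)
  then show ?thesis
    using split(1) pi p_regular_shift[OF assms(1,2,4)] p_characteristic_shift[OF assms(2,5)] by simp
qed

end
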